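(* Let $0<\beta\le 1$, $0<p<\infty$, $1<q<\infty$, $\alpha\in\mathbb R$, and let $w_1\in A_{q_1}$ and $w_2\in A_{q_2}$ be weights on $\mathbb R^n$. Suppose that either of the following holds: (i) $w_1=w_2$, $1\le q_1=q_2\le q$ and $-nq_1/q<\alpha q_1<n(1-q_2/q)$; (ii) $w_1\ne w_2$, $1\le q_1<\infty$, $1\le q_2\le q$ and $0<\alpha q_1<n(1-q_2/q)$. Then the intrinsic square function $\mathcal S_\beta$ is bounded on $\dot K^{\alpha,p}_q(w_1,w_2)$ and on $K^{\alpha,p}_q(w_1,w_2)$; that is, there is a constant $C>0$ independent of $f$ such that $$\|\mathcal S_\beta(f)\|_{\dot K^{\alpha,p}_q(w_1,w_2)}\le C\|f\|_{\dot K^{\alpha,p}_q(w_1,w_2)}\quad\text{for all } f\in\dot K^{\alpha,p}_q(w_1,w_2),$$ and $$\|\mathcal S_\beta(f)\|_{K^{\alpha,p}_q(w_1,w_2)}\le C\|f\|_{K^{\alpha,p}_q(w_1,w_2)}\quad\text{for all } f\in K^{\alpha,p}_q(w_1,w_2).$$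
   Context: **Weights.** A weight $w$ is a nonnegative, locally integrable function on $\mathbb R^n$, not identically zero (a.e.); $w(E)=\int_E w(x)\,dx$. For $1<s<\infty$, $w\in A_s$ means there is $C>0$ such that for every ball $B\subseteq\mathbb R^n$, $\big(\frac1{|B|}\int_B w\,dx\big)\big(\frac1{|B|}\int_B w^{-1/(s-1)}\,dx\big)^{s-1}\le C$; $w\in A_1$ means there is $C>0$ with $\frac1{|B|}\int_B w\,dx\le C\,\operatorname{ess\,inf}_{x\in B}w(x)$ for every ball $B$. $\|f\|_{L^q_w}=\big(\int_{\mathbb R^n}|f|^q w\,dx\big)^{1/q}$. **Weighted Herz spaces.** Let $B_k=\{x\in\mathbb R^n:|x|\le 2^k\}$, $C_k=B_k\setminus B_{k-1}$ for $k\in\mathbb Z$, $\chi_k=\chi_{C_k}$ (characteristic function), $\widetilde\chi_k=\chi_k$ for integers $k\ge1$ and $\widetilde\chi_0=\chi_{B_0}$. The homogeneous space $\dot K^{\alpha,p}_q(w_1,w_2)$ consists of all $f\in L^q_{loc}(\mathbb R^n\setminus\{0\},w_2)$ with $$\|f\|_{\dot K^{\alpha,p}_q(w_1,w_2)}=\Big(\sum_{k\in\mathbb Z}[w_1(B_k)]^{\alpha p/n}\|f\chi_k\|_{L^q_{w_2}}^p\Big)^{1/p}<\infty,$$ and the non-homogeneous space $K^{\alpha,p}_q(w_1,w_2)$ consists of all $f\in L^q_{loc}(\mathbb R^n,w_2)$ with $$\|f\|_{K^{\alpha,p}_q(w_1,w_2)}=\Big(\sum_{k=0}^\infty[w_1(B_k)]^{\alpha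 p/n}\|f\widetilde\chi_k\|_{L^q_{w_2}}^p\Big)^{1/p}<\infty.$$ **Intrinsic square function.** For $0<\beta\le1$, $\mathcal C_\beta$ is the family of functions $\varphi$ on $\mathbb R^n$ with support contained in $\{|x|\le1\}$, $\int_{\mathbb R^n}\varphi\,dx=0$, and $|\varphi(x)-\varphi(x')|\le|x-x'|^\beta$ for all $x,x'\in\mathbb R^n$. With $\varphi_t(x)=t^{-n}\varphi(x/t)$, for $f\in L^1_{loc}(\mathbb R^n)$ and $(y,t)\in\mathbb R^{n+1}_+=\mathbb R^n\times(0,\infty)$ put $A_\beta(f)(y,t)=\sup_{\varphi\in\mathcal C_\beta}|f*\varphi_t(y)|$. With $\Gamma(x)=\{(y,t)\in\mathbb R^{n+1}_+:|x-y|<t\}$, $$\mathcal S_\beta(f)(x)=\Big(\iint_{\Gamma(x)}\big(A_\beta(f)(y,t)\big)^2\frac{dy\,dt}{t^{n+1}}\Big)^{1/2}.$$ *)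

theory Defs
  imports "HOL-Analysis.Analysis"
begin

text \<open>
  Euclidean space of dimension \<open>n\<close> is a type of class \<^class>\<open>euclidean_space\<close>, with \<open>n = DIM('a)\<close>.
  Norms and square functions take values in \<open>[0, \<infinity>]\<close>.
\<close>

text \<open>
  Real powers on \<open>[0, \<infinity>]\<close> with the usual conventions: for \<open>a < 0\<close> the power of \<open>0\<close> is \<open>\<infinity>\<close>
  and the power of \<open>\<infinity>\<close> is \<open>0\<close>. (For \<open>powr\<close> on the reals, \<open>0 powr a = 0\<close> for every \<open>a\<close>.)
\<close>

definition epowr :: "ennreal \<Rightarrow> real \<Rightarrow> ennreal" where
  "epowr x a =
     (if a = 0 then 1
      else if x = 0 then (if a > 0 then 0 else top)
      else if x = top then (if a > 0 then top else 0)
      else ennreal (enn2real x powr a))"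


section \<open>Weights\<close>

definition is_weight :: "('a::euclidean_space \<Rightarrow> real) \<Rightarrow> bool" where
  "is_weight w \<longleftrightarrow>
     w \<in> borel_measurable lebesgue \<and> (\<forall>x. 0 \<le> w x) \<and>
     (\<forall>K. compact K \<longrightarrow> set_integrable lebesgue K w) \<and>
     \<not> (AE x in lebesgue. w x = 0)"

definition weight_measure :: "('a::euclidean_space \<Rightarrow> real) \<Rightarrow> 'a set \<Rightarrow> ennreal" where
  "weight_measure w E = (\<integral>\<^sup>+x\<in>E. ennreal (w x) \<partial>lebesgue)"

definition ball_average :: "'a::euclidean_space \<Rightarrow> real \<Rightarrow> ('a \<Rightarrow> ennreal) \<Rightarrow> ennreal" where
  "ball_average z r g = (\<integral>\<^sup>+x\<in>ball z r. g x \<partial>lebesgue) / emeasure lebesgue (ball z r)"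

definition ess_inf_on :: "'a::euclidean_space set \<Rightarrow> ('a \<Rightarrow> ennreal) \<Rightarrow> ennreal" where
  "ess_inf_on E g = Sup {c. AE x in lebesgue. x \<in> E \<longrightarrow> c \<le> g x}"

text \<open>The Muckenhoupt class \<open>A\<^sub>s\<close>, for \<open>1 \<le> s < \<infinity>\<close> (no weight belongs to it for \<open>s < 1\<close>).\<close>

definition muckenhoupt :: "real \<Rightarrow> ('a::euclidean_space \<Rightarrow> real) \<Rightarrow> bool" where
  "muckenhoupt s w \<longleftrightarrow> is_weight w \<and>
     (if s = 1 then
        (\<exists>C::real. C > 0 \<and> (\<forall>z r. r > 0 \<longrightarrow>
           ball_average z r (\<lambda>x. ennreal (w x))
             \<le> ennreal C * ess_inf_on (ball z r) (\<lambda>x. ennreal (w x))))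
      else
        s > 1 \<and>
        (\<exists>C::real. C > 0 \<and> (\<forall>z r. r > 0 \<longrightarrow>
           ball_average z r (\<lambda>x. ennreal (w x)) *
           epowr (ball_average z r (\<lambda>x. epowr (ennreal (w x)) (- 1 / (s - 1)))) (s - 1)
             \<le> ennreal C)))"

definition Lq_norm :: "real \<Rightarrow> ('a::euclidean_space \<Rightarrow> real) \<Rightarrow> ('a \<Rightarrow> ennreal) \<Rightarrow> ennreal" where
  "Lq_norm q w g = epowr (\<integral>\<^sup>+x. epowr (g x) q * ennreal (w x) \<partial>lebesgue) (1 / q)"

definition Lq_loc :: "real \<Rightarrow> 'a::euclidean_space set \<Rightarrow> ('a \<Rightarrow> real) \<Rightarrow> ('a \<Rightarrow> real) set" where
  "Lq_loc q U w = {f. f \<in> borel_measurable lebesgue \<and>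
     (\<forall>K. compact K \<and> K \<subseteq> U \<longrightarrow> Lq_norm q w (\<lambda>x. ennreal \<bar>f x\<bar> * indicator K x) < top)}"


section \<open>Weighted Herz spaces\<close>

definition dyadic_ball :: "int \<Rightarrow> 'a::euclidean_space set" where
  "dyadic_ball k = {x. norm x \<le> 2 powi k}"

definition dyadic_annulus :: "int \<Rightarrow> 'a::euclidean_space set" where
  "dyadic_annulus k = dyadic_ball k - dyadic_ball (k - 1)"

definition nonhom_shell :: "nat \<Rightarrow> 'a::euclidean_space set" where
  "nonhom_shell k = (if k = 0 then dyadic_ball 0 else dyadic_annulus (int k))"

definition hom_Herz_norm ::
  "real \<Rightarrow> real \<Rightarrow> real \<Rightarrow> ('a::euclidean_space \<Rightarrow> real) \<Rightarrow> ('a \<Rightarrow> real) \<Rightarrow> ('a \<Rightarrow> ennreal) \<Rightarrow> ennreal"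
where
  "hom_Herz_norm \<alpha> p q w1 w2 g =
     epowr (\<Sum>\<^sub>\<infinity>k::int.
              epowr (weight_measure w1 (dyadic_ball k)) (\<alpha> * p / real DIM('a)) *
              epowr (Lq_norm q w2 (\<lambda>x. g x * indicator (dyadic_annulus k) x)) p)
           (1 / p)"

definition hom_Herz ::
  "real \<Rightarrow> real \<Rightarrow> real \<Rightarrow> ('a::euclidean_space \<Rightarrow> real) \<Rightarrow> ('a \<Rightarrow> real) \<Rightarrow> ('a \<Rightarrow> real) set"
where
  "hom_Herz \<alpha> p q w1 w2 =
     {f \<in> Lq_loc q (UNIV - {0}) w2. hom_Herz_norm \<alpha> p q w1 w2 (\<lambda>x. ennreal \<bar>f x\<bar>) < top}"

definition nonhom_Herz_norm ::
  "real \<Rightarrow> real \<Rightarrow> real \<Rightarrow> ('a::euclidean_space \<Rightarrow> real) \<Rightarrow> ('a \<Rightarrow> real) \<Rightarrow> ('a \<Rightarrow> ennreal) \<Rightarrow> ennreal"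
where
  "nonhom_Herz_norm \<alpha> p q w1 w2 g =
     epowr (\<Sum>k::nat.
              epowr (weight_measure w1 (dyadic_ball (int k))) (\<alpha> * p / real DIM('a)) *
              epowr (Lq_norm q w2 (\<lambda>x. g x * indicator (nonhom_shell k) x)) p)
           (1 / p)"

definition nonhom_Herz ::
  "real \<Rightarrow> real \<Rightarrow> real \<Rightarrow> ('a::euclidean_space \<Rightarrow> real) \<Rightarrow> ('a \<Rightarrow> real) \<Rightarrow> ('a \<Rightarrow> real) set"
where
  "nonhom_Herz \<alpha> p q w1 w2 =
     {f \<in> Lq_loc q UNIV w2. nonhom_Herz_norm \<alpha> p q w1 w2 (\<lambda>x. ennreal \<bar>f x\<bar>) < top}"


section \<open>The intrinsic square function\<close>

definition Hoelder_family :: "real \<Rightarrow> ('a::euclidean_space \<Rightarrow> real) set" where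
  "Hoelder_family \<beta> = {\<phi>.
     closure {x. \<phi> x \<noteq> 0} \<subseteq> cball 0 1 \<and>
     (\<integral>x. \<phi> x \<partial>lebesgue) = 0 \<and>
     (\<forall>x x'. \<bar>\<phi> x - \<phi> x'\<bar> \<le> norm (x - x') powr \<beta>)}"

definition dilate :: "real \<Rightarrow> ('a::euclidean_space \<Rightarrow> real) \<Rightarrow> 'a \<Rightarrow> real" where
  "dilate t \<phi> x = \<phi> (x /\<^sub>R t) / t ^ DIM('a)"

definition convol :: "('a::euclidean_space \<Rightarrow> real) \<Rightarrow> ('a \<Rightarrow> real) \<Rightarrow> 'a \<Rightarrow> real" where
  "convol f g y = (\<integral>z. f z * g (y - z) \<partial>lebesgue)"

definition intrinsic_A :: "real \<Rightarrow> ('a::euclidean_space \<Rightarrow> real) \<Rightarrow> 'a \<Rightarrow> real \<Rightarrow> ennreal" where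
  "intrinsic_A \<beta> f y t = (SUP \<phi>\<in>Hoelder_family \<beta>. ennreal \<bar>convol f (dilate t \<phi>) y\<bar>)"

definition cone :: "'a::euclidean_space \<Rightarrow> ('a \<times> real) set" where
  "cone x = {(y, t). t > 0 \<and> norm (x - y) < t}"

definition intrinsic_S :: "real \<Rightarrow> ('a::euclidean_space \<Rightarrow> real) \<Rightarrow> 'a \<Rightarrow> ennreal" where
  "intrinsic_S \<beta> f x =
     epowr (\<integral>\<^sup>+yt\<in>cone x.
              (intrinsic_A \<beta> f (fst yt) (snd yt))\<^sup>2 / ennreal (snd yt ^ (DIM('a) + 1)) \<partial>lebesgue)
           (1 / 2)"

end

theory Submission imports Defs
begin

text \<open>A_beta f is a supremum over an uncountable family, and its measurability is never
  addressed: \<open>intrinsic_A\<close> and \<open>intrinsic_S\<close> are only estimated from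
  above, by monotonicity of the integral, with measurable majorants built from functions constant on
  cells. Fixing one near maximizer per cell linearizes the supremum; Hoelder regularity and mean
  zero then give decay between levels, and the stopping argument works for integrable f without an
  L^2 theory. The square root of a sum of squares of sparse averages is bounded by their plain sum;
  the constant gets worse, but a duality argument becomes possible for every q > 1. Absorbing a term
  into the left-hand side requires that side to be finite, so everything is first proved for
  finitely many levels below a fixed cell, with constants independent of both. The Herz exponent p
  may be smaller than 1, where Minkowski's inequality and duality fail; half of the geometric decay
  is spent instead.\<close>

text \<open>
  The function \<open>S\<^sub>\<beta> f\<close> is dominated by square functions \<open>(\<Sum>\<^sub>i (sup |avg\<^bsub>Q\<^esub> (f \<eta>)|)\<^sup>2)\<close> over the cells \<open>Q\<close> of
  \<open>2\<^sup>n\<close> translated dyadic grids, since every ball lies in a comparable cell of one of them (one-third trick);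
  here \<open>\<eta>\<close> runs through \<open>\<beta>\<close>-Hoelder functions of mean zero on \<open>Q\<close>. Choosing a near maximizer on every cell
  gives an almost orthogonal system, whence a weak type stopping argument and pointwise domination by a sparse
  square function of averages of \<open>|f|\<close>. A Carleson-type estimate, applied to the weight \<open>w\<close> and to its dual,
  then yields boundedness on \<open>L\<^sup>q(w)\<close>.

  For the Herz norms, \<open>f\<close> is split over the shells. Near shells are handled by the \<open>L\<^sup>q(w)\<close> bound, distant ones by
  the size of the kernel, and the (reverse) doubling properties of the two weights turn this into a matrix with
  geometric decay off the diagonal, which acts boundedly on \<open>l\<^sup>p\<close>.
\<close>

section \<open>Real powers on \<open>[0, \<infinity>]\<close>\<close>

lemma epowr_0 [simp]: "a > 0 \<Longrightarrow> epowr 0 a = 0"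
  by (simp add: epowr_def)

lemma epowr_top [simp]: "a > 0 \<Longrightarrow> epowr top a = top"
  by (simp add: epowr_def)

lemma epowr_ennreal: "a > 0 \<Longrightarrow> x \<ge> 0 \<Longrightarrow> epowr (ennreal x) a = ennreal (x powr a)"
  by (auto simp: epowr_def)

lemma epowr_ennreal_pos: "x > 0 \<Longrightarrow> epowr (ennreal x) a = ennreal (x powr a)"
  by (auto simp: epowr_def)

lemma epowr_eq_0_iff [simp]: "a > 0 \<Longrightarrow> epowr x a = 0 \<longleftrightarrow> x = 0"
  by (cases x rule: ennreal_cases) (auto simp: epowr_def)

lemma epowr_eq_top_iff [simp]: "a > 0 \<Longrightarrow> epowr x a = top \<longleftrightarrow> x = top"
  by (cases x rule: ennreal_cases) (auto simp: epowr_def)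

lemma epowr_1 [simp]: "epowr x 1 = x"
  by (cases x rule: ennreal_cases) (auto simp: epowr_def)

lemma epowr_one [simp]: "epowr 1 a = 1"
  by (simp add: epowr_def)

lemma epowr_mono: "a > 0 \<Longrightarrow> x \<le> y \<Longrightarrow> epowr x a \<le> epowr y a"
  by (cases x rule: ennreal_cases; cases y rule: ennreal_cases)
     (auto simp: epowr_ennreal top_unique intro!: powr_mono2)

lemma epowr_mult: "a > 0 \<Longrightarrow> epowr (x * y) a = epowr x a * epowr y a"
proof -
  assume a: "a > 0"
  show ?thesis
  proof (cases "x = 0 \<or> y = 0")
    case False
    then show ?thesis using a
      by (cases x rule: ennreal_cases; cases y rule: ennreal_cases)
         (auto simp: epowr_ennreal ennreal_mult[symmetric] powr_mult ennreal_top_mult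
            ennreal_mult_top)
  qed (use a in auto)
qed

lemma epowr_epowr: "a > 0 \<Longrightarrow> b > 0 \<Longrightarrow> epowr (epowr x a) b = epowr x (a * b)"
  by (cases x rule: ennreal_cases) (auto simp: epowr_ennreal powr_powr)

lemma epowr_inverse_le_iff:
  "a > 0 \<Longrightarrow> epowr x a \<le> y \<longleftrightarrow> x \<le> epowr y (1 / a)"
  using epowr_mono[of a x "epowr y (1/a)"] epowr_mono[of "1/a" "epowr x a" y]
  by (auto simp: epowr_epowr)

lemma epowr_two: "epowr x 2 = x ^ 2"
  by (cases x rule: ennreal_cases) (auto simp: epowr_ennreal ennreal_power ennreal_top_eq_mult_iff power2_eq_square ennreal_mult)

text \<open>Comparing the sum with twice the maximum treats exponents below and above 1
  alike.\<close>

lemma epowr_add_le: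
  assumes "a > 0" shows "epowr (x + y) a \<le> ennreal (2 powr a) * (epowr x a + epowr y a)"
proof -
  have "epowr (x + y) a \<le> epowr (2 * max x y) a"
    by (intro epowr_mono assms) (simp add: add_mono mult_2)
  also have "\<dots> = ennreal (2 powr a) * epowr (max x y) a"
    using epowr_ennreal[OF assms, of 2] by (simp add: epowr_mult assms)
  also have "\<dots> \<le> ennreal (2 powr a) * (epowr x a + epowr y a)"
    by (intro mult_left_mono) (auto simp: max_def)
  finally show ?thesis .
qed

lemma borel_measurable_epowr [measurable (raw)]:
  assumes [measurable]: "f \<in> borel_measurable M" and a: "a > 0"
  shows "(\<lambda>x. epowr (f x) a) \<in> borel_measurable M"
  using a unfolding epowr_def by simp

text \<open>The smaller of \<open>a\<close> and \<open>\<delta> * b\<close> is replaced by the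
  larger one. The parameter sits in front of \<open>b powr r\<close> so that this term can later be
  made small and absorbed.\<close>

lemma powr_young:
  fixes a b \<delta> r :: real
  assumes "a \<ge> 0" "b \<ge> 0" "\<delta> > 0" "r > 1"
  shows "a * b powr (r - 1) \<le> \<delta> powr (1 - r) * a powr r + \<delta> * b powr r"
proof (cases "\<delta> * b \<le> a")
  case True
  have "a * b powr (r - 1) \<le> a * (a / \<delta>) powr (r - 1)"
    using assms True by (intro mult_left_mono powr_mono2) (auto simp: field_simps)
  also have "\<dots> = \<delta> powr (1 - r) * (a * a powr (r - 1))"
    using assms by (simp add: powr_divide powr_diff field_simps)
  also have "\<dots> = \<delta> powr (1 - r) * a powr r"
    using assms by (cases "a = 0") (auto simp: powr_diff)
  finally show ?thesis using assms by (smt (verit) mult_nonneg_nonneg powr_ge_zero)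
next
  case False
  have "a * b powr (r - 1) \<le> \<delta> * b * b powr (r - 1)"
    using False by (intro mult_right_mono) auto
  also have "\<dots> = \<delta> * b powr r"
    using assms by (cases "b = 0") (auto simp: powr_diff)
  finally show ?thesis by (smt (verit) mult_nonneg_nonneg powr_ge_zero)
qed

lemma epowr_young:
  assumes "\<delta> > 0" "r > 1"
  shows "x * epowr y (r - 1) \<le> ennreal (\<delta> powr (1 - r)) * epowr x r + ennreal \<delta> * epowr y r"
proof (cases "x = top \<or> y = top")
  case True
  then show ?thesis using assms by (auto simp: ennreal_mult_top)
next
  case False
  then obtain a b where "x = ennreal a" "y = ennreal b" "a \<ge> 0" "b \<ge> 0"
    by (metis ennreal_cases)
  then show ?thesis using assms powr_young[of a b \<delta> r]
    by (simp add: epowr_ennreal ennreal_mult[symmetric] ennreal_plus[symmetric] del: ennreal_plus)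
qed

lemma epowr_young_conjugate:
  assumes "r > 1"
  shows "x * y \<le> ennreal (1/r) * epowr x r + ennreal (1 - 1/r) * epowr y (r / (r - 1))"
proof (cases "x = top \<or> y = top")
  case True
  then show ?thesis using assms by (auto simp: ennreal_mult_top)
next
  case False
  then obtain a b where "x = ennreal a" "y = ennreal b" "a \<ge> 0" "b \<ge> 0"
    by (metis ennreal_cases)
  moreover have "a * b \<le> 1/r * a powr r + (1 - 1/r) * b powr (r/(r-1))"
    using assms Youngs_inequality[of r "r/(r-1)" a b] \<open>a \<ge> 0\<close> \<open>b \<ge> 0\<close> by (simp add: field_simps)
  ultimately show ?thesis using assms
    by (simp add: epowr_ennreal ennreal_mult[symmetric] ennreal_plus[symmetric]
        del: ennreal_plus)
qed

text \<open>Raising to the power r avoids roots of possibly infinite integrals; the second factor is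
  then the (r - 1)-st power of the integral with the conjugate exponent.\<close>

lemma nn_integral_Holder:
  assumes [measurable]: "f \<in> borel_measurable M" "g \<in> borel_measurable M" and r: "r > 1"
  shows "epowr (\<integral>\<^sup>+x. f x * g x \<partial>M) r
     \<le> (\<integral>\<^sup>+x. epowr (f x) r \<partial>M) * epowr (\<integral>\<^sup>+x. epowr (g x) (r / (r - 1)) \<partial>M) (r - 1)"
proof -
  define A where "A = (\<integral>\<^sup>+x. epowr (f x) r \<partial>M)"
  define B where "B = (\<integral>\<^sup>+x. epowr (g x) (r / (r - 1)) \<partial>M)"
  have r': "r / (r - 1) > 0" using r by simp
  have [measurable]: "(\<lambda>x. epowr (f x) r) \<in> borel_measurable M"
      "(\<lambda>x. epowr (g x) (r / (r - 1))) \<in> borel_measurable M"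
    using r r' by auto
  \<comment> \<open>Normalizing both factors to integral 1 is possible only when A and B are
    positive and finite; the other cases are degenerate.\<close>
  consider "A = 0 \<or> B = 0" | "A \<noteq> 0" "B \<noteq> 0" "A = top \<or> B = top"
    | "A \<noteq> 0" "B \<noteq> 0" "A \<noteq> top" "B \<noteq> top" by blast
  then show ?thesis
  proof cases
    case 1
    then have "(AE x in M. f x = 0) \<or> (AE x in M. g x = 0)"
      using r r' unfolding A_def B_def
      by (subst (asm) nn_integral_0_iff_AE, simp, subst (asm) nn_integral_0_iff_AE, simp, simp)
    then have "AE x in M. f x * g x = 0" by auto
    then have "(\<integral>\<^sup>+x. f x * g x \<partial>M) = 0"
      by (subst nn_integral_0_iff_AE) auto
    then show ?thesis using r by simp
  next
    case 2
    then have "A * epowr B (r - 1) = top" using r by (auto simp: ennreal_mult_eq_top_iff)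
    then show ?thesis by (simp add: A_def B_def)
  next
    case 3
    then obtain a b where ab: "A = ennreal a" "B = ennreal b" "a > 0" "b > 0"
      by (metis ennreal_cases ennreal_eq_0_iff le_less not_le)
    define c where "c = a powr (1/r)"
    define d where "d = b powr ((r - 1)/r)"
    have cd: "c > 0" "d > 0" using ab by (auto simp: c_def d_def)
    have "(\<integral>\<^sup>+x. f x * g x \<partial>M) = ennreal (c * d) * (\<integral>\<^sup>+x. (ennreal (1/c) * f x) * (ennreal (1/d) * g x) \<partial>M)"
    proof -
      have "ennreal (c * d) * ((ennreal (1/c) * u) * (ennreal (1/d) * v)) = u * v" for u v
      proof -
        have "ennreal (c * d) * ((ennreal (1/c) * u) * (ennreal (1/d) * v))
            = ennreal (c * d) * (ennreal (1/c) * ennreal (1/d)) * (u * v)" by (simp add: mult_ac)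
        also have "ennreal (c * d) * (ennreal (1/c) * ennreal (1/d)) = 1"
          using cd by (simp add: ennreal_mult[symmetric])
        finally show ?thesis by simp
      qed
      then show ?thesis by (subst nn_integral_cmult[symmetric]) auto
    qed
    also have "\<dots> \<le> ennreal (c * d) * (\<integral>\<^sup>+x. (ennreal (1/r) * epowr (ennreal (1/c) * f x) r
        + ennreal (1 - 1/r) * epowr (ennreal (1/d) * g x) (r / (r - 1))) \<partial>M)"
      by (intro mult_left_mono nn_integral_mono epowr_young_conjugate r) simp
    also have "(\<lambda>x. ennreal (1/r) * epowr (ennreal (1/c) * f x) r
        + ennreal (1 - 1/r) * epowr (ennreal (1/d) * g x) (r / (r - 1))) =
        (\<lambda>x. ennreal (1/r) * ennreal (1/a) * epowr (f x) r
        + ennreal (1 - 1/r) * ennreal (1/b) * epowr (g x) (r / (r - 1)))"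
    proof -
      have "epowr (ennreal (1/c)) r = ennreal (1/a)"
        using r ab by (simp add: epowr_ennreal c_def powr_divide powr_powr)
      moreover have "epowr (ennreal (1/d)) (r / (r - 1)) = ennreal (1/b)"
        using r r' ab by (simp add: epowr_ennreal d_def powr_divide powr_powr)
      ultimately show ?thesis using r r' by (simp add: epowr_mult mult.assoc)
    qed
    also have "(\<integral>\<^sup>+x. (ennreal (1/r) * ennreal (1/a) * epowr (f x) r
        + ennreal (1 - 1/r) * ennreal (1/b) * epowr (g x) (r / (r - 1))) \<partial>M)
      = ennreal (1/r) * ennreal (1/a) * A + ennreal (1 - 1/r) * ennreal (1/b) * B"
      unfolding A_def B_def by (subst nn_integral_add) (auto simp: nn_integral_cmult)
    also have "\<dots> = 1"
      using r ab by (simp add: ennreal_mult[symmetric] ennreal_plus[symmetric] field_simps del: ennreal_plus)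
    finally have "epowr (\<integral>\<^sup>+x. f x * g x \<partial>M) r \<le> epowr (ennreal (c * d)) r"
      using r by (intro epowr_mono) auto
    also have "\<dots> = A * epowr B (r - 1)"
      using ab r cd by (simp add: c_def d_def ennreal_mult epowr_mult epowr_ennreal powr_powr)
    finally show ?thesis by (simp add: A_def B_def)
  qed
qed

text \<open>Discrete Young inequality valid for every exponent \<open>p > 0\<close>: half of the decay is spent on
  replacing the sum by a supremum.\<close>
lemma epowr_nn_integral_count_le:
  fixes c u :: "'i \<Rightarrow> ennreal"
  assumes p: "p > 0"
  shows "epowr (\<integral>\<^sup>+l. c l * c l * u l \<partial>count_space I) p
    \<le> epowr (\<integral>\<^sup>+l. c l \<partial>count_space I) p * (\<integral>\<^sup>+l. epowr (c l) p * epowr (u l) p \<partial>count_space I)"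
proof -
  define s where "s = (SUP l\<in>I. c l * u l)"
  define t where "t = (\<integral>\<^sup>+l. epowr (c l) p * epowr (u l) p \<partial>count_space I)"
  have "epowr (c l * u l) p \<le> t" if "l \<in> I" for l
    using nn_integral_ge_point[of l I "\<lambda>l. epowr (c l) p * epowr (u l) p"] that p
    by (simp add: t_def epowr_mult)
  then have "s \<le> epowr t (1/p)"
    unfolding s_def using p by (intro SUP_least) (simp add: epowr_inverse_le_iff[symmetric])
  then have s: "epowr s p \<le> t" using p by (simp add: epowr_inverse_le_iff)
  have "(\<integral>\<^sup>+l. c l * c l * u l \<partial>count_space I) \<le> (\<integral>\<^sup>+l. c l * s \<partial>count_space I)"
    by (intro nn_integral_mono) (auto simp: s_def mult.assoc intro!: mult_left_mono SUP_upper)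
  also have "\<dots> = (\<integral>\<^sup>+l. c l \<partial>count_space I) * s"
    by (simp add: nn_integral_multc)
  finally have "epowr (\<integral>\<^sup>+l. c l * c l * u l \<partial>count_space I) p \<le> epowr ((\<integral>\<^sup>+l. c l \<partial>count_space I) * s) p"
    using p by (intro epowr_mono)
  also have "\<dots> \<le> epowr (\<integral>\<^sup>+l. c l \<partial>count_space I) p * t"
    using p s by (simp add: epowr_mult mult_left_mono)
  finally show ?thesis by (simp add: t_def)
qed

text \<open>As an integral over counting measure the unordered sum becomes accessible to Tonelli's
  theorem and monotone convergence.\<close>

lemma infsum_int_eq_nn_integral: "(\<Sum>\<^sub>\<infinity>k::int. f k) = (\<integral>\<^sup>+k. f k \<partial>count_space UNIV)"
  for f :: "int \<Rightarrow> ennreal"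
proof -
  have b: "bij (int_decode :: nat \<Rightarrow> int)" by (rule bij_int_decode)
  have "(\<Sum>\<^sub>\<infinity>k::int. f k) = (\<Sum>\<^sub>\<infinity>n::nat. f (int_decode n))"
    using infsum_reindex_bij_betw[OF b, of f] by simp
  also have "\<dots> = (\<Sum>n. f (int_decode n))"
  proof -
    have "((\<lambda>n. f (int_decode n)) has_sum (\<Sum>\<^sub>\<infinity>n::nat. f (int_decode n))) UNIV"
      by (intro has_sum_infsum nonneg_summable_on_complete) simp
    then show ?thesis by (simp add: has_sum_imp_sums sums_unique)
  qed
  also have "\<dots> = (\<integral>\<^sup>+n. f (int_decode n) \<partial>count_space UNIV)"
    by (simp add: nn_integral_count_space_nat)
  also have "\<dots> = (\<integral>\<^sup>+k. f k \<partial>count_space UNIV)"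
    by (rule nn_integral_bij_count_space[OF b])
  finally show ?thesis .
qed

section \<open>Integration over partitions into cells\<close>

text \<open>A partition is encoded by the map P sending a point to its part. A preimage under g is a
  countable union of preimages under measurable functions, one for each part.\<close>

lemma piecewise_measurable:
  assumes P: "\<And>x. x \<in> P x" "\<And>x y. y \<in> P x \<Longrightarrow> P y = P x" "countable (range P)"
      "\<And>x. P x \<in> sets M" "space M = UNIV"
    and g: "\<And>x y. y \<in> P x \<Longrightarrow> g y = h (P x) y" "\<And>x. h (P x) \<in> measurable M N"
  shows "g \<in> measurable M N"
proof (rule measurableI)
  fix x assume "x \<in> space M"
  then show "g x \<in> space N" using g(1)[OF P(1)[of x]] measurable_space[OF g(2)[of x]] by simp
next
  fix B assume B: "B \<in> sets N"
  have "g -` B \<inter> space M = (\<Union>A\<in>range P. A \<inter> (h A -` B \<inter> space M))"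
  proof (intro set_eqI iffI)
    fix x assume "x \<in> g -` B \<inter> space M"
    then show "x \<in> (\<Union>A\<in>range P. A \<inter> (h A -` B \<inter> space M))"
      using P(1)[of x] g(1)[OF P(1)[of x]] by auto
  next
    fix x assume "x \<in> (\<Union>A\<in>range P. A \<inter> (h A -` B \<inter> space M))"
    then obtain z where "x \<in> P z" "h (P z) x \<in> B" by auto
    then show "x \<in> g -` B \<inter> space M" using g(1)[of x z] P(5) by simp
  qed
  also have "\<dots> \<in> sets M"
    using P(3)
    by (intro sets.countable_UN'' P(3)) (auto intro!: sets.Int P(4) measurable_sets[OF g(2) B])
  finally show "g -` B \<inter> space M \<in> sets M" .
qed

lemma piecewise_constant_measurable:
  assumes P: "\<And>x. x \<in> P x" "\<And>x y. y \<in> P x \<Longrightarrow> P y = P x" "countable (range P)"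
      "\<And>x. P x \<in> sets M" "space M = UNIV"
    and g: "\<And>x y. y \<in> P x \<Longrightarrow> g y = g x" "\<And>x. g x \<in> space N"
  shows "g \<in> measurable M N"
proof (rule piecewise_measurable[OF P, where h = "\<lambda>A y. g (SOME z. z \<in> A)"])
  fix x y assume "y \<in> P x"
  then have "(SOME z. z \<in> P x) \<in> P x" by (rule someI)
  then show "g y = g (SOME z. z \<in> P x)" using g(1)[OF \<open>y \<in> P x\<close>] g(1)[of _ x] by simp
qed (use g(2) in auto)

text \<open>Local-to-global principle: an inequality known on every part is summed over the
  countably many parts inside Q, which must be a union of parts.\<close>

lemma nn_integral_partition_mono:
  assumes P: "\<And>x. x \<in> P x" "\<And>x y. y \<in> P x \<Longrightarrow> P y = P x" "countable (range P)"
      "\<And>x. P x \<in> sets M" "space M = UNIV"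
    and [measurable]: "F \<in> borel_measurable M" "G \<in> borel_measurable M"
    and Q: "\<And>x. x \<in> Q \<Longrightarrow> P x \<subseteq> Q" "Q \<in> sets M"
    and le: "\<And>x. x \<in> Q \<Longrightarrow> (\<integral>\<^sup>+y\<in>P x. F y \<partial>M) \<le> (\<integral>\<^sup>+y\<in>P x. G y \<partial>M)"
  shows "(\<integral>\<^sup>+y\<in>Q. F y \<partial>M) \<le> (\<integral>\<^sup>+y\<in>Q. G y \<partial>M)"
proof -
  have [measurable]: "A \<in> sets M" if "A \<in> range P" for A using that P(4) by auto
  note Q(2)[measurable]
  have eq: "(\<integral>\<^sup>+y\<in>Q. F y \<partial>M) = (\<integral>\<^sup>+A. (\<integral>\<^sup>+y. F y * indicator Q y * indicator A y \<partial>M) \<partial>count_space (range P))"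
    if [measurable]: "F \<in> borel_measurable M" for F
  proof -
    have "F y * indicator Q y = (\<integral>\<^sup>+A. F y * indicator Q y * indicator A y \<partial>count_space (range P))" for y
    proof -
      have "(\<integral>\<^sup>+A. F y * indicator Q y * indicator A y \<partial>count_space (range P))
         = (\<integral>\<^sup>+A. F y * indicator Q y * indicator {P y} A \<partial>count_space (range P))"
      proof (intro nn_integral_cong)
        fix A assume "A \<in> space (count_space (range P))"
        then obtain x where "A = P x" by auto
        then have "y \<in> A \<longleftrightarrow> A = P y" using P(1)[of y] P(2)[of y x] by auto
        then show "F y * indicator Q y * indicator A y = F y * indicator Q y * indicator {P y} A"
          by (simp add: indicator_def)
      qed
      also have "\<dots> = F y * indicator Q y"
        by (simp add: nn_integral_cmult)
      finally show ?thesis by simp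
    qed
    then have "(\<integral>\<^sup>+y\<in>Q. F y \<partial>M) = (\<integral>\<^sup>+y. (\<integral>\<^sup>+A. F y * indicator Q y * indicator A y \<partial>count_space (range P)) \<partial>M)"
      by simp
    also have "\<dots> = (\<integral>\<^sup>+A. (\<integral>\<^sup>+y. F y * indicator Q y * indicator A y \<partial>M) \<partial>count_space (range P))"
      using P(3) by (intro nn_integral_count_space_nn_integral) auto
    finally show ?thesis .
  qed
  show ?thesis
    unfolding eq[OF assms(6)] eq[OF assms(7)]
  proof (rule nn_integral_mono)
    fix A assume "A \<in> space (count_space (range P))"
    then obtain x where A: "A = P x" by auto
    have *: "(\<integral>\<^sup>+y. H y * indicator Q y * indicator A y \<partial>M) = (if x \<in> Q then \<integral>\<^sup>+y\<in>P x. H y \<partial>M else 0)" for H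
    proof (cases "x \<in> Q")
      case True
      then have "indicator Q y * indicator A y = (indicator A y :: ennreal)" for y
        using Q(1)[OF True] A by (auto simp: indicator_def)
      then show ?thesis using True A by (simp add: mult.assoc)
    next
      case False
      then have "y \<notin> Q" if "y \<in> P x" for y
        using Q(1)[of y] P(2)[OF that] P(1)[of x] by auto
      then have "indicator Q y * indicator A y = (0 :: ennreal)" for y
        using A by (auto simp: indicator_def)
      then have "(\<lambda>y. H y * indicator Q y * indicator A y) = (\<lambda>y. 0)" by (simp only: mult.assoc mult_zero_right)
      then show ?thesis using False by simp
    qed
    show "(\<integral>\<^sup>+y. F y * indicator Q y * indicator A y \<partial>M) \<le> (\<integral>\<^sup>+y. G y * indicator Q y * indicator A y \<partial>M)"
      unfolding * using le[of x] by simp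
  qed
qed

lemma enn2real_le_iff_finite: "x < top \<Longrightarrow> y < top \<Longrightarrow> enn2real x \<le> enn2real y \<longleftrightarrow> x \<le> y"
  by (metis enn2real_mono ennreal_enn2real ennreal_leI)

text \<open>Countable sums of signed integrals are avoided: the hypothesis on each part says that
  the negative part of K has the smaller integral, and this comparison of nonnegative integrals is
  what gets summed.\<close>

lemma set_integral_partition_nonneg:
  fixes K :: "'a \<Rightarrow> real"
  assumes P: "\<And>x. x \<in> P x" "\<And>x y. y \<in> P x \<Longrightarrow> P y = P x" "countable (range P)"
      "\<And>x. P x \<in> sets M" "space M = UNIV"
    and [measurable]: "K \<in> borel_measurable M"
    and Q: "\<And>x. x \<in> Q \<Longrightarrow> P x \<subseteq> Q" "Q \<in> sets M"
    and int: "set_integrable M Q K"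
    and le: "\<And>x. x \<in> Q \<Longrightarrow> 0 \<le> (LINT y:P x|M. K y)"
  shows "0 \<le> (LINT y:Q|M. K y)"
proof -
  have form: "(LINT y:A|M. K y) = enn2real (\<integral>\<^sup>+y\<in>A. ennreal (K y) \<partial>M) - enn2real (\<integral>\<^sup>+y\<in>A. ennreal (- K y) \<partial>M)
      \<and> (\<integral>\<^sup>+y\<in>A. ennreal (K y) \<partial>M) < top \<and> (\<integral>\<^sup>+y\<in>A. ennreal (- K y) \<partial>M) < top"
    if A: "set_integrable M A K" for A
  proof -
    have *: "ennreal (indicator A y *\<^sub>R K y) = ennreal (K y) * indicator A y"
      "ennreal (- (indicator A y *\<^sub>R K y)) = ennreal (- K y) * indicator A y" for y
      by (auto simp: indicator_def)
    have i: "integrable M (\<lambda>y. indicator A y *\<^sub>R K y)" using A by (simp add: set_integrable_def)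
    show ?thesis
      using real_lebesgue_integral_def[OF i] i
      unfolding real_integrable_def set_lebesgue_integral_def * by (auto simp: less_top)
  qed
  have intP: "set_integrable M (P x) K" if "x \<in> Q" for x
    by (rule set_integrable_subset[OF int P(4) Q(1)[OF that]])
  have "(\<integral>\<^sup>+y\<in>Q. ennreal (- K y) \<partial>M) \<le> (\<integral>\<^sup>+y\<in>Q. ennreal (K y) \<partial>M)"
  proof (rule nn_integral_partition_mono[OF P _ _ Q])
    fix x assume x: "x \<in> Q"
    from form[OF intP[OF x]] le[OF x]
    have "enn2real (\<integral>\<^sup>+y\<in>P x. ennreal (- K y) \<partial>M) \<le> enn2real (\<integral>\<^sup>+y\<in>P x. ennreal (K y) \<partial>M)"
      by simp
    then show "(\<integral>\<^sup>+y\<in>P x. ennreal (- K y) \<partial>M) \<le> (\<integral>\<^sup>+y\<in>P x. ennreal (K y) \<partial>M)"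
      using form[OF intP[OF x]] by (simp add: enn2real_le_iff_finite)
  qed measurable
  then have "enn2real (\<integral>\<^sup>+y\<in>Q. ennreal (- K y) \<partial>M) \<le> enn2real (\<integral>\<^sup>+y\<in>Q. ennreal (K y) \<partial>M)"
    by (rule enn2real_mono) (use form[OF int] in blast)
  then show ?thesis using form[OF int] by simp
qed

lemma set_integral_partition_mono:
  fixes F G :: "'a \<Rightarrow> real"
  assumes P: "\<And>x. x \<in> P x" "\<And>x y. y \<in> P x \<Longrightarrow> P y = P x" "countable (range P)"
      "\<And>x. P x \<in> sets M" "space M = UNIV"
    and [measurable]: "F \<in> borel_measurable M" "G \<in> borel_measurable M"
    and Q: "\<And>x. x \<in> Q \<Longrightarrow> P x \<subseteq> Q" "Q \<in> sets M"
    and int: "set_integrable M Q F" "set_integrable M Q G"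
    and le: "\<And>x. x \<in> Q \<Longrightarrow> (LINT y:P x|M. F y) \<le> (LINT y:P x|M. G y)"
  shows "(LINT y:Q|M. F y) \<le> (LINT y:Q|M. G y)"
proof -
  have "0 \<le> (LINT y:Q|M. G y - F y)"
  proof (rule set_integral_partition_nonneg[OF P _ Q])
    fix x assume x: "x \<in> Q"
    have "set_integrable M (P x) F" "set_integrable M (P x) G"
      by (rule set_integrable_subset[OF int(1) P(4) Q(1)[OF x]])
         (rule set_integrable_subset[OF int(2) P(4) Q(1)[OF x]])
    then show "0 \<le> (LINT y:P x|M. G y - F y)" using le[OF x] by simp
  qed (use int in auto)
  then show ?thesis using int by simp
qed

lemma set_integrable_bounded:
  fixes g :: "'a \<Rightarrow> real"
  assumes "A \<in> sets M" "emeasure M A < top" "g \<in> borel_measurable M" "\<And>x. x \<in> A \<Longrightarrow> \<bar>g x\<bar> \<le> B"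
  shows "set_integrable M A g"
  unfolding set_integrable_def
  by (rule integrableI_bounded_set_indicator[where B=B]) (use assms in auto)

lemma set_integrable_mult_bounded:
  fixes f g :: "'a \<Rightarrow> real"
  assumes f: "set_integrable M A f" and g: "g \<in> borel_measurable M" "\<And>x. x \<in> A \<Longrightarrow> \<bar>g x\<bar> \<le> B"
    and fm: "f \<in> borel_measurable M" and A: "A \<in> sets M"
  shows "set_integrable M A (\<lambda>x. f x * g x)"
proof -
  have "set_integrable M A (\<lambda>x. \<bar>B\<bar> * f x)" using f by simp
  then show ?thesis
  proof (rule set_integrable_bound)
    show "set_borel_measurable M A (\<lambda>x. f x * g x)"
      using g(1) fm A by (auto simp: set_borel_measurable_def)
    show "AE x in M. x \<in> A \<longrightarrow> norm (f x * g x) \<le> norm (\<bar>B\<bar> * f x)"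
    proof (intro AE_I2 impI)
      fix x assume "x \<in> A"
      then have "\<bar>g x\<bar> \<le> \<bar>B\<bar>" using g(2)[of x] by linarith
      then show "norm (f x * g x) \<le> norm (\<bar>B\<bar> * f x)" 
        using mult_right_mono[of "\<bar>g x\<bar>" "\<bar>B\<bar>" "\<bar>f x\<bar>"] by (simp add: abs_mult mult.commute)
    qed
  qed
qed

text \<open>Cells of level i have side 2^-i, so larger indices mean finer cells. The factor n in the
  diameter bound comes from estimating the Euclidean norm by the sum of the coordinates.\<close>

locale dyadic_cells =
  fixes cell :: "int \<Rightarrow> 'a::euclidean_space \<Rightarrow> 'a set"
  assumes cell_self: "x \<in> cell i x"
    and cell_eq: "y \<in> cell i x \<Longrightarrow> cell i y = cell i x"
    and cell_nested: "cell (i + 1) x \<subseteq> cell i x"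
    and countable_cells: "countable (range (cell i))"
    and sets_cell: "cell i x \<in> sets lebesgue"
    and emeasure_cell: "emeasure lebesgue (cell i x) = ennreal (2 powr (- (real DIM('a) * of_int i)))"
    and cell_diam: "y \<in> cell i x \<Longrightarrow> z \<in> cell i x \<Longrightarrow> norm (y - z) \<le> real DIM('a) * 2 powr (- of_int i)"
begin

definition vol :: "int \<Rightarrow> real" where
  "vol i = 2 powr (- (real DIM('a) * of_int i))"

lemma vol_pos: "vol i > 0" by (simp add: vol_def)

lemma vol_add: "vol (i + int m) * 2 ^ (DIM('a) * m) = vol i"
proof -
  have "(2::real) ^ (DIM('a) * m) = 2 powr (real DIM('a) * m)" by (simp add: powr_realpow[symmetric])
  then show ?thesis unfolding vol_def by (simp add: powr_add[symmetric] algebra_simps)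
qed

lemma measure_cell: "measure lebesgue (cell i x) = vol i"
  by (simp add: measure_def emeasure_cell vol_def)

lemma emeasure_cell': "emeasure lebesgue (cell i x) = ennreal (vol i)"
  by (simp add: emeasure_cell vol_def)

lemma cell_antimono: "i \<le> j \<Longrightarrow> cell j x \<subseteq> cell i x"
proof (induction j rule: int_ge_induct)
  case (step j) show ?case by (rule subset_trans[OF cell_nested step.IH])
qed simp

lemma cell_eq_le: "y \<in> cell j x \<Longrightarrow> i \<le> j \<Longrightarrow> cell i y = cell i x"
  by (rule cell_eq, rule subsetD[OF cell_antimono])

lemmas cell_partition = cell_self cell_eq countable_cells sets_cell

lemma cell_constant_measurable:
  assumes "\<And>x y. y \<in> cell i x \<Longrightarrow> g y = g x" "\<And>x. g x \<in> space N"
  shows "g \<in> measurable lebesgue N"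
  by (rule piecewise_constant_measurable[where P="cell i", OF cell_partition _ assms]) simp_all

end

lemma set_integral_subset_mono:
  fixes g :: "'a \<Rightarrow> real"
  assumes "set_integrable M B g" "A \<in> sets M" "A \<subseteq> B" "\<And>x. 0 \<le> g x"
  shows "(LINT x:A|M. g x) \<le> (LINT x:B|M. g x)"
  using set_integrable_subset[OF assms(1-3)] assms unfolding set_lebesgue_integral_def set_integrable_def
  by (intro integral_mono) (auto simp: indicator_def)

lemma set_integral_finite_sum:
  fixes g :: "'i \<Rightarrow> 'a \<Rightarrow> real"
  assumes "\<And>i. i \<in> I \<Longrightarrow> set_integrable M A (g i)"
  shows "set_integrable M A (\<lambda>x. \<Sum>i\<in>I. g i x)" "(LINT x:A|M. (\<Sum>i\<in>I. g i x)) = (\<Sum>i\<in>I. LINT x:A|M. g i x)"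
  using assms unfolding set_lebesgue_integral_def set_integrable_def
  by (auto simp: sum_distrib_left intro!: integral_sum)

lemma set_integral_indicator_const:
  fixes c :: real
  assumes "S \<subseteq> A" shows "(LINT y:A|lebesgue. indicator S y * c) = measure lebesgue S * c"
proof -
  have "(LINT y:A|lebesgue. indicator S y * c) = (LINT y|lebesgue. indicator S y * c)"
    unfolding set_lebesgue_integral_def using assms
    by (intro Bochner_Integration.integral_cong) (auto simp: indicator_def)
  also have "\<dots> = measure lebesgue S * c" by simp
  finally show ?thesis .
qed

section \<open>Almost orthogonality of test functions on dyadic cells\<close>

text \<open>Each \<open>e i\<close> glues together one test function per cell of level i. Regularity
  is demanded only inside a cell, so \<open>e i\<close> may jump across cell boundaries.\<close>

locale dyadic_test = dyadic_cells cell
  for cell :: "int \<Rightarrow> 'a::euclidean_space \<Rightarrow> 'a set" +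
  fixes f :: "'a \<Rightarrow> real" and e :: "int \<Rightarrow> 'a \<Rightarrow> real" and \<beta> :: real
  assumes beta_pos: "0 < \<beta>"
    and f_measurable [measurable]: "f \<in> borel_measurable lebesgue"
    and f_integrable: "set_integrable lebesgue (cell i x) f"
    and e_measurable [measurable]: "e i \<in> borel_measurable lebesgue"
    and e_bound: "\<bar>e i x\<bar> \<le> 1"
    and e_hoelder: "y \<in> cell i x \<Longrightarrow> z \<in> cell i x \<Longrightarrow> \<bar>e i y - e i z\<bar> \<le> (2 powr of_int i * norm (y - z)) powr \<beta>"
    and e_mean: "(LINT y:cell i x|lebesgue. e i y) = 0"
begin

definition avg :: "int \<Rightarrow> 'a \<Rightarrow> real" where
  "avg i x = (LINT y:cell i x|lebesgue. \<bar>f y\<bar>) / vol i"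

definition coef :: "int \<Rightarrow> 'a \<Rightarrow> real" where
  "coef i x = (LINT y:cell i x|lebesgue. f y * e i y) / vol i"

text \<open>\<open>ndim\<close> is the Hoelder bound belonging to the diameter of a cell and
  \<open>\<theta>\<close> the gain per level of refinement. \<open>B0\<close> = 4 * 2^n bounds the
  average over a stopping cell in units of \<open>a\<close>; \<open>Kc\<close> is the outcome of the
  absorption in \<open>X_le\<close>.\<close>

definition ndim :: real where "ndim = real DIM('a) powr \<beta>"
definition \<theta> :: real where "\<theta> = 2 powr - \<beta>"

definition B0 :: real where "B0 = 2 ^ (DIM('a) + 2)"
definition Kc :: real where "Kc = 2 * B0 * (ndim / (1 - \<theta>)) * (B0 + 4)"

lemma theta: "0 < \<theta>" "\<theta> < 1" and ndim: "ndim \<ge> 1"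
proof -
  show "0 < \<theta>" by (simp add: \<theta>_def)
  show "\<theta> < 1" using beta_pos unfolding \<theta>_def by (simp add: powr_less_one)
  have "real DIM('a) \<ge> 1" using DIM_positive[where 'a='a] by linarith
  then show "ndim \<ge> 1" unfolding ndim_def using beta_pos by (simp add: ge_one_powr_ge_zero)
qed

lemma avg_cell: "y \<in> cell i x \<Longrightarrow> avg i y = avg i x"
  unfolding avg_def by (simp add: cell_eq[of y i x])

lemma coef_cell: "y \<in> cell i x \<Longrightarrow> coef i y = coef i x"
  unfolding coef_def by (simp add: cell_eq[of y i x])

lemma avg_cell_le: "y \<in> cell j x \<Longrightarrow> i \<le> j \<Longrightarrow> avg i y = avg i x"
  unfolding avg_def by (simp add: cell_eq_le[of y j x i])

lemma coef_cell_le: "y \<in> cell j x \<Longrightarrow> i \<le> j \<Longrightarrow> coef i y = coef i x"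
  unfolding coef_def by (simp add: cell_eq_le[of y j x i])

lemma avg_measurable [measurable]: "avg i \<in> borel_measurable lebesgue"
  by (rule cell_constant_measurable[OF avg_cell]) simp_all

lemma coef_measurable [measurable]: "coef i \<in> borel_measurable lebesgue"
  by (rule cell_constant_measurable[OF coef_cell]) simp_all

lemma f_abs_integrable: "set_integrable lebesgue (cell i x) (\<lambda>y. \<bar>f y\<bar>)"
  using set_integrable_abs[OF f_integrable] by simp

lemma avg_nonneg: "avg i x \<ge> 0"
  unfolding avg_def using vol_pos[of i]
  by (intro divide_nonneg_pos) (auto simp: set_lebesgue_integral_def intro!: integral_nonneg)

lemma integral_avg: "(LINT y:cell i x|lebesgue. \<bar>f y\<bar>) = avg i x * vol i"
  using vol_pos[of i] by (simp add: avg_def)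

lemma integral_coef: "(LINT y:cell i x|lebesgue. f y * e i y) = coef i x * vol i"
  using vol_pos[of i] by (simp add: coef_def)

lemma fe_integrable: "set_integrable lebesgue (cell i x) (\<lambda>y. f y * e k y)"
  by (rule set_integrable_mult_bounded[OF f_integrable, where B=1]) (auto simp: e_bound sets_cell)

lemma coef_le_avg: "\<bar>coef i x\<bar> \<le> avg i x"
proof -
  have "\<bar>LINT y:cell i x|lebesgue. f y * e i y\<bar> \<le> (LINT y:cell i x|lebesgue. \<bar>f y * e i y\<bar>)"
    using set_integral_norm_bound[OF fe_integrable[of i x i]] by simp
  also have "\<dots> \<le> (LINT y:cell i x|lebesgue. \<bar>f y\<bar>)"
  proof (rule set_integral_mono)
    show "set_integrable lebesgue (cell i x) (\<lambda>y. \<bar>f y * e i y\<bar>)"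
      using set_integrable_abs[OF fe_integrable[of i x i]] by simp
    show "\<bar>f y * e i y\<bar> \<le> \<bar>f y\<bar>" for y
      using mult_left_mono[OF e_bound[of i y], of "\<bar>f y\<bar>"] by (simp add: abs_mult)
  qed (rule f_abs_integrable)
  finally show ?thesis using vol_pos[of i]
    by (simp add: coef_def avg_def divide_right_mono abs_divide)
qed

lemma avg_add_le: "avg (i + int m) x \<le> 2 ^ (DIM('a) * m) * avg i x"
proof -
  have "(LINT y:cell (i + int m) x|lebesgue. \<bar>f y\<bar>) \<le> (LINT y:cell i x|lebesgue. \<bar>f y\<bar>)"
    by (rule set_integral_subset_mono[OF f_abs_integrable sets_cell cell_antimono]) simp_all
  then have "avg (i + int m) x * vol (i + int m) \<le> avg i x * (vol (i + int m) * 2 ^ (DIM('a) * m))"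
    unfolding integral_avg by (simp add: vol_add)
  then show ?thesis using vol_pos[of "i + int m"] by (simp add: mult_ac)
qed

lemma avg_Suc_le: "avg (i + 1) x \<le> 2 ^ DIM('a) * avg i x"
  using avg_add_le[of i 1 x] by simp

lemma e_osc:
  assumes "y \<in> cell (i + int k) x" "z \<in> cell (i + int k) x"
  shows "\<bar>e i y - e i z\<bar> \<le> ndim * \<theta> ^ k"
proof -
  have "y \<in> cell i x" "z \<in> cell i x" using assms cell_antimono[of i "i + int k" x] by auto
  then have "\<bar>e i y - e i z\<bar> \<le> (2 powr of_int i * norm (y - z)) powr \<beta>" by (rule e_hoelder)
  also have "\<dots> \<le> (2 powr of_int i * (real DIM('a) * 2 powr (- of_int (i + int k)))) powr \<beta>"
    using beta_pos cell_diam[OF assms] by (intro powr_mono2 mult_left_mono) auto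
  also have "2 powr of_int i * (real DIM('a) * 2 powr (- of_int (i + int k))) = real DIM('a) * 2 powr (- real k)"
    by (simp add: powr_diff powr_minus field_simps powr_add)
  also have "\<dots> powr \<beta> = ndim * \<theta> ^ k"
    unfolding ndim_def \<theta>_def by (simp add: powr_mult powr_powr powr_realpow[symmetric] mult.commute)
  finally show ?thesis .
qed

lemma sum_theta_le: "(\<Sum>l\<le>m. \<theta> ^ (m - l)) \<le> 1 / (1 - \<theta>)" for m :: nat
proof -
  have "(\<Sum>l\<le>m. \<theta> ^ (m - l)) = (\<Sum>l\<le>m. \<theta> ^ l)"
    by (rule sum.reindex_bij_witness[of _ "\<lambda>l. m - l" "\<lambda>l. m - l"]) auto
  also have "\<dots> \<le> 1 / (1 - \<theta>)"
    using theta by (simp add: atMost_atLeast0 sum_gp divide_right_mono)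
  finally show ?thesis .
qed

text \<open>Row sums of the matrix with entries \<open>\<theta>\<close> to the power |k - l|, as
  needed for the Schur-type bound in \<open>Psi2_le\<close>.\<close>

lemma sum_theta_diff_le:
  "(\<Sum>k\<le>m. \<theta> ^ (if l \<le> k then k - l else l - k)) \<le> 2 / (1 - \<theta>)" if "l \<le> m" for l m :: nat
proof -
  have "(\<Sum>k\<le>m. \<theta> ^ (if l \<le> k then k - l else l - k))
     \<le> (\<Sum>k\<in>{..l} \<union> {l..m}. \<theta> ^ (if l \<le> k then k - l else l - k))"
    using theta by (intro sum_mono2) auto
  also have "\<dots> \<le> (\<Sum>k\<le>l. \<theta> ^ (if l \<le> k then k - l else l - k)) + (\<Sum>k=l..m. \<theta> ^ (if l \<le> k then k - l else l - k))"
    using theta by (subst sum_Un) (auto intro!: sum_nonneg)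
  also have "(\<Sum>k\<le>l. \<theta> ^ (if l \<le> k then k - l else l - k)) = (\<Sum>k\<le>l. \<theta> ^ (l - k))"
    by (intro sum.cong) auto
  also have "(\<Sum>k=l..m. \<theta> ^ (if l \<le> k then k - l else l - k)) = (\<Sum>k\<le>m - l. \<theta> ^ (m - l - k))"
    using that by (intro sum.reindex_bij_witness[of _ "\<lambda>k. m - k" "\<lambda>k. m - k"]) auto
  finally show ?thesis using sum_theta_le[of l] sum_theta_le[of "m - l"] by linarith
qed


text \<open>
  Starting from the cell \<open>Q = cell j x0\<close> with average \<open>a\<close> of \<open>|f|\<close>, stop at the first subcell whose average exceeds
  \<open>4 a\<close>. The sum \<open>X\<close> of the squared coefficients before stopping is at most the integral of \<open>|f| |Psi|\<close>. On a
  stopping cell \<open>Pc x\<close> the function \<open>Psi\<close> is nearly constant, so \<open>|f|\<close> may be replaced by a multiple of \<open>a\<close>;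
  almost orthogonality bounds the \<open>L\<^sup>2\<close> norm of \<open>Psi\<close> by \<open>X\<close> again, and \<open>X\<close> is at most a multiple of \<open>a\<^sup>2 |Q|\<close>.
\<close>
context
  fixes j :: int and x0 :: 'a and a :: real and m :: nat
  assumes a_eq: "a = avg j x0" and a_pos: "a > 0" and m_pos: "m \<ge> 1"
begin

definition act :: "nat \<Rightarrow> 'a \<Rightarrow> bool" where
  "act k x \<longleftrightarrow> (\<forall>k'\<le>k. avg (j + int k') x \<le> 4 * a)"

definition ch :: "nat \<Rightarrow> 'a \<Rightarrow> real" where
  "ch k x = (if act k x then coef (j + int k) x else 0)"

definition Psi :: "'a \<Rightarrow> real" where
  "Psi x = (\<Sum>k\<le>m. ch k x * e (j + int k) x)"

text \<open>Capping at m makes the least element exist: a stopping cell is either the first one with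
  a large average or a cell of the last level.\<close>

definition stp :: "'a \<Rightarrow> nat" where
  "stp x = (LEAST k. avg (j + int k) x > 4 * a \<or> k \<ge> m)"

definition Pc :: "'a \<Rightarrow> 'a set" where
  "Pc x = cell (j + int (stp x)) x"

abbreviation Q :: "'a set" where "Q \<equiv> cell j x0"

lemma act_cell: "y \<in> cell (j + int k) x \<Longrightarrow> k' \<le> k \<Longrightarrow> act k' y = act k' x"
  unfolding act_def by (auto simp: avg_cell_le[of y "j + int k" x])

lemma ch_cell: "y \<in> cell (j + int k) x \<Longrightarrow> k' \<le> k \<Longrightarrow> ch k' y = ch k' x"
  unfolding ch_def by (simp add: act_cell[of y k x] coef_cell_le[of y "j + int k" x])

lemma ch_measurable [measurable]: "ch k \<in> borel_measurable lebesgue"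
  by (rule cell_constant_measurable[of "j + int k", OF ch_cell[OF _ order_refl]]) simp_all

lemma Psi_measurable [measurable]: "Psi \<in> borel_measurable lebesgue"
  unfolding Psi_def by measurable

lemma ch_bound: "\<bar>ch k x\<bar> \<le> 4 * a"
  unfolding ch_def act_def using coef_le_avg[of "j + int k" x] a_pos by fastforce

lemma ch2_le: "(ch k x)\<^sup>2 \<le> (4 * a)\<^sup>2"
  using ch_bound[of k x] a_pos by (subst abs_le_square_iff[symmetric]) simp

lemma Psi_bound: "\<bar>Psi x\<bar> \<le> (m + 1) * (4 * a)"
proof -
  have "\<bar>Psi x\<bar> \<le> (\<Sum>k\<le>m. \<bar>ch k x * e (j + int k) x\<bar>)" unfolding Psi_def by (rule sum_abs)
  also have "\<dots> \<le> (\<Sum>k\<le>m. 4 * a)"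
  proof (rule sum_mono)
    fix k
    have "\<bar>ch k x\<bar> * \<bar>e (j + int k) x\<bar> \<le> 4 * a * 1"
      using a_pos by (intro mult_mono ch_bound e_bound) auto
    then show "\<bar>ch k x * e (j + int k) x\<bar> \<le> 4 * a" by (simp add: abs_mult)
  qed
  finally show ?thesis by (simp add: algebra_simps)
qed

lemma stp_prop: "avg (j + int (stp x)) x > 4 * a \<or> stp x \<ge> m"
  unfolding stp_def by (rule LeastI[of _ m]) simp

lemma stp_le: "stp x \<le> m"
  unfolding stp_def by (rule Least_le) simp

lemma not_stp: "k < stp x \<Longrightarrow> avg (j + int k) x \<le> 4 * a"
  unfolding stp_def using not_less_Least by fastforce

lemma stp_cell: assumes "y \<in> Pc x" shows "stp y = stp x"
proof -
  have eq: "avg (j + int k) y = avg (j + int k) x" if "k \<le> stp x" for k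
    using assms that unfolding Pc_def by (intro avg_cell_le) auto
  show ?thesis
    unfolding stp_def[of y]
  proof (rule Least_equality)
    show "4 * a < avg (j + int (stp x)) y \<or> m \<le> stp x" using stp_prop[of x] eq[of "stp x"] by simp
    fix k assume k: "4 * a < avg (j + int k) y \<or> m \<le> k"
    show "stp x \<le> k"
    proof (rule ccontr)
      assume "\<not> stp x \<le> k"
      then show False using k eq[of k] not_stp[of k x] stp_le[of x] by auto
    qed
  qed
qed

lemma Pc_partition:
  "x \<in> Pc x" "y \<in> Pc x \<Longrightarrow> Pc y = Pc x" "countable (range Pc)" "Pc x \<in> sets lebesgue" "space lebesgue = UNIV"
proof -
  show "x \<in> Pc x" by (simp add: Pc_def cell_self)
  show "Pc y = Pc x" if "y \<in> Pc x" using stp_cell[OF that] that unfolding Pc_def by (simp add: cell_eq)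
  have "range Pc \<subseteq> (\<Union>k. range (cell (j + int k)))" by (auto simp: Pc_def)
  then show "countable (range Pc)" by (rule countable_subset) (simp add: countable_cells)
  show "Pc x \<in> sets lebesgue" by (simp add: Pc_def sets_cell)
qed simp

lemma cell_sub_Q: "x \<in> Q \<Longrightarrow> cell (j + int k) x \<subseteq> Q"
  using cell_antimono[of j "j + int k" x] cell_eq[of x j x0] by simp

lemma Pc_sub_Q: "x \<in> Q \<Longrightarrow> Pc x \<subseteq> Q"
  unfolding Pc_def by (rule cell_sub_Q)

lemma avg_Q: "x \<in> Q \<Longrightarrow> avg j x = a"
  using a_eq avg_cell by simp

lemma stp_pos: "x \<in> Q \<Longrightarrow> stp x > 0"
  using stp_prop[of x] avg_Q[of x] a_pos m_pos by (cases "stp x") auto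

lemma not_act_stp: assumes "k \<le> m" "stp x < k" shows "\<not> act k x"
proof
  assume "act k x"
  then have "avg (j + int (stp x)) x \<le> 4 * a" using assms unfolding act_def by simp
  then show False using stp_prop[of x] assms by simp
qed

lemma bounded_integrable:
  fixes g :: "'a \<Rightarrow> real"
  assumes "g \<in> borel_measurable lebesgue" "\<And>x. \<bar>g x\<bar> \<le> B"
  shows "set_integrable lebesgue (cell i x) g"
  by (rule set_integrable_bounded[where B=B]) (use assms in \<open>auto simp: sets_cell emeasure_cell'\<close>)

lemma const_integrable: "set_integrable lebesgue (cell i x) (\<lambda>y. c)" for c :: real
proof -
  have "integrable lebesgue (indicat_real (cell i x))"
    by (rule integrable_real_indicator) (simp_all add: sets_cell emeasure_cell')
  then show ?thesis unfolding set_integrable_def by simp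
qed

definition osc :: real where "osc = 4 * a * ndim / (1 - \<theta>)"

lemma osc_pos: "osc \<ge> 0"
  unfolding osc_def using a_pos ndim theta by simp

text \<open>Beyond the stopping level the truncated coefficients vanish. Coarser levels have
  constant coefficients on the cell, and their test functions oscillate by a geometric sequence in
  the distance to the stopping level, with sum independent of m.\<close>

lemma Psi_osc: assumes "y \<in> Pc x" "z \<in> Pc x" shows "\<bar>Psi y - Psi z\<bar> \<le> osc"
proof -
  let ?s = "stp x"
  have le: "\<bar>ch k y * e (j + int k) y - ch k z * e (j + int k) z\<bar> \<le> (if k \<le> ?s then 4 * a * ndim * \<theta> ^ (?s - k) else 0)"
    if "k \<le> m" for k
  proof (cases "k \<le> ?s")
    case True
    then have eq: "ch k y = ch k x" "ch k z = ch k x"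
      using assms unfolding Pc_def by (auto intro: ch_cell)
    have "\<bar>e (j + int k) y - e (j + int k) z\<bar> \<le> ndim * \<theta> ^ (?s - k)"
      using assms True unfolding Pc_def by (intro e_osc[of _ _ _ x]) (auto simp: of_nat_diff)
    then have "\<bar>ch k x\<bar> * \<bar>e (j + int k) y - e (j + int k) z\<bar> \<le> 4 * a * (ndim * \<theta> ^ (?s - k))"
      using a_pos by (intro mult_mono ch_bound) auto
    then show ?thesis using True unfolding eq by (simp add: abs_mult[symmetric] right_diff_distrib mult.assoc)
  next
    case False
    then have "\<not> act k y" "\<not> act k z" using that stp_cell[OF assms(1)] stp_cell[OF assms(2)] not_act_stp[of k y] not_act_stp[of k z] by simp_all
    then show ?thesis using False by (simp add: ch_def)
  qed
  have "\<bar>Psi y - Psi z\<bar> \<le> (\<Sum>k\<le>m. \<bar>ch k y * e (j + int k) y - ch k z * e (j + int k) z\<bar>)"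
    unfolding Psi_def sum_subtractf[symmetric] by (rule sum_abs)
  also have "\<dots> \<le> (\<Sum>k\<le>m. (if k \<le> ?s then 4 * a * ndim * \<theta> ^ (?s - k) else 0))"
    by (intro sum_mono le) auto
  also have "\<dots> = (\<Sum>k\<le>?s. 4 * a * ndim * \<theta> ^ (?s - k))"
    using stp_le[of x] by (intro sum.mono_neutral_cong_right) auto
  also have "\<dots> = 4 * a * ndim * (\<Sum>k\<le>?s. \<theta> ^ (?s - k))" by (simp add: sum_distrib_left)
  also have "\<dots> \<le> 4 * a * ndim * (1 / (1 - \<theta>))"
    using a_pos ndim by (intro mult_left_mono sum_theta_le) auto
  finally show ?thesis by (simp add: osc_def)
qed

text \<open>The parent of a stopping cell has not been stopped, so its average is at most 4 a;
  passing to a child multiplies an average by at most 2^n.\<close>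

lemma Pc_avg: assumes "x \<in> Q" shows "(LINT y:Pc x|lebesgue. \<bar>f y\<bar>) \<le> B0 * a * vol (j + int (stp x))"
proof -
  obtain k where k: "stp x = Suc k" using stp_pos[OF assms] gr0_implies_Suc by blast
  have "avg (j + int (stp x)) x \<le> 2 ^ DIM('a) * avg (j + int k) x"
    using avg_Suc_le[of "j + int k" x] k by (simp add: algebra_simps)
  also have "\<dots> \<le> 2 ^ DIM('a) * (4 * a)"
    using not_stp[of k x] k by (intro mult_left_mono) auto
  finally have "avg (j + int (stp x)) x \<le> B0 * a" by (simp add: B0_def)
  then show ?thesis unfolding Pc_def integral_avg using vol_pos[of "j + int (stp x)"] by (intro mult_right_mono) auto
qed

lemma fPsi_integrable: "set_integrable lebesgue (cell i x) (\<lambda>y. \<bar>f y\<bar> * \<bar>Psi y\<bar>)"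
  by (rule set_integrable_mult_bounded[OF f_abs_integrable, where B="(m + 1) * (4 * a)"]) (use Psi_bound in \<open>auto simp: sets_cell\<close>)

lemma PsiK_integrable: "set_integrable lebesgue (cell i x) (\<lambda>y. B0 * a * (\<bar>Psi y\<bar> + osc))"
  by (rule bounded_integrable[where B="B0 * a * ((m + 1) * (4 * a) + osc)"])
     (use Psi_bound a_pos osc_pos in \<open>auto simp: abs_mult B0_def intro!: mult_left_mono add_mono\<close>)

text \<open>On a stopping cell every value of |Psi| is at most the mean of |Psi| +
  \<open>osc\<close>. Hence only the mean of |f| matters there, and \<open>Pc_avg\<close> trades it
  for a multiple of a.\<close>

lemma fPsi_le: "(LINT y:Q|lebesgue. \<bar>f y\<bar> * \<bar>Psi y\<bar>) \<le> (LINT y:Q|lebesgue. B0 * a * (\<bar>Psi y\<bar> + osc))"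
proof (rule set_integral_partition_mono[OF Pc_partition])
  fix x assume x: "x \<in> Q"
  let ?v = "vol (j + int (stp x))"
  define J where "J = (LINT z:Pc x|lebesgue. (\<bar>Psi z\<bar> + osc))"
  have i1: "set_integrable lebesgue (Pc x) (\<lambda>y. \<bar>Psi y\<bar> + osc)"
    unfolding Pc_def by (rule bounded_integrable[where B="(m + 1) * (4 * a) + osc"])
      (use Psi_bound a_pos osc_pos in \<open>auto intro!: add_mono\<close>)
  have *: "\<bar>Psi y\<bar> * ?v \<le> J" if y: "y \<in> Pc x" for y
  proof -
    have "\<bar>Psi y\<bar> * ?v = (LINT z:Pc x|lebesgue. \<bar>Psi y\<bar>)"
      unfolding Pc_def by (simp add: set_integral_const sets_cell emeasure_cell' measure_cell mult.commute)
    also have "\<dots> \<le> J" unfolding J_def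
    proof (rule set_integral_mono[OF _ i1])
      show "set_integrable lebesgue (Pc x) (\<lambda>z. \<bar>Psi y\<bar>)"
        unfolding Pc_def by (rule const_integrable)
      show "\<bar>Psi y\<bar> \<le> \<bar>Psi z\<bar> + osc" if "z \<in> Pc x" for z
        using Psi_osc[OF y that] by linarith
    qed
    finally show ?thesis .
  qed
  have v: "?v > 0" by (rule vol_pos)
  have J: "J \<ge> 0" using *[OF Pc_partition(1)] v by (smt (verit) mult_nonneg_nonneg)
  have "(LINT y:Pc x|lebesgue. \<bar>f y\<bar> * \<bar>Psi y\<bar>) \<le> (LINT y:Pc x|lebesgue. (J / ?v) * \<bar>f y\<bar>)"
  proof (rule set_integral_mono)
    show "set_integrable lebesgue (Pc x) (\<lambda>y. \<bar>f y\<bar> * \<bar>Psi y\<bar>)" unfolding Pc_def by (rule fPsi_integrable)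
    show "set_integrable lebesgue (Pc x) (\<lambda>y. (J / ?v) * \<bar>f y\<bar>)"
      unfolding Pc_def using f_abs_integrable by simp
    fix y assume "y \<in> Pc x"
    from *[OF this] v have "\<bar>Psi y\<bar> \<le> J / ?v" by (simp add: field_simps)
    then show "\<bar>f y\<bar> * \<bar>Psi y\<bar> \<le> (J / ?v) * \<bar>f y\<bar>"
      using mult_left_mono[of "\<bar>Psi y\<bar>" "J / ?v" "\<bar>f y\<bar>"] by (simp add: mult.commute)
  qed
  also have "\<dots> = (J / ?v) * (LINT y:Pc x|lebesgue. \<bar>f y\<bar>)" by (rule set_integral_mult_right)
  also have "\<dots> \<le> (J / ?v) * (B0 * a * ?v)"
    using J v Pc_avg[OF x] by (intro mult_left_mono) auto
  also have "\<dots> = B0 * a * J" using v by simp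
  also have "\<dots> = (LINT y:Pc x|lebesgue. B0 * a * (\<bar>Psi y\<bar> + osc))" unfolding J_def by (rule set_integral_mult_right[symmetric])
  finally show "(LINT y:Pc x|lebesgue. \<bar>f y\<bar> * \<bar>Psi y\<bar>) \<le> (LINT y:Pc x|lebesgue. B0 * a * (\<bar>Psi y\<bar> + osc))" .
qed (use Pc_sub_Q fPsi_integrable PsiK_integrable sets_cell in auto)

definition X :: real where "X = (\<Sum>k\<le>m. LINT y:Q|lebesgue. (ch k y)\<^sup>2)"

lemma ch2_integrable: "set_integrable lebesgue (cell i x) (\<lambda>y. (ch k y)\<^sup>2)"
  by (rule bounded_integrable[where B="(4 * a)\<^sup>2"]) (use ch2_le in auto)


lemma ch_e_bound: "\<bar>ch k x * e i x\<bar> \<le> 4 * a"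
proof -
  have "\<bar>ch k x\<bar> * \<bar>e i x\<bar> \<le> 4 * a * 1"
    using a_pos by (intro mult_mono ch_bound e_bound) auto
  then show ?thesis by (simp add: abs_mult)
qed

lemma fche_integrable: "set_integrable lebesgue (cell i x) (\<lambda>y. f y * (ch k y * e l y))"
  by (rule set_integrable_mult_bounded[OF f_integrable, where B="4 * a"]) (use ch_e_bound in \<open>auto simp: sets_cell\<close>)

lemma cell_const_integral:
  fixes c :: real
  assumes "\<And>y. y \<in> cell i x \<Longrightarrow> g y = c"
  shows "(LINT y:cell i x|lebesgue. g y) = c * vol i"
proof -
  have "(LINT y:cell i x|lebesgue. g y) = (LINT y:cell i x|lebesgue. c)"
    by (rule set_lebesgue_integral_cong) (use assms sets_cell in auto)
  then show ?thesis by (simp add: set_integral_const sets_cell emeasure_cell' measure_cell mult.commute)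
qed

text \<open>On a cell of level j + k the truncated coefficient is constant, and the integral of f
  against the test function is that coefficient times the volume. Thus integrating f against one
  term of Psi reproduces the square of the coefficient.\<close>

lemma X_le_fPsi: "X \<le> (LINT y:Q|lebesgue. \<bar>f y\<bar> * \<bar>Psi y\<bar>)"
proof -
  have le: "(LINT y:Q|lebesgue. (ch k y)\<^sup>2) \<le> (LINT y:Q|lebesgue. f y * (ch k y * e (j + int k) y))" for k
  proof (rule set_integral_partition_mono[where P="cell (j + int k)", OF cell_partition])
    fix x
    have ch: "ch k y = ch k x" if "y \<in> cell (j + int k) x" for y using that by (rule ch_cell) simp
    have "(LINT y:cell (j + int k) x|lebesgue. f y * (ch k y * e (j + int k) y))
        = (LINT y:cell (j + int k) x|lebesgue. ch k x * (f y * e (j + int k) y))"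
      by (rule set_lebesgue_integral_cong) (use ch sets_cell in auto)
    also have "\<dots> = ch k x * (coef (j + int k) x * vol (j + int k))"
      by (simp only: set_integral_mult_right integral_coef)
    also have "\<dots> = (ch k x)\<^sup>2 * vol (j + int k)"
      by (auto simp: ch_def power2_eq_square)
    also have "\<dots> = (LINT y:cell (j + int k) x|lebesgue. (ch k y)\<^sup>2)"
      by (rule cell_const_integral[symmetric]) (simp add: ch)
    finally show "(LINT y:cell (j + int k) x|lebesgue. (ch k y)\<^sup>2) \<le>
      (LINT y:cell (j + int k) x|lebesgue. f y * (ch k y * e (j + int k) y))" by simp
  qed (simp_all add: cell_sub_Q ch2_integrable fche_integrable sets_cell)
  have "X \<le> (\<Sum>k\<le>m. LINT y:Q|lebesgue. f y * (ch k y * e (j + int k) y))"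
    unfolding X_def by (intro sum_mono le)
  also have "\<dots> = (LINT y:Q|lebesgue. f y * Psi y)"
    unfolding Psi_def sum_distrib_left by (rule set_integral_finite_sum(2)[symmetric, OF fche_integrable])
  also have "\<dots> \<le> (LINT y:Q|lebesgue. \<bar>f y\<bar> * \<bar>Psi y\<bar>)"
  proof (rule set_integral_mono)
    show "set_integrable lebesgue Q (\<lambda>y. f y * Psi y)"
      by (rule set_integrable_mult_bounded[OF f_integrable, where B="(m + 1) * (4 * a)"]) (use Psi_bound in \<open>auto simp: sets_cell\<close>)
    show "f y * Psi y \<le> \<bar>f y\<bar> * \<bar>Psi y\<bar>" for y
      using abs_ge_self[of "f y * Psi y"] by (simp only: abs_mult)
  qed (rule fPsi_integrable)
  finally show ?thesis .
qed

lemma prod_integrable: "set_integrable lebesgue (cell i x) (\<lambda>y. (ch k y * e k' y) * (ch l y * e l' y))"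
proof (rule bounded_integrable[where B="(4 * a) * (4 * a)"])
  show "\<bar>(ch k y * e k' y) * (ch l y * e l' y)\<bar> \<le> (4 * a) * (4 * a)" for y
    unfolding abs_mult[of "ch k y * e k' y"] using a_pos by (intro mult_mono ch_e_bound) auto
qed simp

text \<open>On a cell of the finer level l the function \<open>e (j + int l)\<close> has mean zero,
  so the value of the coarser test function at one point may be subtracted. What remains is its
  oscillation across l - k levels.\<close>

lemma almost_orthogonal:
  assumes "k \<le> l"
  shows "(LINT y:Q|lebesgue. (ch k y * e (j + int k) y) * (ch l y * e (j + int l) y))
    \<le> ndim * \<theta> ^ (l - k) / 2 * ((LINT y:Q|lebesgue. (ch k y)\<^sup>2) + (LINT y:Q|lebesgue. (ch l y)\<^sup>2))"
proof -
  define K where "K = ndim * \<theta> ^ (l - k) / 2"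
  have K: "K \<ge> 0" using ndim theta by (simp add: K_def)
  have i: "set_integrable lebesgue (cell i x) (\<lambda>y. K * ((ch k y)\<^sup>2 + (ch l y)\<^sup>2))" for i x
    using ch2_integrable by simp
  have "(LINT y:Q|lebesgue. (ch k y * e (j + int k) y) * (ch l y * e (j + int l) y))
     \<le> (LINT y:Q|lebesgue. K * ((ch k y)\<^sup>2 + (ch l y)\<^sup>2))"
  proof (rule set_integral_partition_mono[where P="cell (j + int l)", OF cell_partition])
    fix x
    let ?R = "cell (j + int l) x" and ?ek = "e (j + int k)" and ?el = "e (j + int l)"
    have ch: "ch k y = ch k x" "ch l y = ch l x" if "y \<in> ?R" for y
      using ch_cell[OF that] assms by simp_all
    have ie: "set_integrable lebesgue ?R ?el" by (rule bounded_integrable[OF e_measurable e_bound])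
    have bd: "\<bar>(?ek y - ?ek x) * ?el y\<bar> \<le> ndim * \<theta> ^ (l - k)" if "y \<in> ?R" for y
    proof -
      have "\<bar>?ek y - ?ek x\<bar> \<le> ndim * \<theta> ^ (l - k)"
        using that assms cell_self by (intro e_osc[of _ _ _ x]) (auto simp: of_nat_diff)
      then have "\<bar>?ek y - ?ek x\<bar> * \<bar>?el y\<bar> \<le> ndim * \<theta> ^ (l - k) * 1"
        using ndim theta by (intro mult_mono e_bound) auto
      then show ?thesis by (simp add: abs_mult)
    qed
    have id: "set_integrable lebesgue ?R (\<lambda>y. (?ek y - ?ek x) * ?el y)"
      by (rule set_integrable_bounded[where B="ndim * \<theta> ^ (l - k)"]) (use bd in \<open>auto simp: sets_cell emeasure_cell'\<close>)
    have "(LINT y:?R|lebesgue. ?ek y * ?el y) = (LINT y:?R|lebesgue. (?ek y - ?ek x) * ?el y + ?ek x * ?el y)"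
      by (simp add: algebra_simps)
    also have "\<dots> = (LINT y:?R|lebesgue. (?ek y - ?ek x) * ?el y)"
      using ie by (subst set_integral_add) (simp_all add: id e_mean)
    finally have eq: "(LINT y:?R|lebesgue. ?ek y * ?el y) = (LINT y:?R|lebesgue. (?ek y - ?ek x) * ?el y)" .
    have "\<bar>LINT y:?R|lebesgue. (?ek y - ?ek x) * ?el y\<bar> \<le> (LINT y:?R|lebesgue. \<bar>(?ek y - ?ek x) * ?el y\<bar>)"
      using set_integral_norm_bound[OF id] by simp
    also have "\<dots> \<le> (LINT y:?R|lebesgue. ndim * \<theta> ^ (l - k))"
    proof (rule set_integral_mono)
      show "set_integrable lebesgue ?R (\<lambda>y. \<bar>(?ek y - ?ek x) * ?el y\<bar>)"
        by (rule set_integrable_abs[OF id])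
      show "set_integrable lebesgue ?R (\<lambda>y. ndim * \<theta> ^ (l - k))"
        by (rule const_integrable)
    qed (rule bd)
    also have "\<dots> = 2 * K * vol (j + int l)"
      unfolding K_def by (subst cell_const_integral) auto
    finally have le: "\<bar>LINT y:?R|lebesgue. ?ek y * ?el y\<bar> \<le> 2 * K * vol (j + int l)"
      by (simp add: eq)
    have "(LINT y:?R|lebesgue. (ch k y * ?ek y) * (ch l y * ?el y)) = (LINT y:?R|lebesgue. (ch k x * ch l x) * (?ek y * ?el y))"
      by (rule set_lebesgue_integral_cong) (use ch sets_cell in auto)
    also have "\<dots> = (ch k x * ch l x) * (LINT y:?R|lebesgue. ?ek y * ?el y)" by (rule set_integral_mult_right)
    also have "\<dots> \<le> \<bar>ch k x * ch l x\<bar> * \<bar>LINT y:?R|lebesgue. ?ek y * ?el y\<bar>"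
      unfolding abs_mult[symmetric] by (rule abs_ge_self)
    also have "\<dots> \<le> (((ch k x)\<^sup>2 + (ch l x)\<^sup>2) / 2) * (2 * K * vol (j + int l))"
    proof (rule mult_mono[OF _ le])
      show "\<bar>ch k x * ch l x\<bar> \<le> ((ch k x)\<^sup>2 + (ch l x)\<^sup>2) / 2"
        using sum_squares_bound[of "\<bar>ch k x\<bar>" "\<bar>ch l x\<bar>"] by (simp add: abs_mult)
    qed auto
    also have "\<dots> = K * ((ch k x)\<^sup>2 + (ch l x)\<^sup>2) * vol (j + int l)" by simp
    also have "\<dots> = (LINT y:?R|lebesgue. K * ((ch k y)\<^sup>2 + (ch l y)\<^sup>2))"
      by (rule cell_const_integral[symmetric]) (simp add: ch)
    finally show "(LINT y:?R|lebesgue. (ch k y * ?ek y) * (ch l y * ?el y))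
      \<le> (LINT y:?R|lebesgue. K * ((ch k y)\<^sup>2 + (ch l y)\<^sup>2))" .
  qed (simp_all add: cell_sub_Q prod_integrable sets_cell i)
  also have "\<dots> = K * ((LINT y:Q|lebesgue. (ch k y)\<^sup>2) + (LINT y:Q|lebesgue. (ch l y)\<^sup>2))"
    using ch2_integrable by simp
  finally show ?thesis by (simp add: K_def)
qed

text \<open>Expanding the square and symmetrizing the bound of \<open>almost_orthogonal\<close>
  reduces the claim to the row sums of a geometrically decaying matrix.\<close>

lemma Psi2_le: "(LINT y:Q|lebesgue. (Psi y)\<^sup>2) \<le> 2 * (ndim / (1 - \<theta>)) * X"
proof -
  define x where "x k = (LINT y:Q|lebesgue. (ch k y)\<^sup>2)" for k
  define w where "w k l = \<theta> ^ (if k \<le> l then l - k else k - l)" for k l :: nat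
  let ?g = "\<lambda>k y. ch k y * e (j + int k) y"
  have x0: "x k \<ge> 0" for k
    unfolding x_def set_lebesgue_integral_def by (intro Bochner_Integration.integral_nonneg) auto
  have X: "X = (\<Sum>k\<le>m. x k)" by (simp add: X_def x_def)
  have le: "(LINT y:Q|lebesgue. ?g k y * ?g l y) \<le> ndim / 2 * (w k l * x k + w l k * x l)" for k l
  proof (cases "k \<le> l")
    case True
    then show ?thesis using almost_orthogonal[OF True] by (auto simp: w_def x_def algebra_simps)
  next
    case False
    then have "l \<le> k" by simp
    then show ?thesis using almost_orthogonal[OF \<open>l \<le> k\<close>] False by (simp add: w_def x_def algebra_simps)
  qed
  have "(LINT y:Q|lebesgue. (Psi y)\<^sup>2) = (LINT y:Q|lebesgue. (\<Sum>k\<le>m. \<Sum>l\<le>m. ?g k y * ?g l y))"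
    by (simp add: Psi_def power2_eq_square sum_product)
  also have "\<dots> = (\<Sum>k\<le>m. LINT y:Q|lebesgue. (\<Sum>l\<le>m. ?g k y * ?g l y))"
    by (rule set_integral_finite_sum(2), rule set_integral_finite_sum(1), rule prod_integrable)
  also have "\<dots> = (\<Sum>k\<le>m. \<Sum>l\<le>m. LINT y:Q|lebesgue. ?g k y * ?g l y)"
    by (intro sum.cong refl set_integral_finite_sum(2) prod_integrable)
  also have "\<dots> \<le> (\<Sum>k\<le>m. \<Sum>l\<le>m. ndim / 2 * (w k l * x k + w l k * x l))"
    by (intro sum_mono le)
  also have "\<dots> = ndim / 2 * ((\<Sum>k\<le>m. \<Sum>l\<le>m. w k l * x k) + (\<Sum>k\<le>m. \<Sum>l\<le>m. w l k * x l))"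
    by (simp only: sum_distrib_left sum.distrib distrib_left)
  also have "(\<Sum>k\<le>m. \<Sum>l\<le>m. w l k * x l) = (\<Sum>k\<le>m. \<Sum>l\<le>m. w k l * x k)" by (rule sum.swap)
  finally have "(LINT y:Q|lebesgue. (Psi y)\<^sup>2) \<le> ndim * (\<Sum>k\<le>m. \<Sum>l\<le>m. w k l * x k)" by simp
  also have "(\<Sum>k\<le>m. \<Sum>l\<le>m. w k l * x k) \<le> (\<Sum>k\<le>m. 2 / (1 - \<theta>) * x k)"
    unfolding sum_distrib_right[symmetric] using sum_theta_diff_le x0 unfolding w_def by (intro sum_mono mult_right_mono) auto
  also have "\<dots> = 2 / (1 - \<theta>) * X" by (simp add: X sum_distrib_left)
  finally show ?thesis using ndim by (simp add: mult_left_mono mult_ac)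
qed


lemma X_le: "X \<le> Kc * a\<^sup>2 * vol j"
proof -
  define D where "D = ndim / (1 - \<theta>)"
  have D: "D > 0" unfolding D_def using ndim theta by simp
  have B0: "B0 > 0" by (simp add: B0_def)
  define c where "c = B0\<^sup>2 * a\<^sup>2 * D + B0 * a * osc"
  have osc: "osc = 4 * a * D" unfolding osc_def D_def by simp
  have Pint: "set_integrable lebesgue Q (\<lambda>y. (Psi y)\<^sup>2 / (4 * D))"
  proof (rule bounded_integrable[where B="((m + 1) * (4 * a))\<^sup>2 / (4 * D)"])
    fix y
    have "(Psi y)\<^sup>2 \<le> (real (m + 1) * (4 * a))\<^sup>2"
      using Psi_bound[of y] a_pos by (subst abs_le_square_iff[symmetric]) simp
    then show "\<bar>(Psi y)\<^sup>2 / (4 * D)\<bar> \<le> (real (m + 1) * (4 * a))\<^sup>2 / (4 * D)"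
      using D by (simp add: divide_right_mono)
  qed measurable
  have cint: "set_integrable lebesgue Q (\<lambda>y. c)" by (rule const_integrable)
  have "X \<le> (LINT y:Q|lebesgue. B0 * a * (\<bar>Psi y\<bar> + osc))"
    using X_le_fPsi fPsi_le by (rule order_trans)
  also have "\<dots> \<le> (LINT y:Q|lebesgue. c + (Psi y)\<^sup>2 / (4 * D))"
  proof (rule set_integral_mono[OF PsiK_integrable])
    show "set_integrable lebesgue Q (\<lambda>y. c + (Psi y)\<^sup>2 / (4 * D))"
      using Pint cint by simp
    fix y
    \<comment> \<open>Completing the square with weight 1 / (4 D): since \<open>Psi2_le\<close>
      bounds the integral of the square of Psi by 2 D X, the quadratic term costs exactly X / 2,
      which is absorbed.\<close>
    have "0 \<le> (\<bar>Psi y\<bar> - 2 * D * B0 * a)\<^sup>2" by simp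
    then have "4 * D * B0 * a * \<bar>Psi y\<bar> \<le> (Psi y)\<^sup>2 + 4 * D * (D * B0\<^sup>2 * a\<^sup>2)"
      by (simp add: power2_diff power2_eq_square algebra_simps)
    then have "B0 * a * \<bar>Psi y\<bar> \<le> ((Psi y)\<^sup>2 + 4 * D * (D * B0\<^sup>2 * a\<^sup>2)) / (4 * D)"
      using D by (simp add: pos_le_divide_eq mult_ac)
    also have "\<dots> = (Psi y)\<^sup>2 / (4 * D) + D * B0\<^sup>2 * a\<^sup>2" using D by (simp add: add_divide_distrib)
    finally show "B0 * a * (\<bar>Psi y\<bar> + osc) \<le> c + (Psi y)\<^sup>2 / (4 * D)"
      unfolding c_def by (simp add: algebra_simps)
  qed
  also have "\<dots> = c * vol j + (LINT y:Q|lebesgue. (Psi y)\<^sup>2) / (4 * D)"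
    using set_integral_add(2)[OF cint Pint] cell_const_integral[of j x0 "\<lambda>y. c" c]
      set_integral_divide_zero[of lebesgue Q "\<lambda>y. (Psi y)\<^sup>2" "4 * D"] by (simp only: )
  also have "\<dots> \<le> c * vol j + (2 * D * X) / (4 * D)"
    using D Psi2_le by (intro add_left_mono divide_right_mono) (auto simp: D_def)
  also have "\<dots> = c * vol j + X / 2" using D by simp
  finally have "X \<le> 2 * c * vol j" by simp
  also have "2 * c = Kc * a\<^sup>2" unfolding c_def osc Kc_def D_def[symmetric] by (simp add: power2_eq_square algebra_simps)
  finally show ?thesis .
qed

text \<open>Weak type estimate for the dyadic maximal function. The factor 4 in the stopping rule
  confines the exceptional set to a quarter of the cell.\<close>

lemma high_avg_set:
  "4 * measure lebesgue {x \<in> Q. \<exists>k\<le>m. avg (j + int k) x > 4 * a} \<le> vol j"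
proof -
  define S where "S = {x \<in> Q. \<exists>k\<le>m. avg (j + int k) x > 4 * a}"
  have [measurable]: "S \<in> sets lebesgue" "Q \<in> sets lebesgue" unfolding S_def using sets_cell[of j x0] by measurable
  have S_iff: "x \<in> S \<longleftrightarrow> avg (j + int (stp x)) x > 4 * a" if "x \<in> Q" for x
  proof
    assume "x \<in> S"
    then obtain k where k: "k \<le> m" "avg (j + int k) x > 4 * a" by (auto simp: S_def)
    then have "stp x \<le> k" using not_stp[of k x] by force
    with stp_prop[of x] k show "avg (j + int (stp x)) x > 4 * a" by (cases "stp x = k") auto
  next
    assume "avg (j + int (stp x)) x > 4 * a"
    then show "x \<in> S" using that stp_le[of x] by (auto simp: S_def)
  qed
  have iS: "set_integrable lebesgue (cell i x) (\<lambda>y. indicator S y * (4 * a))" for i x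
    by (rule bounded_integrable[where B="4 * a"]) (use a_pos in \<open>auto simp: indicator_def\<close>)
  have "(LINT y:Q|lebesgue. indicator S y * (4 * a)) \<le> (LINT y:Q|lebesgue. \<bar>f y\<bar>)"
  proof (rule set_integral_partition_mono[OF Pc_partition])
    fix x assume x: "x \<in> Q"
    show "(LINT y:Pc x|lebesgue. indicator S y * (4 * a)) \<le> (LINT y:Pc x|lebesgue. \<bar>f y\<bar>)"
    proof (cases "x \<in> S")
      case True
      have "(LINT y:Pc x|lebesgue. indicator S y * (4 * a)) \<le> (LINT y:Pc x|lebesgue. 4 * a)"
        unfolding Pc_def using a_pos
        by (intro set_integral_mono iS const_integrable) (simp add: indicator_def)
      also have "\<dots> = 4 * a * vol (j + int (stp x))" unfolding Pc_def by (rule cell_const_integral) simp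
      also have "\<dots> \<le> avg (j + int (stp x)) x * vol (j + int (stp x))"
        using S_iff[OF x] True vol_pos by (intro mult_right_mono) (auto intro: less_imp_le)
      also have "\<dots> = (LINT y:Pc x|lebesgue. \<bar>f y\<bar>)" unfolding Pc_def integral_avg ..
      finally show ?thesis .
    next
      case False
      have "y \<notin> S" if y: "y \<in> Pc x" for y
      proof -
        have "avg (j + int (stp x)) y = avg (j + int (stp x)) x" using y unfolding Pc_def by (rule avg_cell)
        then show ?thesis using S_iff[of y] S_iff[OF x] False stp_cell[OF y] Pc_sub_Q[OF x] y by auto
      qed
      then have "(LINT y:Pc x|lebesgue. indicator S y * (4 * a)) = 0 * vol (j + int (stp x))"
        unfolding Pc_def by (intro cell_const_integral) simp
      moreover have "0 \<le> (LINT y:Pc x|lebesgue. \<bar>f y\<bar>)" unfolding Pc_def integral_avg using avg_nonneg vol_pos by (simp add: less_imp_le)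
      ultimately show ?thesis by linarith
    qed
  qed (simp_all add: Pc_sub_Q iS f_abs_integrable sets_cell)
  also have "(LINT y:Q|lebesgue. \<bar>f y\<bar>) = a * vol j" by (simp add: integral_avg a_eq)
  also have "(LINT y:Q|lebesgue. indicator S y * (4 * a)) = measure lebesgue S * (4 * a)"
    by (rule set_integral_indicator_const) (auto simp: S_def)
  finally show ?thesis using a_pos unfolding S_def[symmetric] by simp
qed

text \<open>Chebyshev's inequality for the square function of truncated coefficients, whose integral
  is X; the factor 4 in A yields another quarter of the cell.\<close>

lemma high_square_set:
  assumes A: "A = 4 * Kc"
  shows "4 * measure lebesgue {x \<in> Q. (\<Sum>k\<le>m. (ch k x)\<^sup>2) > A * a\<^sup>2} \<le> vol j"
proof -
  have Kc: "Kc > 0" unfolding Kc_def B0_def using ndim theta by (intro mult_pos_pos add_pos_pos divide_pos_pos) auto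
  define S where "S = {x \<in> Q. (\<Sum>k\<le>m. (ch k x)\<^sup>2) > A * a\<^sup>2}"
  have [measurable]: "S \<in> sets lebesgue" "Q \<in> sets lebesgue" unfolding S_def using sets_cell[of j x0] by measurable
  have "measure lebesgue S * (A * a\<^sup>2) = (LINT y:Q|lebesgue. indicator S y * (A * a\<^sup>2))"
    by (rule set_integral_indicator_const[symmetric]) (auto simp: S_def)
  also have "\<dots> \<le> (LINT y:Q|lebesgue. (\<Sum>k\<le>m. (ch k y)\<^sup>2))"
  proof (rule set_integral_mono)
    show "set_integrable lebesgue Q (\<lambda>y. indicator S y * (A * a\<^sup>2))"
      by (rule bounded_integrable[where B="A * a\<^sup>2"]) (use Kc A in \<open>auto simp: indicator_def\<close>)
    show "set_integrable lebesgue Q (\<lambda>y. \<Sum>k\<le>m. (ch k y)\<^sup>2)"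
      by (rule set_integral_finite_sum(1)[OF ch2_integrable])
    show "indicator S y * (A * a\<^sup>2) \<le> (\<Sum>k\<le>m. (ch k y)\<^sup>2)" for y
      by (auto simp: indicator_def S_def intro!: sum_nonneg)
  qed
  also have "\<dots> = X" unfolding X_def by (rule set_integral_finite_sum(2)[OF ch2_integrable])
  also note X_le
  finally have "measure lebesgue S * 4 * (Kc * a\<^sup>2) \<le> vol j * (Kc * a\<^sup>2)" by (simp add: A mult_ac)
  then show ?thesis using Kc a_pos unfolding S_def[symmetric] by (simp add: mult.commute)
qed

text \<open>Where no average is large, all levels are active and truncation changes nothing. The two
  exceptional quarters together cover the bad set.\<close>

lemma bad_set_finite_levels:
  assumes A: "A = 4 * Kc"
  shows "measure lebesgue {x \<in> Q. \<exists>k\<le>m. avg (j + int k) x > 4 * a \<or> (\<Sum>k'\<le>k. (coef (j + int k') x)\<^sup>2) > A * a\<^sup>2}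
    \<le> vol j / 2"
proof -
  define W where "W = {x \<in> Q. \<exists>k\<le>m. avg (j + int k) x > 4 * a \<or> (\<Sum>k'\<le>k. (coef (j + int k') x)\<^sup>2) > A * a\<^sup>2}"
  define U where "U = {x \<in> Q. \<exists>k\<le>m. avg (j + int k) x > 4 * a}"
  define V where "V = {x \<in> Q. (\<Sum>k\<le>m. (ch k x)\<^sup>2) > A * a\<^sup>2}"
  have Qs: "Q \<in> lmeasurable" by (simp add: fmeasurable_def sets_cell emeasure_cell')
  have "U \<in> sets lebesgue" "V \<in> sets lebesgue" unfolding U_def V_def using sets_cell[of j x0] by measurable
  moreover have "U \<subseteq> Q" "V \<subseteq> Q" by (simp_all add: U_def V_def)
  ultimately have UV: "U \<in> lmeasurable" "V \<in> lmeasurable"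
    using fmeasurableI2[OF Qs] by blast+
  have sub: "W \<subseteq> U \<union> V"
  proof (rule subsetI)
    fix x assume "x \<in> W"
    then obtain k where x: "x \<in> Q" and k: "k \<le> m" "avg (j + int k) x > 4 * a \<or> (\<Sum>k'\<le>k. (coef (j + int k') x)\<^sup>2) > A * a\<^sup>2"
      unfolding W_def by auto
    show "x \<in> U \<union> V"
    proof (cases "x \<in> U")
      case False
      then have "avg (j + int k') x \<le> 4 * a" if "k' \<le> m" for k' using x that unfolding U_def by (auto simp: not_less)
      then have "act k' x" if "k' \<le> m" for k' using that unfolding act_def by simp
      then have "(\<Sum>k'\<le>k. (coef (j + int k') x)\<^sup>2) = (\<Sum>k'\<le>k. (ch k' x)\<^sup>2)"
        using k(1) by (intro sum.cong) (auto simp: ch_def)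
      also have "\<dots> \<le> (\<Sum>k'\<le>m. (ch k' x)\<^sup>2)" using k(1) by (intro sum_mono2) auto
      finally have *: "(\<Sum>k'\<le>k. (coef (j + int k') x)\<^sup>2) \<le> (\<Sum>k'\<le>m. (ch k' x)\<^sup>2)" .
      have "\<not> avg (j + int k) x > 4 * a" using False k(1) x unfolding U_def by auto
      with k(2) * have "(\<Sum>k'\<le>m. (ch k' x)\<^sup>2) > A * a\<^sup>2" by linarith
      then show ?thesis using x unfolding V_def by simp
    qed simp
  qed
  have "W = Q \<inter> (\<Union>k\<le>m. {x. avg (j + int k) x > 4 * a} \<union> {x. (\<Sum>k'\<le>k. (coef (j + int k') x)\<^sup>2) > A * a\<^sup>2})"
    unfolding W_def by auto
  also have "\<dots> \<in> sets lebesgue"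
  proof (intro sets.Int sets_cell sets.finite_UN sets.Un)
    fix k
    have "{x \<in> space lebesgue. avg (j + int k) x > 4 * a} \<in> sets lebesgue" by measurable
    then show "{x. avg (j + int k) x > 4 * a} \<in> sets lebesgue" by simp
    have "{x \<in> space lebesgue. (\<Sum>k'\<le>k. (coef (j + int k') x)\<^sup>2) > A * a\<^sup>2} \<in> sets lebesgue" by measurable
    then show "{x. (\<Sum>k'\<le>k. (coef (j + int k') x)\<^sup>2) > A * a\<^sup>2} \<in> sets lebesgue" by simp
  qed simp
  finally have ms: "W \<in> sets lebesgue" .
  have "measure lebesgue W \<le> measure lebesgue (U \<union> V)"
    by (rule measure_mono_fmeasurable[OF sub ms fmeasurable.Un[OF UV]])
  also have "\<dots> \<le> measure lebesgue U + measure lebesgue V"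
    by (rule measure_Un_le) (use UV in \<open>simp_all add: fmeasurableD\<close>)
  also have "\<dots> \<le> vol j / 2"
    using high_avg_set high_square_set[OF A] unfolding U_def V_def by linarith
  finally show ?thesis unfolding W_def .
qed

end

end

section \<open>Sparse domination\<close>

context dyadic_test
begin

definition thr :: real where "thr = 4 * Kc"

lemma thr_ge_1: "thr \<ge> 1"
proof -
  have "1 \<le> ndim / (1 - \<theta>)" using ndim theta by (simp add: pos_le_divide_eq)
  moreover have "B0 \<ge> 1" unfolding B0_def by (rule one_le_power) simp
  ultimately have "1 * 1 \<le> (2 * B0) * (ndim / (1 - \<theta>))" "1 \<le> B0 + 4"
    by (intro mult_mono, auto)
  then have "1 * 1 \<le> (2 * B0 * (ndim / (1 - \<theta>))) * (B0 + 4)"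
    by (intro mult_mono) auto
  then have "1 \<le> Kc" unfolding Kc_def by simp
  then show ?thesis by (simp add: thr_def)
qed

definition stops :: "int \<Rightarrow> nat \<Rightarrow> 'a \<Rightarrow> bool" where
  "stops i k x \<longleftrightarrow> avg (i + int k) x > 4 * avg i x \<or> (\<Sum>k'\<le>k. (coef (i + int k') x)\<^sup>2) > thr * (avg i x)\<^sup>2"

lemma stops_measurable [measurable]: "Measurable.pred lebesgue (stops i k)"
  unfolding stops_def by measurable

lemma stops_cell: "y \<in> cell (i + int k) x \<Longrightarrow> stops i k y = stops i k x"
proof -
  assume y: "y \<in> cell (i + int k) x"
  have "(\<Sum>k'\<le>k. (coef (i + int k') y)\<^sup>2) = (\<Sum>k'\<le>k. (coef (i + int k') x)\<^sup>2)"
    by (intro sum.cong refl) (simp add: coef_cell_le[OF y])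
  then show ?thesis unfolding stops_def by (simp add: avg_cell_le[OF y])
qed

text \<open>Continuity of the measure from below removes the restriction to finitely many
  levels.\<close>

lemma bad_set: "emeasure lebesgue {y \<in> cell i x. \<exists>k. stops i k y} \<le> ennreal (vol i / 2)"
proof (cases "avg i x > 0")
  \<comment> \<open>A vanishing average forces all finer averages and coefficients to vanish, so
    neither strict inequality in \<open>stops\<close> can hold.\<close>
  case False
  then have 0: "avg i y = 0" if "y \<in> cell i x" for y using avg_cell[OF that] avg_nonneg[of i x] by linarith
  have "\<not> stops i k y" if y: "y \<in> cell i x" for k y
  proof -
    have z: "avg (i + int k') y = 0" for k'
      using avg_add_le[of i k' y] avg_nonneg[of "i + int k'" y] 0[OF y] by simp
    then have "coef (i + int k') y = 0" for k' using coef_le_avg[of "i + int k'" y] by simp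
    then show ?thesis unfolding stops_def by (simp add: z 0[OF y])
  qed
  then have "{y \<in> cell i x. \<exists>k. stops i k y} = {}" by auto
  then show ?thesis by (simp only: emeasure_empty zero_le)
next
  case True
  define a where "a = avg i x"
  define W where "W m = {y \<in> cell i x. \<exists>k\<le>m. avg (i + int k) y > 4 * a \<or> (\<Sum>k'\<le>k. (coef (i + int k') y)\<^sup>2) > thr * a\<^sup>2}" for m
  have W: "W m = {y \<in> cell i x. \<exists>k\<le>m. stops i k y}" for m
    unfolding W_def stops_def a_def using avg_cell by auto
  have Ws: "W m \<in> sets lebesgue" for m
  proof -
    have "W m = cell i x \<inter> {y \<in> space lebesgue. \<exists>k\<in>{..m}. stops i k y}" unfolding W by auto
    also have "\<dots> \<in> sets lebesgue" by (intro sets.Int sets_cell) measurable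
    finally show ?thesis .
  qed
  \<comment> \<open>The finite version requires at least one level below the starting cell, hence
    the successor.\<close>
  have le: "emeasure lebesgue (W (Suc m)) \<le> ennreal (vol i / 2)" for m
  proof -
    have "measure lebesgue (W (Suc m)) \<le> vol i / 2"
      unfolding W_def by (rule bad_set_finite_levels[OF a_def]) (use True in \<open>simp_all add: a_def thr_def\<close>)
    moreover have "W (Suc m) \<subseteq> cell i x" by (auto simp: W)
    then have "emeasure lebesgue (W (Suc m)) \<noteq> top"
      using emeasure_mono[OF _ sets_cell, of "W (Suc m)" i x] by (auto simp: emeasure_cell' top_unique)
    ultimately show ?thesis by (simp add: emeasure_eq_ennreal_measure ennreal_leI)
  qed
  have "incseq (\<lambda>m. W (Suc m))"
    by (rule incseq_SucI) (auto simp: W intro: le_SucI)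
  then have "emeasure lebesgue (\<Union>m. W (Suc m)) = (SUP m. emeasure lebesgue (W (Suc m)))"
    using Ws by (intro SUP_emeasure_incseq[symmetric]) auto
  also have "\<dots> \<le> ennreal (vol i / 2)" by (intro SUP_least le)
  also have "(\<Union>m. W (Suc m)) = {y \<in> cell i x. \<exists>k. stops i k y}"
    by (auto simp: W intro: le_SucI)
  finally show ?thesis .
qed

text \<open>Along the cells containing \<open>x\<close>, a new cell is selected whenever one of the two stopping conditions holds
  relative to the last selected cell; \<open>top_sel K n x\<close> is the last level selected up to \<open>n\<close>.\<close>
primrec top_sel :: "int \<Rightarrow> nat \<Rightarrow> 'a \<Rightarrow> nat" where
  "top_sel K 0 x = 0"
| "top_sel K (Suc n) x =
    (if stops (K + int (top_sel K n x)) (Suc n - top_sel K n x) x then Suc n else top_sel K n x)"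

definition sel :: "int \<Rightarrow> nat \<Rightarrow> 'a \<Rightarrow> bool" where
  "sel K n x \<longleftrightarrow> top_sel K n x = n"

text \<open>Within a selected cell these are the points lying in no smaller selected cell: the
  pairwise disjoint large parts of a sparse family.\<close>

definition last_sel :: "int \<Rightarrow> nat \<Rightarrow> 'a set" where
  "last_sel K n = {x. sel K n x \<and> (\<forall>k>n. \<not> sel K k x)}"

lemma top_sel_le: "top_sel K n x \<le> n"
  by (induction n) (auto intro: le_SucI)

lemma top_sel_cell: "y \<in> cell (K + int n) x \<Longrightarrow> top_sel K n y = top_sel K n x"
proof (induction n)
  case (Suc n)
  have "y \<in> cell (K + int n) x" using Suc.prems cell_antimono[of "K + int n" "K + int (Suc n)" x] by auto
  then have eq: "top_sel K n y = top_sel K n x" by (rule Suc.IH)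
  have "stops (K + int (top_sel K n x)) (Suc n - top_sel K n x) y = stops (K + int (top_sel K n x)) (Suc n - top_sel K n x) x"
    using Suc.prems top_sel_le[of K n x] by (intro stops_cell) (simp add: of_nat_diff algebra_simps)
  then show ?case by (simp add: eq)
qed simp

lemma sel_cell: "y \<in> cell (K + int n) x \<Longrightarrow> k \<le> n \<Longrightarrow> sel K k y = sel K k x"
  unfolding sel_def using top_sel_cell[of y K k x] cell_antimono[of "K + int k" "K + int n" x] by auto

lemma sel_measurable [measurable]: "Measurable.pred lebesgue (sel K n)"
  by (rule cell_constant_measurable[OF sel_cell[OF _ order_refl]]) simp_all

lemma last_sel_sets [measurable]: "last_sel K n \<in> sets lebesgue"
proof -
  have "last_sel K n = {x \<in> space lebesgue. sel K n x \<and> (\<forall>k. k > n \<longrightarrow> \<not> sel K k x)}" by (simp add: last_sel_def)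
  also have "\<dots> \<in> sets lebesgue" by measurable
  finally show ?thesis .
qed

lemma disjoint_last_sel: "x \<in> last_sel K n \<Longrightarrow> x \<in> last_sel K n' \<Longrightarrow> n = n'"
  by (auto simp: last_sel_def) (metis linorder_neqE_nat)

lemma top_sel_mono: "n \<le> n' \<Longrightarrow> top_sel K n x \<le> top_sel K n' x"
proof (induction n' rule: dec_induct)
  case (step n')
  then show ?case using top_sel_le[of K n x] by auto
qed simp

lemma sel_top_sel: "sel K (top_sel K n x) x"
  unfolding sel_def by (induction n) auto

text \<open>Consider the first selected level after n. Just before it the last selected level is
  still n, so the new selection was triggered by a condition relative to the cell of level
  n.\<close>

lemma next_sel_stops:
  assumes "sel K n x" "sel K k x" "n < k"
  shows "\<exists>k. stops (K + int n) k x"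
proof -
  define l where "l = (LEAST l. n < l \<and> sel K l x)"
  have l: "n < l" "sel K l x" unfolding l_def using LeastI[of "\<lambda>l. n < l \<and> sel K l x" k] assms by auto
  have least: "\<not> sel K l' x" if "n < l'" "l' < l" for l'
    using not_less_Least[of l' "\<lambda>l. n < l \<and> sel K l x"] that by (auto simp: l_def)
  obtain p where p: "l = Suc p" using l(1) by (cases l) auto
  have "n \<le> top_sel K p x" using top_sel_mono[of n p K x] assms(1) l(1) p by (simp add: sel_def)
  moreover have "\<not> n < top_sel K p x"
    using least[of "top_sel K p x"] sel_top_sel[of K p x] top_sel_le[of K p x] p by auto
  ultimately have tp: "top_sel K p x = n" by simp
  then have "stops (K + int n) (Suc p - n) x"
    using l(2) l(1) unfolding sel_def p by (auto split: if_splits)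
  then show ?thesis ..
qed

text \<open>By \<open>next_sel_stops\<close>, a point of the cell that is selected again later lies
  in the bad set of the cell, which fills at most half of it.\<close>

lemma sparse_sel:
  assumes "sel K n x"
  shows "emeasure lebesgue (cell (K + int n) x - last_sel K n) \<le> ennreal (vol (K + int n) / 2)"
proof -
  let ?B = "{y \<in> cell (K + int n) x. \<exists>k. stops (K + int n) k y}"
  have "cell (K + int n) x - last_sel K n \<subseteq> ?B"
  proof
    fix y assume y: "y \<in> cell (K + int n) x - last_sel K n"
    then have "sel K n y" using assms sel_cell[of y K n x n] by simp
    then show "y \<in> ?B" using y next_sel_stops[of K n y] unfolding last_sel_def by auto
  qed
  moreover have "?B \<in> sets lebesgue"
  proof -
    have "?B = cell (K + int n) x \<inter> {y \<in> space lebesgue. \<exists>k. stops (K + int n) k y}" by auto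
    also have "\<dots> \<in> sets lebesgue" by (intro sets.Int sets_cell) measurable
    finally show ?thesis .
  qed
  ultimately have "emeasure lebesgue (cell (K + int n) x - last_sel K n) \<le> emeasure lebesgue ?B"
    by (rule emeasure_mono)
  also note bad_set
  finally show ?thesis .
qed

text \<open>The levels fall into blocks starting at selected levels. Inside a block the stopping
  rule has not fired, which bounds the sum of squares by \<open>thr\<close> times the squared
  average at the start of the block. The induction keeps the unfinished block separate, because its
  bound is charged only once, when the block closes.\<close>

lemma pointwise_sparse_domination:
  "(\<Sum>k\<le>n. (coef (K + int k) x)\<^sup>2) \<le> thr * (\<Sum>k\<le>n. if sel K k x then (avg (K + int k) x)\<^sup>2 else 0)"
proof -
  let ?c = "\<lambda>k. (coef (K + int k) x)\<^sup>2" and ?s = "\<lambda>k. if sel K k x then (avg (K + int k) x)\<^sup>2 else 0"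
  let ?a = "\<lambda>k. (avg (K + int k) x)\<^sup>2"
  have c_le: "?c k \<le> thr * ?a k" for k
  proof -
    have "?c k \<le> ?a k"
      using coef_le_avg[of "K + int k" x] avg_nonneg[of "K + int k" x] by (subst abs_le_square_iff[symmetric]) simp
    also have "\<dots> \<le> thr * ?a k" using mult_right_mono[OF thr_ge_1, of "?a k"] by simp
    finally show ?thesis .
  qed
  have "(\<Sum>k<top_sel K n x. ?c k) \<le> thr * (\<Sum>k<top_sel K n x. ?s k) \<and>
      (\<Sum>k=top_sel K n x..n. ?c k) \<le> thr * ?a (top_sel K n x)"
  proof (induction n)
    case 0
    show ?case using c_le[of 0] by simp
  next
    case (Suc n)
    define t where "t = top_sel K n x"
    have tn: "t \<le> n" using top_sel_le by (simp add: t_def)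
    have st: "sel K t x" unfolding t_def by (rule sel_top_sel)
    show ?case
    proof (cases "stops (K + int t) (Suc n - t) x")
      case True
      then have t': "top_sel K (Suc n) x = Suc n" by (simp add: t_def)
      have split: "(\<Sum>k<Suc n. g k) = (\<Sum>k<t. g k) + (\<Sum>k=t..n. g k)" for g :: "nat \<Rightarrow> real"
        using sum.atLeastLessThan_concat[of 0 t "Suc n" g] tn
        by (simp add: atLeast0LessThan atLeastLessThanSuc_atLeastAtMost lessThan_Suc_atMost atLeast0AtMost del: sum.lessThan_Suc)
      have "?s t \<le> (\<Sum>k=t..n. ?s k)" using tn by (intro member_le_sum) auto
      then have "?a t \<le> (\<Sum>k=t..n. ?s k)" using st by simp
      then have "thr * ?a t \<le> thr * (\<Sum>k=t..n. ?s k)" using thr_ge_1 by (intro mult_left_mono) auto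
      then have "(\<Sum>k<Suc n. ?c k) \<le> thr * (\<Sum>k<Suc n. ?s k)"
        using Suc.IH unfolding split t_def[symmetric] distrib_left by linarith
      then show ?thesis unfolding t' using c_le[of "Suc n"] by simp
    next
      case False
      then have t': "top_sel K (Suc n) x = t" by (simp add: t_def)
      have "(\<Sum>k=t..Suc n. ?c k) = (\<Sum>k'\<le>Suc n - t. (coef (K + int t + int k') x)\<^sup>2)"
        using tn by (intro sum.reindex_bij_witness[of _ "\<lambda>k. k + t" "\<lambda>k. k - t"]) (auto simp: of_nat_diff)
      also have "\<dots> \<le> thr * ?a t" using False unfolding stops_def by simp
      finally show ?thesis using Suc.IH unfolding t' t_def by simp
    qed
  qed
  moreover have split: "(\<Sum>k\<le>n. g k) = (\<Sum>k<top_sel K n x. g k) + (\<Sum>k=top_sel K n x..n. g k)" for g :: "nat \<Rightarrow> real"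
    using sum.atLeastLessThan_concat[of 0 "top_sel K n x" "Suc n" g] top_sel_le[of K n x]
    by (simp add: atLeast0LessThan atLeastLessThanSuc_atLeastAtMost lessThan_Suc_atMost atLeast0AtMost)
  have "?s (top_sel K n x) \<le> (\<Sum>k=top_sel K n x..n. ?s k)"
    using top_sel_le[of K n x] by (intro member_le_sum) auto
  then have "?a (top_sel K n x) \<le> (\<Sum>k=top_sel K n x..n. ?s k)" using sel_top_sel[of K n x] by simp
  then have "thr * ?a (top_sel K n x) \<le> thr * (\<Sum>k=top_sel K n x..n. ?s k)" using thr_ge_1 by (intro mult_left_mono) auto
  ultimately show ?thesis unfolding split distrib_left by linarith
qed

end

section \<open>Weighted estimates for sparse sums\<close>

text \<open>Convexity: the increment of the r-th power is at most its length times the slope at the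
  right end point. Young's inequality takes the place of a derivative.\<close>

lemma epowr_add_le_tangent:
  assumes "r > 1"
  shows "epowr (x + y) r \<le> epowr x r + ennreal r * (y * epowr (x + y) (r - 1))"
proof (cases "x = top \<or> y = top")
  case True
  then show ?thesis using assms by (auto simp: ennreal_mult_top ennreal_top_mult)
next
  case False
  then obtain a b where ab: "x = ennreal a" "y = ennreal b" "a \<ge> 0" "b \<ge> 0"
    by (metis ennreal_cases)
  let ?s = "a + b"
  have s: "?s \<ge> 0" using ab by simp
  have eq: "?s powr r = ?s * ?s powr (r - 1)"
    using s by (cases "?s = 0") (auto simp: powr_diff)
  have "a * ?s powr (r - 1) \<le> a powr r / r + (?s powr (r - 1)) powr (r / (r - 1)) / (r / (r - 1))"
    using assms ab by (intro Youngs_inequality) (auto simp: field_simps)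
  also have "(?s powr (r - 1)) powr (r / (r - 1)) = ?s powr r"
    using assms by (simp add: powr_powr)
  finally have "a * ?s powr (r - 1) \<le> a powr r / r + ?s powr r * (1 - 1 / r)"
    using assms by (simp add: field_simps)
  then have "?s powr r \<le> a powr r / r + ?s powr r * (1 - 1 / r) + b * ?s powr (r - 1)"
    using eq by (simp add: distrib_right)
  then have "?s powr r / r \<le> a powr r / r + b * ?s powr (r - 1)" by (simp add: right_diff_distrib)
  then have "r * (?s powr r / r) \<le> r * (a powr r / r + b * ?s powr (r - 1))"
    using assms by (intro mult_left_mono) auto
  then have "?s powr r \<le> a powr r + r * (b * ?s powr (r - 1))"
    using assms by (simp add: distrib_left)
  then show ?thesis
    using assms ab by (simp add: epowr_ennreal ennreal_mult[symmetric] ennreal_plus[symmetric] del: ennreal_plus)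
qed

text \<open>Telescoping the tangent inequality. Each term meets only the partial sum up to its own
  level, and this partial sum is constant on cells of that level.\<close>

lemma epowr_sum_le_tangent:
  fixes l :: "nat \<Rightarrow> ennreal"
  assumes "r > 1"
  shows "epowr (\<Sum>k\<le>m. l k) r \<le> ennreal r * (\<Sum>k\<le>m. l k * epowr (\<Sum>i\<le>k. l i) (r - 1))"
proof (induction m)
  case 0
  have "epowr (l 0) r \<le> epowr 0 r + ennreal r * (l 0 * epowr (0 + l 0) (r - 1))"
    using epowr_add_le_tangent[OF assms, of 0 "l 0"] by simp
  then show ?case using assms by simp
next
  case (Suc m)
  have "epowr (\<Sum>k\<le>Suc m. l k) r \<le> epowr (\<Sum>k\<le>m. l k) r + ennreal r * (l (Suc m) * epowr (\<Sum>k\<le>Suc m. l k) (r - 1))"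
    using epowr_add_le_tangent[OF assms, of "\<Sum>k\<le>m. l k" "l (Suc m)"] by simp
  also have "\<dots> \<le> ennreal r * (\<Sum>k\<le>m. l k * epowr (\<Sum>i\<le>k. l i) (r - 1)) + ennreal r * (l (Suc m) * epowr (\<Sum>k\<le>Suc m. l k) (r - 1))"
    by (intro add_right_mono Suc.IH)
  also have "\<dots> = ennreal r * (\<Sum>k\<le>Suc m. l k * epowr (\<Sum>i\<le>k. l i) (r - 1))"
    by (simp add: distrib_left)
  finally show ?case .
qed

text \<open>Finiteness of X is essential, as X = top satisfies the second hypothesis for every
  Y.\<close>

lemma ennreal_absorb_half:
  assumes "X < top" "X \<le> Y + ennreal (1/2) * X"
  shows "X \<le> 2 * Y"
proof (cases "Y = top")
  case False
  then obtain x y where xy: "X = ennreal x" "Y = ennreal y" "x \<ge> 0" "y \<ge> 0"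
    using assms(1) by (metis ennreal_cases less_irrefl)
  have "ennreal (y + 1/2 * x) = Y + ennreal (1/2) * X"
    using ennreal_plus[of y "1/2 * x"] ennreal_mult[of "1/2" x] xy by simp
  then have "ennreal x \<le> ennreal (y + 1/2 * x)" using assms(2) xy by simp
  then have "x \<le> y + 1/2 * x" by (subst (asm) ennreal_le_iff) (use xy in auto)
  then have "x \<le> 2 * y" by simp
  then have "ennreal x \<le> ennreal (2 * y)" by (rule ennreal_leI)
  also have "\<dots> = 2 * ennreal y" using xy by (simp add: ennreal_mult)
  finally show ?thesis using xy by simp
qed (simp add: ennreal_mult_top)

text \<open>This is 2 r d^(1 - r) for d = 1 / (2 r C), the Young parameter for which the absorbed
  term is exactly one half.\<close>

definition sparse_const :: "real \<Rightarrow> real \<Rightarrow> real" where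
  "sparse_const r C = 2 * r * (1 / (2 * r * C)) powr (1 - r)"

lemma sparse_const_pos: "r > 1 \<Longrightarrow> C > 0 \<Longrightarrow> sparse_const r C > 0"
  unfolding sparse_const_def by (intro mult_pos_pos) auto

text \<open>A Carleson-type bound. On \<open>s k\<close> the partial sum \<open>\<Sum>i\<le>k. l i\<close> is comparable in the mean with
  its restriction to the disjoint sets \<open>E k\<close>; the term produced by Young's inequality is thereby absorbed
  into the left-hand side.\<close>
lemma nn_integral_sparse_sum_le:
  fixes l :: "nat \<Rightarrow> 'a \<Rightarrow> ennreal"
  assumes r: "r > 1" and C: "C > 0"
    and [measurable]: "\<And>k. l k \<in> borel_measurable M" "\<And>k. s k \<in> sets M" "\<And>k. E k \<in> sets M"
    and supp: "\<And>k x. x \<notin> s k \<Longrightarrow> l k x = 0"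
    and disj: "\<And>x k k'. x \<in> E k \<Longrightarrow> x \<in> E k' \<Longrightarrow> k = k'"
    and sparse: "\<And>k. k \<le> m \<Longrightarrow> (\<integral>\<^sup>+x\<in>s k. epowr (\<Sum>i\<le>k. l i x) r \<partial>M) \<le> ennreal C * (\<integral>\<^sup>+x\<in>E k. epowr (\<Sum>i\<le>k. l i x) r \<partial>M)"
    and fin: "(\<integral>\<^sup>+x. epowr (\<Sum>i\<le>m. l i x) r \<partial>M) < top"
  shows "(\<integral>\<^sup>+x. epowr (\<Sum>i\<le>m. l i x) r \<partial>M) \<le> ennreal (sparse_const r C) * (\<Sum>k\<le>m. \<integral>\<^sup>+x. epowr (l k x) r \<partial>M)"
proof -
  define L where "L k x = (\<Sum>i\<le>k. l i x)" for k x
  have [measurable]: "L k \<in> borel_measurable M" for k unfolding L_def by measurable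
  have [measurable]: "(\<lambda>x. epowr (L k x) r) \<in> borel_measurable M" "(\<lambda>x. epowr (l k x) r) \<in> borel_measurable M" for k
    using r by (auto intro!: borel_measurable_epowr)
  have [measurable]: "(\<lambda>x. epowr (L k x) (r - 1)) \<in> borel_measurable M" for k
    using r by (intro borel_measurable_epowr) auto
  define d where "d = 1 / (2 * r * C)"
  have d: "d > 0" using r C by (simp add: d_def)
  define X where "X = (\<integral>\<^sup>+x. epowr (L m x) r \<partial>M)"
  define Y where "Y = (\<Sum>k\<le>m. \<integral>\<^sup>+x. epowr (l k x) r \<partial>M)"
  have young: "l k x * epowr (L k x) (r - 1) \<le> ennreal (d powr (1 - r)) * epowr (l k x) r + ennreal d * (epowr (L k x) r * indicator (s k) x)" for k x
  proof (cases "x \<in> s k")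
    case True then show ?thesis using epowr_young[OF d r, of "l k x" "L k x"] by simp
  qed (simp add: supp)
  have "X \<le> (\<integral>\<^sup>+x. ennreal r * (\<Sum>k\<le>m. l k x * epowr (L k x) (r - 1)) \<partial>M)"
    unfolding X_def L_def by (intro nn_integral_mono epowr_sum_le_tangent r)
  also have "\<dots> = ennreal r * (\<Sum>k\<le>m. \<integral>\<^sup>+x. l k x * epowr (L k x) (r - 1) \<partial>M)"
    by (subst nn_integral_cmult) (auto simp: nn_integral_sum)
  also have "\<dots> \<le> ennreal r * (\<Sum>k\<le>m. ennreal (d powr (1 - r)) * (\<integral>\<^sup>+x. epowr (l k x) r \<partial>M) + ennreal d * (\<integral>\<^sup>+x\<in>s k. epowr (L k x) r \<partial>M))"
  proof (intro mult_left_mono sum_mono)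
    fix k
    have "(\<integral>\<^sup>+x. l k x * epowr (L k x) (r - 1) \<partial>M) \<le> (\<integral>\<^sup>+x. ennreal (d powr (1 - r)) * epowr (l k x) r + ennreal d * (epowr (L k x) r * indicator (s k) x) \<partial>M)"
      by (intro nn_integral_mono young)
    also have "\<dots> = ennreal (d powr (1 - r)) * (\<integral>\<^sup>+x. epowr (l k x) r \<partial>M) + ennreal d * (\<integral>\<^sup>+x\<in>s k. epowr (L k x) r \<partial>M)"
      by (subst nn_integral_add) (auto simp: nn_integral_cmult)
    finally show "(\<integral>\<^sup>+x. l k x * epowr (L k x) (r - 1) \<partial>M) \<le> \<dots>" .
  qed simp
  also have "\<dots> = ennreal r * (ennreal (d powr (1 - r)) * Y + ennreal d * (\<Sum>k\<le>m. \<integral>\<^sup>+x\<in>s k. epowr (L k x) r \<partial>M))"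
    unfolding Y_def by (simp add: sum.distrib sum_distrib_left)
  also have "(\<Sum>k\<le>m. \<integral>\<^sup>+x\<in>s k. epowr (L k x) r \<partial>M) \<le> ennreal C * X"
  proof -
    have "(\<Sum>k\<le>m. \<integral>\<^sup>+x\<in>s k. epowr (L k x) r \<partial>M) \<le> (\<Sum>k\<le>m. ennreal C * (\<integral>\<^sup>+x\<in>E k. epowr (L k x) r \<partial>M))"
      using sparse unfolding L_def by (intro sum_mono) auto
    also have "\<dots> = ennreal C * (\<integral>\<^sup>+x. (\<Sum>k\<le>m. epowr (L k x) r * indicator (E k) x) \<partial>M)"
      by (subst nn_integral_sum) (auto simp: sum_distrib_left)
    also have "\<dots> \<le> ennreal C * X"
      unfolding X_def
    proof (intro mult_left_mono nn_integral_mono)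
      fix x
      have "(\<Sum>k\<le>m. epowr (L k x) r * indicator (E k) x) \<le> (\<Sum>k\<le>m. epowr (L m x) r * indicator (E k) x)"
      proof (intro sum_mono mult_right_mono epowr_mono)
        fix k assume "k \<in> {..m}"
        then show "L k x \<le> L m x" unfolding L_def by (intro sum_mono2) auto
      qed (use r in auto)
      also have "\<dots> = epowr (L m x) r * (\<Sum>k\<le>m. indicator (E k) x)" by (simp add: sum_distrib_left)
      also have "(\<Sum>k\<le>m. indicator (E k) x :: ennreal) \<le> 1"
      proof (cases "\<exists>k\<le>m. x \<in> E k")
        case True
        then obtain k where k: "k \<le> m" "x \<in> E k" by auto
        have "(\<Sum>k'\<le>m. indicator (E k') x :: ennreal) = (\<Sum>k'\<le>m. if k' = k then 1 else 0)"
        proof (intro sum.cong refl)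
          fix k' have "x \<in> E k' \<longleftrightarrow> k' = k" using k(2) disj[of x k' k] by blast
          then show "indicator (E k') x = (if k' = k then 1 else (0 :: ennreal))" by (simp add: indicator_def)
        qed
        then show ?thesis using k by simp
      next
        case False
        then have "(\<Sum>k'\<le>m. indicator (E k') x :: ennreal) = 0"
          by (intro sum.neutral) (auto simp: indicator_def)
        then show ?thesis by simp
      qed
      finally show "(\<Sum>k\<le>m. epowr (L k x) r * indicator (E k) x) \<le> epowr (L m x) r"
        by (simp add: mult_left_mono)
    qed simp
    finally show ?thesis .
  qed
  finally have "X \<le> ennreal r * (ennreal (d powr (1 - r)) * Y + ennreal d * (ennreal C * X))"
    by (simp add: mult_left_mono add_left_mono)
  also have "\<dots> = ennreal (r * d powr (1 - r)) * Y + ennreal (1/2) * X"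
  proof -
    have "ennreal r * (ennreal d * (ennreal C * X)) = ennreal (r * d * C) * X"
      using r d C by (simp add: ennreal_mult mult_ac)
    also have "r * d * C = 1/2" using r C by (simp add: d_def)
    finally show ?thesis unfolding distrib_left using r by (simp only: ennreal_mult' mult.assoc)
  qed
  finally have "X \<le> 2 * (ennreal (r * d powr (1 - r)) * Y)"
    using fin by (intro ennreal_absorb_half) (auto simp: X_def L_def)
  also have "\<dots> = ennreal (sparse_const r C) * Y"
    using r unfolding sparse_const_def d_def[symmetric] by (simp add: ennreal_mult mult.assoc)
  finally show ?thesis by (simp add: X_def Y_def L_def)
qed

text \<open>The relation \<open>v = w powr (- 1 / (q - 1))\<close> is only required almost everywhere, so that both weights can be
  real-valued.\<close>
definition dual_weight :: "real \<Rightarrow> ('a::euclidean_space \<Rightarrow> real) \<Rightarrow> ('a \<Rightarrow> real) \<Rightarrow> bool" where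
  "dual_weight q w v \<longleftrightarrow> w \<in> borel_measurable lebesgue \<and> v \<in> borel_measurable lebesgue \<and>
     (\<forall>x. 0 \<le> w x) \<and> (\<forall>x. 0 \<le> v x) \<and> (AE x in lebesgue. w x > 0 \<and> v x = w x powr (- 1 / (q - 1)))"

text \<open>Insert w^(1/q) w^(-1/q) and apply Hoelder's inequality; the conjugate power of the
  second factor is v almost everywhere.\<close>

lemma nn_integral_Holder_weight:
  assumes q: "q > 1" and wv: "dual_weight q w v"
    and [measurable]: "f \<in> borel_measurable lebesgue" "E \<in> sets lebesgue"
  shows "epowr (\<integral>\<^sup>+x\<in>E. f x \<partial>lebesgue) q
    \<le> (\<integral>\<^sup>+x\<in>E. epowr (f x) q * ennreal (w x) \<partial>lebesgue) * epowr (\<integral>\<^sup>+x\<in>E. ennreal (v x) \<partial>lebesgue) (q - 1)"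
proof -
  have [measurable]: "w \<in> borel_measurable lebesgue" "v \<in> borel_measurable lebesgue"
    and w0: "\<And>x. w x \<ge> 0" "\<And>x. v x \<ge> 0"
    and ae: "AE x in lebesgue. w x > 0 \<and> v x = w x powr (- 1 / (q - 1))"
    using wv by (auto simp: dual_weight_def)
  define F where "F x = f x * ennreal (w x powr (1/q)) * indicator E x" for x
  define G where "G x = ennreal (w x powr (- 1/q)) * indicator E x" for x
  have [measurable]: "F \<in> borel_measurable lebesgue" "G \<in> borel_measurable lebesgue"
    unfolding F_def G_def by measurable
  have "(\<integral>\<^sup>+x\<in>E. f x \<partial>lebesgue) = (\<integral>\<^sup>+x. F x * G x \<partial>lebesgue)"
  proof (rule nn_integral_cong_AE, use ae in eventually_elim)
    fix x assume "w x > 0 \<and> v x = w x powr (- 1 / (q - 1))"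
    then have "ennreal (w x powr (1/q)) * ennreal (w x powr (- 1/q)) = 1"
      by (simp add: ennreal_mult[symmetric] powr_add[symmetric])
    then have "f x * (ennreal (w x powr (1/q)) * ennreal (w x powr (- 1/q))) = f x" by simp
    then show "f x * indicator E x = F x * G x" unfolding F_def G_def
      by (auto simp: indicator_def mult.assoc)
  qed
  then have "epowr (\<integral>\<^sup>+x\<in>E. f x \<partial>lebesgue) q
     \<le> (\<integral>\<^sup>+x. epowr (F x) q \<partial>lebesgue) * epowr (\<integral>\<^sup>+x. epowr (G x) (q / (q - 1)) \<partial>lebesgue) (q - 1)"
    using nn_integral_Holder[of F lebesgue G q] q by simp
  also have "(\<integral>\<^sup>+x. epowr (F x) q \<partial>lebesgue) = (\<integral>\<^sup>+x\<in>E. epowr (f x) q * ennreal (w x) \<partial>lebesgue)"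
  proof (rule nn_integral_cong)
    fix x
    have "(w x powr (1/q)) powr q = w x" using q w0(1)[of x] by (simp add: powr_powr)
    then show "epowr (F x) q = epowr (f x) q * ennreal (w x) * indicator E x"
      unfolding F_def using q by (auto simp: epowr_mult epowr_ennreal indicator_def)
  qed
  also have "(\<integral>\<^sup>+x. epowr (G x) (q / (q - 1)) \<partial>lebesgue) = (\<integral>\<^sup>+x\<in>E. ennreal (v x) \<partial>lebesgue)"
  proof (rule nn_integral_cong_AE, use ae in eventually_elim)
    fix x assume x: "w x > 0 \<and> v x = w x powr (- 1 / (q - 1))"
    have "(w x powr (- 1/q)) powr (q / (q - 1)) = v x" using x q by (simp add: powr_powr)
    then show "epowr (G x) (q / (q - 1)) = ennreal (v x) * indicator E x"
      unfolding G_def using q by (auto simp: epowr_ennreal indicator_def)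
  qed
  finally show ?thesis .
qed

lemma ennreal_mult_cancel_le:
  fixes a b c :: ennreal
  assumes "a * c \<le> b * c" "c \<noteq> 0" "c < top"
  shows "a \<le> b"
  using assms by (metis ennreal_mult_le_mult_iff less_irrefl mult.commute)

text \<open>Hoelder's inequality for the constant 1 on E gives |E|^q <= w(E) v(E)^(q-1). Enlarging E
  to B in the dual factor and multiplying by w(B) brings in the A_q condition.\<close>

lemma weight_lower_bound:
  assumes q: "q > 1" and wv: "dual_weight q w v"
    and [measurable]: "E \<in> sets lebesgue" "B \<in> sets lebesgue" and "E \<subseteq> B"
    and Aq: "(\<integral>\<^sup>+x\<in>B. ennreal (w x) \<partial>lebesgue) * epowr (\<integral>\<^sup>+x\<in>B. ennreal (v x) \<partial>lebesgue) (q - 1) \<le> D"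
  shows "(\<integral>\<^sup>+x\<in>B. ennreal (w x) \<partial>lebesgue) * epowr (emeasure lebesgue E) q
      \<le> D * (\<integral>\<^sup>+x\<in>E. ennreal (w x) \<partial>lebesgue)"
proof -
  let ?W = "\<lambda>A. \<integral>\<^sup>+x\<in>A. ennreal (w x) \<partial>lebesgue" and ?V = "\<lambda>A. \<integral>\<^sup>+x\<in>A. ennreal (v x) \<partial>lebesgue"
  have V: "?V E \<le> ?V B" using \<open>E \<subseteq> B\<close> by (intro nn_integral_mono) (auto simp: indicator_def)
  have "epowr (emeasure lebesgue E) q \<le> ?W E * epowr (?V E) (q - 1)"
    using nn_integral_Holder_weight[OF q wv, of "\<lambda>x. 1" E] q epowr_ennreal[of q 1] by simp
  also have "\<dots> \<le> ?W E * epowr (?V B) (q - 1)"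
    using q V by (intro mult_left_mono epowr_mono) auto
  finally have "?W B * epowr (emeasure lebesgue E) q \<le> ?W B * (?W E * epowr (?V B) (q - 1))"
    by (intro mult_left_mono) auto
  also have "\<dots> = (?W B * epowr (?V B) (q - 1)) * ?W E" by (simp add: mult_ac)
  also have "\<dots> \<le> D * ?W E" by (intro mult_right_mono Aq) auto
  finally show ?thesis .
qed

text \<open>The same argument with E enlarged to B in the factor w(E) and multiplication by
  v(B)^(q-1).\<close>

lemma weight_lower_bound_dual:
  assumes q: "q > 1" and wv: "dual_weight q w v"
    and [measurable]: "E \<in> sets lebesgue" "B \<in> sets lebesgue" and "E \<subseteq> B"
    and Aq: "(\<integral>\<^sup>+x\<in>B. ennreal (w x) \<partial>lebesgue) * epowr (\<integral>\<^sup>+x\<in>B. ennreal (v x) \<partial>lebesgue) (q - 1) \<le> D"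
  shows "epowr (\<integral>\<^sup>+x\<in>B. ennreal (v x) \<partial>lebesgue) (q - 1) * epowr (emeasure lebesgue E) q
      \<le> D * epowr (\<integral>\<^sup>+x\<in>E. ennreal (v x) \<partial>lebesgue) (q - 1)"
proof -
  let ?W = "\<lambda>A. \<integral>\<^sup>+x\<in>A. ennreal (w x) \<partial>lebesgue" and ?V = "\<lambda>A. \<integral>\<^sup>+x\<in>A. ennreal (v x) \<partial>lebesgue"
  have W: "?W E \<le> ?W B" using \<open>E \<subseteq> B\<close> by (intro nn_integral_mono) (auto simp: indicator_def)
  have "epowr (emeasure lebesgue E) q \<le> ?W E * epowr (?V E) (q - 1)"
    using nn_integral_Holder_weight[OF q wv, of "\<lambda>x. 1" E] q epowr_ennreal[of q 1] by simp
  also have "\<dots> \<le> ?W B * epowr (?V E) (q - 1)"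
    using W by (intro mult_right_mono) auto
  finally have "epowr (?V B) (q - 1) * epowr (emeasure lebesgue E) q \<le> epowr (?V B) (q - 1) * (?W B * epowr (?V E) (q - 1))"
    by (intro mult_left_mono) auto
  also have "\<dots> = (?W B * epowr (?V B) (q - 1)) * epowr (?V E) (q - 1)" by (simp add: mult_ac)
  also have "\<dots> \<le> D * epowr (?V E) (q - 1)" by (intro mult_right_mono Aq) auto
  finally show ?thesis .
qed

locale weighted_cells = dyadic_cells cell
  for cell :: "int \<Rightarrow> 'a::euclidean_space \<Rightarrow> 'a set" +
  fixes w v :: "'a \<Rightarrow> real" and q Cw :: real
  assumes q_gt_1: "1 < q" and Cw_pos: "0 < Cw"
    and wv_dual: "dual_weight q w v"
    and w_finite: "(\<integral>\<^sup>+y\<in>cell i x. ennreal (w y) \<partial>lebesgue) < top"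
    and v_finite: "(\<integral>\<^sup>+y\<in>cell i x. ennreal (v y) \<partial>lebesgue) < top"
    and Aq_cell: "(\<integral>\<^sup>+y\<in>cell i x. ennreal (w y) \<partial>lebesgue) * epowr (\<integral>\<^sup>+y\<in>cell i x. ennreal (v y) \<partial>lebesgue) (q - 1)
       \<le> ennreal (Cw * vol i powr q)"
begin

lemma w_measurable [measurable]: "w \<in> borel_measurable lebesgue"
  and v_measurable [measurable]: "v \<in> borel_measurable lebesgue"
  and w_nonneg: "w x \<ge> 0" and v_nonneg: "v x \<ge> 0"
  and w_v_ae: "AE x in lebesgue. w x > 0 \<and> v x = w x powr (- 1 / (q - 1))"
  using wv_dual by (auto simp: dual_weight_def)

text \<open>One constant for both weights: 2^q comes from subsets filling half of a cell, and the
  root from undoing the exponent q - 1 of the dual measure.\<close>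

definition Cs :: real where "Cs = max (Cw * 2 powr q) ((Cw * 2 powr q) powr (1 / (q - 1)))"

lemma Cs_pos: "Cs > 0"
  unfolding Cs_def using Cw_pos by (simp add: less_max_iff_disj)

lemma half_measure:
  assumes "E \<in> sets lebesgue" "emeasure lebesgue (cell i x - E) \<le> ennreal (vol i / 2)"
  shows "ennreal (vol i / 2) \<le> emeasure lebesgue (cell i x \<inter> E)"
proof -
  have "ennreal (vol i / 2) + ennreal (vol i / 2) = emeasure lebesgue (cell i x)"
    using vol_pos[of i] by (simp add: emeasure_cell' ennreal_plus[symmetric] del: ennreal_plus)
  also have "\<dots> = emeasure lebesgue (cell i x \<inter> E) + emeasure lebesgue (cell i x - E)"
    using plus_emeasure[of "cell i x \<inter> E" lebesgue "cell i x - E"] assms(1) sets_cell[of i x]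
    by (simp add: Int_Diff_disjoint Int_Diff_Un)
  also have "\<dots> \<le> emeasure lebesgue (cell i x \<inter> E) + ennreal (vol i / 2)"
    by (intro add_left_mono assms)
  finally show ?thesis by (simp add: ennreal_add_left_cancel_le add.commute)
qed

lemma half_powr: "epowr (ennreal (vol i / 2)) q = ennreal (vol i powr q / 2 powr q)"
  using vol_pos[of i] by (simp add: epowr_ennreal_pos powr_divide)

text \<open>A set filling half of a cell in Lebesgue measure carries a fixed share of its weight. In
  this form sparsity passes from Lebesgue measure to w.\<close>

lemma w_sparse:
  assumes E: "E \<in> sets lebesgue" "emeasure lebesgue (cell i x - E) \<le> ennreal (vol i / 2)"
  shows "(\<integral>\<^sup>+y\<in>cell i x. ennreal (w y) \<partial>lebesgue) \<le> ennreal Cs * (\<integral>\<^sup>+y\<in>cell i x \<inter> E. ennreal (w y) \<partial>lebesgue)"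
proof -
  let ?W = "\<lambda>A. \<integral>\<^sup>+x\<in>A. ennreal (w x) \<partial>lebesgue"
  let ?c = "ennreal (vol i powr q / 2 powr q)"
  have "?W (cell i x) * ?c \<le> ?W (cell i x) * epowr (emeasure lebesgue (cell i x \<inter> E)) q"
    unfolding half_powr[symmetric] using q_gt_1 by (intro mult_left_mono epowr_mono half_measure E) auto
  also have "\<dots> \<le> ennreal (Cw * vol i powr q) * ?W (cell i x \<inter> E)"
    by (rule weight_lower_bound[OF q_gt_1 wv_dual _ _ _ Aq_cell]) (use E(1) sets_cell in auto)
  also have "ennreal (Cw * vol i powr q) = ennreal (Cw * 2 powr q) * ?c"
    using Cw_pos by (simp add: ennreal_mult[symmetric])
  also have "ennreal (Cw * 2 powr q) * ?c * ?W (cell i x \<inter> E) = (ennreal (Cw * 2 powr q) * ?W (cell i x \<inter> E)) * ?c"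
    by (simp add: mult_ac)
  finally have "?W (cell i x) \<le> ennreal (Cw * 2 powr q) * ?W (cell i x \<inter> E)"
    by (rule ennreal_mult_cancel_le) (use vol_pos[of i] in auto)
  also have "\<dots> \<le> ennreal Cs * ?W (cell i x \<inter> E)"
    by (intro mult_right_mono ennreal_leI) (auto simp: Cs_def)
  finally show ?thesis .
qed

lemma v_sparse:
  assumes E: "E \<in> sets lebesgue" "emeasure lebesgue (cell i x - E) \<le> ennreal (vol i / 2)"
  shows "(\<integral>\<^sup>+y\<in>cell i x. ennreal (v y) \<partial>lebesgue) \<le> ennreal Cs * (\<integral>\<^sup>+y\<in>cell i x \<inter> E. ennreal (v y) \<partial>lebesgue)"
proof -
  let ?V = "\<lambda>A. \<integral>\<^sup>+x\<in>A. ennreal (v x) \<partial>lebesgue"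
  let ?c = "ennreal (vol i powr q / 2 powr q)"
  have "epowr (?V (cell i x)) (q - 1) * ?c \<le> epowr (?V (cell i x)) (q - 1) * epowr (emeasure lebesgue (cell i x \<inter> E)) q"
    unfolding half_powr[symmetric] using q_gt_1 by (intro mult_left_mono epowr_mono half_measure E) auto
  also have "\<dots> \<le> ennreal (Cw * vol i powr q) * epowr (?V (cell i x \<inter> E)) (q - 1)"
    by (rule weight_lower_bound_dual[OF q_gt_1 wv_dual _ _ _ Aq_cell]) (use E(1) sets_cell in auto)
  also have "ennreal (Cw * vol i powr q) = ennreal (Cw * 2 powr q) * ?c"
    using Cw_pos by (simp add: ennreal_mult[symmetric])
  also have "ennreal (Cw * 2 powr q) * ?c * epowr (?V (cell i x \<inter> E)) (q - 1) = (ennreal (Cw * 2 powr q) * epowr (?V (cell i x \<inter> E)) (q - 1)) * ?c"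
    by (simp add: mult_ac)
  finally have "epowr (?V (cell i x)) (q - 1) \<le> ennreal (Cw * 2 powr q) * epowr (?V (cell i x \<inter> E)) (q - 1)"
    by (rule ennreal_mult_cancel_le) (use vol_pos[of i] in auto)
  then have "?V (cell i x) \<le> epowr (ennreal (Cw * 2 powr q) * epowr (?V (cell i x \<inter> E)) (q - 1)) (1 / (q - 1))"
    using q_gt_1 by (subst (asm) epowr_inverse_le_iff) auto
  also have "\<dots> = ennreal ((Cw * 2 powr q) powr (1 / (q - 1))) * ?V (cell i x \<inter> E)"
    using q_gt_1 Cw_pos by (simp add: epowr_mult epowr_epowr epowr_ennreal_pos)
  also have "\<dots> \<le> ennreal Cs * ?V (cell i x \<inter> E)"
    by (intro mult_right_mono ennreal_leI) (auto simp: Cs_def)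
  finally show ?thesis .
qed

end

lemma nn_integral_sum_powr_finite:
  assumes r: "r > 0" and b: "\<And>k x. x \<in> Q \<Longrightarrow> k \<le> m \<Longrightarrow> l k x \<le> ennreal (b k)"
    and fin: "(\<integral>\<^sup>+x\<in>Q. u x \<partial>M) < top" and [measurable]: "u \<in> borel_measurable M" "Q \<in> sets M"
  shows "(\<integral>\<^sup>+x. (u x * indicator Q x) * epowr (\<Sum>k\<le>(m::nat). l k x) r \<partial>M) < top"
proof -
  have "(\<integral>\<^sup>+x. (u x * indicator Q x) * epowr (\<Sum>k\<le>m. l k x) r \<partial>M)
     \<le> (\<integral>\<^sup>+x. epowr (\<Sum>k\<le>m. ennreal (b k)) r * (u x * indicator Q x) \<partial>M)"
  proof (rule nn_integral_mono)
    fix x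
    show "(u x * indicator Q x) * epowr (\<Sum>k\<le>m. l k x) r \<le> epowr (\<Sum>k\<le>m. ennreal (b k)) r * (u x * indicator Q x)"
      by (cases "x \<in> Q") (auto simp: mult.commute intro!: mult_left_mono epowr_mono r sum_mono b)
  qed
  also have "\<dots> = epowr (\<Sum>k\<le>m. ennreal (b k)) r * (\<integral>\<^sup>+x\<in>Q. u x \<partial>M)"
    by (rule nn_integral_cmult) measurable
  also have "\<dots> < top"
  proof -
    have "(\<Sum>k\<le>m. ennreal (b k)) \<noteq> top" by (induction m) simp_all
    then have "epowr (\<Sum>k\<le>m. ennreal (b k)) r < top" using r by (simp add: less_top[symmetric])
    then show ?thesis using fin by (simp add: ennreal_mult_less_top)
  qed
  finally show ?thesis .
qed

section \<open>Carleson embedding for the selected cells\<close>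

locale weighted_test = dyadic_test cell f e \<beta> + weighted_cells cell w v q Cw
  for cell :: "int \<Rightarrow> 'a::euclidean_space \<Rightarrow> 'a set" and f e \<beta> w v q Cw
begin

lemma nn_integral_avg: "(\<integral>\<^sup>+y\<in>cell i x. ennreal \<bar>f y\<bar> \<partial>lebesgue) = ennreal (avg i x * vol i)"
proof -
  have "(\<integral>\<^sup>+y\<in>cell i x. ennreal \<bar>f y\<bar> \<partial>lebesgue) = (\<integral>\<^sup>+y. ennreal (indicator (cell i x) y *\<^sub>R \<bar>f y\<bar>) \<partial>lebesgue)"
    by (intro nn_integral_cong) (auto simp: indicator_def)
  also have "\<dots> = ennreal (LINT y|lebesgue. indicator (cell i x) y *\<^sub>R \<bar>f y\<bar>)"
    using f_abs_integrable[of i x] by (intro nn_integral_eq_integral) (auto simp: set_integrable_def)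
  finally show ?thesis unfolding integral_avg[symmetric] set_lebesgue_integral_def .
qed

definition wm :: "int \<Rightarrow> 'a \<Rightarrow> real" where
  "wm i x = enn2real (\<integral>\<^sup>+y\<in>cell i x. ennreal (w y) \<partial>lebesgue)"
definition vm :: "int \<Rightarrow> 'a \<Rightarrow> real" where
  "vm i x = enn2real (\<integral>\<^sup>+y\<in>cell i x. ennreal (v y) \<partial>lebesgue)"

lemma wm: "(\<integral>\<^sup>+y\<in>cell i x. ennreal (w y) \<partial>lebesgue) = ennreal (wm i x)" "wm i x \<ge> 0"
  and vm: "(\<integral>\<^sup>+y\<in>cell i x. ennreal (v y) \<partial>lebesgue) = ennreal (vm i x)" "vm i x \<ge> 0"
  using w_finite[of i x] v_finite[of i x] by (simp_all add: wm_def vm_def less_top)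

lemma wm_cell: "y \<in> cell i x \<Longrightarrow> wm i y = wm i x"
  unfolding wm_def by (simp add: cell_eq[of y i x])

lemma wm_measurable [measurable]: "wm i \<in> borel_measurable lebesgue"
  by (rule cell_constant_measurable[OF wm_cell]) simp_all

definition Cd :: real where "Cd = Cw powr (1 / (q - 1))"

text \<open>The A_q condition raised to the power 1 / (q - 1) and multiplied by
  \<open>wm i x\<close>: exactly what compares the conjugate power of \<open>mu\<close> under v with
  the q-th power of \<open>lam\<close> under w.\<close>

lemma wm_vm: "(wm i x / vol i) powr (q / (q - 1)) * vm i x \<le> Cd * wm i x"
proof -
  have V: "vol i > 0" by (rule vol_pos)
  have "ennreal (wm i x * vm i x powr (q - 1)) \<le> ennreal (Cw * vol i powr q)"
    using Aq_cell[of i x] q_gt_1 wm(2)[of i x] vm(2)[of i x] unfolding wm(1) vm(1) by (simp add: epowr_ennreal ennreal_mult)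
  then have "wm i x * vm i x powr (q - 1) \<le> Cw * vol i powr q"
    using Cw_pos by (subst (asm) ennreal_le_iff) auto
  then have "(wm i x * vm i x powr (q - 1)) powr (1 / (q - 1)) \<le> (Cw * vol i powr q) powr (1 / (q - 1))"
    using q_gt_1 wm(2)[of i x] by (intro powr_mono2) auto
  then have 1: "wm i x powr (1 / (q - 1)) * vm i x \<le> Cd * vol i powr (q / (q - 1))"
    using q_gt_1 wm(2)[of i x] vm(2)[of i x] Cw_pos by (simp add: powr_mult powr_powr Cd_def)
  have "q / (q - 1) = 1 + 1 / (q - 1)" using q_gt_1 by (simp add: field_simps)
  then have "wm i x powr (q / (q - 1)) = wm i x * wm i x powr (1 / (q - 1))"
    using wm(2)[of i x] by (cases "wm i x = 0") (auto simp: powr_add)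
  then have "wm i x powr (q / (q - 1)) * vm i x = wm i x * (wm i x powr (1 / (q - 1)) * vm i x)" by simp
  also have "\<dots> \<le> wm i x * (Cd * vol i powr (q / (q - 1)))" using wm(2) 1 by (intro mult_left_mono)
  finally show ?thesis using V wm(2)[of i x] by (simp add: powr_divide field_simps)
qed

context
  fixes K :: int and x0 :: 'a and m :: nat
begin

abbreviation Q0 :: "'a set" where "Q0 \<equiv> cell K x0"

definition lam :: "nat \<Rightarrow> 'a \<Rightarrow> real" where
  "lam k x = (if sel K k x then avg (K + int k) x else 0)"

text \<open>The dual sequence to \<open>lam\<close>: the integral of |f| \<open>mu\<close> over a
  selected cell R is the q-th power of the average times w(R), while its conjugate power integrated
  against v is controlled by the same quantity.\<close>

definition mu :: "nat \<Rightarrow> 'a \<Rightarrow> real" where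
  "mu k x = (if sel K k x then avg (K + int k) x powr (q - 1) * (wm (K + int k) x / vol (K + int k)) else 0)"

lemma lam_nonneg: "lam k x \<ge> 0" by (simp add: lam_def avg_nonneg)
lemma mu_nonneg: "mu k x \<ge> 0"
  using vol_pos[of "K + int k"] by (auto simp: mu_def wm(2) avg_nonneg intro!: mult_nonneg_nonneg divide_nonneg_pos)

lemma lam_measurable [measurable]: "lam k \<in> borel_measurable lebesgue"
  and mu_measurable [measurable]: "mu k \<in> borel_measurable lebesgue"
  unfolding lam_def mu_def by measurable

lemma lam_cell: "y \<in> cell (K + int n) x \<Longrightarrow> k \<le> n \<Longrightarrow> lam k y = lam k x"
  unfolding lam_def by (simp add: sel_cell[of y K n x k] avg_cell_le[of y "K + int n" x "K + int k"])

lemma mu_cell: "y \<in> cell (K + int n) x \<Longrightarrow> k \<le> n \<Longrightarrow> mu k y = mu k x"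
proof -
  assume y: "y \<in> cell (K + int n) x" and k: "k \<le> n"
  then have "y \<in> cell (K + int k) x" using cell_antimono[of "K + int k" "K + int n" x] by auto
  then show ?thesis unfolding mu_def using y k
    by (simp add: sel_cell[of y K n x k] avg_cell_le[of y "K + int n" x "K + int k"] wm_cell)
qed

lemma cell_sub_Q0: "x \<in> Q0 \<Longrightarrow> cell (K + int k) x \<subseteq> Q0"
  using cell_antimono[of K "K + int k" x] cell_eq[of x K x0] by simp

lemma avg_le_Q0: "x \<in> Q0 \<Longrightarrow> avg (K + int k) x \<le> 2 ^ (DIM('a) * k) * avg K x0"
  using avg_add_le[of K k x] avg_cell[of x K x0] by simp

lemma wm_le_Q0: assumes "x \<in> Q0" shows "wm (K + int k) x \<le> wm K x0"
proof -
  have "ennreal (wm (K + int k) x) \<le> ennreal (wm K x0)"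
    unfolding wm(1)[symmetric] using cell_sub_Q0[OF assms, of k]
    by (intro nn_integral_mono) (auto simp: indicator_def)
  then show ?thesis using wm(2) by simp
qed

text \<open>Supplies the sparsity hypothesis of \<open>nn_integral_sparse_sum_le\<close> cell by
  cell: g stands for a power of a partial sum, which is constant on cells of level K + k and leaves
  the integral.\<close>

lemma sparse_transfer:
  fixes g :: "'a \<Rightarrow> ennreal" and u :: "'a \<Rightarrow> real"
  assumes [measurable]: "u \<in> borel_measurable lebesgue"
    and g: "\<And>x y. y \<in> cell (K + int k) x \<Longrightarrow> g y = g x"
    and u: "\<And>E i x. E \<in> sets lebesgue \<Longrightarrow> emeasure lebesgue (cell i x - E) \<le> ennreal (vol i / 2) \<Longrightarrow>
       (\<integral>\<^sup>+y\<in>cell i x. ennreal (u y) \<partial>lebesgue) \<le> ennreal C * (\<integral>\<^sup>+y\<in>cell i x \<inter> E. ennreal (u y) \<partial>lebesgue)"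
  shows "(\<integral>\<^sup>+x. (ennreal (u x) * indicator Q0 x) * (g x * indicator {x. sel K k x} x) \<partial>lebesgue)
     \<le> ennreal C * (\<integral>\<^sup>+x. (ennreal (u x) * indicator Q0 x) * (g x * indicator (last_sel K k) x) \<partial>lebesgue)"
proof -
  let ?i = "K + int k"
  have gm [measurable]: "g \<in> borel_measurable lebesgue"
    by (rule cell_constant_measurable[OF g]) simp_all
  have [measurable]: "Q0 \<in> sets lebesgue" by (rule sets_cell)
  have ss [measurable]: "{x. sel K k x} \<in> sets lebesgue"
  proof -
    have "{x \<in> space lebesgue. sel K k x} \<in> sets lebesgue" by measurable
    then show ?thesis by simp
  qed
  let ?F = "\<lambda>x. ennreal (u x) * (g x * indicator {x. sel K k x} x)"
  let ?G = "\<lambda>x. ennreal C * (ennreal (u x) * (g x * indicator (last_sel K k) x))"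
  have "(\<integral>\<^sup>+x\<in>Q0. ?F x \<partial>lebesgue) \<le> (\<integral>\<^sup>+x\<in>Q0. ?G x \<partial>lebesgue)"
  proof (rule nn_integral_partition_mono[where P="cell ?i", OF cell_partition])
    fix x
    have [measurable]: "cell ?i x \<in> sets lebesgue" by (rule sets_cell)
    show "(\<integral>\<^sup>+y\<in>cell ?i x. ?F y \<partial>lebesgue) \<le> (\<integral>\<^sup>+y\<in>cell ?i x. ?G y \<partial>lebesgue)"
    proof (cases "sel K k x")
      case False
      then have "(\<integral>\<^sup>+y\<in>cell ?i x. ?F y \<partial>lebesgue) = (\<integral>\<^sup>+(y::'a). 0 \<partial>lebesgue)"
        using sel_cell[of _ K k x k] by (intro nn_integral_cong) (auto simp: indicator_def)
      then show ?thesis by simp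
    next
      case True
      have "(\<integral>\<^sup>+y\<in>cell ?i x. ?F y \<partial>lebesgue) = (\<integral>\<^sup>+y. g x * (ennreal (u y) * indicator (cell ?i x) y) \<partial>lebesgue)"
        using sel_cell[of _ K k x k] g[of _ x] True by (intro nn_integral_cong) (auto simp: indicator_def mult_ac)
      also have "\<dots> = g x * (\<integral>\<^sup>+y\<in>cell ?i x. ennreal (u y) \<partial>lebesgue)"
        by (rule nn_integral_cmult) measurable
      also have "\<dots> \<le> g x * (ennreal C * (\<integral>\<^sup>+y\<in>cell ?i x \<inter> last_sel K k. ennreal (u y) \<partial>lebesgue))"
        by (intro mult_left_mono u sparse_sel True last_sel_sets) simp
      also have "\<dots> = (\<integral>\<^sup>+y. (g x * ennreal C) * (ennreal (u y) * indicator (cell ?i x \<inter> last_sel K k) y) \<partial>lebesgue)"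
        by (subst nn_integral_cmult) (auto simp: mult.assoc)
      also have "\<dots> = (\<integral>\<^sup>+y\<in>cell ?i x. ?G y \<partial>lebesgue)"
        using g[of _ x] by (intro nn_integral_cong) (auto simp: indicator_def mult_ac)
      finally show ?thesis .
    qed
  qed (simp_all add: cell_sub_Q0 sets_cell)
  also have "(\<integral>\<^sup>+x\<in>Q0. ?G x \<partial>lebesgue) = (\<integral>\<^sup>+x. ennreal C * ((ennreal (u x) * indicator Q0 x) * (g x * indicator (last_sel K k) x)) \<partial>lebesgue)"
    by (intro nn_integral_cong) (simp add: mult_ac)
  also have "\<dots> = ennreal C * (\<integral>\<^sup>+x. (ennreal (u x) * indicator Q0 x) * (g x * indicator (last_sel K k) x) \<partial>lebesgue)"
    by (rule nn_integral_cmult) measurable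
  also have "(\<integral>\<^sup>+x\<in>Q0. ?F x \<partial>lebesgue) = (\<integral>\<^sup>+x. (ennreal (u x) * indicator Q0 x) * (g x * indicator {x. sel K k x} x) \<partial>lebesgue)"
    by (intro nn_integral_cong) (simp add: mult_ac)
  finally show ?thesis .
qed

text \<open>Common form of the two applications of the sparse sum estimate (to \<open>w\<close> and to its dual \<open>v\<close>).\<close>
lemma sparse_sum_weight:
  fixes u :: "'a \<Rightarrow> real" and l :: "nat \<Rightarrow> 'a \<Rightarrow> real"
  assumes r: "r > 1" and [measurable]: "u \<in> borel_measurable lebesgue" and C: "C > 0"
    and fin: "(\<integral>\<^sup>+y\<in>Q0. ennreal (u y) \<partial>lebesgue) < top"
    and u: "\<And>E i x. E \<in> sets lebesgue \<Longrightarrow> emeasure lebesgue (cell i x - E) \<le> ennreal (vol i / 2) \<Longrightarrow>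
       (\<integral>\<^sup>+y\<in>cell i x. ennreal (u y) \<partial>lebesgue) \<le> ennreal C * (\<integral>\<^sup>+y\<in>cell i x \<inter> E. ennreal (u y) \<partial>lebesgue)"
    and l: "\<And>k. l k \<in> borel_measurable lebesgue" "\<And>k n x y. y \<in> cell (K + int n) x \<Longrightarrow> k \<le> n \<Longrightarrow> l k y = l k x"
      "\<And>k x. \<not> sel K k x \<Longrightarrow> l k x = 0" "\<And>k x. l k x \<ge> 0"
    and b: "\<And>k x. x \<in> Q0 \<Longrightarrow> l k x \<le> b k"
  shows "(\<integral>\<^sup>+x. (ennreal (u x) * indicator Q0 x) * epowr (\<Sum>k\<le>m. ennreal (l k x)) r \<partial>lebesgue)
    \<le> ennreal (sparse_const r C) * (\<Sum>k\<le>m. \<integral>\<^sup>+x. (ennreal (u x) * indicator Q0 x) * epowr (ennreal (l k x)) r \<partial>lebesgue)"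
proof -
  note l(1)[measurable]
  have [measurable]: "Q0 \<in> sets lebesgue" by (rule sets_cell)
  define M where "M = density lebesgue (\<lambda>x. ennreal (u x) * indicator Q0 x)"
  have ss [measurable]: "{x. sel K k x} \<in> sets lebesgue" for k
  proof -
    have "{x \<in> space lebesgue. sel K k x} \<in> sets lebesgue" by measurable
    then show ?thesis by simp
  qed
  have sm: "sets M = sets lebesgue" by (simp add: M_def)
  have mm: "borel_measurable M = (borel_measurable lebesgue :: ('a \<Rightarrow> ennreal) set)"
    by (rule measurable_cong_sets) (simp_all add: sm)
  have dens: "(\<integral>\<^sup>+x. g x \<partial>M) = (\<integral>\<^sup>+x. (ennreal (u x) * indicator Q0 x) * g x \<partial>lebesgue)"
    if "g \<in> borel_measurable lebesgue" for g
    unfolding M_def using that by (intro nn_integral_density) measurable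
  have [measurable]: "(\<lambda>x. epowr (\<Sum>i\<le>k. ennreal (l i x)) r) \<in> borel_measurable lebesgue" for k
    using r by (intro borel_measurable_epowr) auto
  have [measurable]: "(\<lambda>x. epowr (ennreal (l k x)) r) \<in> borel_measurable lebesgue" for k
    using r by (intro borel_measurable_epowr) auto
  have "(\<integral>\<^sup>+x. epowr (\<Sum>k\<le>m. ennreal (l k x)) r \<partial>M) \<le> ennreal (sparse_const r C) * (\<Sum>k\<le>m. \<integral>\<^sup>+x. epowr (ennreal (l k x)) r \<partial>M)"
  proof (rule nn_integral_sparse_sum_le[OF r C, where s="\<lambda>k. {x. sel K k x}" and E="last_sel K"])
    show "k = k'" if "x \<in> last_sel K k" "x \<in> last_sel K k'" for x k k' using that by (rule disjoint_last_sel)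
    show "(\<integral>\<^sup>+x\<in>{x. sel K k x}. epowr (\<Sum>i\<le>k. ennreal (l i x)) r \<partial>M) \<le> ennreal C * (\<integral>\<^sup>+x\<in>last_sel K k. epowr (\<Sum>i\<le>k. ennreal (l i x)) r \<partial>M)" for k
    proof (subst (1 2) dens)
      show "(\<integral>\<^sup>+x. (ennreal (u x) * indicator Q0 x) * (epowr (\<Sum>i\<le>k. ennreal (l i x)) r * indicator {x. sel K k x} x) \<partial>lebesgue)
        \<le> ennreal C * (\<integral>\<^sup>+x. (ennreal (u x) * indicator Q0 x) * (epowr (\<Sum>i\<le>k. ennreal (l i x)) r * indicator (last_sel K k) x) \<partial>lebesgue)"
      proof (rule sparse_transfer[OF _ _ u])
        fix x y assume y: "y \<in> cell (K + int k) x"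
        have "(\<Sum>i\<le>k. ennreal (l i y)) = (\<Sum>i\<le>k. ennreal (l i x))"
          using l(2)[OF y] by (intro sum.cong) auto
        then show "epowr (\<Sum>i\<le>k. ennreal (l i y)) r = epowr (\<Sum>i\<le>k. ennreal (l i x)) r" by simp
      qed auto
    qed measurable
    show "(\<integral>\<^sup>+x. epowr (\<Sum>k\<le>m. ennreal (l k x)) r \<partial>M) < top"
    proof (subst dens)
      show "(\<integral>\<^sup>+x. (ennreal (u x) * indicator Q0 x) * epowr (\<Sum>k\<le>m. ennreal (l k x)) r \<partial>lebesgue) < top"
        by (rule nn_integral_sum_powr_finite[where b=b]) (use r b fin in \<open>auto intro: ennreal_leI\<close>)
    qed measurable
  qed (use l(3) in \<open>auto simp: mm sm\<close>)
  then show ?thesis by (simp add: dens)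
qed


text \<open>Young's inequality for |f| w^(1/q) and G w^(-1/q). It holds almost everywhere because v
  is the dual power of w only there; negative values of G are sent to 0 by
  \<open>ennreal\<close>.\<close>

lemma dual_young:
  fixes G :: "'a \<Rightarrow> real"
  assumes "\<delta> > 0"
  shows "AE x in lebesgue. ennreal \<bar>f x\<bar> * ennreal (G x)
    \<le> ennreal (\<delta> powr (1 - q)) * (ennreal (\<bar>f x\<bar> powr q) * ennreal (w x)) + ennreal \<delta> * (ennreal (v x) * ennreal (G x powr (q / (q - 1))))"
  using w_v_ae
proof eventually_elim
  case (elim x)
  have W: "w x > 0" and V: "v x = w x powr (- 1 / (q - 1))" using elim by auto
  define g where "g = G x"
  have "ennreal \<bar>f x\<bar> * ennreal g
    \<le> ennreal (\<delta> powr (1 - q)) * (ennreal (\<bar>f x\<bar> powr q) * ennreal (w x)) + ennreal \<delta> * (ennreal (v x) * ennreal (g powr (q / (q - 1))))"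
  proof (cases "g \<ge> 0")
    case True
    define a where "a = \<bar>f x\<bar> * w x powr (1 / q)"
    define b where "b = (g * w x powr (- 1 / q)) powr (1 / (q - 1))"
    have b1: "b powr (q - 1) = g * w x powr (- 1 / q)"
      using q_gt_1 True by (simp add: b_def powr_powr)
    have aq: "a powr q = \<bar>f x\<bar> powr q * w x"
      using q_gt_1 W by (simp add: a_def powr_mult powr_powr)
    have bq: "b powr q = v x * g powr (q / (q - 1))"
      using q_gt_1 W True by (simp add: b_def powr_mult powr_powr V mult.commute)
    have ab: "a * b powr (q - 1) = \<bar>f x\<bar> * g"
      unfolding b1 a_def using W by (simp add: powr_minus_divide powr_add[symmetric] mult_ac)
    have "\<bar>f x\<bar> * g \<le> \<delta> powr (1 - q) * (\<bar>f x\<bar> powr q * w x) + \<delta> * (v x * g powr (q / (q - 1)))"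
      using powr_young[of a b \<delta> q] assms q_gt_1 unfolding ab aq bq by (simp add: a_def b_def)
    then have "ennreal (\<bar>f x\<bar> * g) \<le> ennreal (\<delta> powr (1 - q) * (\<bar>f x\<bar> powr q * w x) + \<delta> * (v x * g powr (q / (q - 1))))"
      by (rule ennreal_leI)
    then show ?thesis using assms W True v_nonneg[of x] by (simp add: ennreal_mult ennreal_plus)
  qed (simp add: ennreal_neg)
  then show ?case by (simp only: g_def)
qed

text \<open>The Carleson sum of avg(R)^q w(R) over the selected cells R inside \<open>Q0\<close> at
  the levels from K to K + m.\<close>

definition Xs :: ennreal where
  "Xs = (\<Sum>k\<le>m. \<integral>\<^sup>+x\<in>Q0. ennreal (lam k x powr q) * ennreal (w x) \<partial>lebesgue)"

lemma lam_bound: "x \<in> Q0 \<Longrightarrow> lam k x \<le> 2 ^ (DIM('a) * k) * avg K x0"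
  unfolding lam_def using avg_le_Q0[of x k] avg_nonneg[of K x0] by simp

lemma mu_bound: assumes "x \<in> Q0"
  shows "mu k x \<le> (2 ^ (DIM('a) * k) * avg K x0) powr (q - 1) * (wm K x0 / vol (K + int k))"
proof -
  have "avg (K + int k) x powr (q - 1) * (wm (K + int k) x / vol (K + int k))
     \<le> (2 ^ (DIM('a) * k) * avg K x0) powr (q - 1) * (wm K x0 / vol (K + int k))"
    using q_gt_1 avg_nonneg avg_le_Q0[OF assms] wm_le_Q0[OF assms, of k] wm(2) vol_pos[of "K + int k"]
    by (intro mult_mono powr_mono2 divide_right_mono) (auto intro: divide_nonneg_pos less_imp_le)
  moreover have "0 \<le> (2 ^ (DIM('a) * k) * avg K x0) powr (q - 1) * (wm K x0 / vol (K + int k))"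
    using wm(2)[of K x0] vol_pos[of "K + int k"] by (intro mult_nonneg_nonneg) auto
  ultimately show ?thesis unfolding mu_def by simp
qed

text \<open>A crude bound depending on m is enough: it only legitimates the absorption in
  \<open>carleson_embedding\<close>.\<close>

lemma Xs_finite: "Xs < top"
proof -
  have "(\<integral>\<^sup>+x\<in>Q0. ennreal (lam k x powr q) * ennreal (w x) \<partial>lebesgue) < top" for k
  proof -
    let ?b = "2 ^ (DIM('a) * k) * avg K x0"
    have [measurable]: "Q0 \<in> sets lebesgue" by (rule sets_cell)
    have "(\<integral>\<^sup>+x\<in>Q0. ennreal (lam k x powr q) * ennreal (w x) \<partial>lebesgue)
       \<le> (\<integral>\<^sup>+x. ennreal (?b powr q) * (ennreal (w x) * indicator Q0 x) \<partial>lebesgue)"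
    proof (rule nn_integral_mono)
      fix x
      show "ennreal (lam k x powr q) * ennreal (w x) * indicator Q0 x \<le> ennreal (?b powr q) * (ennreal (w x) * indicator Q0 x)"
        using lam_bound[of x k] lam_nonneg[of k x] q_gt_1
        by (cases "x \<in> Q0") (auto intro!: mult_right_mono ennreal_leI powr_mono2)
    qed
    also have "\<dots> = ennreal (?b powr q) * (\<integral>\<^sup>+x\<in>Q0. ennreal (w x) \<partial>lebesgue)"
      by (rule nn_integral_cmult) measurable
    also have "\<dots> < top" using w_finite[of K x0] by (simp add: ennreal_mult_less_top)
    finally show ?thesis .
  qed
  then show ?thesis unfolding Xs_def by (simp add: less_top)
qed

lemma cell_constant_nn_integral:
  fixes c :: ennreal
  assumes [measurable]: "u \<in> borel_measurable lebesgue"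
    and "\<And>y. y \<in> cell i x \<Longrightarrow> g y = c * u y"
  shows "(\<integral>\<^sup>+y\<in>cell i x. g y \<partial>lebesgue) = c * (\<integral>\<^sup>+y\<in>cell i x. u y \<partial>lebesgue)"
proof -
  have [measurable]: "cell i x \<in> sets lebesgue" by (rule sets_cell)
  have "(\<integral>\<^sup>+y\<in>cell i x. g y \<partial>lebesgue) = (\<integral>\<^sup>+y. c * (u y * indicator (cell i x) y) \<partial>lebesgue)"
    using assms(2) by (intro nn_integral_cong) (auto simp: indicator_def)
  also have "\<dots> = c * (\<integral>\<^sup>+y\<in>cell i x. u y \<partial>lebesgue)" by (rule nn_integral_cmult) measurable
  finally show ?thesis .
qed

lemma lam_eq_mu: "(\<integral>\<^sup>+x\<in>Q0. ennreal (lam k x powr q) * ennreal (w x) \<partial>lebesgue)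
    \<le> (\<integral>\<^sup>+x\<in>Q0. ennreal \<bar>f x\<bar> * ennreal (mu k x) \<partial>lebesgue)"
proof (rule nn_integral_partition_mono[where P="cell (K + int k)", OF cell_partition])
  fix x
  let ?i = "K + int k"
  have V: "vol ?i > 0" by (rule vol_pos)
  have "(\<integral>\<^sup>+y\<in>cell ?i x. ennreal (lam k y powr q) * ennreal (w y) \<partial>lebesgue) = ennreal (lam k x powr q) * ennreal (wm ?i x)"
    unfolding wm(1)[symmetric] by (rule cell_constant_nn_integral) (simp_all add: lam_cell[of _ k x k])
  also have "\<dots> = ennreal (mu k x) * ennreal (avg ?i x * vol ?i)"
  proof -
    have "avg ?i x powr q = avg ?i x powr (q - 1) * avg ?i x"
      using avg_nonneg[of ?i x] by (cases "avg ?i x = 0") (auto simp: powr_diff)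
    then have "lam k x powr q * wm ?i x = mu k x * (avg ?i x * vol ?i)"
      using V by (simp add: lam_def mu_def)
    then have "ennreal (lam k x powr q * wm ?i x) = ennreal (mu k x * (avg ?i x * vol ?i))" by simp
    then show ?thesis using wm(2)[of ?i x] mu_nonneg[of k x] avg_nonneg[of ?i x] V by (simp add: ennreal_mult)
  qed
  also have "\<dots> = (\<integral>\<^sup>+y\<in>cell ?i x. ennreal \<bar>f y\<bar> * ennreal (mu k y) \<partial>lebesgue)"
    unfolding nn_integral_avg[symmetric] by (rule cell_constant_nn_integral[symmetric]) (simp_all add: mu_cell[of _ k x k] mult.commute)
  finally show "(\<integral>\<^sup>+y\<in>cell ?i x. ennreal (lam k y powr q) * ennreal (w y) \<partial>lebesgue)
     \<le> (\<integral>\<^sup>+y\<in>cell ?i x. ennreal \<bar>f y\<bar> * ennreal (mu k y) \<partial>lebesgue)" by simp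
qed (simp_all add: cell_sub_Q0 sets_cell)

text \<open>On a selected cell both sides are multiples of avg^q, and \<open>wm_vm\<close> compares
  the factors.\<close>

lemma mu_le_lam: "(\<integral>\<^sup>+x\<in>Q0. ennreal (mu k x powr (q / (q - 1))) * ennreal (v x) \<partial>lebesgue)
    \<le> (\<integral>\<^sup>+x\<in>Q0. ennreal Cd * (ennreal (lam k x powr q) * ennreal (w x)) \<partial>lebesgue)"
proof (rule nn_integral_partition_mono[where P="cell (K + int k)", OF cell_partition])
  fix x
  let ?i = "K + int k"
  have Cd: "Cd \<ge> 0" by (simp add: Cd_def)
  have "(\<integral>\<^sup>+y\<in>cell ?i x. ennreal (mu k y powr (q / (q - 1))) * ennreal (v y) \<partial>lebesgue) = ennreal (mu k x powr (q / (q - 1))) * ennreal (vm ?i x)"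
    unfolding vm(1)[symmetric] by (rule cell_constant_nn_integral) (simp_all add: mu_cell[of _ k x k])
  also have "\<dots> \<le> ennreal Cd * ennreal (lam k x powr q) * ennreal (wm ?i x)"
  proof -
    have "mu k x powr (q / (q - 1)) * vm ?i x \<le> Cd * lam k x powr q * wm ?i x"
    proof (cases "sel K k x")
      case True
      have "(avg ?i x powr (q - 1)) powr (q / (q - 1)) = avg ?i x powr q"
        using q_gt_1 by (simp add: powr_powr)
      moreover have "mu k x powr (q / (q - 1)) = (avg ?i x powr (q - 1)) powr (q / (q - 1)) * (wm ?i x / vol ?i) powr (q / (q - 1))"
      proof -
        have "mu k x = avg ?i x powr (q - 1) * (wm ?i x / vol ?i)" using True by (simp add: mu_def)
        moreover have "wm ?i x / vol ?i \<ge> 0" using wm(2)[of ?i x] vol_pos[of ?i] by simp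
        ultimately show ?thesis by (simp only: powr_mult powr_ge_zero)
      qed
      ultimately have "mu k x powr (q / (q - 1)) * vm ?i x = avg ?i x powr q * ((wm ?i x / vol ?i) powr (q / (q - 1)) * vm ?i x)"
        by (simp only: mult.assoc)
      also have "\<dots> \<le> avg ?i x powr q * (Cd * wm ?i x)" by (intro mult_left_mono wm_vm) auto
      finally show ?thesis using True by (simp add: lam_def mult_ac)
    qed (simp add: mu_def lam_def)
    then have "ennreal (mu k x powr (q / (q - 1)) * vm ?i x) \<le> ennreal (Cd * lam k x powr q * wm ?i x)" by (rule ennreal_leI)
    then show ?thesis using Cd wm(2)[of ?i x] vm(2)[of ?i x] by (simp add: ennreal_mult)
  qed
  also have "\<dots> = (\<integral>\<^sup>+y\<in>cell ?i x. ennreal Cd * (ennreal (lam k y powr q) * ennreal (w y)) \<partial>lebesgue)"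
    unfolding wm(1)[symmetric] by (rule cell_constant_nn_integral[symmetric]) (simp_all add: lam_cell[of _ k x k] mult.assoc)
  finally show "(\<integral>\<^sup>+y\<in>cell ?i x. ennreal (mu k y powr (q / (q - 1))) * ennreal (v y) \<partial>lebesgue)
     \<le> (\<integral>\<^sup>+y\<in>cell ?i x. ennreal Cd * (ennreal (lam k y powr q) * ennreal (w y)) \<partial>lebesgue)" .
qed (simp_all add: cell_sub_Q0 sets_cell)

end

definition q' :: real where "q' = q / (q - 1)"
text \<open>Equal to 2 \<open>\<delta>\<close>^(1 - q) for the value of \<open>\<delta>\<close> that
  makes the absorbed part of the Carleson sum one half.\<close>

definition Ccar :: real where
  "Ccar = 2 * (1 / (2 * (sparse_const q' Cs * Cd))) powr (1 - q)"
definition Cfin :: real where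
  "Cfin = thr powr (q / 2) * (sparse_const q Cs * Ccar)"

lemma const_pos: "q' > 1" "Cd > 0" "Ccar > 0" "Cfin > 0" "sparse_const q' Cs > 0" "sparse_const q Cs > 0"
proof -
  show "q' > 1" using q_gt_1 by (simp add: q'_def)
  then show "sparse_const q' Cs > 0" by (rule sparse_const_pos[OF _ Cs_pos])
  then have s: "sparse_const q' Cs > 0" .
  show sq: "sparse_const q Cs > 0" by (rule sparse_const_pos[OF q_gt_1 Cs_pos])
  show Cd: "Cd > 0" using Cw_pos by (simp add: Cd_def)
  show C: "Ccar > 0" using s Cd by (simp add: Ccar_def)
  show "Cfin > 0" using C sq thr_ge_1 by (simp add: Cfin_def)
qed

context
  fixes K :: int and x0 :: 'a and m :: nat
begin

text \<open>The Carleson sum is at most the integral of |f| against the sum of all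
  \<open>mu k\<close>. Young's inequality splits this into the weighted norm of f and a small
  multiple of the dual norm; the sparse sum estimate for v and \<open>mu_le_lam\<close> return the
  latter to the Carleson sum.\<close>

lemma carleson_embedding:
  "Xs K x0 m \<le> ennreal Ccar * (\<integral>\<^sup>+x\<in>cell K x0. ennreal (\<bar>f x\<bar> powr q) * ennreal (w x) \<partial>lebesgue)"
proof -
  let ?Q = "cell K x0" and ?mu = "\<lambda>k. mu K k" and ?lam = "\<lambda>k. lam K k"
  let ?X = "Xs K x0 m"
  let ?S = "sparse_const q' Cs"
  define I where "I = (\<integral>\<^sup>+x\<in>?Q. ennreal (\<bar>f x\<bar> powr q) * ennreal (w x) \<partial>lebesgue)"
  define \<delta> where "\<delta> = 1 / (2 * (?S * Cd))"
  have \<delta>: "\<delta> > 0" using const_pos by (simp add: \<delta>_def)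
  have q': "q' > 1" by (rule const_pos)
  have [measurable]: "?Q \<in> sets lebesgue" by (rule sets_cell)
  define G where "G x = (\<Sum>k\<le>m. ?mu k x)" for x
  have G0: "G x \<ge> 0" for x unfolding G_def by (intro sum_nonneg mu_nonneg)
  have [measurable]: "G \<in> borel_measurable lebesgue" unfolding G_def by measurable
  have G_sum: "ennreal (G x) = (\<Sum>k\<le>m. ennreal (?mu k x))" for x
    unfolding G_def by (rule sum_ennreal[symmetric]) (rule mu_nonneg)
  have Geq: "ennreal (G x powr q') = epowr (\<Sum>k\<le>m. ennreal (?mu k x)) q'" for x
    using q' G0[of x] unfolding G_sum[symmetric] by (simp add: epowr_ennreal)
  have "?X \<le> (\<Sum>k\<le>m. \<integral>\<^sup>+x\<in>?Q. ennreal \<bar>f x\<bar> * ennreal (?mu k x) \<partial>lebesgue)"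
    unfolding Xs_def by (intro sum_mono lam_eq_mu)
  also have "\<dots> = (\<integral>\<^sup>+x. (\<Sum>k\<le>m. ennreal \<bar>f x\<bar> * ennreal (?mu k x) * indicator ?Q x) \<partial>lebesgue)"
    by (rule nn_integral_sum[symmetric]) measurable
  also have "\<dots> = (\<integral>\<^sup>+x. (ennreal \<bar>f x\<bar> * ennreal (G x)) * indicator ?Q x \<partial>lebesgue)"
    by (simp only: G_sum sum_distrib_left sum_distrib_right)
  also have "\<dots> \<le> (\<integral>\<^sup>+x. ennreal (\<delta> powr (1 - q)) * (ennreal (\<bar>f x\<bar> powr q) * ennreal (w x) * indicator ?Q x)
      + ennreal \<delta> * ((ennreal (v x) * indicator ?Q x) * ennreal (G x powr q')) \<partial>lebesgue)"
  proof (rule nn_integral_mono_AE)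
    have young: "AE x in lebesgue. ennreal \<bar>f x\<bar> * ennreal (G x)
      \<le> ennreal (\<delta> powr (1 - q)) * (ennreal (\<bar>f x\<bar> powr q) * ennreal (w x)) + ennreal \<delta> * (ennreal (v x) * ennreal (G x powr q'))"
      unfolding q'_def by (rule dual_young[OF \<delta>])
    then show "AE x in lebesgue. ennreal \<bar>f x\<bar> * ennreal (G x) * indicator ?Q x
      \<le> ennreal (\<delta> powr (1 - q)) * (ennreal (\<bar>f x\<bar> powr q) * ennreal (w x) * indicator ?Q x)
      + ennreal \<delta> * ((ennreal (v x) * indicator ?Q x) * ennreal (G x powr q'))"
    proof eventually_elim
      case (elim x)
      then show ?case by (cases "x \<in> ?Q") auto
    qed
  qed
  also have "\<dots> = ennreal (\<delta> powr (1 - q)) * I + ennreal \<delta> * (\<integral>\<^sup>+x. (ennreal (v x) * indicator ?Q x) * ennreal (G x powr q') \<partial>lebesgue)"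
    unfolding I_def by (subst nn_integral_add) (auto simp: nn_integral_cmult)
  also have "(\<integral>\<^sup>+x. (ennreal (v x) * indicator ?Q x) * ennreal (G x powr q') \<partial>lebesgue) \<le> ennreal (?S * Cd) * ?X"
  proof -
    have "(\<integral>\<^sup>+x. (ennreal (v x) * indicator ?Q x) * ennreal (G x powr q') \<partial>lebesgue)
      \<le> ennreal ?S * (\<Sum>k\<le>m. \<integral>\<^sup>+x. (ennreal (v x) * indicator ?Q x) * epowr (ennreal (?mu k x)) q' \<partial>lebesgue)"
      unfolding Geq
      \<comment> \<open>The pointwise bounds may grow with k: they guarantee finiteness and do not
        enter the constant.\<close>
      by (rule sparse_sum_weight[OF q' v_measurable Cs_pos v_finite v_sparse, where b="\<lambda>k. (2 ^ (DIM('a) * k) * avg K x0) powr (q - 1) * (wm K x0 / vol (K + int k))"])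
        (rule mu_measurable mu_cell mu_nonneg mu_bound | assumption | simp add: mu_def)+
    also have "\<dots> \<le> ennreal ?S * (\<Sum>k\<le>m. ennreal Cd * (\<integral>\<^sup>+x\<in>?Q. ennreal (?lam k x powr q) * ennreal (w x) \<partial>lebesgue))"
    proof (intro mult_left_mono sum_mono)
      fix k
      have "(\<integral>\<^sup>+x. (ennreal (v x) * indicator ?Q x) * epowr (ennreal (?mu k x)) q' \<partial>lebesgue)
        = (\<integral>\<^sup>+x\<in>?Q. ennreal (?mu k x powr q') * ennreal (v x) \<partial>lebesgue)"
        using q' by (intro nn_integral_cong) (simp add: epowr_ennreal mu_nonneg mult_ac)
      also have "\<dots> \<le> (\<integral>\<^sup>+x\<in>?Q. ennreal Cd * (ennreal (?lam k x powr q) * ennreal (w x)) \<partial>lebesgue)"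
        unfolding q'_def by (rule mu_le_lam)
      also have "\<dots> = ennreal Cd * (\<integral>\<^sup>+x\<in>?Q. ennreal (?lam k x powr q) * ennreal (w x) \<partial>lebesgue)"
        by (subst nn_integral_cmult[symmetric]) (auto simp: mult.assoc)
      finally show "(\<integral>\<^sup>+x. (ennreal (v x) * indicator ?Q x) * epowr (ennreal (?mu k x)) q' \<partial>lebesgue) \<le> \<dots>" .
    qed simp
    also have "\<dots> = ennreal (?S * Cd) * ?X"
      using const_pos unfolding Xs_def by (simp add: ennreal_mult sum_distrib_left mult.assoc)
    finally show ?thesis .
  qed
  finally have "?X \<le> ennreal (\<delta> powr (1 - q)) * I + ennreal \<delta> * (ennreal (?S * Cd) * ?X)"
    by (simp add: add_left_mono mult_left_mono)
  also have "ennreal \<delta> * (ennreal (?S * Cd) * ?X) = ennreal (1/2) * ?X"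
  proof -
    have "ennreal \<delta> * (ennreal (?S * Cd) * ?X) = ennreal (\<delta> * (?S * Cd)) * ?X"
      using \<delta> const_pos by (simp add: ennreal_mult' mult.assoc)
    also have "\<delta> * (?S * Cd) = 1/2" using const_pos by (simp add: \<delta>_def)
    finally show ?thesis .
  qed
  finally have "?X \<le> 2 * (ennreal (\<delta> powr (1 - q)) * I)"
    by (rule ennreal_absorb_half[OF Xs_finite])
  also have "\<dots> = ennreal Ccar * I"
    unfolding Ccar_def \<delta>_def[symmetric] by (simp add: ennreal_mult mult.assoc)
  finally show ?thesis unfolding I_def .
qed

text \<open>After sparse domination the sum of the squares of \<open>lam\<close> is bounded by the
  square of their sum, so that the sparse sum estimate applies with exponent q and weight w, for all
  q > 1 at once.\<close>

lemma local_square_function_bound: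
  "(\<integral>\<^sup>+x\<in>cell K x0. epowr (ennreal (\<Sum>k\<le>m. (coef (K + int k) x)\<^sup>2)) (q / 2) * ennreal (w x) \<partial>lebesgue)
    \<le> ennreal Cfin * (\<integral>\<^sup>+x\<in>cell K x0. ennreal (\<bar>f x\<bar> powr q) * ennreal (w x) \<partial>lebesgue)"
proof -
  let ?Q = "cell K x0" and ?lam = "\<lambda>k. lam K k"
  have [measurable]: "?Q \<in> sets lebesgue" by (rule sets_cell)
  have q2: "q / 2 > 0" and q0: "q > 0" using q_gt_1 by auto
  have [measurable]: "(\<lambda>x. epowr (\<Sum>k\<le>m. ennreal (?lam k x)) q) \<in> borel_measurable lebesgue"
    using q0 by (intro borel_measurable_epowr) auto
  have pw: "epowr (ennreal (\<Sum>k\<le>m. (coef (K + int k) x)\<^sup>2)) (q / 2) \<le> ennreal (thr powr (q / 2)) * epowr (\<Sum>k\<le>m. ennreal (?lam k x)) q" for x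
  proof -
    let ?L = "\<Sum>k\<le>m. ?lam k x"
    have L: "?L \<ge> 0" by (intro sum_nonneg lam_nonneg)
    have "(\<Sum>k\<le>m. (?lam k x)\<^sup>2) \<le> ?L\<^sup>2"
    proof -
      have "(\<Sum>k\<le>m. (?lam k x)\<^sup>2) \<le> (\<Sum>k\<le>m. ?lam k x * ?L)"
        unfolding power2_eq_square by (intro sum_mono mult_left_mono member_le_sum lam_nonneg) auto
      then show ?thesis by (simp add: sum_distrib_right power2_eq_square)
    qed
    then have "thr * (\<Sum>k\<le>m. (?lam k x)\<^sup>2) \<le> thr * ?L\<^sup>2" using thr_ge_1 by (intro mult_left_mono) auto
    moreover have "(\<Sum>k\<le>m. (?lam k x)\<^sup>2) = (\<Sum>k\<le>m. if sel K k x then (avg (K + int k) x)\<^sup>2 else 0)"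
      by (intro sum.cong) (auto simp: lam_def)
    ultimately have "(\<Sum>k\<le>m. (coef (K + int k) x)\<^sup>2) \<le> thr * ?L\<^sup>2"
      using pointwise_sparse_domination[of K x m] by (simp only:)
    then have "epowr (ennreal (\<Sum>k\<le>m. (coef (K + int k) x)\<^sup>2)) (q / 2) \<le> epowr (ennreal (thr * ?L\<^sup>2)) (q / 2)"
      by (intro epowr_mono q2 ennreal_leI)
    also have "\<dots> = ennreal (thr powr (q / 2)) * epowr (epowr (ennreal ?L) 2) (q / 2)"
      using thr_ge_1 q2 L by (simp add: epowr_mult epowr_ennreal ennreal_mult)
    also have "epowr (epowr (ennreal ?L) 2) (q / 2) = epowr (ennreal ?L) q"
      using q2 by (subst epowr_epowr) auto
    also have "ennreal ?L = (\<Sum>k\<le>m. ennreal (?lam k x))" by (simp add: sum_ennreal lam_nonneg)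
    finally show ?thesis .
  qed
  have "(\<integral>\<^sup>+x\<in>?Q. epowr (ennreal (\<Sum>k\<le>m. (coef (K + int k) x)\<^sup>2)) (q / 2) * ennreal (w x) \<partial>lebesgue)
     \<le> (\<integral>\<^sup>+x. ennreal (thr powr (q / 2)) * ((ennreal (w x) * indicator ?Q x) * epowr (\<Sum>k\<le>m. ennreal (?lam k x)) q) \<partial>lebesgue)"
  proof (rule nn_integral_mono)
    fix x
    show "epowr (ennreal (\<Sum>k\<le>m. (coef (K + int k) x)\<^sup>2)) (q / 2) * ennreal (w x) * indicator ?Q x
      \<le> ennreal (thr powr (q / 2)) * ((ennreal (w x) * indicator ?Q x) * epowr (\<Sum>k\<le>m. ennreal (?lam k x)) q)"
      using mult_right_mono[OF pw[of x], of "ennreal (w x) * indicator ?Q x"] by (simp add: mult_ac)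
  qed
  also have "\<dots> = ennreal (thr powr (q / 2)) * (\<integral>\<^sup>+x. (ennreal (w x) * indicator ?Q x) * epowr (\<Sum>k\<le>m. ennreal (?lam k x)) q \<partial>lebesgue)"
    by (rule nn_integral_cmult) measurable
  also have "(\<integral>\<^sup>+x. (ennreal (w x) * indicator ?Q x) * epowr (\<Sum>k\<le>m. ennreal (?lam k x)) q \<partial>lebesgue)
     \<le> ennreal (sparse_const q Cs) * (\<Sum>k\<le>m. \<integral>\<^sup>+x. (ennreal (w x) * indicator ?Q x) * epowr (ennreal (?lam k x)) q \<partial>lebesgue)"
    by (rule sparse_sum_weight[OF q_gt_1 w_measurable Cs_pos w_finite w_sparse, where b="\<lambda>k. 2 ^ (DIM('a) * k) * avg K x0"])
      (rule lam_measurable lam_cell lam_nonneg lam_bound | assumption | simp add: lam_def)+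
  also have "(\<Sum>k\<le>m. \<integral>\<^sup>+x. (ennreal (w x) * indicator ?Q x) * epowr (ennreal (?lam k x)) q \<partial>lebesgue) = Xs K x0 m"
    unfolding Xs_def using q0 by (intro sum.cong nn_integral_cong) (auto simp: epowr_ennreal lam_nonneg mult_ac)
  also note carleson_embedding
  finally show ?thesis
    using const_pos unfolding Cfin_def by (simp add: ennreal_mult mult.assoc mult_left_mono)
qed

end

end

section \<open>From finitely many levels below one cell to all levels on the whole space\<close>

lemma epowr_SUP_le:
  assumes "a > 0"
  shows "epowr (SUP i\<in>I. y i) a \<le> (SUP i\<in>I. epowr (y i) a)"
proof -
  have "y i \<le> epowr (SUP i\<in>I. epowr (y i) a) (1 / a)" if "i \<in> I" for i
    using assms SUP_upper[OF that, of "\<lambda>i. epowr (y i) a"] by (simp add: epowr_inverse_le_iff)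
  then have "(SUP i\<in>I. y i) \<le> epowr (SUP i\<in>I. epowr (y i) a) (1 / a)" by (rule SUP_least)
  then show ?thesis using assms by (simp add: epowr_inverse_le_iff)
qed

text \<open>Exhaustion by the intervals from -N to N, listed as 2 N + 1 consecutive levels starting
  at -N to match the indexing of the local bound.\<close>

lemma nn_integral_int_le_SUP:
  fixes g :: "int \<Rightarrow> ennreal"
  shows "(\<integral>\<^sup>+k. g k \<partial>count_space UNIV) \<le> (SUP N. \<Sum>k\<le>2 * N. g (- int N + int k))"
proof -
  have "(\<integral>\<^sup>+k. g k \<partial>count_space UNIV) = (\<integral>\<^sup>+k. (SUP N. g k * indicator {- int N..int N} k) \<partial>count_space UNIV)"
  proof (rule nn_integral_cong)
    fix k
    have "(SUP N. g k * indicator {- int N..int N} k) = g k"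
    proof (rule antisym)
      show "(SUP N. g k * indicator {- int N..int N} k) \<le> g k" by (rule SUP_least) (auto simp: indicator_def)
      have "g k = g k * indicator {- int (nat \<bar>k\<bar>)..int (nat \<bar>k\<bar>)} k" by (auto simp: indicator_def)
      also have "\<dots> \<le> (SUP N. g k * indicator {- int N..int N} k)" by (rule SUP_upper) simp
      finally show "g k \<le> (SUP N. g k * indicator {- int N..int N} k)" .
    qed
    then show "g k = (SUP N. g k * indicator {- int N..int N} k)" by simp
  qed
  also have "\<dots> = (SUP N. \<integral>\<^sup>+k. g k * indicator {- int N..int N} k \<partial>count_space UNIV)"
    by (rule nn_integral_monotone_convergence_SUP)
       (auto simp: incseq_def le_fun_def indicator_def)
  also have "\<dots> = (SUP N. \<Sum>k\<le>2 * N. g (- int N + int k))"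
  proof (rule SUP_cong[OF refl])
    fix N
    have "(\<integral>\<^sup>+k. g k * indicator {- int N..int N} k \<partial>count_space UNIV) = (\<Sum>k\<in>{- int N..int N}. g k * indicator {- int N..int N} k)"
      by (rule nn_integral_count_space') auto
    also have "\<dots> = (\<Sum>k\<in>{- int N..int N}. g k)" by (intro sum.cong) auto
    also have "\<dots> = (\<Sum>k\<le>2 * N. g (- int N + int k))"
      by (rule sum.reindex_bij_witness[of _ "\<lambda>k. - int N + int k" "\<lambda>k. nat (k + int N)"]) auto
    finally show "(\<integral>\<^sup>+k. g k * indicator {- int N..int N} k \<partial>count_space UNIV) = (\<Sum>k\<le>2 * N. g (- int N + int k))" .
  qed
  finally show ?thesis by simp
qed

context weighted_test
begin

text \<open>For fixed N the cells of the coarsest level -N tile the space, and the local bounds add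
  up with the same constant. Monotone convergence then lets N tend to infinity.\<close>

theorem square_function_bound:
  "(\<integral>\<^sup>+x. epowr (\<integral>\<^sup>+k. ennreal ((coef k x)\<^sup>2) \<partial>count_space UNIV) (q / 2) * ennreal (w x) \<partial>lebesgue)
    \<le> ennreal Cfin * (\<integral>\<^sup>+x. ennreal (\<bar>f x\<bar> powr q) * ennreal (w x) \<partial>lebesgue)"
proof -
  have q2: "q / 2 > 0" using q_gt_1 by simp
  define T where "T N x = epowr (ennreal (\<Sum>k\<le>2 * N. (coef (- int N + int k) x)\<^sup>2)) (q / 2)" for N x
  have [measurable]: "T N \<in> borel_measurable lebesgue" for N
    unfolding T_def using q2 by (intro borel_measurable_epowr) auto
  have T_le: "(\<integral>\<^sup>+x. T N x * ennreal (w x) \<partial>lebesgue) \<le> ennreal Cfin * (\<integral>\<^sup>+x. ennreal (\<bar>f x\<bar> powr q) * ennreal (w x) \<partial>lebesgue)" for N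
  proof -
    let ?G = "\<lambda>x. ennreal Cfin * (ennreal (\<bar>f x\<bar> powr q) * ennreal (w x))"
    have "(\<integral>\<^sup>+x\<in>UNIV. T N x * ennreal (w x) \<partial>lebesgue) \<le> (\<integral>\<^sup>+x\<in>UNIV. ?G x \<partial>lebesgue)"
    proof (rule nn_integral_partition_mono[where P="cell (- int N)", OF cell_partition])
      fix x
      have [measurable]: "cell (- int N) x \<in> sets lebesgue" by (rule sets_cell)
      have "(\<integral>\<^sup>+y\<in>cell (- int N) x. T N y * ennreal (w y) \<partial>lebesgue) \<le> ennreal Cfin * (\<integral>\<^sup>+y\<in>cell (- int N) x. ennreal (\<bar>f y\<bar> powr q) * ennreal (w y) \<partial>lebesgue)"
        unfolding T_def by (rule local_square_function_bound)
      also have "\<dots> = (\<integral>\<^sup>+y\<in>cell (- int N) x. ?G y \<partial>lebesgue)"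
        by (subst nn_integral_cmult[symmetric]) (auto simp: mult.assoc)
      finally show "(\<integral>\<^sup>+y\<in>cell (- int N) x. T N y * ennreal (w y) \<partial>lebesgue) \<le> (\<integral>\<^sup>+y\<in>cell (- int N) x. ?G y \<partial>lebesgue)" .
    qed auto
    then show ?thesis by (simp add: nn_integral_cmult)
  qed
  have inc: "incseq (\<lambda>N. \<Sum>k\<le>2 * N. (coef (- int N + int k) x)\<^sup>2)" for x
  proof -
    have eq: "(\<Sum>k\<le>2 * N. (coef (- int N + int k) x)\<^sup>2) = (\<Sum>k\<in>{- int N..int N}. (coef k x)\<^sup>2)" for N
      by (rule sum.reindex_bij_witness[of _ "\<lambda>k. nat (k + int N)" "\<lambda>k. - int N + int k"]) auto
    show ?thesis unfolding eq incseq_def by (intro allI impI sum_mono2) auto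
  qed
  have "(\<integral>\<^sup>+x. epowr (\<integral>\<^sup>+k. ennreal ((coef k x)\<^sup>2) \<partial>count_space UNIV) (q / 2) * ennreal (w x) \<partial>lebesgue)
     \<le> (\<integral>\<^sup>+x. (SUP N. T N x * ennreal (w x)) \<partial>lebesgue)"
  proof (rule nn_integral_mono)
    fix x
    have "epowr (\<integral>\<^sup>+k. ennreal ((coef k x)\<^sup>2) \<partial>count_space UNIV) (q / 2) \<le> epowr (SUP N. \<Sum>k\<le>2 * N. ennreal ((coef (- int N + int k) x)\<^sup>2)) (q / 2)"
      by (intro epowr_mono q2 nn_integral_int_le_SUP)
    also have "\<dots> \<le> (SUP N. T N x)"
      unfolding T_def using epowr_SUP_le[OF q2, of "\<lambda>N. \<Sum>k\<le>2 * N. ennreal ((coef (- int N + int k) x)\<^sup>2)" UNIV]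
      by (simp add: sum_ennreal)
    finally have "epowr (\<integral>\<^sup>+k. ennreal ((coef k x)\<^sup>2) \<partial>count_space UNIV) (q / 2) * ennreal (w x) \<le> (SUP N. T N x) * ennreal (w x)"
      by (rule mult_right_mono) simp
    then show "epowr (\<integral>\<^sup>+k. ennreal ((coef k x)\<^sup>2) \<partial>count_space UNIV) (q / 2) * ennreal (w x) \<le> (SUP N. T N x * ennreal (w x))"
      unfolding SUP_mult_right_ennreal .
  qed
  also have "\<dots> = (SUP N. \<integral>\<^sup>+x. T N x * ennreal (w x) \<partial>lebesgue)"
  proof (rule nn_integral_monotone_convergence_SUP)
    show "incseq (\<lambda>N x. T N x * ennreal (w x))"
      unfolding incseq_def le_fun_def T_def using inc q2
      by (auto intro!: mult_right_mono epowr_mono ennreal_leI simp: incseq_def)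
  qed measurable
  also have "\<dots> \<le> ennreal Cfin * (\<integral>\<^sup>+x. ennreal (\<bar>f x\<bar> powr q) * ennreal (w x) \<partial>lebesgue)"
    by (intro SUP_least T_le)
  finally show ?thesis .
qed

end

text \<open>\<open>Cfin\<close> lives in a locale fixing f and e, although its value does not
  involve them. An arbitrary instance \<open>t0\<close> provides the constant before f and e are
  quantified; if there is no instance, any constant will do.\<close>

lemma (in weighted_cells) square_function_bound_uniform:
  "\<exists>C>0. \<forall>f e. dyadic_test cell f e \<beta> \<longrightarrow>
    (\<integral>\<^sup>+x. epowr (\<integral>\<^sup>+k. ennreal ((dyadic_test.coef cell f e k x)\<^sup>2) \<partial>count_space UNIV) (q / 2) * ennreal (w x) \<partial>lebesgue)
    \<le> ennreal C * (\<integral>\<^sup>+x. ennreal (\<bar>f x\<bar> powr q) * ennreal (w x) \<partial>lebesgue)"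
proof (cases "\<exists>f e. dyadic_test cell f e \<beta>")
  case True
  then obtain f0 e0 where "dyadic_test cell f0 e0 \<beta>" by blast
  then interpret t0: weighted_test cell f0 e0 \<beta> w v q Cw
    by (intro weighted_test.intro weighted_cells_axioms)
  show ?thesis
  proof (intro exI[of _ t0.Cfin] conjI allI impI)
    show "t0.Cfin > 0" by (rule t0.const_pos)
    fix f e assume "dyadic_test cell f e \<beta>"
    then interpret t: weighted_test cell f e \<beta> w v q Cw
      by (intro weighted_test.intro weighted_cells_axioms)
    show "(\<integral>\<^sup>+x. epowr (\<integral>\<^sup>+k. ennreal ((t.coef k x)\<^sup>2) \<partial>count_space UNIV) (q / 2) * ennreal (w x) \<partial>lebesgue)
      \<le> ennreal t0.Cfin * (\<integral>\<^sup>+x. ennreal (\<bar>f x\<bar> powr q) * ennreal (w x) \<partial>lebesgue)"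
      by (rule t.square_function_bound)
  qed
qed (auto intro: exI[of _ 1])

section \<open>Translated dyadic grids\<close>

text \<open>The grid is translated by \<open>\<plusminus>1/3\<close> of the side length in the coordinates in \<open>U\<close>; the sign alternates
  with the level, which is what makes the translated cells nested.\<close>
definition grid_shift :: "'a::euclidean_space set \<Rightarrow> int \<Rightarrow> 'a \<Rightarrow> real" where
  "grid_shift U i b = (if b \<in> U then (if even i then 1/3 else - 1/3) else 0)"

definition grid_index :: "'a::euclidean_space set \<Rightarrow> int \<Rightarrow> 'a \<Rightarrow> 'a \<Rightarrow> int" where
  "grid_index U i x b = \<lfloor>2 powr of_int i * (x \<bullet> b) - grid_shift U i b\<rfloor>"

definition grid_cell :: "'a::euclidean_space set \<Rightarrow> int \<Rightarrow> 'a \<Rightarrow> 'a set" where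
  "grid_cell U i x = {y. \<forall>b\<in>Basis. grid_index U i y b = grid_index U i x b}"

text \<open>The reason for nestedness: c is the shift at level i + 1 minus twice the shift at level
  i, an integer since the thirds alternate in sign. Hence the index of a cell determines that of its
  parent.\<close>

lemma grid_index_Suc:
  "\<exists>c. \<forall>x. grid_index U i x b = (grid_index U (i + 1) x b + c) div 2"
proof -
  define c :: int where "c = (if b \<in> U then (if even i then - 1 else 1) else 0)"
  have "grid_index U i x b = (grid_index U (i + 1) x b + c) div 2" for x
  proof -
    let ?z = "2 powr of_int (i + 1) * (x \<bullet> b) - grid_shift U (i + 1) b"
    have "2 powr of_int i * (x \<bullet> b) - grid_shift U i b = (?z + of_int c) / of_int 2"
      by (auto simp: c_def grid_shift_def powr_add field_simps)
    then have "grid_index U i x b = \<lfloor>?z + of_int c\<rfloor> div 2"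
      unfolding grid_index_def by (simp only: floor_divide_real_eq_div)
    then show ?thesis by (simp add: grid_index_def)
  qed
  then show ?thesis by blast
qed

lemma grid_index_eq_iff:
  "grid_index U i x b = m \<longleftrightarrow>
    (of_int m + grid_shift U i b) * 2 powr (- of_int i) \<le> x \<bullet> b \<and> x \<bullet> b < (of_int m + 1 + grid_shift U i b) * 2 powr (- of_int i)"
proof -
  have "grid_index U i x b = m \<longleftrightarrow> of_int m \<le> 2 powr of_int i * (x \<bullet> b) - grid_shift U i b \<and> 2 powr of_int i * (x \<bullet> b) - grid_shift U i b < of_int m + 1"
    unfolding grid_index_def by (rule floor_eq_iff)
  moreover have "(2::real) powr of_int i > 0" by simp
  ultimately show ?thesis by (simp add: powr_minus field_simps)
qed

text \<open>A cell is a half-open cube; squeezing it between an open and a closed box of the same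
  size gives its measure and diameter.\<close>

lemma grid_cell_box:
  fixes x :: "'a::euclidean_space"
  obtains l u :: 'a where "box l u \<subseteq> grid_cell U i x" "grid_cell U i x \<subseteq> cbox l u"
    "\<And>b. b \<in> Basis \<Longrightarrow> (u - l) \<bullet> b = 2 powr (- of_int i)"
proof
  let ?m = "\<lambda>b. grid_index U i x b"
  define l where "l = (\<Sum>b\<in>Basis. ((of_int (?m b) + grid_shift U i b) * 2 powr (- of_int i)) *\<^sub>R b)"
  define u where "u = (\<Sum>b\<in>Basis. ((of_int (?m b) + 1 + grid_shift U i b) * 2 powr (- of_int i)) *\<^sub>R b)"
  have l: "l \<bullet> b = (of_int (?m b) + grid_shift U i b) * 2 powr (- of_int i)" if "b \<in> Basis" for b
    using that by (simp add: l_def inner_sum_left inner_Basis if_distrib sum.delta cong: if_cong)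
  have u: "u \<bullet> b = (of_int (?m b) + 1 + grid_shift U i b) * 2 powr (- of_int i)" if "b \<in> Basis" for b
    using that by (simp add: u_def inner_sum_left inner_Basis if_distrib sum.delta cong: if_cong)
  show "box l u \<subseteq> grid_cell U i x"
    unfolding grid_cell_def grid_index_eq_iff by (auto simp: mem_box l u intro: less_imp_le)
  show "grid_cell U i x \<subseteq> cbox l u"
  proof
    fix y assume "y \<in> grid_cell U i x"
    then have "(of_int (?m b) + grid_shift U i b) * 2 powr (- of_int i) \<le> y \<bullet> b"
      "y \<bullet> b < (of_int (?m b) + 1 + grid_shift U i b) * 2 powr (- of_int i)" if "b \<in> Basis" for b
      unfolding grid_cell_def grid_index_eq_iff using that by auto
    then show "y \<in> cbox l u" by (simp add: mem_box l u less_imp_le)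
  qed
  show "(u - l) \<bullet> b = 2 powr (- of_int i)" if "b \<in> Basis" for b
    using that by (simp add: inner_diff_left l u algebra_simps)
qed

interpretation grid: dyadic_cells "grid_cell U" for U :: "'a::euclidean_space set"
proof
  fix i :: int and x y z :: 'a
  show "x \<in> grid_cell U i x" by (simp add: grid_cell_def)
  show "grid_cell U i y = grid_cell U i x" if "y \<in> grid_cell U i x" using that by (auto simp: grid_cell_def)
  show "grid_cell U (i + 1) x \<subseteq> grid_cell U i x"
  proof
    fix y assume y: "y \<in> grid_cell U (i + 1) x"
    have "grid_index U i y b = grid_index U i x b" if "b \<in> Basis" for b
    proof -
      obtain c where "\<And>x. grid_index U i x b = (grid_index U (i + 1) x b + c) div 2"
        using grid_index_Suc[of U i b] by blast
      then show ?thesis using y that by (simp add: grid_cell_def)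
    qed
    then show "y \<in> grid_cell U i x" by (simp add: grid_cell_def)
  qed
  show "countable (range (grid_cell U i))"
  proof -
    have "range (grid_cell U i) \<subseteq> (\<lambda>g. {y. \<forall>b\<in>Basis. grid_index U i y b = g b}) ` (Pi\<^sub>E Basis (\<lambda>_. UNIV))"
    proof
      fix A assume "A \<in> range (grid_cell U i)"
      then obtain x where "A = grid_cell U i x" by auto
      then have "A = {y. \<forall>b\<in>Basis. grid_index U i y b = restrict (grid_index U i x) Basis b}"
        by (auto simp: grid_cell_def)
      then show "A \<in> (\<lambda>g. {y. \<forall>b\<in>Basis. grid_index U i y b = g b}) ` (Pi\<^sub>E Basis (\<lambda>_. UNIV))"
        by (rule image_eqI[where x="restrict (grid_index U i x) Basis"]) simp
    qed
    then show ?thesis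
      by (rule countable_subset) (intro countable_image countable_PiE, auto)
  qed
  have b: "grid_cell U i x \<in> sets borel"
  proof -
    have "grid_cell U i x = (\<Inter>b\<in>Basis. {y \<in> space borel. grid_index U i y b = grid_index U i x b})"
      by (auto simp: grid_cell_def)
    also have "\<dots> \<in> sets borel"
      unfolding grid_index_def by (intro sets.finite_INT) auto
    finally show ?thesis .
  qed
  then show "grid_cell U i x \<in> sets lebesgue" by simp
  obtain l u :: 'a where lu: "box l u \<subseteq> grid_cell U i x" "grid_cell U i x \<subseteq> cbox l u"
    "\<And>b. b \<in> Basis \<Longrightarrow> (u - l) \<bullet> b = 2 powr (- of_int i)"
    using grid_cell_box[of U i x] by blast
  have le: "l \<bullet> b \<le> u \<bullet> b" if "b \<in> Basis" for b
  proof -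
    have "(u - l) \<bullet> b > 0" using lu(3)[OF that] by simp
    then show ?thesis by (simp add: inner_diff_left)
  qed
  have P: "(\<Prod>b\<in>Basis. (u - l) \<bullet> b) = 2 powr (- (real DIM('a) * of_int i))"
  proof -
    have "(\<Prod>b\<in>Basis. (u - l) \<bullet> b) = (2 powr (- of_int i)) ^ DIM('a)" using lu(3) by simp
    also have "\<dots> = (2 powr (- of_int i)) powr real DIM('a)" by (rule powr_realpow[symmetric]) simp
    also have "\<dots> = 2 powr (- (real DIM('a) * of_int i))" by (simp add: powr_powr mult.commute)
    finally show ?thesis .
  qed
  have "emeasure lborel (grid_cell U i x) \<le> emeasure lborel (cbox l u)"
    by (rule emeasure_mono[OF lu(2)]) simp
  moreover have "emeasure lborel (box l u) \<le> emeasure lborel (grid_cell U i x)"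
    by (rule emeasure_mono[OF lu(1)]) (use b in simp)
  ultimately have "emeasure lborel (grid_cell U i x) = ennreal (2 powr (- (real DIM('a) * of_int i)))"
    using le P by (simp add: emeasure_lborel_cbox_eq emeasure_lborel_box_eq)
  then show "emeasure lebesgue (grid_cell U i x) = ennreal (2 powr (- (real DIM('a) * of_int i)))"
    using b by simp
  show "norm (y - z) \<le> real DIM('a) * 2 powr (- of_int i)" if "y \<in> grid_cell U i x" "z \<in> grid_cell U i x"
  proof -
    have "\<bar>(y - z) \<bullet> b\<bar> \<le> 2 powr (- of_int i)" if "b \<in> Basis" for b
    proof -
      have "y \<in> cbox l u" "z \<in> cbox l u" using lu(2) \<open>y \<in> grid_cell U i x\<close> \<open>z \<in> grid_cell U i x\<close> by auto
      then have "l \<bullet> b \<le> y \<bullet> b" "y \<bullet> b \<le> u \<bullet> b" "l \<bullet> b \<le> z \<bullet> b" "z \<bullet> b \<le> u \<bullet> b"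
        using that unfolding mem_box by blast+
      then show ?thesis using lu(3)[OF that] by (simp add: inner_diff_left abs_le_iff)
    qed
    then have "(\<Sum>b\<in>Basis. \<bar>(y - z) \<bullet> b\<bar>) \<le> (\<Sum>b\<in>(Basis::'a set). 2 powr (- of_int i))" by (rule sum_mono)
    then show ?thesis using norm_le_l1[of "y - z"] by simp
  qed
qed

text \<open>One-third trick on the line. If both intervals crossed an integer, then s and s - d
  would each lie within \<open>\<rho>\<close> of an integer, and d would be closer than 2
  \<open>\<rho>\<close> < 1/3 to an integer, whereas 1/3 and -1/3 have distance exactly 1/3 from the
  integers.\<close>

lemma floor_third_shift:
  fixes s \<rho> d :: real
  assumes "\<rho> < 1/6" "d = 1/3 \<or> d = - 1/3"
  shows "(\<forall>t. \<bar>t - s\<bar> \<le> \<rho> \<longrightarrow> \<lfloor>t\<rfloor> = \<lfloor>s\<rfloor>) \<or> (\<forall>t. \<bar>t - s\<bar> \<le> \<rho> \<longrightarrow> \<lfloor>t - d\<rfloor> = \<lfloor>s - d\<rfloor>)"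
proof (rule ccontr)
  assume "\<not> ?thesis"
  then obtain t t' where t: "\<bar>t - s\<bar> \<le> \<rho>" "\<lfloor>t\<rfloor> \<noteq> \<lfloor>s\<rfloor>" "\<bar>t' - s\<bar> \<le> \<rho>" "\<lfloor>t' - d\<rfloor> \<noteq> \<lfloor>s - d\<rfloor>" by blast
  have sep: "\<exists>m::int. \<bar>of_int m - b\<bar> \<le> \<rho>" if ab: "\<bar>a - b\<bar> \<le> \<rho>" and ne: "\<lfloor>a\<rfloor> \<noteq> \<lfloor>b\<rfloor>" for a b :: real
  proof (cases "a < b")
    case True
    then have "\<lfloor>a\<rfloor> < \<lfloor>b\<rfloor>" using ne floor_mono[of a b] by linarith
    then have "a < of_int \<lfloor>b\<rfloor>" by linarith
    then show ?thesis using ab True of_int_floor_le[of b] by (intro exI[of _ "\<lfloor>b\<rfloor>"]) linarith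
  next
    case False
    then have "\<lfloor>b\<rfloor> < \<lfloor>a\<rfloor>" using ne floor_mono[of b a] by linarith
    then have "b < of_int \<lfloor>a\<rfloor>" by linarith
    then show ?thesis using ab False of_int_floor_le[of a] by (intro exI[of _ "\<lfloor>a\<rfloor>"]) linarith
  qed
  obtain m where m: "\<bar>of_int m - s\<bar> \<le> \<rho>" using sep[OF t(1,2)] by blast
  obtain m' where m': "\<bar>of_int m' - (s - d)\<bar> \<le> \<rho>" using sep[of "t' - d" "s - d"] t(3,4) by auto
  have "\<bar>of_int (m - m') - d\<bar> < 1/3" using m m' assms(1) unfolding of_int_diff by linarith
  then have k: "\<bar>of_int k - d\<bar> < 1/3" if "k = m - m'" for k using that by simp
  show False using assms(2)
  proof
    assume "d = 1/3"
    then have "0 < real_of_int (m - m')" "real_of_int (m - m') < 1" using k[OF refl] by linarith+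
    then show False unfolding of_int_0_less_iff of_int_less_1_iff by linarith
  next
    assume "d = - 1/3"
    then have "- 1 < real_of_int (m - m')" "real_of_int (m - m') < 0" using k[OF refl] by linarith+
    then have "real_of_int (- 1) < real_of_int (m - m')" "real_of_int (m - m') < real_of_int 0" by simp_all
    then show False unfolding of_int_less_iff by linarith
  qed
qed

text \<open>The decision is made coordinate by coordinate: U collects the coordinates in which the
  unshifted grid would cut the ball.\<close>

lemma cball_in_shifted_cell:
  fixes x :: "'a::euclidean_space"
  assumes "r * 2 powr of_int i < 1/6"
  obtains U where "U \<subseteq> Basis" "cball x r \<subseteq> grid_cell U i x"
proof
  define d :: real where "d = (if even i then 1/3 else - 1/3)"
  let ?s = "\<lambda>b. 2 powr of_int i * (x \<bullet> b)" and ?\<rho> = "r * 2 powr of_int i"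
  define U :: "'a set" where "U = {b \<in> Basis. \<not> (\<forall>t. \<bar>t - ?s b\<bar> \<le> ?\<rho> \<longrightarrow> \<lfloor>t\<rfloor> = \<lfloor>?s b\<rfloor>)}"
  show "U \<subseteq> Basis" by (auto simp: U_def)
  show "cball x r \<subseteq> grid_cell U i x"
  proof
    fix y assume y: "y \<in> cball x r"
    have "grid_index U i y b = grid_index U i x b" if b: "b \<in> Basis" for b
    proof -
      have "\<bar>(y - x) \<bullet> b\<bar> \<le> norm (y - x)" using b by (rule Basis_le_norm)
      also have "\<dots> \<le> r" using y by (simp add: dist_norm norm_minus_commute)
      finally have *: "2 powr of_int i * \<bar>(y - x) \<bullet> b\<bar> \<le> 2 powr of_int i * r" by (intro mult_left_mono) auto
      have le: "\<bar>s' - ?s b\<bar> \<le> ?\<rho>" if "s' = 2 powr of_int i * (y \<bullet> b)" for s'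
      proof -
        have eq: "s' - ?s b = 2 powr of_int i * ((y - x) \<bullet> b)" by (simp add: that inner_diff_left right_diff_distrib)
        have "\<bar>s' - ?s b\<bar> = \<bar>2 powr of_int i\<bar> * \<bar>(y - x) \<bullet> b\<bar>" unfolding eq by (rule abs_mult)
        also have "\<dots> = 2 powr of_int i * \<bar>(y - x) \<bullet> b\<bar>" by simp
        also note *
        also have "2 powr of_int i * r = ?\<rho>" by (rule mult.commute)
        finally show ?thesis .
      qed
      show ?thesis
      proof (cases "b \<in> U")
        case True
        then have "\<forall>t. \<bar>t - ?s b\<bar> \<le> ?\<rho> \<longrightarrow> \<lfloor>t - d\<rfloor> = \<lfloor>?s b - d\<rfloor>"
        proof -
          have "d = 1/3 \<or> d = - 1/3" by (simp add: d_def)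
          from floor_third_shift[OF assms this, of "?s b"] True show ?thesis unfolding U_def by blast
        qed
        then have "\<lfloor>2 powr of_int i * (y \<bullet> b) - d\<rfloor> = \<lfloor>?s b - d\<rfloor>" using le[OF refl] by blast
        then show ?thesis using True by (simp add: grid_index_def grid_shift_def d_def)
      next
        case False
        then have "\<lfloor>2 powr of_int i * (y \<bullet> b)\<rfloor> = \<lfloor>?s b\<rfloor>" using le[OF refl] b unfolding U_def by blast
        then show ?thesis using False by (simp add: grid_index_def grid_shift_def)
      qed
    qed
    then show "y \<in> grid_cell U i x" by (simp add: grid_cell_def)
  qed
qed

section \<open>Domination of the intrinsic square function\<close>

text \<open>Normalized to the side length 2^-i of a cell. Regularity holds on the whole space, while
  the mean is taken over Q only.\<close>

definition test_family :: "real \<Rightarrow> int \<Rightarrow> 'a::euclidean_space set \<Rightarrow> ('a \<Rightarrow> real) set" where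
  "test_family \<beta> i Q = {\<eta>. \<eta> \<in> borel_measurable lebesgue \<and> (\<forall>y. \<bar>\<eta> y\<bar> \<le> 1) \<and>
     (\<forall>y z. \<bar>\<eta> y - \<eta> z\<bar> \<le> (2 powr of_int i * norm (y - z)) powr \<beta>) \<and> (LINT y:Q|lebesgue. \<eta> y) = 0}"

definition test_sup :: "real \<Rightarrow> 'a::euclidean_space set \<Rightarrow> ('a \<Rightarrow> real) \<Rightarrow> int \<Rightarrow> 'a \<Rightarrow> ennreal" where
  "test_sup \<beta> U f i x = (SUP \<eta>\<in>test_family \<beta> i (grid_cell U i x).
     ennreal (\<bar>LINT y:grid_cell U i x|lebesgue. f y * \<eta> y\<bar> / measure lebesgue (grid_cell U i x)))"

lemma zero_in_test_family: "(\<lambda>y. 0) \<in> test_family \<beta> i Q"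
  by (simp add: test_family_def)

text \<open>An uncountable supremum, but it depends on the point only through its cell, and there
  are countably many cells.\<close>

lemma test_sup_measurable [measurable]: "test_sup \<beta> U f i \<in> borel_measurable lebesgue"
proof (rule grid.cell_constant_measurable[where i=i])
  show "test_sup \<beta> U f i y = test_sup \<beta> U f i x" if "y \<in> grid_cell U i x" for x y
    using grid.cell_eq[OF that] by (simp add: test_sup_def)
qed simp

lemma nn_integral_int_measurable [measurable (raw)]:
  fixes g :: "int \<Rightarrow> 'b \<Rightarrow> ennreal"
  assumes [measurable]: "\<And>i. g i \<in> borel_measurable M"
  shows "(\<lambda>x. \<integral>\<^sup>+i. g i x \<partial>count_space UNIV) \<in> borel_measurable M"
proof -
  have "(\<integral>\<^sup>+i. g i x \<partial>count_space UNIV) = (\<Sum>n. g (int_decode n) x)" for x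
    using nn_integral_bij_count_space[OF bij_int_decode, of "\<lambda>i. g i x"] by (simp add: nn_integral_count_space_nat)
  then show ?thesis by simp
qed

text \<open>Integrability of f makes the supremum finite, so half of it is exceeded by some test
  function unless it is 0, when the zero function serves.\<close>

lemma near_maximizer:
  assumes f: "set_integrable lebesgue (grid_cell U i x) f" "f \<in> borel_measurable lebesgue"
  shows "\<exists>\<eta>\<in>test_family \<beta> i (grid_cell U i x).
    test_sup \<beta> U f i x \<le> ennreal (2 * (\<bar>LINT y:grid_cell U i x|lebesgue. f y * \<eta> y\<bar> / measure lebesgue (grid_cell U i x)))"
proof -
  let ?Q = "grid_cell U i x" and ?F = "test_family \<beta> i (grid_cell U i x)"
  let ?v = "\<lambda>\<eta>. \<bar>LINT y:?Q|lebesgue. f y * \<eta> y\<bar> / measure lebesgue ?Q"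
  have bd: "?v \<eta> \<le> (LINT y:?Q|lebesgue. \<bar>f y\<bar>) / measure lebesgue ?Q" if \<eta>: "\<eta> \<in> ?F" for \<eta>
  proof (rule divide_right_mono)
    have i: "set_integrable lebesgue ?Q (\<lambda>y. f y * \<eta> y)"
      by (rule set_integrable_mult_bounded[OF f(1), where B=1]) (use \<eta> f(2) grid.sets_cell in \<open>auto simp: test_family_def\<close>)
    have "\<bar>LINT y:?Q|lebesgue. f y * \<eta> y\<bar> \<le> (LINT y:?Q|lebesgue. \<bar>f y * \<eta> y\<bar>)"
      using set_integral_norm_bound[OF i] by simp
    also have "\<dots> \<le> (LINT y:?Q|lebesgue. \<bar>f y\<bar>)"
    proof (rule set_integral_mono)
      show "set_integrable lebesgue ?Q (\<lambda>y. \<bar>f y * \<eta> y\<bar>)" by (rule set_integrable_abs[OF i])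
      show "set_integrable lebesgue ?Q (\<lambda>y. \<bar>f y\<bar>)" by (rule set_integrable_abs[OF f(1)])
      fix y
      have "\<bar>\<eta> y\<bar> \<le> 1" using \<eta> by (simp add: test_family_def)
      then show "\<bar>f y * \<eta> y\<bar> \<le> \<bar>f y\<bar>" using mult_left_mono[of "\<bar>\<eta> y\<bar>" 1 "\<bar>f y\<bar>"] by (simp add: abs_mult)
    qed
    finally show "\<bar>LINT y:?Q|lebesgue. f y * \<eta> y\<bar> \<le> (LINT y:?Q|lebesgue. \<bar>f y\<bar>)" .
  qed simp
  have "test_sup \<beta> U f i x \<le> ennreal ((LINT y:?Q|lebesgue. \<bar>f y\<bar>) / measure lebesgue ?Q)"
    unfolding test_sup_def by (intro SUP_least ennreal_leI bd)
  then have fin: "test_sup \<beta> U f i x < top" by (rule order_le_less_trans) simp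
  then obtain s where s: "test_sup \<beta> U f i x = ennreal s" "s \<ge> 0"
    by (metis ennreal_cases less_irrefl)
  show ?thesis
  proof (cases "s = 0")
    case True
    then show ?thesis using zero_in_test_family s by (intro bexI[of _ "\<lambda>y. 0"]) auto
  next
    case False
    then have "ennreal (s / 2) < test_sup \<beta> U f i x" using s by (simp add: ennreal_less_iff)
    then obtain \<eta> where \<eta>: "\<eta> \<in> ?F" "ennreal (s / 2) < ennreal (?v \<eta>)"
      unfolding test_sup_def less_SUP_iff by blast
    then have "s / 2 < ?v \<eta>" using s(2) by (subst (asm) ennreal_less_iff) auto
    then have "ennreal s \<le> ennreal (2 * ?v \<eta>)" by (intro ennreal_leI) linarith
    then show ?thesis using \<eta>(1) s(1) by auto
  qed
qed

lemma test_sup_bound: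
  fixes w v :: "'a::euclidean_space \<Rightarrow> real"
  assumes \<beta>: "\<beta> > 0" and wc: "weighted_cells (grid_cell U) w v q Cw"
  shows "\<exists>C>0. \<forall>f\<in>borel_measurable lebesgue.
    (\<integral>\<^sup>+x. epowr (\<integral>\<^sup>+i. (test_sup \<beta> U f i x)\<^sup>2 \<partial>count_space UNIV) (q / 2) * ennreal (w x) \<partial>lebesgue)
    \<le> ennreal C * (\<integral>\<^sup>+x. ennreal (\<bar>f x\<bar> powr q) * ennreal (w x) \<partial>lebesgue)"
proof -
  interpret weighted_cells "grid_cell U" w v q Cw by (rule wc)
  obtain C where C: "C > 0" and bound: "\<And>f e. dyadic_test (grid_cell U) f e \<beta> \<Longrightarrow>
    (\<integral>\<^sup>+x. epowr (\<integral>\<^sup>+k. ennreal ((dyadic_test.coef (grid_cell U) f e k x)\<^sup>2) \<partial>count_space UNIV) (q / 2) * ennreal (w x) \<partial>lebesgue)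
    \<le> ennreal C * (\<integral>\<^sup>+x. ennreal (\<bar>f x\<bar> powr q) * ennreal (w x) \<partial>lebesgue)"
    using square_function_bound_uniform[of \<beta>] by blast
  have q2: "q / 2 > 0" using q_gt_1 by simp
  define C' where "C' = 2 powr q * C"
  show ?thesis
  proof (intro exI[of _ C'] conjI ballI)
    show "C' > 0" using C by (simp add: C'_def)
    fix f :: "'a \<Rightarrow> real" assume fm [measurable]: "f \<in> borel_measurable lebesgue"
    define I where "I = (\<integral>\<^sup>+x. ennreal (\<bar>f x\<bar> powr q) * ennreal (w x) \<partial>lebesgue)"
    show "(\<integral>\<^sup>+x. epowr (\<integral>\<^sup>+i. (test_sup \<beta> U f i x)\<^sup>2 \<partial>count_space UNIV) (q / 2) * ennreal (w x) \<partial>lebesgue)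
      \<le> ennreal C' * (\<integral>\<^sup>+x. ennreal (\<bar>f x\<bar> powr q) * ennreal (w x) \<partial>lebesgue)"
    proof (cases "I = top")
      case True
      then show ?thesis using \<open>C' > 0\<close> unfolding I_def[symmetric] by (simp add: ennreal_mult_top)
    next
      case False
      \<comment> \<open>With a finite right-hand side, Hoelder's inequality and finiteness of the
        dual weight on cells make f integrable on every cell.\<close>
      have fint: "set_integrable lebesgue (grid_cell U i x) f" for i x
      proof -
        let ?Q = "grid_cell U i x"
        have [measurable]: "?Q \<in> sets lebesgue" by (rule grid.sets_cell)
        have "epowr (\<integral>\<^sup>+y\<in>?Q. ennreal \<bar>f y\<bar> \<partial>lebesgue) q
          \<le> (\<integral>\<^sup>+y\<in>?Q. epowr (ennreal \<bar>f y\<bar>) q * ennreal (w y) \<partial>lebesgue) * epowr (\<integral>\<^sup>+y\<in>?Q. ennreal (v y) \<partial>lebesgue) (q - 1)"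
          by (rule nn_integral_Holder_weight[OF q_gt_1 wv_dual]) measurable
        also have "\<dots> \<le> I * epowr (\<integral>\<^sup>+y\<in>?Q. ennreal (v y) \<partial>lebesgue) (q - 1)"
          unfolding I_def using q_gt_1
          by (intro mult_right_mono nn_integral_mono) (auto simp: indicator_def epowr_ennreal)
        also have "\<dots> < top"
          using False v_finite[of i x] q_gt_1 by (simp add: ennreal_mult_eq_top_iff less_top[symmetric])
        finally have "(\<integral>\<^sup>+y\<in>?Q. ennreal \<bar>f y\<bar> \<partial>lebesgue) \<noteq> top" using q_gt_1 by auto
        then have "(\<integral>\<^sup>+y. ennreal (norm (indicator ?Q y *\<^sub>R f y)) \<partial>lebesgue) < top"
        proof -
          have "(\<integral>\<^sup>+y. ennreal (norm (indicator ?Q y *\<^sub>R f y)) \<partial>lebesgue) = (\<integral>\<^sup>+y\<in>?Q. ennreal \<bar>f y\<bar> \<partial>lebesgue)"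
            by (intro nn_integral_cong) (auto simp: indicator_def)
          then show ?thesis using \<open>(\<integral>\<^sup>+y\<in>?Q. ennreal \<bar>f y\<bar> \<partial>lebesgue) \<noteq> top\<close> by (simp add: less_top)
        qed
        then show ?thesis unfolding set_integrable_def
          by (intro integrableI_bounded) auto
      qed
      \<comment> \<open>The near maximizer is chosen as a function of the cell and not of the point,
        so that all points of a cell use the same test function.\<close>
      define h where "h i Q = (SOME \<eta>. \<eta> \<in> test_family \<beta> i Q \<and>
        (\<forall>x. Q = grid_cell U i x \<longrightarrow> test_sup \<beta> U f i x \<le> ennreal (2 * (\<bar>LINT y:Q|lebesgue. f y * \<eta> y\<bar> / measure lebesgue Q))))" for i Q
      have h: "h i (grid_cell U i x) \<in> test_family \<beta> i (grid_cell U i x)"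
        "test_sup \<beta> U f i x \<le> ennreal (2 * (\<bar>LINT y:grid_cell U i x|lebesgue. f y * h i (grid_cell U i x) y\<bar> / measure lebesgue (grid_cell U i x)))" for i x
      proof -
        obtain \<eta> where \<eta>: "\<eta> \<in> test_family \<beta> i (grid_cell U i x)"
          "test_sup \<beta> U f i x \<le> ennreal (2 * (\<bar>LINT y:grid_cell U i x|lebesgue. f y * \<eta> y\<bar> / measure lebesgue (grid_cell U i x)))"
          using near_maximizer[OF fint fm] by blast
        have ex: "\<exists>\<eta>. \<eta> \<in> test_family \<beta> i (grid_cell U i x) \<and>
          (\<forall>x'. grid_cell U i x = grid_cell U i x' \<longrightarrow> test_sup \<beta> U f i x' \<le> ennreal (2 * (\<bar>LINT y:grid_cell U i x|lebesgue. f y * \<eta> y\<bar> / measure lebesgue (grid_cell U i x))))"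
        proof (intro exI[of _ \<eta>] conjI allI impI \<eta>(1))
          fix x' assume "grid_cell U i x = grid_cell U i x'"
          then have eq: "test_sup \<beta> U f i x' = test_sup \<beta> U f i x" by (simp only: test_sup_def)
          show "test_sup \<beta> U f i x' \<le> ennreal (2 * (\<bar>LINT y:grid_cell U i x|lebesgue. f y * \<eta> y\<bar> / measure lebesgue (grid_cell U i x)))"
            unfolding eq by (rule \<eta>(2))
        qed
        note h' = someI_ex[OF ex, folded h_def]
        show "h i (grid_cell U i x) \<in> test_family \<beta> i (grid_cell U i x)" by (rule conjunct1[OF h'])
        show "test_sup \<beta> U f i x \<le> ennreal (2 * (\<bar>LINT y:grid_cell U i x|lebesgue. f y * h i (grid_cell U i x) y\<bar> / measure lebesgue (grid_cell U i x)))"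
          by (rule conjunct2[OF h', rule_format, OF refl])
      qed
      define e where "e i y = h i (grid_cell U i y) y" for i y
      have e_eq: "e i y = h i (grid_cell U i x) y" if "y \<in> grid_cell U i x" for i x y
        using grid.cell_eq[OF that] by (simp add: e_def)
      have e_int: "(LINT y:grid_cell U i x|lebesgue. g y * e i y) = (LINT y:grid_cell U i x|lebesgue. g y * h i (grid_cell U i x) y)" for i x and g :: "'a \<Rightarrow> real"
        by (rule set_lebesgue_integral_cong) (simp_all add: grid.sets_cell e_eq)
      have dt: "dyadic_test (grid_cell U) f e \<beta>"
      proof (intro dyadic_test.intro grid.dyadic_cells_axioms dyadic_test_axioms.intro \<beta> fm fint)
        fix i x
        note hx = h(1)[of i x, unfolded test_family_def, simplified]
        show "e i \<in> borel_measurable lebesgue"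
        proof (rule piecewise_measurable[where P="grid_cell U i" and h="h i", OF grid.cell_partition _ e_eq])
          show "space (lebesgue :: 'a measure) = UNIV" by simp
          show "h i (grid_cell U i x) \<in> borel_measurable lebesgue" for x
            using h(1)[of i x] by (simp add: test_family_def)
        qed
        show "\<bar>e i x\<bar> \<le> 1" using hx by (simp add: e_def)
        show "(LINT y:grid_cell U i x|lebesgue. e i y) = 0"
          using e_int[of i x "\<lambda>_. 1"] hx by simp
        show "\<bar>e i y - e i z\<bar> \<le> (2 powr of_int i * norm (y - z)) powr \<beta>"
          if "y \<in> grid_cell U i x" "z \<in> grid_cell U i x" for y z
          unfolding e_eq[OF that(1)] e_eq[OF that(2)] using hx by simp
      qed
      interpret t: dyadic_test "grid_cell U" f e \<beta> by (rule dt)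
      have le: "(test_sup \<beta> U f i x)\<^sup>2 \<le> 4 * ennreal ((t.coef i x)\<^sup>2)" for i x
      proof -
        have "test_sup \<beta> U f i x \<le> ennreal (2 * \<bar>t.coef i x\<bar>)"
          using h(2)[of i x] grid.vol_pos[where 'a='a, of i] unfolding t.coef_def e_int grid.measure_cell by (simp add: abs_divide)
        then have "(test_sup \<beta> U f i x)\<^sup>2 \<le> (ennreal (2 * \<bar>t.coef i x\<bar>))\<^sup>2" by (rule power_mono) simp
        also have "\<dots> = 4 * ennreal ((t.coef i x)\<^sup>2)"
          by (simp add: ennreal_power power_mult_distrib ennreal_mult)
        finally show ?thesis .
      qed
      have "(\<integral>\<^sup>+x. epowr (\<integral>\<^sup>+i. (test_sup \<beta> U f i x)\<^sup>2 \<partial>count_space UNIV) (q / 2) * ennreal (w x) \<partial>lebesgue)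
        \<le> (\<integral>\<^sup>+x. ennreal (2 powr q) * (epowr (\<integral>\<^sup>+i. ennreal ((t.coef i x)\<^sup>2) \<partial>count_space UNIV) (q / 2) * ennreal (w x)) \<partial>lebesgue)"
      proof (rule nn_integral_mono)
        fix x
        have "epowr (\<integral>\<^sup>+i. (test_sup \<beta> U f i x)\<^sup>2 \<partial>count_space UNIV) (q / 2) \<le> epowr (4 * (\<integral>\<^sup>+i. ennreal ((t.coef i x)\<^sup>2) \<partial>count_space UNIV)) (q / 2)"
        proof (rule epowr_mono[OF q2])
          have "(\<integral>\<^sup>+i. (test_sup \<beta> U f i x)\<^sup>2 \<partial>count_space UNIV) \<le> (\<integral>\<^sup>+i. 4 * ennreal ((t.coef i x)\<^sup>2) \<partial>count_space UNIV)"
            by (intro nn_integral_mono le)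
          also have "\<dots> = 4 * (\<integral>\<^sup>+i. ennreal ((t.coef i x)\<^sup>2) \<partial>count_space UNIV)"
            by (rule nn_integral_cmult) simp
          finally show "(\<integral>\<^sup>+i. (test_sup \<beta> U f i x)\<^sup>2 \<partial>count_space UNIV) \<le> 4 * (\<integral>\<^sup>+i. ennreal ((t.coef i x)\<^sup>2) \<partial>count_space UNIV)" .
        qed
        also have "\<dots> = ennreal (2 powr q) * epowr (\<integral>\<^sup>+i. ennreal ((t.coef i x)\<^sup>2) \<partial>count_space UNIV) (q / 2)"
        proof -
          have "(4::real) = 2 powr 2" by simp
          then have "(4::real) powr (q / 2) = (2 powr 2) powr (q / 2)" by (rule arg_cong)
          also have "\<dots> = 2 powr (2 * (q / 2))" by (rule powr_powr)
          also have "2 * (q / 2) = q" by simp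
          finally have "epowr 4 (q / 2) = ennreal (2 powr q)" using epowr_ennreal[OF q2, of 4] by simp
          then show ?thesis by (simp only: epowr_mult[OF q2])
        qed
        finally show "epowr (\<integral>\<^sup>+i. (test_sup \<beta> U f i x)\<^sup>2 \<partial>count_space UNIV) (q / 2) * ennreal (w x)
          \<le> ennreal (2 powr q) * (epowr (\<integral>\<^sup>+i. ennreal ((t.coef i x)\<^sup>2) \<partial>count_space UNIV) (q / 2) * ennreal (w x))"
          unfolding mult.assoc[symmetric] by (rule mult_right_mono) simp
      qed
      also have "\<dots> = ennreal (2 powr q) * (\<integral>\<^sup>+x. epowr (\<integral>\<^sup>+i. ennreal ((t.coef i x)\<^sup>2) \<partial>count_space UNIV) (q / 2) * ennreal (w x) \<partial>lebesgue)"
      proof (rule nn_integral_cmult)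
        have "(\<lambda>x. \<integral>\<^sup>+i. ennreal ((t.coef i x)\<^sup>2) \<partial>count_space UNIV) \<in> borel_measurable lebesgue"
          by (rule nn_integral_int_measurable) measurable
        then show "(\<lambda>x. epowr (\<integral>\<^sup>+i. ennreal ((t.coef i x)\<^sup>2) \<partial>count_space UNIV) (q / 2) * ennreal (w x)) \<in> borel_measurable lebesgue"
          using q2 by measurable
      qed
      also have "\<dots> \<le> ennreal (2 powr q) * (ennreal C * I)"
        unfolding I_def by (intro mult_left_mono bound dt) simp
      also have "\<dots> = ennreal C' * I" using C by (simp add: C'_def ennreal_mult mult.assoc)
      finally show ?thesis unfolding I_def .
    qed
  qed
qed

section \<open>From convolution kernels to test functions on cells\<close>

lemma Hoelder_continuous:
  fixes \<phi> :: "'a::euclidean_space \<Rightarrow> real"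
  assumes \<beta>: "\<beta> > 0" and \<phi>: "\<And>x x'. \<bar>\<phi> x - \<phi> x'\<bar> \<le> norm (x - x') powr \<beta>"
  shows "continuous_on UNIV \<phi>"
  unfolding continuous_on_iff
proof (intro ballI allI impI)
  fix x :: 'a and e :: real assume e: "e > 0"
  show "\<exists>d>0. \<forall>x'\<in>UNIV. dist x' x < d \<longrightarrow> dist (\<phi> x') (\<phi> x) < e"
  proof (intro exI[of _ "e powr (1 / \<beta>)"] conjI ballI impI)
    fix x' assume "dist x' x < e powr (1 / \<beta>)"
    then have "norm (x' - x) powr \<beta> < (e powr (1 / \<beta>)) powr \<beta>"
      using \<beta> by (intro powr_less_mono2) (auto simp: dist_norm)
    also have "\<dots> = e" using \<beta> e by (simp add: powr_powr)
    finally show "dist (\<phi> x') (\<phi> x) < e" using \<phi>[of x' x] by (simp add: dist_real_def)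
  qed (use e in simp)
qed

lemma Hoelder_family_facts:
  fixes \<phi> :: "'a::euclidean_space \<Rightarrow> real"
  assumes \<phi>: "\<phi> \<in> Hoelder_family \<beta>" and \<beta>: "0 < \<beta>" "\<beta> \<le> 1"
  shows "\<phi> \<in> borel_measurable borel" "\<And>u. norm u > 1 \<Longrightarrow> \<phi> u = 0" "\<And>u. \<bar>\<phi> u\<bar> \<le> 3"
    "\<And>u u'. \<bar>\<phi> u - \<phi> u'\<bar> \<le> norm (u - u') powr \<beta>" "(\<integral>u. \<phi> u \<partial>lborel) = 0"
proof -
  show H: "\<bar>\<phi> u - \<phi> u'\<bar> \<le> norm (u - u') powr \<beta>" for u u' using \<phi> by (simp add: Hoelder_family_def)
  show m: "\<phi> \<in> borel_measurable borel"
    by (rule borel_measurable_continuous_onI[OF Hoelder_continuous[OF \<beta>(1) H]])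
  show z: "\<phi> u = 0" if "norm u > 1" for u
  proof (rule ccontr)
    assume "\<phi> u \<noteq> 0"
    then have "u \<in> {x. \<phi> x \<noteq> 0}" by simp
    then have "u \<in> closure {x. \<phi> x \<noteq> 0}" by (rule subsetD[OF closure_subset])
    then show False using \<phi> that by (auto simp: Hoelder_family_def)
  qed
  show "\<bar>\<phi> u\<bar> \<le> 3" for u
  proof (cases "norm u > 1")
    case False
    \<comment> \<open>Moving three units along a basis vector leaves the unit ball for good, so the
      function value is at most 3^beta <= 3.\<close>
    obtain b :: 'a where b: "b \<in> Basis" using nonempty_Basis by blast
    have nb: "norm (3 *\<^sub>R b) = 3" using b by simp
    have "norm (u + 3 *\<^sub>R b) \<ge> norm (3 *\<^sub>R b) - norm u"
      using norm_triangle_ineq2[of "3 *\<^sub>R b" "- u"] by (simp add: add.commute)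
    then have "\<phi> (u + 3 *\<^sub>R b) = 0" using False nb by (intro z) linarith
    then have "\<bar>\<phi> u\<bar> \<le> norm (u - (u + 3 *\<^sub>R b)) powr \<beta>" using H[of u "u + 3 *\<^sub>R b"] by simp
    also have "\<dots> = 3 powr \<beta>" using b by simp
    also have "\<dots> \<le> 3 powr 1" using \<beta> by (intro powr_mono) auto
    finally show ?thesis by simp
  qed (simp add: z)
  have "(\<integral>u. \<phi> u \<partial>lebesgue) = 0" using \<phi> by (simp add: Hoelder_family_def)
  then show "(\<integral>u. \<phi> u \<partial>lborel) = 0" using m by (simp add: integral_completion)
qed

lemma lborel_integral_affine:
  fixes g :: "'a::euclidean_space \<Rightarrow> real"
  assumes "c \<noteq> 0" "g \<in> borel_measurable borel" "(\<integral>x. g x \<partial>lborel) = 0"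
  shows "(\<integral>x. g (t + c *\<^sub>R x) \<partial>lborel) = 0"
proof -
  have "(\<integral>x. g x \<partial>lborel) = (\<integral>x. g x \<partial>density (distr lborel borel (\<lambda>x. t + c *\<^sub>R x)) (\<lambda>_. ennreal (\<bar>c\<bar> ^ DIM('a))))"
    using lborel_affine[OF assms(1), of t] by simp
  also have "\<dots> = (\<integral>x. \<bar>c\<bar> ^ DIM('a) *\<^sub>R g x \<partial>distr lborel borel (\<lambda>x. t + c *\<^sub>R x))"
    using assms(2) by (intro integral_density) auto
  also have "\<dots> = (\<integral>x. \<bar>c\<bar> ^ DIM('a) *\<^sub>R g (t + c *\<^sub>R x) \<partial>lborel)"
    using assms(2) by (intro integral_distr) auto
  also have "\<dots> = \<bar>c\<bar> ^ DIM('a) * (\<integral>x. g (t + c *\<^sub>R x) \<partial>lborel)" by simp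
  finally show ?thesis using assms by simp
qed

text \<open>Multiplied by V / \<open>\<kappa>\<close>, the kernel centred at y becomes an admissible
  test function on the cell: it lives on the ball of radius t about y, inside the ball of radius 2 t
  about x, and its mean zero survives dilation and reflection.\<close>

lemma convol_le_test_sup:
  fixes f :: "'a::euclidean_space \<Rightarrow> real"
  assumes \<phi>: "\<phi> \<in> Hoelder_family \<beta>" and \<beta>: "0 < \<beta>" "\<beta> \<le> 1"
    and t: "t > 0" "norm (x - y) < t" "2 powr (- of_int i) \<le> 64 * t" and sub: "cball x (2 * t) \<subseteq> grid_cell U i x"
  shows "ennreal \<bar>convol f (dilate t \<phi>) y\<bar> \<le> ennreal (64 ^ (DIM('a) + 1)) * test_sup \<beta> U f i x"
proof -
  let ?Q = "grid_cell U i x" and ?n = "DIM('a)"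
  define V where "V = measure lebesgue ?Q"
  have V: "V = 2 powr (- (real ?n * of_int i))" unfolding V_def grid.measure_cell grid.vol_def ..
  \<comment> \<open>64^n compensates the ratio of V and t^n; the additional factor 64 pays for the
    rescaled Hoelder constant 64^beta <= 64.\<close>
  define \<kappa> :: real where "\<kappa> = 64 ^ (?n + 1)"
  define K where "K = V / t ^ ?n / \<kappa>"
  define \<eta> where "\<eta> z = K * \<phi> ((y - z) /\<^sub>R t)" for z
  note F = Hoelder_family_facts[OF \<phi> \<beta>]
  have [measurable]: "\<phi> \<in> borel_measurable borel" by (rule F)
  have \<kappa>: "\<kappa> > 0" by (simp add: \<kappa>_def)
  have Vpos: "V > 0" by (simp add: V)
  have Kpos: "K > 0" using Vpos \<kappa> t by (simp add: K_def)
  have "V = (2 powr (- of_int i)) ^ ?n" unfolding V by (simp add: powr_realpow[symmetric] powr_powr mult.commute)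
  also have "\<dots> \<le> (64 * t) ^ ?n" using t by (intro power_mono) auto
  finally have "V / t ^ ?n \<le> 64 ^ ?n" using t by (simp add: power_mult_distrib pos_divide_le_eq)
  then have "K \<le> 64 ^ ?n / \<kappa>" unfolding K_def using \<kappa> by (intro divide_right_mono) auto
  also have "\<dots> = 1 / 64" by (simp add: \<kappa>_def)
  finally have K64: "K \<le> 1 / 64" .
  have supp: "\<eta> z = 0" if "z \<notin> ?Q" for z
  proof -
    have "z \<notin> cball x (2 * t)" using sub that by auto
    then have "norm (x - z) > 2 * t" by (simp add: dist_norm)
    moreover have "norm (x - z) \<le> norm (x - y) + norm (y - z)" using norm_triangle_ineq[of "x - y" "y - z"] by simp
    ultimately have "norm (y - z) > t" using t by linarith
    then have "norm ((y - z) /\<^sub>R t) > 1" using t by (simp add: divide_simps)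
    then show ?thesis unfolding \<eta>_def by (simp only: F(2) mult_zero_right)
  qed
  have eta_meas: "\<eta> \<in> borel_measurable borel" unfolding \<eta>_def by measurable
  have "\<eta> \<in> test_family \<beta> i ?Q"
    unfolding test_family_def
  proof (intro CollectI conjI allI)
    show "\<eta> \<in> borel_measurable lebesgue" using eta_meas by (simp add: measurable_completion)
    show "\<bar>\<eta> z\<bar> \<le> 1" for z
    proof -
      have "K * \<bar>\<phi> ((y - z) /\<^sub>R t)\<bar> \<le> (1/64) * 3" using K64 Kpos F(3) by (intro mult_mono) auto
      then show ?thesis using Kpos by (simp add: \<eta>_def abs_mult)
    qed
    show "\<bar>\<eta> z - \<eta> z'\<bar> \<le> (2 powr of_int i * norm (z - z')) powr \<beta>" for z z'
    proof -
      have "1 / t \<le> 64 * 2 powr of_int i"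
        using t by (simp add: powr_minus field_simps)
      then have "norm (z - z') * (1 / t) \<le> norm (z - z') * (64 * 2 powr of_int i)" by (intro mult_left_mono) auto
      then have le: "norm (z - z') / t \<le> 64 * (2 powr of_int i * norm (z - z'))" by (simp add: mult_ac)
      have "\<bar>\<phi> ((y - z) /\<^sub>R t) - \<phi> ((y - z') /\<^sub>R t)\<bar> \<le> norm ((y - z) /\<^sub>R t - (y - z') /\<^sub>R t) powr \<beta>" by (rule F(4))
      also have "(y - z) /\<^sub>R t - (y - z') /\<^sub>R t = (z' - z) /\<^sub>R t" by (simp add: scaleR_diff_right[symmetric])
      also have "norm ((z' - z) /\<^sub>R t) = norm (z - z') / t" using t by (simp add: norm_minus_commute divide_inverse mult.commute)
      also have "(norm (z - z') / t) powr \<beta> \<le> (64 * (2 powr of_int i * norm (z - z'))) powr \<beta>"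
        using t \<beta> le by (intro powr_mono2) auto
      also have "\<dots> = 64 powr \<beta> * (2 powr of_int i * norm (z - z')) powr \<beta>" by (simp add: powr_mult)
      also have "\<dots> \<le> 64 * (2 powr of_int i * norm (z - z')) powr \<beta>"
      proof (rule mult_right_mono)
        have "(64::real) powr \<beta> \<le> 64 powr 1" using \<beta> by (intro powr_mono) auto
        then show "(64::real) powr \<beta> \<le> 64" by simp
      qed simp
      finally have *: "\<bar>\<phi> ((y - z) /\<^sub>R t) - \<phi> ((y - z') /\<^sub>R t)\<bar> \<le> 64 * (2 powr of_int i * norm (z - z')) powr \<beta>" .
      have "\<bar>\<eta> z - \<eta> z'\<bar> = K * \<bar>\<phi> ((y - z) /\<^sub>R t) - \<phi> ((y - z') /\<^sub>R t)\<bar>"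
        using Kpos by (simp add: \<eta>_def right_diff_distrib[symmetric] abs_mult)
      also have "\<dots> \<le> (1/64) * (64 * (2 powr of_int i * norm (z - z')) powr \<beta>)"
        using K64 * by (intro mult_mono) auto
      finally show ?thesis by simp
    qed
    show "(LINT z:?Q|lebesgue. \<eta> z) = 0"
    proof -
      have "(LINT z:?Q|lebesgue. \<eta> z) = (\<integral>z. \<eta> z \<partial>lebesgue)"
        unfolding set_lebesgue_integral_def using supp
        by (intro Bochner_Integration.integral_cong) (auto simp: indicator_def)
      also have "\<dots> = (\<integral>z. \<eta> z \<partial>lborel)" using eta_meas by (simp add: integral_completion)
      also have "\<dots> = K * (\<integral>z. \<phi> ((1 / t) *\<^sub>R y + (- 1 / t) *\<^sub>R z) \<partial>lborel)"
        unfolding \<eta>_def by (simp add: scaleR_diff_right inverse_eq_divide)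
      also have "(\<integral>z. \<phi> ((1 / t) *\<^sub>R y + (- 1 / t) *\<^sub>R z) \<partial>lborel) = 0"
        by (rule lborel_integral_affine) (use t F in auto)
      finally show ?thesis by simp
    qed
  qed
  then have "ennreal (\<bar>LINT z:?Q|lebesgue. f z * \<eta> z\<bar> / V) \<le> test_sup \<beta> U f i x"
    unfolding test_sup_def V_def by (rule SUP_upper)
  moreover have "\<bar>convol f (dilate t \<phi>) y\<bar> = \<kappa> * (\<bar>LINT z:?Q|lebesgue. f z * \<eta> z\<bar> / V)"
  proof -
    have "(LINT z:?Q|lebesgue. f z * \<eta> z) = (\<integral>z. (V / \<kappa>) * (f z * (\<phi> ((y - z) /\<^sub>R t) / t ^ ?n)) \<partial>lebesgue)"
      unfolding set_lebesgue_integral_def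
    proof (intro Bochner_Integration.integral_cong refl)
      fix z
      have "indicator ?Q z *\<^sub>R (f z * \<eta> z) = f z * \<eta> z" using supp[of z] by (auto simp: indicator_def)
      also have "\<dots> = (V / \<kappa>) * (f z * (\<phi> ((y - z) /\<^sub>R t) / t ^ ?n))"
        by (simp add: \<eta>_def K_def mult_ac)
      finally show "indicator ?Q z *\<^sub>R (f z * \<eta> z) = (V / \<kappa>) * (f z * (\<phi> ((y - z) /\<^sub>R t) / t ^ ?n))" .
    qed
    also have "\<dots> = (V / \<kappa>) * convol f (dilate t \<phi>) y"
      unfolding convol_def dilate_def by (rule integral_mult_right_zero)
    finally have "\<bar>LINT z:?Q|lebesgue. f z * \<eta> z\<bar> = (V / \<kappa>) * \<bar>convol f (dilate t \<phi>) y\<bar>"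
      using Vpos \<kappa> by (simp add: abs_mult)
    then show ?thesis using Vpos \<kappa> by simp
  qed
  ultimately show ?thesis using \<kappa> Vpos unfolding \<kappa>_def[symmetric]
    by (simp only: ennreal_mult' less_imp_le) (rule mult_left_mono, simp_all)
qed

text \<open>The suitable grid depends on the ball, hence the sum over all of them.\<close>

lemma intrinsic_A_le_test_sup:
  fixes f :: "'a::euclidean_space \<Rightarrow> real"
  assumes \<beta>: "0 < \<beta>" "\<beta> \<le> 1" and t: "norm (x - y) < t" "2 powr (of_int j - 1) < t" "t \<le> 2 powr of_int j"
  shows "intrinsic_A \<beta> f y t \<le> ennreal (64 ^ (DIM('a) + 1)) * (\<Sum>U\<in>Pow Basis. test_sup \<beta> U f (- (j + 5)) x)"
  unfolding intrinsic_A_def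
proof (rule SUP_least)
  fix \<phi> :: "'a \<Rightarrow> real" assume \<phi>: "\<phi> \<in> Hoelder_family \<beta>"
  \<comment> \<open>Five levels up the cells have side 2^(j+5): large enough that 2 t is at most
    1/16 < 1/6 of the side, and still less than 64 t.\<close>
  let ?i = "- (j + 5)"
  have "(2::real) powr of_int ?i = 2 powr (- of_int j) * 2 powr (-5)" by (simp add: powr_add[symmetric])
  also have "(2::real) powr (-5) = 1/32" by (simp add: powr_minus)
  finally have p1: "(2::real) powr of_int ?i = 2 powr (- of_int j) / 32" by simp
  have "2 * t * 2 powr of_int ?i \<le> 2 * 2 powr of_int j * (2 powr (- of_int j) / 32)"
    unfolding p1 using t by (intro mult_right_mono) auto
  also have "\<dots> = 1/16" by (simp add: powr_minus)
  finally have "2 * t * 2 powr of_int ?i < 1/6" by simp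
  then obtain U where U: "U \<subseteq> Basis" "cball x (2 * t) \<subseteq> grid_cell U ?i x"
    by (rule cball_in_shifted_cell)
  have "(2::real) powr (- of_int ?i) = 2 powr ((of_int j - 1) + 6)" by simp
  also have "\<dots> = 2 powr (of_int j - 1) * 2 powr 6" by (rule powr_add)
  also have "\<dots> = 64 * 2 powr (of_int j - 1)" by simp
  also have "\<dots> \<le> 64 * t" using t by simp
  finally have p2: "(2::real) powr (- of_int ?i) \<le> 64 * t" .
  have t0: "t > 0" using t(1) norm_ge_zero[of "x - y"] by linarith
  have "ennreal \<bar>convol f (dilate t \<phi>) y\<bar> \<le> ennreal (64 ^ (DIM('a) + 1)) * test_sup \<beta> U f ?i x"
    by (rule convol_le_test_sup[OF \<phi> \<beta> t0 t(1) p2 U(2)])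
  also have "\<dots> \<le> ennreal (64 ^ (DIM('a) + 1)) * (\<Sum>U\<in>Pow Basis. test_sup \<beta> U f ?i x)"
    using U(1) by (intro mult_left_mono member_le_sum) auto
  finally show "ennreal \<bar>convol f (dilate t \<phi>) y\<bar> \<le> \<dots>" .
qed

text \<open>On the complement of D no cancellation is used, only the bound 3 / t^n for the kernel.
  If the product with the kernel is not integrable, the convolution has the default value 0.\<close>

lemma convol_split_le:
  fixes f :: "'a::euclidean_space \<Rightarrow> real"
  assumes \<phi>: "\<phi> \<in> Hoelder_family \<beta>" and \<beta>: "0 < \<beta>" "\<beta> \<le> 1" and t: "t > 0"
    and [measurable]: "f \<in> borel_measurable lebesgue" "D \<in> sets lebesgue"
  shows "ennreal \<bar>convol f (dilate t \<phi>) y\<bar> \<le> ennreal \<bar>convol (\<lambda>z. f z * indicator D z) (dilate t \<phi>) y\<bar>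
    + ennreal (3 / t ^ DIM('a)) * (\<integral>\<^sup>+z. ennreal \<bar>f z\<bar> * indicator (cball y t - D) z \<partial>lebesgue)"
proof -
  note F = Hoelder_family_facts[OF \<phi> \<beta>]
  let ?n = "DIM('a)"
  define \<psi> where "\<psi> z = dilate t \<phi> (y - z)" for z
  have \<psi>b: "\<bar>\<psi> z\<bar> \<le> 3 / t ^ ?n * indicator (cball y t) z" for z
  proof (cases "z \<in> cball y t")
    case True
    then show ?thesis using F(3) t by (simp add: \<psi>_def dilate_def divide_right_mono)
  next
    case False
    then have "norm ((y - z) /\<^sub>R t) > 1" using t by (simp add: dist_norm divide_simps)
    then show ?thesis using False by (simp add: \<psi>_def dilate_def F(2))
  qed
  show ?thesis
  proof (cases "integrable lebesgue (\<lambda>z. f z * \<psi> z)")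
    case False
    then have "convol f (dilate t \<phi>) y = 0" unfolding convol_def \<psi>_def by (rule not_integrable_integral_eq)
    then show ?thesis by simp
  next
    case True
    have i1: "integrable lebesgue (\<lambda>z. f z * indicator D z * \<psi> z)"
      using integrable_mult_indicator[OF assms(6) True] by (simp add: mult_ac)
    have "- D \<in> sets lebesgue" using sets.compl_sets[OF assms(6)] by (simp add: Compl_eq_Diff_UNIV)
    then have i2: "integrable lebesgue (\<lambda>z. f z * indicator (- D) z * \<psi> z)"
      using integrable_mult_indicator[OF _ True, of "- D"] by (simp add: mult_ac)
    have "convol f (dilate t \<phi>) y = (\<integral>z. f z * indicator D z * \<psi> z + f z * indicator (- D) z * \<psi> z \<partial>lebesgue)"
      unfolding convol_def \<psi>_def by (intro Bochner_Integration.integral_cong) (auto simp: indicator_def)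
    also have "\<dots> = convol (\<lambda>z. f z * indicator D z) (dilate t \<phi>) y + (\<integral>z. f z * indicator (- D) z * \<psi> z \<partial>lebesgue)"
      unfolding convol_def \<psi>_def[symmetric] by (rule Bochner_Integration.integral_add[OF i1 i2])
    finally have "\<bar>convol f (dilate t \<phi>) y\<bar> \<le> \<bar>convol (\<lambda>z. f z * indicator D z) (dilate t \<phi>) y\<bar> + \<bar>\<integral>z. f z * indicator (- D) z * \<psi> z \<partial>lebesgue\<bar>"
      by linarith
    then have "ennreal \<bar>convol f (dilate t \<phi>) y\<bar> \<le> ennreal \<bar>convol (\<lambda>z. f z * indicator D z) (dilate t \<phi>) y\<bar> + ennreal \<bar>\<integral>z. f z * indicator (- D) z * \<psi> z \<partial>lebesgue\<bar>"
      by (simp add: ennreal_plus[symmetric] ennreal_leI del: ennreal_plus)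
    also have "ennreal \<bar>\<integral>z. f z * indicator (- D) z * \<psi> z \<partial>lebesgue\<bar> \<le> (\<integral>\<^sup>+z. ennreal (norm (f z * indicator (- D) z * \<psi> z)) \<partial>lebesgue)"
      using integral_norm_bound_ennreal[OF i2] by simp
    also have "\<dots> \<le> (\<integral>\<^sup>+z. ennreal (3 / t ^ ?n) * (ennreal \<bar>f z\<bar> * indicator (cball y t - D) z) \<partial>lebesgue)"
    proof (rule nn_integral_mono)
      fix z
      show "ennreal (norm (f z * indicator (- D) z * \<psi> z)) \<le> ennreal (3 / t ^ ?n) * (ennreal \<bar>f z\<bar> * indicator (cball y t - D) z)"
      proof (cases "z \<in> cball y t - D")
        case True
        then have "\<bar>f z\<bar> * \<bar>\<psi> z\<bar> \<le> \<bar>f z\<bar> * (3 / t ^ ?n)" using \<psi>b[of z] by (intro mult_left_mono) auto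
        then have "ennreal (\<bar>f z\<bar> * \<bar>\<psi> z\<bar>) \<le> ennreal \<bar>f z\<bar> * ennreal (3 / t ^ ?n)"
          using t by (subst ennreal_mult[symmetric]) (auto intro: ennreal_leI)
        then show ?thesis using True by (simp add: abs_mult mult.commute)
      next
        case False
        then have "z \<in> D \<or> \<psi> z = 0" using \<psi>b[of z] by (cases "z \<in> D") auto
        then show ?thesis by auto
      qed
    qed
    also have "\<dots> = ennreal (3 / t ^ ?n) * (\<integral>\<^sup>+z. ennreal \<bar>f z\<bar> * indicator (cball y t - D) z \<partial>lebesgue)"
    proof (rule nn_integral_cmult)
      have [measurable]: "cball y t - D \<in> sets lebesgue" by (intro sets.Diff assms(6)) simp
      have "(\<lambda>z. indicator (cball y t - D) z :: ennreal) \<in> borel_measurable lebesgue"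
        by (rule borel_measurable_indicator) fact
      then show "(\<lambda>z. ennreal \<bar>f z\<bar> * indicator (cball y t - D) z) \<in> borel_measurable lebesgue"
        by (intro borel_measurable_times_ennreal) auto
    qed
    finally show ?thesis by (simp add: add_left_mono)
  qed
qed

lemma intrinsic_A_split_le:
  fixes f :: "'a::euclidean_space \<Rightarrow> real"
  assumes \<beta>: "0 < \<beta>" "\<beta> \<le> 1" and t: "t > 0"
    and f: "f \<in> borel_measurable lebesgue" "D \<in> sets lebesgue"
  shows "intrinsic_A \<beta> f y t \<le> intrinsic_A \<beta> (\<lambda>z. f z * indicator D z) y t
    + ennreal (3 / t ^ DIM('a)) * (\<integral>\<^sup>+z. ennreal \<bar>f z\<bar> * indicator (cball y t - D) z \<partial>lebesgue)"
  unfolding intrinsic_A_def[of \<beta> f]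
proof (rule SUP_least)
  fix \<phi> :: "'a \<Rightarrow> real" assume \<phi>: "\<phi> \<in> Hoelder_family \<beta>"
  have "ennreal \<bar>convol (\<lambda>z. f z * indicator D z) (dilate t \<phi>) y\<bar> \<le> intrinsic_A \<beta> (\<lambda>z. f z * indicator D z) y t"
    unfolding intrinsic_A_def by (rule SUP_upper[OF \<phi>])
  then show "ennreal \<bar>convol f (dilate t \<phi>) y\<bar> \<le> intrinsic_A \<beta> (\<lambda>z. f z * indicator D z) y t
    + ennreal (3 / t ^ DIM('a)) * (\<integral>\<^sup>+z. ennreal \<bar>f z\<bar> * indicator (cball y t - D) z \<partial>lebesgue)"
    using convol_split_le[OF \<phi> \<beta> t f, of y] by (meson add_right_mono order_trans)
qed

section \<open>Slicing the cone at dyadic heights\<close>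

lemma dyadic_shell:
  fixes t :: real assumes "t > 0"
  obtains j :: int where "2 powr (of_int j - 1) < t" "t \<le> 2 powr of_int j"
proof
  have l: "2 powr (log 2 t) = t" using assms by simp
  have "2 powr (of_int \<lceil>log 2 t\<rceil> - 1) < 2 powr (log 2 t)" by (intro powr_less_mono) linarith+
  then show "2 powr (of_int \<lceil>log 2 t\<rceil> - 1) < t" by (simp only: l)
  have "2 powr (log 2 t) \<le> 2 powr (of_int \<lceil>log 2 t\<rceil>)" by (intro powr_mono) auto
  then show "t \<le> 2 powr (of_int \<lceil>log 2 t\<rceil>)" by (simp only: l)
qed

lemma emeasure_shell:
  fixes x :: "'a::euclidean_space"
  shows "emeasure lebesgue (ball x (2 powr of_int j) \<times> {2 powr (of_int j - 1)<..2 powr of_int j :: real})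
    = ennreal (measure lborel (ball (0::'a) 1) * 2 powr (of_int j * real DIM('a)) * 2 powr (of_int j - 1))"
proof -
  let ?r = "2 powr of_int j :: real"
  have "measure lborel (ball x ?r) = ?r ^ DIM('a) * measure lborel (ball (0::'a) 1)"
    by (rule content_ball_conv_unit_ball) simp
  then have b: "emeasure lborel (ball x ?r) = ennreal (?r ^ DIM('a) * measure lborel (ball (0::'a) 1))"
    using emeasure_eq_ennreal_measure[of lborel "ball x ?r"] emeasure_lborel_ball_finite[of x ?r] by (simp add: less_top)
  have h: "?r - 2 powr (of_int j - 1) = 2 powr (of_int j - 1)" by (simp add: powr_diff)
  have "emeasure lborel (ball x ?r \<times> {2 powr (of_int j - 1)<..?r}) = emeasure (lborel \<Otimes>\<^sub>M lborel) (ball x ?r \<times> {2 powr (of_int j - 1)<..?r})"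
    by (simp add: lborel_prod)
  also have "\<dots> = emeasure lborel (ball x ?r) * emeasure lborel {2 powr (of_int j - 1)<..?r}"
    by (rule lborel.emeasure_pair_measure_Times) auto
  also have "\<dots> = ennreal (?r ^ DIM('a) * measure lborel (ball (0::'a) 1)) * ennreal (2 powr (of_int j - 1))"
    unfolding b by (subst emeasure_lborel_Ioc) (simp_all add: h)
  also have "\<dots> = ennreal (measure lborel (ball (0::'a) 1) * 2 powr (of_int j * real DIM('a)) * 2 powr (of_int j - 1))"
    by (simp add: ennreal_mult[symmetric] powr_realpow[symmetric] powr_powr mult_ac)
  finally have "emeasure lborel (ball x ?r \<times> {2 powr (of_int j - 1)<..?r}) =
    ennreal (measure lborel (ball (0::'a) 1) * 2 powr (of_int j * real DIM('a)) * 2 powr (of_int j - 1))" .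
  moreover have "ball x ?r \<times> {2 powr (of_int j - 1)<..?r} \<in> sets borel"
    unfolding borel_prod[symmetric] by (intro pair_measureI) auto
  ultimately show ?thesis by simp
qed

text \<open>Volume of the slab of height between 2^(j-1) and 2^j over the ball of radius 2^j, times
  2^(-(j-1)(n+1)); by homogeneity it does not depend on j.\<close>

definition shell_const :: "'a::euclidean_space itself \<Rightarrow> real" where
  "shell_const _ = measure lborel (ball (0::'a) 1) * 2 ^ DIM('a)"

text \<open>On each slab of the cone \<open>intrinsic_A\<close> is replaced by a constant and the
  density by its value at the lower end, so the integral becomes a sum over dyadic scales.\<close>

lemma intrinsic_S_le_shells:
  fixes f :: "'a::euclidean_space \<Rightarrow> real"
  assumes "\<And>j y t. norm (x - y) < t \<Longrightarrow> 2 powr (of_int j - 1) < t \<Longrightarrow> t \<le> 2 powr of_int j \<Longrightarrow> intrinsic_A \<beta> f y t \<le> a j"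
  shows "intrinsic_S \<beta> f x \<le> epowr (ennreal (shell_const TYPE('a)) * (\<integral>\<^sup>+j. (a j)\<^sup>2 \<partial>count_space UNIV)) (1 / 2)"
proof -
  let ?n = "DIM('a)"
  define D where "D j = ball x (2 powr of_int j) \<times> {2 powr (of_int j - 1)<..2 powr of_int j :: real}" for j :: int
  define c where "c j = (2 powr (of_int j - 1)) powr (- (real ?n + 1))" for j :: int
  have [measurable]: "D j \<in> sets lebesgue" for j
  proof -
    have "D j \<in> sets (borel \<Otimes>\<^sub>M borel)" unfolding D_def by (intro pair_measureI) auto
    then have "D j \<in> sets borel" by (simp only: borel_prod)
    then show ?thesis by simp
  qed
  have le: "(intrinsic_A \<beta> f (fst yt) (snd yt))\<^sup>2 / ennreal (snd yt ^ (?n + 1)) * indicator (cone x) yt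
     \<le> (\<integral>\<^sup>+j. ((a j)\<^sup>2 * ennreal (c j)) * indicator (D j) yt \<partial>count_space UNIV)" for yt
  proof (cases "yt \<in> cone x")
    case True
    obtain y t where yt: "yt = (y, t)" by (cases yt)
    then have t: "t > 0" "norm (x - y) < t" using True by (auto simp: cone_def)
    obtain j :: int where j: "2 powr (of_int j - 1) < t" "t \<le> 2 powr of_int j" using dyadic_shell[OF t(1)] by blast
    have D: "yt \<in> D j" using t j by (auto simp: D_def yt dist_norm)
    have "inverse (t ^ (?n + 1)) \<le> inverse ((2 powr (of_int j - 1)) ^ (?n + 1))"
      using j t by (intro le_imp_inverse_le power_mono) auto
    also have "(2 powr (of_int j - 1)) ^ (?n + 1) = (2 powr (of_int j - 1) :: real) powr (real ?n + 1)"
      using powr_realpow[of "2 powr (of_int j - 1)" "?n + 1"] by (simp add: add.commute)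
    also have "inverse \<dots> = c j" unfolding c_def by (rule powr_minus[symmetric])
    finally have c: "inverse (t ^ (?n + 1)) \<le> c j" .
    have "(intrinsic_A \<beta> f y t)\<^sup>2 / ennreal (t ^ (?n + 1)) = (intrinsic_A \<beta> f y t)\<^sup>2 * ennreal (inverse (t ^ (?n + 1)))"
      using t by (simp add: divide_ennreal_def inverse_ennreal)
    also have "\<dots> \<le> (a j)\<^sup>2 * ennreal (c j)"
      by (intro mult_mono power_mono ennreal_leI c assms t j) auto
    also have "\<dots> = ((a j)\<^sup>2 * ennreal (c j)) * indicator (D j) yt" using D by simp
    also have "\<dots> \<le> (\<integral>\<^sup>+j. ((a j)\<^sup>2 * ennreal (c j)) * indicator (D j) yt \<partial>count_space UNIV)"
      by (rule nn_integral_ge_point) simp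
    finally show ?thesis using True by (simp add: yt)
  qed simp
  have meas: "emeasure lebesgue (D j) * ennreal (c j) = ennreal (shell_const TYPE('a))" for j
  proof -
    let ?p = "2 powr (of_int j - 1) :: real"
    have p: "2 powr (of_int j * real ?n) = 2 ^ ?n * ?p powr (real ?n)"
    proof -
      have "?p powr (real ?n) = 2 powr (of_int j * real ?n - real ?n)" by (simp add: powr_powr algebra_simps)
      then show ?thesis by (simp add: powr_diff powr_realpow)
    qed
    have "?p powr (real ?n) * ?p * c j = 1"
    proof -
      have "?p powr (real ?n) * ?p = ?p powr (real ?n + 1)" by (simp add: powr_add)
      then show ?thesis unfolding c_def by (simp only: powr_minus) simp
    qed
    then have "measure lborel (ball (0::'a) 1) * 2 powr (of_int j * real ?n) * ?p * c j = shell_const TYPE('a)"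
      unfolding p shell_const_def by (simp add: mult.assoc)
    then show ?thesis unfolding D_def emeasure_shell
      by (subst ennreal_mult[symmetric]) (auto simp: c_def)
  qed
  have "(\<integral>\<^sup>+yt\<in>cone x. (intrinsic_A \<beta> f (fst yt) (snd yt))\<^sup>2 / ennreal (snd yt ^ (?n + 1)) \<partial>lebesgue)
     \<le> (\<integral>\<^sup>+yt. (\<integral>\<^sup>+j. ((a j)\<^sup>2 * ennreal (c j)) * indicator (D j) yt \<partial>count_space UNIV) \<partial>lebesgue)"
    by (intro nn_integral_mono le)
  also have "\<dots> = (\<integral>\<^sup>+j. (\<integral>\<^sup>+yt. ((a j)\<^sup>2 * ennreal (c j)) * indicator (D j) yt \<partial>lebesgue) \<partial>count_space UNIV)"
    by (rule nn_integral_count_space_nn_integral) auto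
  also have "\<dots> = (\<integral>\<^sup>+j. ennreal (shell_const TYPE('a)) * (a j)\<^sup>2 \<partial>count_space UNIV)"
  proof (rule nn_integral_cong)
    fix j
    have "(\<integral>\<^sup>+yt. ((a j)\<^sup>2 * ennreal (c j)) * indicator (D j) yt \<partial>lebesgue) = (a j)\<^sup>2 * ennreal (c j) * emeasure lebesgue (D j)"
      by (rule nn_integral_cmult_indicator) simp
    also have "\<dots> = (a j)\<^sup>2 * (emeasure lebesgue (D j) * ennreal (c j))" by (simp add: mult_ac)
    finally show "(\<integral>\<^sup>+yt. ((a j)\<^sup>2 * ennreal (c j)) * indicator (D j) yt \<partial>lebesgue) = ennreal (shell_const TYPE('a)) * (a j)\<^sup>2"
      unfolding meas by (simp add: mult.commute)
  qed
  also have "\<dots> = ennreal (shell_const TYPE('a)) * (\<integral>\<^sup>+j. (a j)\<^sup>2 \<partial>count_space UNIV)"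
    by (rule nn_integral_cmult) simp
  finally show ?thesis unfolding intrinsic_S_def by (intro epowr_mono) auto
qed

lemma epowr_sum_le:
  fixes x :: "'i \<Rightarrow> ennreal"
  assumes "finite I" "a > 0"
  shows "epowr (\<Sum>i\<in>I. x i) a \<le> ennreal (real (card I) powr a) * (\<Sum>i\<in>I. epowr (x i) a)"
proof (cases "I = {}")
  case True then show ?thesis using assms by simp
next
  case False
  define M where "M = Max (x ` I)"
  have "M \<in> x ` I" unfolding M_def using assms False by (intro Max_in) auto
  then obtain m where m: "m \<in> I" "x m = M" by (elim imageE) simp
  have "(\<Sum>i\<in>I. x i) \<le> (\<Sum>i\<in>I. M)"
    unfolding M_def using assms by (intro sum_mono Max_ge) auto
  also have "\<dots> = ennreal (real (card I)) * M" by (simp add: ennreal_of_nat_eq_real_of_nat)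
  finally have "epowr (\<Sum>i\<in>I. x i) a \<le> epowr (ennreal (real (card I)) * M) a"
    using assms by (intro epowr_mono)
  also have "\<dots> = ennreal (real (card I) powr a) * epowr (x m) a"
    using assms m by (simp add: epowr_mult epowr_ennreal)
  also have "\<dots> \<le> ennreal (real (card I) powr a) * (\<Sum>i\<in>I. epowr (x i) a)"
    using assms m by (intro mult_left_mono member_le_sum) auto
  finally show ?thesis .
qed

text \<open>The measurable majorant of the square of S_beta f, up to a constant: all scales and all
  translated grids at once.\<close>

definition grid_square :: "real \<Rightarrow> ('a::euclidean_space \<Rightarrow> real) \<Rightarrow> 'a \<Rightarrow> ennreal" where
  "grid_square \<beta> f x = (\<integral>\<^sup>+j. (\<Sum>U\<in>Pow Basis. test_sup \<beta> U f j x)\<^sup>2 \<partial>count_space UNIV)"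

lemma grid_square_measurable [measurable]: "grid_square \<beta> f \<in> borel_measurable lebesgue"
  unfolding grid_square_def by measurable

lemma grid_square_bound:
  fixes w v :: "'a::euclidean_space \<Rightarrow> real"
  assumes \<beta>: "\<beta> > 0" and q: "q > 1" and wc: "\<And>U. weighted_cells (grid_cell U) w v q Cw"
    and [measurable]: "w \<in> borel_measurable lebesgue"
  shows "\<exists>C>0. \<forall>f\<in>borel_measurable lebesgue.
    (\<integral>\<^sup>+x. epowr (grid_square \<beta> f x) (q / 2) * ennreal (w x) \<partial>lebesgue)
    \<le> ennreal C * (\<integral>\<^sup>+x. ennreal (\<bar>f x\<bar> powr q) * ennreal (w x) \<partial>lebesgue)"
proof -
  let ?P = "Pow Basis :: 'a set set"
  let ?T = "\<lambda>U f x. \<integral>\<^sup>+j. (test_sup \<beta> U f j x)\<^sup>2 \<partial>count_space UNIV"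
  have "\<forall>U. \<exists>C>0. \<forall>f\<in>borel_measurable lebesgue. (\<integral>\<^sup>+x. epowr (?T U f x) (q / 2) * ennreal (w x) \<partial>lebesgue)
    \<le> ennreal C * (\<integral>\<^sup>+x. ennreal (\<bar>f x\<bar> powr q) * ennreal (w x) \<partial>lebesgue)"
    using test_sup_bound[OF \<beta> wc] by blast
  then obtain C where C: "\<And>U. C U > 0" and bound: "\<And>U f. f \<in> borel_measurable lebesgue \<Longrightarrow>
    (\<integral>\<^sup>+x. epowr (?T U f x) (q / 2) * ennreal (w x) \<partial>lebesgue) \<le> ennreal (C U) * (\<integral>\<^sup>+x. ennreal (\<bar>f x\<bar> powr q) * ennreal (w x) \<partial>lebesgue)"
    unfolding choice_iff by blast
  have q2: "q / 2 > 0" using q by simp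
  have fin: "finite ?P" by simp
  define N where "N = real (card ?P)"
  have N: "N > 0" unfolding N_def by (simp add: card_Pow)
  \<comment> \<open>The first factor comes from squaring a sum of N terms, the second from the power
    q / 2 of such a sum.\<close>
  define K where "K = (N powr 2) powr (q / 2) * N powr (q / 2)"
  have K: "K > 0" using N by (simp add: K_def)
  show ?thesis
  proof (intro exI[of _ "K * (\<Sum>U\<in>?P. C U)"] conjI ballI)
    show "K * (\<Sum>U\<in>?P. C U) > 0" using K C fin by (intro mult_pos_pos sum_pos) auto
    fix f :: "'a \<Rightarrow> real" assume fm [measurable]: "f \<in> borel_measurable lebesgue"
    define I where "I = (\<integral>\<^sup>+x. ennreal (\<bar>f x\<bar> powr q) * ennreal (w x) \<partial>lebesgue)"
    have Tm [measurable]: "(\<lambda>x. epowr (?T U f x) (q / 2)) \<in> borel_measurable lebesgue" for U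
      using q2 by (intro borel_measurable_epowr) measurable
    have pw: "epowr (grid_square \<beta> f x) (q / 2) \<le> ennreal K * (\<Sum>U\<in>?P. epowr (?T U f x) (q / 2))" for x
    proof -
      have "grid_square \<beta> f x \<le> (\<integral>\<^sup>+j. ennreal (N powr 2) * (\<Sum>U\<in>?P. (test_sup \<beta> U f j x)\<^sup>2) \<partial>count_space UNIV)"
        unfolding grid_square_def N_def
        using epowr_sum_le[OF fin, of 2] by (intro nn_integral_mono) (simp add: epowr_two)
      also have "\<dots> = ennreal (N powr 2) * (\<Sum>U\<in>?P. ?T U f x)"
        by (subst nn_integral_cmult) (simp_all add: nn_integral_sum)
      finally have "epowr (grid_square \<beta> f x) (q / 2) \<le> epowr (ennreal (N powr 2) * (\<Sum>U\<in>?P. ?T U f x)) (q / 2)"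
        by (intro epowr_mono q2)
      also have "\<dots> = ennreal ((N powr 2) powr (q / 2)) * epowr (\<Sum>U\<in>?P. ?T U f x) (q / 2)"
        using epowr_mult[OF q2] epowr_ennreal[OF q2, of "N powr 2"] by simp
      also have "\<dots> \<le> ennreal ((N powr 2) powr (q / 2)) * (ennreal (N powr (q / 2)) * (\<Sum>U\<in>?P. epowr (?T U f x) (q / 2)))"
        unfolding N_def by (intro mult_left_mono epowr_sum_le[OF fin q2]) simp
      also have "\<dots> = ennreal K * (\<Sum>U\<in>?P. epowr (?T U f x) (q / 2))"
        by (simp only: K_def ennreal_mult' mult.assoc powr_ge_zero)
      finally show ?thesis .
    qed
    have "(\<integral>\<^sup>+x. epowr (grid_square \<beta> f x) (q / 2) * ennreal (w x) \<partial>lebesgue)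
      \<le> (\<integral>\<^sup>+x. ennreal K * (\<Sum>U\<in>?P. epowr (?T U f x) (q / 2) * ennreal (w x)) \<partial>lebesgue)"
    proof (rule nn_integral_mono)
      fix x
      have "epowr (grid_square \<beta> f x) (q / 2) * ennreal (w x) \<le> ennreal K * (\<Sum>U\<in>?P. epowr (?T U f x) (q / 2)) * ennreal (w x)"
        by (rule mult_right_mono[OF pw]) simp
      then show "epowr (grid_square \<beta> f x) (q / 2) * ennreal (w x) \<le> ennreal K * (\<Sum>U\<in>?P. epowr (?T U f x) (q / 2) * ennreal (w x))"
        by (simp only: mult.assoc sum_distrib_right)
    qed
    also have "\<dots> = ennreal K * (\<Sum>U\<in>?P. \<integral>\<^sup>+x. epowr (?T U f x) (q / 2) * ennreal (w x) \<partial>lebesgue)"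
    proof -
      have m: "(\<lambda>x. epowr (?T U f x) (q / 2) * ennreal (w x)) \<in> borel_measurable lebesgue" for U by measurable
      have "(\<integral>\<^sup>+x. ennreal K * (\<Sum>U\<in>?P. epowr (?T U f x) (q / 2) * ennreal (w x)) \<partial>lebesgue)
        = ennreal K * (\<integral>\<^sup>+x. (\<Sum>U\<in>?P. epowr (?T U f x) (q / 2) * ennreal (w x)) \<partial>lebesgue)"
        by (rule nn_integral_cmult, rule borel_measurable_sum, rule m)
      also have "(\<integral>\<^sup>+x. (\<Sum>U\<in>?P. epowr (?T U f x) (q / 2) * ennreal (w x)) \<partial>lebesgue) = (\<Sum>U\<in>?P. \<integral>\<^sup>+x. epowr (?T U f x) (q / 2) * ennreal (w x) \<partial>lebesgue)"
        by (rule nn_integral_sum, rule m)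
      finally show ?thesis .
    qed
    also have "\<dots> \<le> ennreal K * (\<Sum>U\<in>?P. ennreal (C U) * I)"
      unfolding I_def by (intro mult_left_mono sum_mono bound fm) simp
    also have "\<dots> = ennreal (K * (\<Sum>U\<in>?P. C U)) * I"
    proof -
      have "(\<Sum>U\<in>?P. ennreal (C U) * I) = ennreal (\<Sum>U\<in>?P. C U) * I"
        using C by (simp add: sum_distrib_right[symmetric] sum_ennreal less_imp_le)
      moreover have "(\<Sum>U\<in>?P. C U) \<ge> 0" using C by (intro sum_nonneg) (simp add: less_imp_le)
      ultimately show ?thesis using K by (simp add: ennreal_mult mult.assoc)
    qed
    finally show "(\<integral>\<^sup>+x. epowr (grid_square \<beta> f x) (q / 2) * ennreal (w x) \<partial>lebesgue)
      \<le> ennreal (K * (\<Sum>U\<in>?P. C U)) * (\<integral>\<^sup>+x. ennreal (\<bar>f x\<bar> powr q) * ennreal (w x) \<partial>lebesgue)"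
      unfolding I_def .
  qed
qed

text \<open>64^(n+1) belongs to the local part and 3 * 2^n to the kernel bound at heights above
  2^(j-1); the factors 4 and 2^(1/2) come from \<open>epowr_add_le\<close> with exponents 2 and
  1/2.\<close>

definition split_const :: "'a::euclidean_space itself \<Rightarrow> real" where
  "split_const _ = (shell_const TYPE('a) * 4 * ((64 ^ (DIM('a) + 1))\<^sup>2 + (3 * 2 ^ DIM('a))\<^sup>2)) powr (1 / 2) * 2 powr (1 / 2)"

text \<open>The part of f inside D keeps its cancellation and goes to the grids. Of the rest only
  the mass within reach at scale 2^j counts, for which d j is a bound.\<close>

lemma intrinsic_S_split:
  fixes f :: "'a::euclidean_space \<Rightarrow> real"
  assumes \<beta>: "0 < \<beta>" "\<beta> \<le> 1" and f: "f \<in> borel_measurable lebesgue" "D \<in> sets lebesgue"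
    and d: "\<And>j y t. norm (x - y) < t \<Longrightarrow> t \<le> 2 powr of_int j \<Longrightarrow>
      (\<integral>\<^sup>+z. ennreal \<bar>f z\<bar> * indicator (cball y t - D) z \<partial>lebesgue) \<le> d j"
  shows "intrinsic_S \<beta> f x \<le> ennreal (split_const TYPE('a)) *
     (epowr (grid_square \<beta> (\<lambda>z. f z * indicator D z) x) (1 / 2)
      + epowr (\<integral>\<^sup>+j. (ennreal (2 powr (- (real DIM('a) * of_int j))) * d j)\<^sup>2 \<partial>count_space UNIV) (1 / 2))"
proof -
  let ?n = "DIM('a)"
  define \<kappa> :: real where "\<kappa> = 64 ^ (?n + 1)"
  define \<kappa>' :: real where "\<kappa>' = 3 * 2 ^ ?n"
  define g where "g = (\<lambda>z. f z * indicator D z)"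
  define s where "s j = (\<Sum>U\<in>Pow Basis. test_sup \<beta> U g j x)" for j
  define e where "e j = ennreal (2 powr (- (real ?n * of_int j))) * d j" for j
  define a where "a j = ennreal \<kappa> * s (- (j + 5)) + ennreal \<kappa>' * e j" for j :: int
  define G where "G = grid_square \<beta> g x"
  define H where "H = (\<integral>\<^sup>+j. (e j)\<^sup>2 \<partial>count_space UNIV)"
  have \<kappa>: "\<kappa> > 0" "\<kappa>' > 0" by (simp_all add: \<kappa>_def \<kappa>'_def)
  have "intrinsic_S \<beta> f x \<le> epowr (ennreal (shell_const TYPE('a)) * (\<integral>\<^sup>+j. (a j)\<^sup>2 \<partial>count_space UNIV)) (1 / 2)"
  proof (rule intrinsic_S_le_shells)
    fix j :: int and y :: 'a and t :: real
    assume t: "norm (x - y) < t" "2 powr (of_int j - 1) < t" "t \<le> 2 powr of_int j"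
    have t0: "t > 0" using t(1) norm_ge_zero[of "x - y"] by linarith
    have "3 / t ^ ?n \<le> 3 / (2 powr (of_int j - 1)) ^ ?n"
      using t t0 by (intro divide_left_mono power_mono mult_pos_pos zero_less_power) auto
    also have "(2 powr (of_int j - 1)) ^ ?n = 2 powr (real ?n * of_int j) / (2::real) ^ ?n"
      by (simp add: powr_diff power_divide powr_realpow[symmetric] powr_powr mult.commute)
    also have "3 / \<dots> = \<kappa>' * 2 powr (- (real ?n * of_int j))"
      by (simp add: \<kappa>'_def powr_minus divide_simps)
    finally have c: "3 / t ^ ?n \<le> \<kappa>' * 2 powr (- (real ?n * of_int j))" .
    have "intrinsic_A \<beta> f y t \<le> intrinsic_A \<beta> g y t + ennreal (3 / t ^ ?n) * (\<integral>\<^sup>+z. ennreal \<bar>f z\<bar> * indicator (cball y t - D) z \<partial>lebesgue)"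
      unfolding g_def by (rule intrinsic_A_split_le[OF \<beta> t0 f])
    also have "\<dots> \<le> ennreal \<kappa> * s (- (j + 5)) + ennreal (\<kappa>' * 2 powr (- (real ?n * of_int j))) * d j"
      unfolding \<kappa>_def s_def
      by (intro add_mono mult_mono ennreal_leI c d t intrinsic_A_le_test_sup \<beta>) auto
    also have "\<dots> = a j" using \<kappa> by (simp add: a_def e_def ennreal_mult mult.assoc)
    finally show "intrinsic_A \<beta> f y t \<le> a j" .
  qed
  also have "(\<integral>\<^sup>+j. (a j)\<^sup>2 \<partial>count_space UNIV) \<le> ennreal (4 * (\<kappa>\<^sup>2 + \<kappa>'\<^sup>2)) * (G + H)"
  proof -
    have sq: "(ennreal c * y)\<^sup>2 \<le> ennreal (\<kappa>\<^sup>2 + \<kappa>'\<^sup>2) * y\<^sup>2" if "c = \<kappa> \<or> c = \<kappa>'" for c y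
    proof -
      have "(ennreal c * y)\<^sup>2 = ennreal (c\<^sup>2) * y\<^sup>2"
        using that \<kappa> by (auto simp: power_mult_distrib ennreal_power)
      also have "\<dots> \<le> ennreal (\<kappa>\<^sup>2 + \<kappa>'\<^sup>2) * y\<^sup>2"
        using that by (intro mult_right_mono ennreal_leI) auto
      finally show ?thesis .
    qed
    have "(a j)\<^sup>2 \<le> ennreal (4 * (\<kappa>\<^sup>2 + \<kappa>'\<^sup>2)) * ((s (- (j + 5)))\<^sup>2 + (e j)\<^sup>2)" for j
    proof -
      have "(a j)\<^sup>2 \<le> ennreal (2 powr 2) * ((ennreal \<kappa> * s (- (j + 5)))\<^sup>2 + (ennreal \<kappa>' * e j)\<^sup>2)"
        using epowr_add_le[of 2 "ennreal \<kappa> * s (- (j + 5))" "ennreal \<kappa>' * e j"] by (simp only: epowr_two a_def)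
      also have "\<dots> \<le> ennreal 4 * (ennreal (\<kappa>\<^sup>2 + \<kappa>'\<^sup>2) * (s (- (j + 5)))\<^sup>2 + ennreal (\<kappa>\<^sup>2 + \<kappa>'\<^sup>2) * (e j)\<^sup>2)"
        by (intro mult_mono add_mono sq) auto
      also have "\<dots> = ennreal (4 * (\<kappa>\<^sup>2 + \<kappa>'\<^sup>2)) * ((s (- (j + 5)))\<^sup>2 + (e j)\<^sup>2)"
      proof -
        have "ennreal (4 * (\<kappa>\<^sup>2 + \<kappa>'\<^sup>2)) = ennreal 4 * ennreal (\<kappa>\<^sup>2 + \<kappa>'\<^sup>2)" by (rule ennreal_mult) auto
        then show ?thesis by (simp only: distrib_left mult.assoc)
      qed
      finally show ?thesis .
    qed
    then have "(\<integral>\<^sup>+j. (a j)\<^sup>2 \<partial>count_space UNIV) \<le> (\<integral>\<^sup>+j. ennreal (4 * (\<kappa>\<^sup>2 + \<kappa>'\<^sup>2)) * ((s (- (j + 5)))\<^sup>2 + (e j)\<^sup>2) \<partial>count_space UNIV)"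
      by (intro nn_integral_mono)
    also have "\<dots> = ennreal (4 * (\<kappa>\<^sup>2 + \<kappa>'\<^sup>2)) * ((\<integral>\<^sup>+j. (s (- (j + 5)))\<^sup>2 \<partial>count_space UNIV) + H)"
      unfolding H_def by (subst nn_integral_cmult, simp, subst nn_integral_add) simp_all
    also have "(\<integral>\<^sup>+j. (s (- (j + 5)))\<^sup>2 \<partial>count_space UNIV) = G"
    proof -
      have "bij (\<lambda>j::int. - (j + 5))"
        by (rule o_bij[of "\<lambda>j. - j - 5"]) (auto simp: fun_eq_iff)
      then show ?thesis unfolding G_def grid_square_def s_def[symmetric]
        by (rule nn_integral_bij_count_space)
    qed
    finally show ?thesis .
  qed
  finally have "intrinsic_S \<beta> f x \<le> epowr (ennreal (shell_const TYPE('a)) * (ennreal (4 * (\<kappa>\<^sup>2 + \<kappa>'\<^sup>2)) * (G + H))) (1 / 2)"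
    by (simp add: epowr_mono mult_left_mono)
  also have "\<dots> = ennreal ((shell_const TYPE('a) * 4 * (\<kappa>\<^sup>2 + \<kappa>'\<^sup>2)) powr (1 / 2)) * epowr (G + H) (1 / 2)"
  proof -
    have sc: "shell_const TYPE('a) \<ge> 0" by (simp add: shell_const_def)
    have "ennreal (shell_const TYPE('a)) * (ennreal (4 * (\<kappa>\<^sup>2 + \<kappa>'\<^sup>2)) * (G + H)) = ennreal (shell_const TYPE('a) * 4 * (\<kappa>\<^sup>2 + \<kappa>'\<^sup>2)) * (G + H)"
      using sc by (simp add: ennreal_mult mult.assoc del: ennreal_plus)
    moreover have "epowr (ennreal (shell_const TYPE('a) * 4 * (\<kappa>\<^sup>2 + \<kappa>'\<^sup>2))) (1 / 2) = ennreal ((shell_const TYPE('a) * 4 * (\<kappa>\<^sup>2 + \<kappa>'\<^sup>2)) powr (1 / 2))"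
      using sc by (intro epowr_ennreal mult_nonneg_nonneg) auto
    moreover have "epowr (ennreal (shell_const TYPE('a) * 4 * (\<kappa>\<^sup>2 + \<kappa>'\<^sup>2)) * (G + H)) (1 / 2)
      = epowr (ennreal (shell_const TYPE('a) * 4 * (\<kappa>\<^sup>2 + \<kappa>'\<^sup>2))) (1 / 2) * epowr (G + H) (1 / 2)"
      by (rule epowr_mult) simp
    ultimately show ?thesis by (simp only:)
  qed
  also have "\<dots> \<le> ennreal ((shell_const TYPE('a) * 4 * (\<kappa>\<^sup>2 + \<kappa>'\<^sup>2)) powr (1 / 2)) * (ennreal (2 powr (1/2)) * (epowr G (1 / 2) + epowr H (1 / 2)))"
    by (intro mult_left_mono epowr_add_le) auto
  also have "\<dots> = ennreal (split_const TYPE('a)) * (epowr G (1 / 2) + epowr H (1 / 2))"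
    unfolding split_const_def \<kappa>_def \<kappa>'_def by (simp only: ennreal_mult' powr_ge_zero mult.assoc)
  finally show ?thesis unfolding G_def H_def e_def g_def .
qed

section \<open>Muckenhoupt weights\<close>

lemma emeasure_ball_pos_finite:
  fixes z :: "'a::euclidean_space"
  assumes "r > 0" shows "0 < emeasure lebesgue (ball z r)" "emeasure lebesgue (ball z r) < top"
proof -
  show "emeasure lebesgue (ball z r) < top" using emeasure_lborel_ball_finite[of z r] by simp
  have "\<not> negligible (ball z r)" using assms by (intro open_not_negligible) auto
  then have "ball z r \<notin> null_sets lebesgue" by (simp add: negligible_iff_null_sets)
  then have "emeasure lebesgue (ball z r) \<noteq> 0" by (auto simp: null_sets_def)
  then show "0 < emeasure lebesgue (ball z r)" by (simp add: zero_less_iff_neq_zero)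
qed

lemma is_weightD:
  fixes w :: "'a::euclidean_space \<Rightarrow> real"
  assumes "is_weight w"
  shows "w \<in> borel_measurable lebesgue" "\<And>x. 0 \<le> w x"
    "weight_measure w (cball z r) < top" "\<exists>N::nat. N > 0 \<and> weight_measure w (ball 0 (real N)) > 0"
proof -
  show wm [measurable]: "w \<in> borel_measurable lebesgue" and w0: "\<And>x. 0 \<le> w x" using assms by (auto simp: is_weight_def)
  have "set_integrable lebesgue (cball z r) w" using assms by (simp add: is_weight_def)
  then have "(\<integral>\<^sup>+x. ennreal (norm (indicator (cball z r) x *\<^sub>R w x)) \<partial>lebesgue) < top"
    unfolding set_integrable_def integrable_iff_bounded by simp
  also have "(\<integral>\<^sup>+x. ennreal (norm (indicator (cball z r) x *\<^sub>R w x)) \<partial>lebesgue) = weight_measure w (cball z r)"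
    unfolding weight_measure_def by (intro nn_integral_cong) (auto simp: indicator_def w0)
  finally show "weight_measure w (cball z r) < top" .
  show "\<exists>N::nat. N > 0 \<and> weight_measure w (ball 0 (real N)) > 0"
  proof (rule ccontr)
    assume neg: "\<not> ?thesis"
    have "AE x in lebesgue. \<forall>N::nat. x \<in> ball 0 (real (Suc N)) \<longrightarrow> w x = 0"
      unfolding AE_all_countable
    proof
      fix N :: nat
      have "weight_measure w (ball 0 (real (Suc N))) = 0" using neg by (meson not_gr_zero zero_less_Suc)
      then have "AE x in lebesgue. ennreal (w x) * indicator (ball 0 (real (Suc N))) x = 0"
        unfolding weight_measure_def
      proof (rule nn_integral_0_iff_AE[THEN iffD1, rotated])
        have [measurable]: "ball (0::'a) (real (Suc N)) \<in> sets lebesgue" by simp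
        show "(\<lambda>x. ennreal (w x) * indicator (ball 0 (real (Suc N))) x) \<in> borel_measurable lebesgue" by measurable
      qed
      then show "AE x in lebesgue. x \<in> ball 0 (real (Suc N)) \<longrightarrow> w x = 0"
        by eventually_elim (use w0 in \<open>auto simp: indicator_def ennreal_eq_0_iff antisym\<close>)
    qed
    then have "AE x in lebesgue. w x = 0"
    proof eventually_elim
      case (elim x)
      obtain N :: nat where "norm x < real N" using reals_Archimedean2 by blast
      then have "x \<in> ball 0 (real (Suc N))" by simp
      then show ?case using elim by blast
    qed
    then show False using assms by (simp add: is_weight_def)
  qed
qed

lemma weight_measure_mono: "A \<subseteq> B \<Longrightarrow> weight_measure w A \<le> weight_measure w B"
  unfolding weight_measure_def by (intro nn_integral_mono) (auto simp: indicator_def)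

lemma weight_measure_ball_finite:
  assumes "is_weight w" shows "weight_measure w (ball z r) < top"
  using is_weightD(3)[OF assms, of z r] weight_measure_mono[of "ball z r" "cball z r" w] by (simp add: ball_subset_cball order_le_less_trans)

lemma ball_average_eq_0_iff:
  assumes "is_weight w" "r > 0"
  shows "ball_average z r (\<lambda>x. ennreal (w x)) = 0 \<longleftrightarrow> weight_measure w (ball z r) = 0"
  using emeasure_ball_pos_finite[OF assms(2), of z]
  by (auto simp: ball_average_def weight_measure_def ennreal_divide_eq_0_iff)

text \<open>An \<open>A\<^sub>1\<close> weight is bounded below on a ball by half of its mean value divided by the constant; the factor
  one half avoids discussing whether the essential infimum is attained.\<close>
lemma A1_lower_bound:
  fixes w :: "'a::euclidean_space \<Rightarrow> real"
  assumes w: "is_weight w" and r: "r > 0" and C: "C > 0"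
    and A1: "ball_average z r (\<lambda>x. ennreal (w x)) \<le> ennreal C * ess_inf_on (ball z r) (\<lambda>x. ennreal (w x))"
  shows "AE x in lebesgue. x \<in> ball z r \<longrightarrow>
    weight_measure w (ball z r) \<le> ennreal (2 * C) * emeasure lebesgue (ball z r) * ennreal (w x)"
proof (cases "weight_measure w (ball z r) = 0")
  case False
  note b = emeasure_ball_pos_finite[OF r, of z]
  obtain W where W: "weight_measure w (ball z r) = ennreal W" "W > 0"
    using False weight_measure_ball_finite[OF w, of z r] by (cases "weight_measure w (ball z r)" rule: ennreal_cases) (auto simp: le_less)
  obtain B where B: "emeasure lebesgue (ball z r) = ennreal B" "B > 0"
    using b by (cases "emeasure lebesgue (ball z r)" rule: ennreal_cases) auto
  define c where "c = W / (2 * C * B)"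
  have c: "c > 0" using W B C by (simp add: c_def)
  have av: "ball_average z r (\<lambda>x. ennreal (w x)) = ennreal (W / B)"
    using W B unfolding ball_average_def weight_measure_def[symmetric] by (simp add: divide_ennreal)
  have "ennreal c < ess_inf_on (ball z r) (\<lambda>x. ennreal (w x))"
  proof (rule ccontr)
    assume "\<not> ?thesis"
    then have "ennreal (W / B) \<le> ennreal C * ennreal c"
      using A1 unfolding av by (meson mult_left_mono not_less order_trans zero_le)
    then have "W / B \<le> C * c" using C c W B by (simp add: ennreal_mult[symmetric])
    also have "C * c = W / B / 2" using C by (simp add: c_def)
    finally have "W / B \<le> W / B / 2" .
    moreover have "W / B > 0" using W B by simp
    moreover have "\<not> k \<le> k / 2" if "k > 0" for k :: real using that by linarith
    ultimately show False by blast
  qed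
  then obtain c' where c': "ennreal c < c'" "AE x in lebesgue. x \<in> ball z r \<longrightarrow> c' \<le> ennreal (w x)"
    unfolding ess_inf_on_def less_Sup_iff by auto
  from c'(2) show ?thesis
  proof eventually_elim
    case (elim x)
    show ?case
    proof
      assume "x \<in> ball z r"
      then have "ennreal c \<le> ennreal (w x)" using elim c'(1) by (meson less_imp_le order_trans)
      then have "ennreal (2 * C * B) * ennreal c \<le> ennreal (2 * C * B) * ennreal (w x)" by (intro mult_left_mono) auto
      moreover have "ennreal (2 * C * B) * ennreal c = ennreal W"
        using C B c by (simp add: ennreal_mult[symmetric] c_def)
      ultimately show "weight_measure w (ball z r) \<le> ennreal (2 * C) * emeasure lebesgue (ball z r) * ennreal (w x)"
        using C B(2) unfolding W(1) B(1) by (simp add: ennreal_mult)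
    qed
  qed
qed simp

text \<open>For s > 1 the dual power of w has finite integral over balls, and \<open>epowr\<close>
  sends 0 to top for negative exponents, so w cannot vanish on a set of positive measure. For s = 1
  the lower bound by the mean value does the same.\<close>

lemma muckenhoupt_pos_ae:
  fixes w :: "'a::euclidean_space \<Rightarrow> real"
  assumes "muckenhoupt s w"
  shows "AE x in lebesgue. w x > 0"
proof -
  have w: "is_weight w" using assms by (simp add: muckenhoupt_def)
  note wf = is_weightD[OF w]
  have [measurable]: "w \<in> borel_measurable lebesgue" by (rule wf)
  \<comment> \<open>Only balls of positive weight are informative: if the mean of w were 0, the
    product in the A_s condition would be 0 even for an infinite dual mean.\<close>
  obtain N :: nat where N: "N > 0" "weight_measure w (ball 0 (real N)) > 0" using wf(4) by blast
  have ball: "AE x in lebesgue. x \<in> ball 0 r \<longrightarrow> w x > 0" if r: "r \<ge> real N" for r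
  proof -
    have r0: "r > 0" using r N(1) by linarith
    have "weight_measure w (ball 0 (real N)) \<le> weight_measure w (ball 0 r)"
      using r by (intro weight_measure_mono) auto
    then have Wpos: "weight_measure w (ball 0 r) > 0" using N(2) by (rule order_less_le_trans[rotated])
    show ?thesis
    proof (cases "s = 1")
      case True
      then obtain C where C: "C > 0" and A1: "\<And>z r. r > 0 \<Longrightarrow> ball_average z r (\<lambda>x. ennreal (w x)) \<le> ennreal C * ess_inf_on (ball z r) (\<lambda>x. ennreal (w x))"
        using assms unfolding muckenhoupt_def by auto
      from A1_lower_bound[OF w r0 C A1[OF r0], of 0] show ?thesis
      proof eventually_elim
        case (elim x)
        show ?case
        proof
          assume "x \<in> ball 0 r"
          then have "weight_measure w (ball 0 r) \<le> ennreal (2 * C) * emeasure lebesgue (ball (0::'a) r) * ennreal (w x)"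
            using elim by blast
          with Wpos have "0 < ennreal (2 * C) * emeasure lebesgue (ball (0::'a) r) * ennreal (w x)"
            by (rule order_less_le_trans)
          then have "ennreal (w x) \<noteq> 0" by auto
          then show "w x > 0" using wf(2)[of x] by (simp add: ennreal_eq_0_iff)
        qed
      qed
    next
      case False
      then obtain C where s: "s > 1" and C: "C > 0" and As: "\<And>z r. r > 0 \<Longrightarrow> ball_average z r (\<lambda>x. ennreal (w x)) *
           epowr (ball_average z r (\<lambda>x. epowr (ennreal (w x)) (- 1 / (s - 1)))) (s - 1) \<le> ennreal C"
        using assms unfolding muckenhoupt_def by auto
      define \<sigma> where "\<sigma> x = epowr (ennreal (w x)) (- 1 / (s - 1))" for x
      have [measurable]: "\<sigma> \<in> borel_measurable lebesgue" unfolding \<sigma>_def epowr_def using s by simp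
      have "ball_average 0 r (\<lambda>x. ennreal (w x)) \<noteq> 0"
        using Wpos ball_average_eq_0_iff[OF w r0, of 0] by simp
      moreover have "ball_average 0 r (\<lambda>x. ennreal (w x)) * epowr (ball_average 0 r \<sigma>) (s - 1) < top"
        using As[OF r0, of 0] unfolding \<sigma>_def by (rule order_le_less_trans) simp
      ultimately have "epowr (ball_average 0 r \<sigma>) (s - 1) \<noteq> top" by (auto simp: ennreal_mult_top)
      then have "ball_average 0 r \<sigma> \<noteq> top" using s by simp
      then have "(\<integral>\<^sup>+x\<in>ball 0 r. \<sigma> x \<partial>lebesgue) \<noteq> top"
        using emeasure_ball_pos_finite[OF r0, of "0::'a"] unfolding ball_average_def by (auto simp: ennreal_top_divide split: if_splits)
      then have "AE x in lebesgue. \<sigma> x * indicator (ball 0 r) x \<noteq> top"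
      proof -
        have [measurable]: "ball (0::'a) r \<in> sets lebesgue" by simp
        have "(\<lambda>x. \<sigma> x * indicator (ball 0 r) x) \<in> borel_measurable lebesgue" by measurable
        from nn_integral_PInf_AE[OF this] \<open>(\<integral>\<^sup>+x\<in>ball 0 r. \<sigma> x \<partial>lebesgue) \<noteq> top\<close> show ?thesis
          by (simp add: infinity_ennreal_def)
      qed
      then show ?thesis
      proof eventually_elim
        case (elim x)
        show ?case
        proof
          assume "x \<in> ball 0 r"
          then have "\<sigma> x \<noteq> top" using elim by simp
          then have "w x \<noteq> 0" using s by (auto simp: \<sigma>_def epowr_def)
          then show "w x > 0" using wf(2)[of x] by linarith
        qed
      qed
    qed
  qed
  have "AE x in lebesgue. \<forall>M::nat. x \<in> ball 0 (real (N + M)) \<longrightarrow> w x > 0"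
    unfolding AE_all_countable using ball by simp
  then show ?thesis
  proof eventually_elim
    case (elim x)
    obtain M :: nat where "norm x < real M" using reals_Archimedean2 by blast
    then have "x \<in> ball 0 (real (N + M))" by simp
    then show ?case using elim by blast
  qed
qed

lemma muckenhoupt_ball_pos:
  fixes w :: "'a::euclidean_space \<Rightarrow> real"
  assumes "muckenhoupt s w" and E: "E \<in> sets lebesgue" "emeasure lebesgue E > 0"
  shows "weight_measure w E > 0"
proof (rule ccontr)
  assume "\<not> ?thesis"
  then have 0: "weight_measure w E = 0" by simp
  have w: "is_weight w" using assms by (simp add: muckenhoupt_def)
  have [measurable]: "w \<in> borel_measurable lebesgue" "E \<in> sets lebesgue" using is_weightD(1)[OF w] E by auto
  have "AE x in lebesgue. ennreal (w x) * indicator E x = 0"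
    using 0 unfolding weight_measure_def by (subst (asm) nn_integral_0_iff_AE) auto
  then have "AE x in lebesgue. x \<notin> E"
    using muckenhoupt_pos_ae[OF assms(1)] by eventually_elim (auto simp: indicator_def split: if_splits)
  then have "E \<in> null_sets lebesgue" using E(1) by (simp add: AE_iff_null_sets)
  then show False using E(2) by (auto simp: null_sets_def)
qed

text \<open>\<open>A\<^sub>s \<subseteq> A\<^sub>q\<close> for \<open>s \<le> q\<close>, stated with the dual weight \<open>w powr (- 1 / (q - 1))\<close>.\<close>
lemma muckenhoupt_dual:
  fixes w :: "'a::euclidean_space \<Rightarrow> real"
  assumes "muckenhoupt s w" and q: "q > 1" "s \<le> q"
  defines "v \<equiv> \<lambda>x. w x powr (- 1 / (q - 1))"
  shows "dual_weight q w v"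
    and "\<exists>C>0. \<forall>z r. r > 0 \<longrightarrow> weight_measure v (ball z r) < top \<and>
      weight_measure w (ball z r) * epowr (weight_measure v (ball z r)) (q - 1) \<le> ennreal C * epowr (emeasure lebesgue (ball z r)) q"
proof -
  have w: "is_weight w" using assms by (simp add: muckenhoupt_def)
  have wm [measurable]: "w \<in> borel_measurable lebesgue" by (rule is_weightD[OF w])
  have ae: "AE x in lebesgue. w x > 0" by (rule muckenhoupt_pos_ae[OF assms(1)])
  have vm [measurable]: "v \<in> borel_measurable lebesgue" unfolding v_def by measurable
  show "dual_weight q w v"
    unfolding dual_weight_def using is_weightD(2)[OF w] ae by (auto simp: v_def[symmetric] wm vm) (auto simp: v_def)
  have pos: "weight_measure w (ball z r) > 0" if "r > 0" for z r
    using emeasure_ball_pos_finite[OF that, of z] by (intro muckenhoupt_ball_pos[OF assms(1)]) auto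
  show "\<exists>C>0. \<forall>z r. r > 0 \<longrightarrow> weight_measure v (ball z r) < top \<and>
      weight_measure w (ball z r) * epowr (weight_measure v (ball z r)) (q - 1) \<le> ennreal C * epowr (emeasure lebesgue (ball z r)) q"
  proof (cases "s = 1")
    case True
    then obtain C where C: "C > 0" and A1: "\<And>z r. r > 0 \<Longrightarrow> ball_average z r (\<lambda>x. ennreal (w x)) \<le> ennreal C * ess_inf_on (ball z r) (\<lambda>x. ennreal (w x))"
      using assms unfolding muckenhoupt_def by auto
    show ?thesis
    proof (intro exI[of _ "2 * C"] conjI allI impI)
      show "2 * C > 0" using C by simp
      fix z :: 'a and r :: real assume r: "r > 0"
      have [measurable]: "ball z r \<in> sets lebesgue" by simp
      obtain W where W: "weight_measure w (ball z r) = ennreal W" "W > 0"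
        using pos[OF r, of z] weight_measure_ball_finite[OF w, of z r] by (cases "weight_measure w (ball z r)" rule: ennreal_cases) (auto simp: le_less)
      obtain B where B: "emeasure lebesgue (ball z r) = ennreal B" "B > 0"
        using emeasure_ball_pos_finite[OF r, of z] by (cases "emeasure lebesgue (ball z r)" rule: ennreal_cases) auto
      define c where "c = W / (2 * C * B)"
      have c: "c > 0" using W B C by (simp add: c_def)
      have "AE x in lebesgue. x \<in> ball z r \<longrightarrow> v x \<le> c powr (- 1 / (q - 1))"
        using A1_lower_bound[OF w r C A1[OF r], of z] ae
      proof eventually_elim
        case (elim x)
        show ?case
        proof
          assume x: "x \<in> ball z r"
          have "ennreal W \<le> ennreal (2 * C * B * w x)"
            using elim x C B(2) unfolding W(1) B(1) by (simp add: ennreal_mult)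
          then have "W \<le> 2 * C * B * w x" using C B(2) elim by (subst (asm) ennreal_le_iff) auto
          then have "c \<le> w x" using C B(2) unfolding c_def by (simp add: field_simps)
          then show "v x \<le> c powr (- 1 / (q - 1))"
            unfolding v_def using c q by (intro powr_mono2') (auto simp: divide_nonpos_pos)
        qed
      qed
      then have "weight_measure v (ball z r) \<le> (\<integral>\<^sup>+x. ennreal (c powr (- 1 / (q - 1))) * indicator (ball z r) x \<partial>lebesgue)"
        unfolding weight_measure_def
        by (intro nn_integral_mono_AE, eventually_elim) (auto simp: indicator_def intro: ennreal_leI)
      also have "\<dots> = ennreal (c powr (- 1 / (q - 1)) * B)"
        using B by (subst nn_integral_cmult_indicator) (simp_all add: ennreal_mult)
      finally have V: "weight_measure v (ball z r) \<le> ennreal (c powr (- 1 / (q - 1)) * B)" .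
      then show "weight_measure v (ball z r) < top" by (rule order_le_less_trans) simp
      have "weight_measure w (ball z r) * epowr (weight_measure v (ball z r)) (q - 1) \<le> ennreal W * epowr (ennreal (c powr (- 1 / (q - 1)) * B)) (q - 1)"
        unfolding W(1) using q by (intro mult_left_mono epowr_mono V) auto
      also have "epowr (ennreal (c powr (- 1 / (q - 1)) * B)) (q - 1) = ennreal (1 / c * B powr (q - 1))"
      proof -
        have "(c powr (- 1 / (q - 1))) powr (q - 1) = c powr (- 1 / (q - 1) * (q - 1))" by (rule powr_powr)
        also have "- 1 / (q - 1) * (q - 1) = - 1" using q by simp
        also have "c powr (- 1) = 1 / c" using c by (simp add: powr_minus_divide)
        finally have "(c powr (- 1 / (q - 1)) * B) powr (q - 1) = 1 / c * B powr (q - 1)"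
          using B by (simp only: powr_mult)
        moreover have "epowr (ennreal (c powr (- 1 / (q - 1)) * B)) (q - 1) = ennreal ((c powr (- 1 / (q - 1)) * B) powr (q - 1))"
          using q B by (intro epowr_ennreal) auto
        ultimately show ?thesis by (simp only:)
      qed
      also have "ennreal W * ennreal (1 / c * B powr (q - 1)) = ennreal (2 * C * B powr q)"
      proof -
        have "W * (1 / c * B powr (q - 1)) = 2 * C * (B * B powr (q - 1))" using W C B by (simp add: c_def)
        also have "B * B powr (q - 1) = B powr q" using B by (simp add: powr_diff)
        finally show ?thesis using W c by (simp add: ennreal_mult[symmetric])
      qed
      also have "\<dots> = ennreal (2 * C) * epowr (emeasure lebesgue (ball z r)) q"
        using B C by (simp add: epowr_ennreal_pos ennreal_mult)
      finally show "weight_measure w (ball z r) * epowr (weight_measure v (ball z r)) (q - 1) \<le> ennreal (2 * C) * epowr (emeasure lebesgue (ball z r)) q" .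
    qed
  next
    case False
    then obtain C where s: "s > 1" and C: "C > 0" and As: "\<And>z r. r > 0 \<Longrightarrow> ball_average z r (\<lambda>x. ennreal (w x)) *
         epowr (ball_average z r (\<lambda>x. epowr (ennreal (w x)) (- 1 / (s - 1)))) (s - 1) \<le> ennreal C"
      using assms unfolding muckenhoupt_def by auto
    define u where "u x = w x powr (- 1 / (s - 1))" for x
    have um [measurable]: "u \<in> borel_measurable lebesgue" unfolding u_def by measurable
    show ?thesis
    proof (intro exI[of _ C] conjI allI impI C)
      fix z :: 'a and r :: real assume r: "r > 0"
      have [measurable]: "ball z r \<in> sets lebesgue" by simp
      obtain W where W: "weight_measure w (ball z r) = ennreal W" "W > 0"
        using pos[OF r, of z] weight_measure_ball_finite[OF w, of z r] by (cases "weight_measure w (ball z r)" rule: ennreal_cases) (auto simp: le_less)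
      obtain B where B: "emeasure lebesgue (ball z r) = ennreal B" "B > 0"
        using emeasure_ball_pos_finite[OF r, of z] by (cases "emeasure lebesgue (ball z r)" rule: ennreal_cases) auto
      have ueq: "(\<integral>\<^sup>+x\<in>ball z r. epowr (ennreal (w x)) (- 1 / (s - 1)) \<partial>lebesgue) = weight_measure u (ball z r)"
        unfolding weight_measure_def
        by (rule nn_integral_cong_AE, use ae in eventually_elim) (simp add: epowr_ennreal_pos u_def)
      have "ennreal W / ennreal B * epowr (weight_measure u (ball z r) / ennreal B) (s - 1) \<le> ennreal C"
        using As[OF r, of z] unfolding ball_average_def ueq B(1) weight_measure_def[symmetric] W(1) .
      then have As': "ennreal (W / B) * epowr (weight_measure u (ball z r) / ennreal B) (s - 1) \<le> ennreal C"
        using W B by (simp add: divide_ennreal)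
      have "epowr (weight_measure u (ball z r) / ennreal B) (s - 1) \<noteq> top"
      proof
        assume "epowr (weight_measure u (ball z r) / ennreal B) (s - 1) = top"
        then have "ennreal (W / B) * epowr (weight_measure u (ball z r) / ennreal B) (s - 1) = top"
          using W B by (simp add: ennreal_mult_top)
        then show False using As' by (simp add: top_unique)
      qed
      then have "weight_measure u (ball z r) / ennreal B \<noteq> top" using s by simp
      then have "weight_measure u (ball z r) \<noteq> top" by (auto simp: ennreal_top_divide)
      then obtain V where V: "weight_measure u (ball z r) = ennreal V" "V \<ge> 0" by (metis ennreal_cases)
      have "ennreal (W / B * (V / B) powr (s - 1)) \<le> ennreal C"
      proof -
        have "weight_measure u (ball z r) / ennreal B = ennreal (V / B)" unfolding V(1) using V B by (simp add: divide_ennreal)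
        then have "epowr (weight_measure u (ball z r) / ennreal B) (s - 1) = ennreal ((V / B) powr (s - 1))"
          using V B s by (simp only: epowr_ennreal) (simp add: epowr_ennreal)
        moreover have "ennreal (W / B * (V / B) powr (s - 1)) = ennreal (W / B) * ennreal ((V / B) powr (s - 1))"
          using W B by (intro ennreal_mult) auto
        ultimately show ?thesis using As' by (simp only:)
      qed
      then have WV: "W / B * (V / B) powr (s - 1) \<le> C" using C by (subst (asm) ennreal_le_iff) auto
      have WVs: "W * V powr (s - 1) \<le> C * B powr s"
      proof -
        have "W / B * (V / B) powr (s - 1) = W * V powr (s - 1) / B powr s"
          using B V by (simp add: powr_divide powr_diff)
        then show ?thesis using WV B by (simp add: pos_divide_le_eq)
      qed
      text \<open>Jensen's inequality for the power \<open>(q - 1) / (s - 1) \<ge> 1\<close>.\<close>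
      have Vq: "weight_measure v (ball z r) \<le> ennreal ((V * B powr ((q - 1) / (s - 1) - 1)) powr ((s - 1) / (q - 1)))"
      proof (cases "s = q")
        case True
        then have "weight_measure v (ball z r) = ennreal V" using V by (simp add: v_def u_def[abs_def])
        then show ?thesis using True q V B by simp
      next
        case False
        let ?\<rho> = "(q - 1) / (s - 1)"
        have \<rho>: "?\<rho> > 1" using False q s by simp
        have "epowr (\<integral>\<^sup>+x. ennreal (v x) * indicator (ball z r) x * indicator (ball z r) x \<partial>lebesgue) ?\<rho>
          \<le> (\<integral>\<^sup>+x. epowr (ennreal (v x) * indicator (ball z r) x) ?\<rho> \<partial>lebesgue)
            * epowr (\<integral>\<^sup>+x. epowr (indicator (ball z r) x) (?\<rho> / (?\<rho> - 1)) \<partial>lebesgue) (?\<rho> - 1)"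
          by (rule nn_integral_Holder[OF _ _ \<rho>]) measurable
        also have "(\<integral>\<^sup>+x. ennreal (v x) * indicator (ball z r) x * indicator (ball z r) x \<partial>lebesgue) = weight_measure v (ball z r)"
          unfolding weight_measure_def by (intro nn_integral_cong) (auto simp: indicator_def)
        also have "(\<integral>\<^sup>+x. epowr (ennreal (v x) * indicator (ball z r) x) ?\<rho> \<partial>lebesgue) = ennreal V"
          unfolding V(1)[symmetric] weight_measure_def
        proof (rule nn_integral_cong)
          fix x
          have "v x powr ?\<rho> = u x" unfolding v_def u_def powr_powr using q s by simp
          then show "epowr (ennreal (v x) * indicator (ball z r) x) ?\<rho> = ennreal (u x) * indicator (ball z r) x"
            using \<rho> by (auto simp: indicator_def epowr_ennreal v_def)
        qed
        also have "(\<integral>\<^sup>+x. epowr (indicator (ball z r) x) (?\<rho> / (?\<rho> - 1)) \<partial>lebesgue) = (\<integral>\<^sup>+x. indicator (ball z r) x \<partial>lebesgue)"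
        proof (intro nn_integral_cong)
          fix x :: 'a
          have p: "?\<rho> / (?\<rho> - 1) > 0" using \<rho> q s by (intro divide_pos_pos) auto
          show "epowr (indicator (ball z r) x) (?\<rho> / (?\<rho> - 1)) = indicator (ball z r) x"
            by (cases "x \<in> ball z r") (simp_all only: indicator_simps epowr_one epowr_0[OF p] not_False_eq_True simp_thms)
        qed
        also have "(\<integral>\<^sup>+x. indicator (ball z r) x \<partial>lebesgue) = ennreal B" using B by (simp add: nn_integral_indicator)
        finally have "epowr (weight_measure v (ball z r)) ?\<rho> \<le> ennreal (V * B powr (?\<rho> - 1))"
          using B V by (simp add: epowr_ennreal_pos ennreal_mult)
        then have "weight_measure v (ball z r) \<le> epowr (ennreal (V * B powr (?\<rho> - 1))) (1 / ?\<rho>)"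
          using \<rho> by (subst (asm) epowr_inverse_le_iff) auto
        also have "\<dots> = ennreal ((V * B powr (?\<rho> - 1)) powr (1 / ?\<rho>))"
          using \<rho> V q s by (intro epowr_ennreal) auto
        finally show ?thesis by simp
      qed
      then show "weight_measure v (ball z r) < top" by (rule order_le_less_trans) simp
      have "weight_measure w (ball z r) * epowr (weight_measure v (ball z r)) (q - 1)
        \<le> ennreal W * epowr (ennreal ((V * B powr ((q - 1) / (s - 1) - 1)) powr ((s - 1) / (q - 1)))) (q - 1)"
        unfolding W(1) using q by (intro mult_left_mono epowr_mono Vq) auto
      also have "epowr (ennreal ((V * B powr ((q - 1) / (s - 1) - 1)) powr ((s - 1) / (q - 1)))) (q - 1) = ennreal (V powr (s - 1) * B powr (q - s))"
      proof -
        have e: "((q - 1) / (s - 1) - 1) * (s - 1) = q - s" using s by (simp add: field_simps)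
        have "((V * B powr ((q - 1) / (s - 1) - 1)) powr ((s - 1) / (q - 1))) powr (q - 1) = (V * B powr ((q - 1) / (s - 1) - 1)) powr (s - 1)"
          using q by (simp add: powr_powr)
        also have "\<dots> = V powr (s - 1) * B powr (q - s)" using V B by (simp add: powr_mult powr_powr e)
        finally show ?thesis using q by (simp add: epowr_ennreal)
      qed
      also have "ennreal W * ennreal (V powr (s - 1) * B powr (q - s)) \<le> ennreal (C * B powr q)"
      proof -
        have "W * (V powr (s - 1) * B powr (q - s)) \<le> C * B powr s * B powr (q - s)"
          using WVs by (simp add: mult.assoc[symmetric] mult_right_mono)
        also have "\<dots> = C * B powr q" by (simp add: mult.assoc powr_add[symmetric])
        finally show ?thesis using W by (simp add: ennreal_mult[symmetric] ennreal_leI)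
      qed
      also have "\<dots> = ennreal C * epowr (emeasure lebesgue (ball z r)) q"
        using B C by (simp add: epowr_ennreal_pos ennreal_mult)
      finally show "weight_measure w (ball z r) * epowr (weight_measure v (ball z r)) (q - 1) \<le> ennreal C * epowr (emeasure lebesgue (ball z r)) q" .
    qed
  qed
qed

text \<open>The quantity playing the role of \<open>|E| / |B|\<close> in the comparison \<open>w(B) (|E| / |B|)\<^sup>s \<le> C w(E)\<close> is written
  without division, to stay in \<open>[0, \<infinity>]\<close>.\<close>
lemma muckenhoupt_lower_bound:
  fixes w :: "'a::euclidean_space \<Rightarrow> real"
  assumes "muckenhoupt s w"
  shows "\<exists>C>0. \<forall>z r E. r > 0 \<longrightarrow> E \<in> sets lebesgue \<longrightarrow> E \<subseteq> ball z r \<longrightarrow>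
    weight_measure w (ball z r) * epowr (emeasure lebesgue E) s
      \<le> ennreal C * epowr (emeasure lebesgue (ball z r)) s * weight_measure w E"
proof -
  have w: "is_weight w" using assms by (simp add: muckenhoupt_def)
  have [measurable]: "w \<in> borel_measurable lebesgue" by (rule is_weightD[OF w])
  show ?thesis
  proof (cases "s = 1")
    case True
    then obtain C where C: "C > 0" and A1: "\<And>z r. r > 0 \<Longrightarrow> ball_average z r (\<lambda>x. ennreal (w x)) \<le> ennreal C * ess_inf_on (ball z r) (\<lambda>x. ennreal (w x))"
      using assms unfolding muckenhoupt_def by auto
    show ?thesis
    proof (intro exI[of _ "2 * C"] conjI allI impI)
      show "2 * C > 0" using C by simp
      fix z :: 'a and r E assume r: "r > 0" and E [measurable]: "E \<in> sets lebesgue" and sub: "E \<subseteq> ball z r"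
      let ?W = "weight_measure w (ball z r)" and ?K = "ennreal (2 * C) * emeasure lebesgue (ball z r)"
      have "?W * emeasure lebesgue E = (\<integral>\<^sup>+x. ?W * indicator E x \<partial>lebesgue)" by (simp add: nn_integral_cmult_indicator)
      also have "\<dots> \<le> (\<integral>\<^sup>+x. ?K * (ennreal (w x) * indicator E x) \<partial>lebesgue)"
        using A1_lower_bound[OF w r C A1[OF r], of z]
      proof (intro nn_integral_mono_AE, eventually_elim)
        case (elim x)
        then show ?case using sub by (cases "x \<in> E") auto
      qed
      also have "\<dots> = ?K * weight_measure w E"
        unfolding weight_measure_def by (rule nn_integral_cmult) measurable
      finally show "?W * epowr (emeasure lebesgue E) s \<le> ennreal (2 * C) * epowr (emeasure lebesgue (ball z r)) s * weight_measure w E"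
        unfolding True by simp
    qed
  next
    case False
    then have s: "s > 1" using assms unfolding muckenhoupt_def by auto
    define v where "v x = w x powr (- 1 / (s - 1))" for x
    have dw: "dual_weight s w v" unfolding v_def by (rule muckenhoupt_dual(1)[OF assms s order_refl])
    obtain C where C: "C > 0" and Aq: "\<And>z r. r > 0 \<Longrightarrow> weight_measure w (ball z r) * epowr (weight_measure v (ball z r)) (s - 1) \<le> ennreal C * epowr (emeasure lebesgue (ball z r)) s"
      using muckenhoupt_dual(2)[OF assms s order_refl] unfolding v_def by blast
    show ?thesis
    proof (intro exI[of _ C] conjI allI impI C)
      fix z :: 'a and r E assume r: "r > 0" and E: "E \<in> sets lebesgue" and sub: "E \<subseteq> ball z r"
      show "weight_measure w (ball z r) * epowr (emeasure lebesgue E) s \<le> ennreal C * epowr (emeasure lebesgue (ball z r)) s * weight_measure w E"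
        unfolding weight_measure_def
        by (rule weight_lower_bound[OF s dw E _ sub Aq[OF r, unfolded weight_measure_def]]) simp
    qed
  qed
qed

section \<open>Weights of dyadic balls: doubling and reverse doubling\<close>

lemma dyadic_ball_cball: "dyadic_ball k = cball (0::'a::euclidean_space) (2 powr of_int k)"
  by (auto simp: dyadic_ball_def powr_real_of_int')

lemma emeasure_ball_0:
  "emeasure lebesgue (ball (0::'a::euclidean_space) (2 powr x)) = ennreal (unit_ball_vol (real DIM('a)) * 2 powr (x * real DIM('a)))"
  using emeasure_ball[of "2 powr x" "0::'a"] by (simp add: powr_realpow[symmetric] powr_powr)

lemma emeasure_dyadic_ball:
  "emeasure lebesgue (dyadic_ball k :: 'a::euclidean_space set) = ennreal (unit_ball_vol (real DIM('a)) * 2 powr (of_int k * real DIM('a)))"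
  using emeasure_cball[of "2 powr of_int k" "0::'a"] by (simp add: dyadic_ball_cball powr_realpow[symmetric] powr_powr)

lemma dyadic_ball_sets [measurable]: "dyadic_ball k \<in> sets lebesgue"
  by (simp add: dyadic_ball_cball)

lemma dyadic_ball_mono: "k \<le> l \<Longrightarrow> dyadic_ball k \<subseteq> dyadic_ball l"
  unfolding dyadic_ball_cball by (intro subset_cball powr_mono) auto

lemma dyadic_ball_subset_ball: "dyadic_ball k \<subseteq> ball (0::'a::euclidean_space) (2 powr (of_int k + 1))"
proof -
  have lt: "(2::real) powr of_int k < 2 powr (of_int k + 1)" by (rule powr_less_mono) auto
  show ?thesis unfolding dyadic_ball_cball
    by (rule subsetI) (simp only: mem_cball mem_ball order_le_less_trans[OF _ lt])
qed

definition dyadic_weight :: "('a::euclidean_space \<Rightarrow> real) \<Rightarrow> int \<Rightarrow> real" where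
  "dyadic_weight w k = enn2real (weight_measure w (dyadic_ball k))"

lemma unit_vol_pos: "unit_ball_vol (real n) > 0" by simp

lemma dyadic_weight:
  fixes w :: "'a::euclidean_space \<Rightarrow> real"
  assumes "muckenhoupt s w"
  shows "weight_measure w (dyadic_ball k) = ennreal (dyadic_weight w k)" "dyadic_weight w k > 0"
proof -
  have w: "is_weight w" using assms by (simp add: muckenhoupt_def)
  have fin: "weight_measure w (dyadic_ball k) < top" unfolding dyadic_ball_cball by (rule is_weightD(3)[OF w])
  have "weight_measure w (dyadic_ball k) > 0"
    by (rule muckenhoupt_ball_pos[OF assms dyadic_ball_sets]) (simp add: emeasure_dyadic_ball del: emeasure_completion)
  then show "weight_measure w (dyadic_ball k) = ennreal (dyadic_weight w k)" "dyadic_weight w k > 0"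
    using fin unfolding dyadic_weight_def by (simp_all add: less_top enn2real_positive_iff)
qed

lemma dyadic_weight_mono:
  fixes w :: "'a::euclidean_space \<Rightarrow> real"
  assumes "muckenhoupt s w" "k \<le> l"
  shows "dyadic_weight w k \<le> dyadic_weight w l"
proof -
  have "ennreal (dyadic_weight w k) \<le> ennreal (dyadic_weight w l)"
    unfolding dyadic_weight(1)[OF assms(1), symmetric] by (intro weight_measure_mono dyadic_ball_mono assms)
  then show ?thesis using dyadic_weight(2)[OF assms(1), of l] by (subst (asm) ennreal_le_iff) auto
qed

text \<open>Measuring the size of E by a dyadic ball of no larger volume serves both uses: E is a
  smaller ball for doubling and an annulus for reverse doubling.\<close>

lemma dyadic_weight_lower_bound:
  fixes w :: "'a::euclidean_space \<Rightarrow> real"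
  assumes w: "muckenhoupt s w" and s: "s \<ge> 1"
  shows "\<exists>C>0. \<forall>k l E. E \<in> sets lebesgue \<longrightarrow> E \<subseteq> dyadic_ball k \<longrightarrow>
    emeasure lebesgue (dyadic_ball l :: 'a set) \<le> emeasure lebesgue E \<longrightarrow>
    ennreal (dyadic_weight w k) \<le> ennreal (C * 2 powr (s * real DIM('a) * of_int (k - l))) * weight_measure w E"
proof -
  obtain C where C: "C > 0" and lb: "\<And>z r E. r > 0 \<Longrightarrow> E \<in> sets lebesgue \<Longrightarrow> E \<subseteq> ball z r \<Longrightarrow>
    weight_measure w (ball z r) * epowr (emeasure lebesgue E) s
      \<le> ennreal C * epowr (emeasure lebesgue (ball z r)) s * weight_measure w E"
    using muckenhoupt_lower_bound[OF w] by blast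
  let ?n = "real DIM('a)" and ?c = "unit_ball_vol (real DIM('a))"
  show ?thesis
  \<comment> \<open>The A_s bound is about open balls; the closed dyadic ball is placed in the open
    ball of twice its radius, at the cost of 2^(s n).\<close>
  proof (intro exI[of _ "C * 2 powr (s * ?n)"] conjI allI impI)
    show "C * 2 powr (s * ?n) > 0" using C by simp
    fix k l :: int and E :: "'a set"
    assume E: "E \<in> sets lebesgue" "E \<subseteq> dyadic_ball k" "emeasure lebesgue (dyadic_ball l :: 'a set) \<le> emeasure lebesgue E"
    let ?B = "ball (0::'a) (2 powr (of_int k + 1))"
    let ?x = "(?c * 2 powr (of_int l * ?n)) powr s" and ?y = "(?c * 2 powr ((of_int k + 1) * ?n)) powr s"
    have s0: "s > 0" using s by simp
    have c0: "?c \<noteq> 0" using unit_vol_pos[of "DIM('a)"] by (metis less_irrefl)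
    have "ennreal (dyadic_weight w k) * ennreal ?x \<le> weight_measure w ?B * epowr (emeasure lebesgue E) s"
    proof (rule mult_mono)
      show "ennreal (dyadic_weight w k) \<le> weight_measure w ?B"
        unfolding dyadic_weight(1)[OF w, symmetric] by (intro weight_measure_mono dyadic_ball_subset_ball)
      have "ennreal ?x = epowr (emeasure lebesgue (dyadic_ball l :: 'a set)) s"
        unfolding emeasure_dyadic_ball using s0 by (intro epowr_ennreal[symmetric]) (auto intro!: mult_nonneg_nonneg)
      also have "\<dots> \<le> epowr (emeasure lebesgue E) s" by (intro epowr_mono s0 E)
      finally show "ennreal ?x \<le> epowr (emeasure lebesgue E) s" .
    qed auto
    also have "\<dots> \<le> ennreal C * epowr (emeasure lebesgue ?B) s * weight_measure w E"
      using E dyadic_ball_subset_ball[of k] by (intro lb) auto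
    also have "epowr (emeasure lebesgue ?B) s = ennreal ?y"
      unfolding emeasure_ball_0 using s0 by (intro epowr_ennreal) (auto intro!: mult_nonneg_nonneg)
    also have "ennreal C * ennreal ?y * weight_measure w E = (ennreal (C * 2 powr (s * ?n) * 2 powr (s * ?n * of_int (k - l))) * weight_measure w E) * ennreal ?x"
    proof -
      have "C * ?y = C * 2 powr (s * ?n) * 2 powr (s * ?n * of_int (k - l)) * ?x"
      proof -
        have "?y = ?c powr s * 2 powr ((of_int k + 1) * ?n * s)" by (simp add: powr_mult powr_powr)
        also have "\<dots> = ?c powr s * (2 powr (s * ?n) * 2 powr (s * ?n * of_int (k - l)) * 2 powr (of_int l * ?n * s))"
          unfolding powr_add[symmetric] by (simp add: algebra_simps)
        also have "\<dots> = 2 powr (s * ?n) * 2 powr (s * ?n * of_int (k - l)) * ?x" by (simp add: powr_mult powr_powr)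
        finally show ?thesis by simp
      qed
      then have "ennreal (C * ?y) = ennreal (C * 2 powr (s * ?n) * 2 powr (s * ?n * of_int (k - l))) * ennreal ?x"
        using C by (simp only: ennreal_mult' powr_ge_zero)
          (simp add: ennreal_mult mult_ac)
      moreover have "ennreal (C * ?y) = ennreal C * ennreal ?y" using C by (intro ennreal_mult) auto
      ultimately show ?thesis by (simp only: mult_ac)
    qed
    finally show "ennreal (dyadic_weight w k) \<le> ennreal (C * 2 powr (s * ?n) * 2 powr (s * ?n * of_int (k - l))) * weight_measure w E"
      by (rule ennreal_mult_cancel_le) (use c0 in auto)
  qed
qed

lemma dyadic_doubling:
  fixes w :: "'a::euclidean_space \<Rightarrow> real"
  assumes w: "muckenhoupt s w" and s: "s \<ge> 1"
  shows "\<exists>C>0. \<forall>k l. l \<le> k \<longrightarrow> dyadic_weight w k \<le> C * 2 powr (s * real DIM('a) * of_int (k - l)) * dyadic_weight w l"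
proof -
  obtain C where C: "C > 0" and lb: "\<And>k l E. E \<in> sets lebesgue \<Longrightarrow> E \<subseteq> dyadic_ball k \<Longrightarrow>
    emeasure lebesgue (dyadic_ball l :: 'a set) \<le> emeasure lebesgue E \<Longrightarrow>
    ennreal (dyadic_weight w k) \<le> ennreal (C * 2 powr (s * real DIM('a) * of_int (k - l))) * weight_measure w E"
    using dyadic_weight_lower_bound[OF w s] by blast
  show ?thesis
  proof (intro exI[of _ C] conjI allI impI C)
    fix k l :: int assume "l \<le> k"
    then have "ennreal (dyadic_weight w k) \<le> ennreal (C * 2 powr (s * real DIM('a) * of_int (k - l))) * weight_measure w (dyadic_ball l)"
      by (intro lb dyadic_ball_mono) auto
    then have "ennreal (dyadic_weight w k) \<le> ennreal (C * 2 powr (s * real DIM('a) * of_int (k - l)) * dyadic_weight w l)"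
      unfolding dyadic_weight(1)[OF w] using C dyadic_weight(2)[OF w, of l] by (simp add: ennreal_mult)
    then show "dyadic_weight w k \<le> C * 2 powr (s * real DIM('a) * of_int (k - l)) * dyadic_weight w l"
      using C dyadic_weight(2)[OF w, of l] by (subst (asm) ennreal_le_iff) auto
  qed
qed

text \<open>The annulus has at least the volume of the inner ball because 2^n >= 2, so it carries at
  least the fraction 1 / D of the weight of the larger ball. One step inward thus loses a fixed
  factor, and iteration gives the power.\<close>

lemma dyadic_reverse_doubling:
  fixes w :: "'a::euclidean_space \<Rightarrow> real"
  assumes w: "muckenhoupt s w" and s: "s \<ge> 1"
  shows "\<exists>\<delta>>0. \<forall>k l. k \<le> l \<longrightarrow> dyadic_weight w k \<le> 2 powr (- \<delta> * of_int (l - k)) * dyadic_weight w l"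
proof -
  let ?n = "real DIM('a)" and ?c = "unit_ball_vol (real DIM('a))"
  let ?W = "dyadic_weight w"
  obtain C where C: "C > 0" and lb: "\<And>k l E. E \<in> sets lebesgue \<Longrightarrow> E \<subseteq> dyadic_ball k \<Longrightarrow>
    emeasure lebesgue (dyadic_ball l :: 'a set) \<le> emeasure lebesgue E \<Longrightarrow>
    ennreal (?W k) \<le> ennreal (C * 2 powr (s * real DIM('a) * of_int (k - l))) * weight_measure w E"
    using dyadic_weight_lower_bound[OF w s] by blast
  have wm [measurable]: "w \<in> borel_measurable lebesgue" using w is_weightD(1) by (auto simp: muckenhoupt_def)
  define D where "D = C * 2 powr (s * ?n)"
  have D: "D > 0" using C by (simp add: D_def)
  \<comment> \<open>The maximum with 1/2 keeps \<open>\<theta>\<close> positive, so that its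
    logarithm defines \<open>\<delta>\<close>.\<close>
  define \<theta> where "\<theta> = max (1 - 1 / D) (1 / 2)"
  have \<theta>: "0 < \<theta>" "\<theta> < 1" using D by (auto simp: \<theta>_def)
  define \<delta> where "\<delta> = - log 2 \<theta>"
  have \<delta>: "\<delta> > 0" using \<theta> by (simp add: \<delta>_def)
  have \<theta>\<delta>: "2 powr (- \<delta>) = \<theta>" using \<theta> by (simp add: \<delta>_def)
  have step: "?W k \<le> \<theta> * ?W (k + 1)" for k
  proof -
    define E where "E = (dyadic_ball (k + 1) - dyadic_ball k :: 'a set)"
    have Es [measurable]: "E \<in> sets lebesgue" unfolding E_def by (intro sets.Diff dyadic_ball_sets)
    have sub: "dyadic_ball k \<subseteq> (dyadic_ball (k + 1) :: 'a set)" by (rule dyadic_ball_mono) simp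
    have "emeasure lebesgue E = emeasure lebesgue (dyadic_ball (k + 1) :: 'a set) - emeasure lebesgue (dyadic_ball k :: 'a set)"
      unfolding E_def by (rule emeasure_Diff[OF _ dyadic_ball_sets dyadic_ball_sets sub]) (simp add: emeasure_dyadic_ball del: emeasure_completion)
    also have "\<dots> = ennreal (?c * 2 powr (of_int (k + 1) * ?n) - ?c * 2 powr (of_int k * ?n))"
      unfolding emeasure_dyadic_ball by (rule ennreal_minus) (auto intro!: mult_nonneg_nonneg)
    also have "\<dots> \<ge> emeasure lebesgue (dyadic_ball k :: 'a set)"
      unfolding emeasure_dyadic_ball
    proof (rule ennreal_leI)
      have "(2::real) \<le> 2 powr ?n" using powr_mono[of 1 ?n 2] DIM_positive[where 'a='a] by simp
      then have "2 * 2 powr (of_int k * ?n) \<le> 2 powr ?n * 2 powr (of_int k * ?n)" by (intro mult_right_mono) auto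
      also have "\<dots> = 2 powr (of_int (k + 1) * ?n)" unfolding powr_add[symmetric] by (simp add: algebra_simps)
      finally have "?c * (2 * 2 powr (of_int k * ?n)) \<le> ?c * 2 powr (of_int (k + 1) * ?n)"
        by (intro mult_left_mono) auto
      then show "?c * 2 powr (of_int k * ?n) \<le> ?c * 2 powr (of_int (k + 1) * ?n) - ?c * 2 powr (of_int k * ?n)" by simp
    qed
    finally have big: "emeasure lebesgue (dyadic_ball k :: 'a set) \<le> emeasure lebesgue E" .
    have "ennreal (?W (k + 1)) \<le> ennreal (C * 2 powr (s * ?n * of_int (k + 1 - k))) * weight_measure w E"
      by (rule lb[OF Es _ big]) (auto simp: E_def)
    then have le: "ennreal (?W (k + 1)) \<le> ennreal D * weight_measure w E" by (simp add: D_def)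
    have "weight_measure w (dyadic_ball (k + 1)) = weight_measure w E + weight_measure w (dyadic_ball k)"
      unfolding weight_measure_def
    proof (subst nn_integral_add[symmetric])
      show "(\<integral>\<^sup>+x\<in>dyadic_ball (k + 1). ennreal (w x) \<partial>lebesgue) = (\<integral>\<^sup>+x. ennreal (w x) * indicator E x + ennreal (w x) * indicator (dyadic_ball k) x \<partial>lebesgue)"
        using sub by (intro nn_integral_cong) (auto simp: indicator_def E_def)
    qed measurable
    then have "ennreal (?W (k + 1)) = weight_measure w E + ennreal (?W k)" unfolding dyadic_weight(1)[OF w] .
    then have "weight_measure w E = ennreal (?W (k + 1)) - ennreal (?W k)" by simp
    also have "\<dots> = ennreal (?W (k + 1) - ?W k)" using dyadic_weight(2)[OF w, of k] by (intro ennreal_minus) simp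
    finally have "ennreal (?W (k + 1)) \<le> ennreal (D * (?W (k + 1) - ?W k))"
      using le D dyadic_weight_mono[OF w, of k "k + 1"] by (simp add: ennreal_mult)
    then have "?W (k + 1) \<le> D * (?W (k + 1) - ?W k)"
      using D dyadic_weight_mono[OF w, of k "k + 1"] by (subst (asm) ennreal_le_iff) auto
    then have "?W (k + 1) / D \<le> ?W (k + 1) - ?W k" using D by (simp add: pos_divide_le_eq mult.commute)
    then have "?W k \<le> (1 - 1 / D) * ?W (k + 1)" by (simp add: algebra_simps)
    also have "\<dots> \<le> \<theta> * ?W (k + 1)" using dyadic_weight(2)[OF w, of "k + 1"] by (intro mult_right_mono) (auto simp: \<theta>_def)
    finally show ?thesis .
  qed
  have "?W k \<le> 2 powr (- \<delta> * of_int (l - k)) * ?W l" if "k \<le> l" for k l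
    using that
  proof (induction l rule: int_ge_induct)
    case (step l)
    have "?W k \<le> 2 powr (- \<delta> * of_int (l - k)) * (\<theta> * ?W (l + 1))"
      using step.IH \<open>\<And>k. ?W k \<le> \<theta> * ?W (k + 1)\<close>[of l] by (meson mult_left_mono order_trans powr_ge_zero)
    also have "\<dots> = (2 powr (- \<delta> * of_int (l - k)) * 2 powr (- \<delta>)) * ?W (l + 1)" by (simp add: \<theta>\<delta>)
    also have "2 powr (- \<delta> * of_int (l - k)) * 2 powr (- \<delta>) = 2 powr (- \<delta> * of_int (l + 1 - k))"
      unfolding powr_add[symmetric] by (simp add: algebra_simps)
    finally show ?case .
  qed simp
  then show ?thesis using \<delta> by blast
qed

section \<open>Geometric series over the integers and powers of weight ratios\<close>

lemma nn_integral_geometric_ge: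
  fixes a :: int and x :: real
  assumes x: "x > 0"
  shows "(\<integral>\<^sup>+j. ennreal (2 powr (- x * of_int j)) * indicator {a..} j \<partial>count_space UNIV)
    = ennreal (2 powr (- x * of_int a) / (1 - 2 powr (- x)))"
proof -
  let ?r = "2 powr (- x)"
  have r: "0 < ?r" "?r < 1" using x by (simp_all add: powr_less_one)
  have "(\<integral>\<^sup>+j. ennreal (2 powr (- x * of_int j)) * indicator {a..} j \<partial>count_space UNIV) = (\<integral>\<^sup>+j. ennreal (2 powr (- x * of_int j)) \<partial>count_space {a..})"
    by (simp add: nn_integral_count_space_indicator)
  also have "\<dots> = (\<integral>\<^sup>+i. ennreal (2 powr (- x * of_int (a + int i))) \<partial>count_space UNIV)"
  proof (rule nn_integral_bij_count_space[symmetric])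
    show "bij_betw (\<lambda>i. a + int i) UNIV {a..}"
      by (rule bij_betw_byWitness[where f'="\<lambda>j. nat (j - a)"]) auto
  qed
  also have "\<dots> = (\<Sum>i. ennreal (2 powr (- x * of_int a) * ?r ^ i))"
    unfolding nn_integral_count_space_nat
  proof (intro suminf_cong arg_cong[where f=ennreal])
    fix i
    have "2 powr (- x * of_int (a + int i)) = 2 powr (- x * of_int a) * 2 powr (- x * real i)"
      unfolding powr_add[symmetric] by (simp add: algebra_simps)
    also have "2 powr (- x * real i) = ?r ^ i" by (simp add: powr_realpow[symmetric] powr_powr)
    finally show "2 powr (- x * of_int (a + int i)) = 2 powr (- x * of_int a) * ?r ^ i" .
  qed
  also have "\<dots> = ennreal (\<Sum>i. 2 powr (- x * of_int a) * ?r ^ i)"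
    using r by (intro suminf_ennreal2 summable_mult summable_geometric) auto
  also have "(\<Sum>i. 2 powr (- x * of_int a) * ?r ^ i) = 2 powr (- x * of_int a) / (1 - ?r)"
    using r by (subst suminf_mult[OF summable_geometric]) (auto simp: suminf_geometric)
  finally show ?thesis .
qed

lemma nn_integral_geometric_two_sided:
  fixes k :: int and x :: real
  assumes x: "x > 0"
  shows "(\<integral>\<^sup>+l. ennreal (2 powr (- x * \<bar>of_int (k - l)\<bar>)) \<partial>count_space UNIV) \<le> ennreal (2 / (1 - 2 powr (- x)))"
proof -
  let ?r = "2 powr (- x)"
  have r: "0 < ?r" "?r < 1" using x by (simp_all add: powr_less_one)
  let ?g = "\<lambda>j::int. ennreal (2 powr (- x * of_int j)) * indicator {0..} j"
  have "(\<integral>\<^sup>+l. ennreal (2 powr (- x * \<bar>of_int (k - l)\<bar>)) \<partial>count_space UNIV) \<le> (\<integral>\<^sup>+l. ?g (k - l) + ?g (l - k) \<partial>count_space UNIV)"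
  proof (rule nn_integral_mono)
    fix l
    show "ennreal (2 powr (- x * \<bar>of_int (k - l)\<bar>)) \<le> ?g (k - l) + ?g (l - k)"
      by (cases "l \<le> k") (auto simp: indicator_def)
  qed
  also have "\<dots> = (\<integral>\<^sup>+l. ?g (k - l) \<partial>count_space UNIV) + (\<integral>\<^sup>+l. ?g (l - k) \<partial>count_space UNIV)"
    by (rule nn_integral_add) auto
  also have "(\<integral>\<^sup>+l. ?g (k - l) \<partial>count_space UNIV) = (\<integral>\<^sup>+j. ?g j \<partial>count_space UNIV)"
  proof -
    have "bij (\<lambda>l::int. k - l)" by (rule o_bij[of "\<lambda>l. k - l"]) (auto simp: fun_eq_iff)
    then show ?thesis by (rule nn_integral_bij_count_space)
  qed
  also have "(\<integral>\<^sup>+l. ?g (l - k) \<partial>count_space UNIV) = (\<integral>\<^sup>+j. ?g j \<partial>count_space UNIV)"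
  proof -
    have "bij (\<lambda>l::int. l - k)" by (rule o_bij[of "\<lambda>l. l + k"]) (auto simp: fun_eq_iff)
    then show ?thesis by (rule nn_integral_bij_count_space)
  qed
  also have "(\<integral>\<^sup>+j. ?g j \<partial>count_space UNIV) = ennreal (1 / (1 - ?r))"
    using nn_integral_geometric_ge[OF x, of 0] by simp
  also have "ennreal (1 / (1 - ?r)) + ennreal (1 / (1 - ?r)) = ennreal (2 / (1 - ?r))"
    using r by (simp add: ennreal_plus[symmetric] del: ennreal_plus)
  finally show ?thesis .
qed

lemma dyadic_weight_ratio_le:
  fixes w :: "'a::euclidean_space \<Rightarrow> real"
  assumes w: "muckenhoupt s w" and s: "s \<ge> 1" and \<gamma>: "\<gamma> > 0"
  shows "\<exists>C>0. \<exists>\<delta>>0. \<forall>k l. (l \<le> k \<longrightarrow> (dyadic_weight w k / dyadic_weight w l) powr \<gamma> \<le> C * 2 powr (s * real DIM('a) * \<gamma> * of_int (k - l)))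
    \<and> (k \<le> l \<longrightarrow> (dyadic_weight w k / dyadic_weight w l) powr \<gamma> \<le> C * 2 powr (- \<delta> * of_int (l - k)))"
proof -
  obtain C where C: "C > 0" and up: "\<And>k l. l \<le> k \<Longrightarrow> dyadic_weight w k \<le> C * 2 powr (s * real DIM('a) * of_int (k - l)) * dyadic_weight w l"
    using dyadic_doubling[OF w s] by blast
  obtain \<delta> where \<delta>: "\<delta> > 0" and down: "\<And>k l. k \<le> l \<Longrightarrow> dyadic_weight w k \<le> 2 powr (- \<delta> * of_int (l - k)) * dyadic_weight w l"
    using dyadic_reverse_doubling[OF w s] by blast
  have pos: "dyadic_weight w k > 0" for k by (rule dyadic_weight(2)[OF w])
  show ?thesis
  proof (rule exI[of _ "max 1 (C powr \<gamma>)"], rule conjI[rotated], rule exI[of _ "\<delta> * \<gamma>"], intro conjI allI impI)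
    fix k l :: int
    show "(dyadic_weight w k / dyadic_weight w l) powr \<gamma> \<le> max 1 (C powr \<gamma>) * 2 powr (s * real DIM('a) * \<gamma> * of_int (k - l))" if "l \<le> k"
    proof -
      have "dyadic_weight w k / dyadic_weight w l \<le> C * 2 powr (s * real DIM('a) * of_int (k - l))"
        using up[OF that] pos[of l] by (simp add: pos_divide_le_eq)
      then have "(dyadic_weight w k / dyadic_weight w l) powr \<gamma> \<le> (C * 2 powr (s * real DIM('a) * of_int (k - l))) powr \<gamma>"
        using pos[of k] pos[of l] \<gamma> by (intro powr_mono2) auto
      also have "\<dots> = C powr \<gamma> * 2 powr (s * real DIM('a) * \<gamma> * of_int (k - l))"
        using C by (simp add: powr_mult powr_powr mult_ac)
      also have "\<dots> \<le> max 1 (C powr \<gamma>) * 2 powr (s * real DIM('a) * \<gamma> * of_int (k - l))" by (intro mult_right_mono) auto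
      finally show ?thesis .
    qed
    show "(dyadic_weight w k / dyadic_weight w l) powr \<gamma> \<le> max 1 (C powr \<gamma>) * 2 powr (- (\<delta> * \<gamma>) * of_int (l - k))" if "k \<le> l"
    proof -
      have "dyadic_weight w k / dyadic_weight w l \<le> 2 powr (- \<delta> * of_int (l - k))"
        using down[OF that] pos[of l] by (simp add: pos_divide_le_eq)
      then have "(dyadic_weight w k / dyadic_weight w l) powr \<gamma> \<le> (2 powr (- \<delta> * of_int (l - k))) powr \<gamma>"
        using pos[of k] pos[of l] \<gamma> by (intro powr_mono2) auto
      also have "\<dots> = 1 * 2 powr (- (\<delta> * \<gamma>) * of_int (l - k))" by (simp add: powr_powr mult_ac)
      also have "\<dots> \<le> max 1 (C powr \<gamma>) * 2 powr (- (\<delta> * \<gamma>) * of_int (l - k))" by (intro mult_right_mono) auto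
      finally show ?thesis .
    qed
  qed (use \<delta> \<gamma> in auto)
qed

section \<open>Estimates on shells\<close>

text \<open>The matrix governing the interaction of the shells \<open>k\<close> and \<open>l\<close>: the kernel contributes the first factor,
  the two weights the others.\<close>
definition shell_matrix :: "real \<Rightarrow> real \<Rightarrow> ('a::euclidean_space \<Rightarrow> real) \<Rightarrow> ('a \<Rightarrow> real) \<Rightarrow> int \<Rightarrow> int \<Rightarrow> real" where
  "shell_matrix \<alpha> q w1 w2 k l = 2 powr (real DIM('a) * of_int (l - max k l))
     * (dyadic_weight w2 k / dyadic_weight w2 l) powr (1 / q) * (dyadic_weight w1 k / dyadic_weight w1 l) powr (\<alpha> / real DIM('a))"

lemma powr_decay_mono:
  fixes \<epsilon> \<delta> m :: real
  assumes "\<epsilon> \<le> \<delta>" "m \<ge> 0" shows "2 powr (- \<delta> * m) \<le> 2 powr (- \<epsilon> * m)"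
  using assms by (intro powr_mono) (auto simp: mult_right_mono)

text \<open>For k <= l reverse doubling gives the decay. For l <= k doubling allows growth with
  exponent n q2 / q + alpha q1, which the kernel factor with exponent n outweighs by the upper bound
  on alpha. In case (ii) alpha is positive and the two weights are treated separately; in case (i)
  alpha may be negative, so both ratios are first merged into one power.\<close>

lemma shell_matrix_decay:
  fixes w1 w2 :: "'a::euclidean_space \<Rightarrow> real"
  assumes q: "1 < q" and w: "muckenhoupt q1 w1" "muckenhoupt q2 w2"
    and hyp: "(w1 = w2 \<and> 1 \<le> q1 \<and> q1 = q2 \<and> q2 \<le> q \<and>
            - real DIM('a) * q1 / q < \<alpha> * q1 \<and> \<alpha> * q1 < real DIM('a) * (1 - q2 / q))
         \<or> (w1 \<noteq> w2 \<and> 1 \<le> q1 \<and> 1 \<le> q2 \<and> q2 \<le> q \<and>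
            0 < \<alpha> * q1 \<and> \<alpha> * q1 < real DIM('a) * (1 - q2 / q))"
  shows "\<exists>C>0. \<exists>\<epsilon>>0. \<forall>k l. shell_matrix \<alpha> q w1 w2 k l \<le> C * 2 powr (- \<epsilon> * \<bar>of_int (k - l)\<bar>)"
proof -
  let ?n = "real DIM('a)"
  let ?R1 = "\<lambda>k l. dyadic_weight w1 k / dyadic_weight w1 l" and ?R2 = "\<lambda>k l. dyadic_weight w2 k / dyadic_weight w2 l"
  have n: "?n > 0" by simp
  have pos: "?R1 k l > 0" "?R2 k l > 0" for k l using dyadic_weight(2)[OF w(1)] dyadic_weight(2)[OF w(2)] by auto
  \<comment> \<open>The gap in the upper bound on alpha is precisely the decay rate for l <=
    k.\<close>
  define \<epsilon>1 where "\<epsilon>1 = ?n * (1 - q2 / q) - \<alpha> * q1"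
  have \<epsilon>1: "\<epsilon>1 > 0" using hyp by (auto simp: \<epsilon>1_def)
  have main: "\<exists>C>0. \<exists>\<delta>>0. \<forall>k l. (l \<le> k \<longrightarrow> ?R2 k l powr (1/q) * ?R1 k l powr (\<alpha> / ?n) \<le> C * 2 powr ((?n * q2 / q + \<alpha> * q1) * of_int (k - l)))
    \<and> (k \<le> l \<longrightarrow> ?R2 k l powr (1/q) * ?R1 k l powr (\<alpha> / ?n) \<le> C * 2 powr (- \<delta> * of_int (l - k)))"
    using hyp
  proof
    assume h: "w1 = w2 \<and> 1 \<le> q1 \<and> q1 = q2 \<and> q2 \<le> q \<and>
            - real DIM('a) * q1 / q < \<alpha> * q1 \<and> \<alpha> * q1 < real DIM('a) * (1 - q2 / q)"
    \<comment> \<open>The lower bound on alpha says that this merged exponent is positive, which is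
      what makes reverse doubling usable.\<close>
    define \<gamma> where "\<gamma> = 1 / q + \<alpha> / ?n"
    have "- ?n * q1 / q < \<alpha> * q1" using h by blast
    then have "q1 * (- ?n / q) < q1 * \<alpha>" by (simp add: mult.commute)
    then have "- ?n / q < \<alpha>" using h by (subst (asm) mult_less_cancel_left_pos) auto
    then have "(- ?n / q) / ?n < \<alpha> / ?n" using n by (intro divide_strict_right_mono)
    then have \<gamma>: "\<gamma> > 0" using n by (simp add: \<gamma>_def)
    have eq: "?R2 k l powr (1/q) * ?R1 k l powr (\<alpha> / ?n) = ?R2 k l powr \<gamma>" for k l
      using h by (simp add: \<gamma>_def powr_add)
    have ex: "q2 * ?n * \<gamma> = ?n * q2 / q + \<alpha> * q1" using h n by (simp add: \<gamma>_def field_simps)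
    have "q2 \<ge> 1" using h by simp
    from dyadic_weight_ratio_le[OF w(2) this \<gamma>] show ?thesis unfolding eq ex .
  next
    assume h: "w1 \<noteq> w2 \<and> 1 \<le> q1 \<and> 1 \<le> q2 \<and> q2 \<le> q \<and>
            0 < \<alpha> * q1 \<and> \<alpha> * q1 < real DIM('a) * (1 - q2 / q)"
    have \<alpha>: "\<alpha> / ?n > 0" using h n by (auto simp: zero_less_mult_iff)
    have q0: "1 / q > 0" using q by simp
    have s: "q1 \<ge> 1" "q2 \<ge> 1" using h by auto
    obtain C1 \<delta>1 where C1: "C1 > 0" "\<delta>1 > 0" and b1: "\<And>k l. l \<le> k \<Longrightarrow> ?R1 k l powr (\<alpha> / ?n) \<le> C1 * 2 powr (q1 * ?n * (\<alpha> / ?n) * of_int (k - l))"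
      "\<And>k l. k \<le> l \<Longrightarrow> ?R1 k l powr (\<alpha> / ?n) \<le> C1 * 2 powr (- \<delta>1 * of_int (l - k))"
      using dyadic_weight_ratio_le[OF w(1) s(1) \<alpha>] by blast
    obtain C2 \<delta>2 where C2: "C2 > 0" "\<delta>2 > 0" and b2: "\<And>k l. l \<le> k \<Longrightarrow> ?R2 k l powr (1/q) \<le> C2 * 2 powr (q2 * ?n * (1/q) * of_int (k - l))"
      "\<And>k l. k \<le> l \<Longrightarrow> ?R2 k l powr (1/q) \<le> C2 * 2 powr (- \<delta>2 * of_int (l - k))"
      using dyadic_weight_ratio_le[OF w(2) s(2) q0] by blast
    show ?thesis
    proof (rule exI[of _ "C2 * C1"], rule conjI[rotated], rule exI[of _ "\<delta>2 + \<delta>1"], intro conjI allI impI)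
      fix k l :: int
      show "?R2 k l powr (1/q) * ?R1 k l powr (\<alpha> / ?n) \<le> C2 * C1 * 2 powr ((?n * q2 / q + \<alpha> * q1) * of_int (k - l))" if "l \<le> k"
      proof -
        have "?R2 k l powr (1/q) * ?R1 k l powr (\<alpha> / ?n) \<le> (C2 * 2 powr (q2 * ?n * (1/q) * of_int (k - l))) * (C1 * 2 powr (q1 * ?n * (\<alpha> / ?n) * of_int (k - l)))"
          using b1(1)[OF that] b2(1)[OF that] C2 by (intro mult_mono) auto
        also have "\<dots> = C2 * C1 * (2 powr (q2 * ?n * (1/q) * of_int (k - l)) * 2 powr (q1 * ?n * (\<alpha> / ?n) * of_int (k - l)))" by (simp only: mult_ac)
        also have "2 powr (q2 * ?n * (1/q) * of_int (k - l)) * 2 powr (q1 * ?n * (\<alpha> / ?n) * of_int (k - l)) = 2 powr ((?n * q2 / q + \<alpha> * q1) * of_int (k - l))"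
          unfolding powr_add[symmetric] using n by (simp add: field_simps)
        finally show ?thesis .
      qed
      show "?R2 k l powr (1/q) * ?R1 k l powr (\<alpha> / ?n) \<le> C2 * C1 * 2 powr (- (\<delta>2 + \<delta>1) * of_int (l - k))" if "k \<le> l"
      proof -
        have "?R2 k l powr (1/q) * ?R1 k l powr (\<alpha> / ?n) \<le> (C2 * 2 powr (- \<delta>2 * of_int (l - k))) * (C1 * 2 powr (- \<delta>1 * of_int (l - k)))"
          using b1(2)[OF that] b2(2)[OF that] C2 by (intro mult_mono) auto
        also have "\<dots> = C2 * C1 * (2 powr (- \<delta>2 * of_int (l - k)) * 2 powr (- \<delta>1 * of_int (l - k)))" by (simp only: mult_ac)
        also have "2 powr (- \<delta>2 * of_int (l - k)) * 2 powr (- \<delta>1 * of_int (l - k)) = 2 powr (- (\<delta>2 + \<delta>1) * of_int (l - k))"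
          unfolding powr_add[symmetric] by (simp add: algebra_simps)
        finally show ?thesis .
      qed
    qed (use C1 C2 in auto)
  qed
  obtain C \<delta> where C: "C > 0" "\<delta> > 0"
    and up: "\<And>k l. l \<le> k \<Longrightarrow> ?R2 k l powr (1/q) * ?R1 k l powr (\<alpha> / ?n) \<le> C * 2 powr ((?n * q2 / q + \<alpha> * q1) * of_int (k - l))"
    and down: "\<And>k l. k \<le> l \<Longrightarrow> ?R2 k l powr (1/q) * ?R1 k l powr (\<alpha> / ?n) \<le> C * 2 powr (- \<delta> * of_int (l - k))"
    using main by blast
  define \<epsilon> where "\<epsilon> = min \<epsilon>1 \<delta>"
  have \<epsilon>: "\<epsilon> > 0" "\<epsilon> \<le> \<epsilon>1" "\<epsilon> \<le> \<delta>" using \<epsilon>1 C by (auto simp: \<epsilon>_def)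
  have "shell_matrix \<alpha> q w1 w2 k l \<le> C * 2 powr (- \<epsilon> * \<bar>of_int (k - l)\<bar>)" for k l
  proof (cases "l \<le> k")
    case True
    have "shell_matrix \<alpha> q w1 w2 k l = 2 powr (- ?n * of_int (k - l)) * (?R2 k l powr (1/q) * ?R1 k l powr (\<alpha> / ?n))"
      using True by (simp add: shell_matrix_def max_def algebra_simps)
    also have "\<dots> \<le> 2 powr (- ?n * of_int (k - l)) * (C * 2 powr ((?n * q2 / q + \<alpha> * q1) * of_int (k - l)))"
      by (intro mult_left_mono up True) auto
    also have "\<dots> = C * (2 powr (- ?n * of_int (k - l)) * 2 powr ((?n * q2 / q + \<alpha> * q1) * of_int (k - l)))" by (simp only: mult_ac)
    also have "2 powr (- ?n * of_int (k - l)) * 2 powr ((?n * q2 / q + \<alpha> * q1) * of_int (k - l)) = 2 powr (- \<epsilon>1 * of_int (k - l))"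
      unfolding powr_add[symmetric] by (simp add: \<epsilon>1_def algebra_simps)
    also have "C * 2 powr (- \<epsilon>1 * of_int (k - l)) \<le> C * 2 powr (- \<epsilon> * of_int (k - l))"
      using True C \<epsilon> by (intro mult_left_mono powr_decay_mono) auto
    finally show ?thesis using True by simp
  next
    case False
    then have kl: "k \<le> l" by simp
    have "shell_matrix \<alpha> q w1 w2 k l = ?R2 k l powr (1/q) * ?R1 k l powr (\<alpha> / ?n)"
      using kl by (simp add: shell_matrix_def max_def)
    also have "\<dots> \<le> C * 2 powr (- \<delta> * of_int (l - k))" by (rule down[OF kl])
    also have "\<dots> \<le> C * 2 powr (- \<epsilon> * of_int (l - k))"
      using kl C \<epsilon> by (intro mult_left_mono powr_decay_mono) auto
    finally show ?thesis using kl by simp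
  qed
  then show ?thesis using C \<epsilon> by blast
qed

text \<open>The exponent may have either sign: for a negative one the roles of k and l are
  interchanged.\<close>

lemma neighbour_weight_ratio:
  fixes w :: "'a::euclidean_space \<Rightarrow> real"
  assumes w: "muckenhoupt s w" and s: "s \<ge> 1"
  shows "\<exists>C>0. \<forall>k l. \<bar>k - l\<bar> \<le> 1 \<longrightarrow> (dyadic_weight w k / dyadic_weight w l) powr \<gamma> \<le> C"
proof -
  obtain C where C: "C > 0" and up: "\<And>k l. l \<le> k \<Longrightarrow> dyadic_weight w k \<le> C * 2 powr (s * real DIM('a) * of_int (k - l)) * dyadic_weight w l"
    using dyadic_doubling[OF w s] by blast
  define D where "D = max 1 (C * 2 powr (s * real DIM('a)))"
  have D: "D \<ge> 1" by (simp add: D_def)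
  have pos: "dyadic_weight w k > 0" for k by (rule dyadic_weight(2)[OF w])
  have step: "dyadic_weight w k / dyadic_weight w l \<le> D" if "\<bar>k - l\<bar> \<le> 1" for k l
  proof (cases "l < k")
    case True
    then have "k = l + 1" using that by simp
    then have "dyadic_weight w k \<le> C * 2 powr (s * real DIM('a)) * dyadic_weight w l"
      using up[of l k] by simp
    also have "\<dots> \<le> D * dyadic_weight w l"
      using pos[of l] by (intro mult_right_mono) (auto simp: D_def)
    finally have "dyadic_weight w k \<le> D * dyadic_weight w l" .
    then show ?thesis using pos[of l] by (simp add: pos_divide_le_eq)
  next
    case False
    then have "dyadic_weight w k / dyadic_weight w l \<le> 1"
      using dyadic_weight_mono[OF w, of k l] pos[of l] by (simp add: pos_divide_le_eq)
    then show ?thesis using D by simp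
  qed
  have "(dyadic_weight w k / dyadic_weight w l) powr \<gamma> \<le> D powr \<bar>\<gamma>\<bar>" if kl: "\<bar>k - l\<bar> \<le> 1" for k l
  proof (cases "\<gamma> \<ge> 0")
    case True
    then show ?thesis using step[OF kl] pos[of k] pos[of l] by (simp add: powr_mono2)
  next
    case False
    have "(dyadic_weight w k / dyadic_weight w l) powr \<gamma> = (dyadic_weight w l / dyadic_weight w k) powr (- \<gamma>)"
      using pos[of k] pos[of l] by (simp add: powr_divide powr_minus field_simps)
    also have "\<dots> \<le> D powr (- \<gamma>)"
      using False step[of l k] kl pos[of k] pos[of l] by (intro powr_mono2) auto
    finally show ?thesis using False by simp
  qed
  then show ?thesis using D by (intro exI[of _ "D powr \<bar>\<gamma>\<bar>"]) auto
qed

text \<open>Hoelder's inequality produces v(E)^(q-1), and the A_q condition bounds it by a multiple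
  of |B|^q / w(B) for a ball B of radius comparable to 2^l. The estimate is divided by the weight of
  the dyadic ball before the root is taken.\<close>

lemma shell_Holder:
  fixes w v :: "'a::euclidean_space \<Rightarrow> real"
  assumes w: "muckenhoupt s w" and q: "q > 1" "s \<le> q"
  shows "\<exists>C>0. \<forall>l E. \<forall>f\<in>borel_measurable lebesgue. E \<in> sets lebesgue \<longrightarrow> E \<subseteq> dyadic_ball l \<longrightarrow>
    (\<integral>\<^sup>+x\<in>E. ennreal \<bar>f x\<bar> \<partial>lebesgue)
      \<le> ennreal (C * 2 powr (real DIM('a) * of_int l) * dyadic_weight w l powr (- 1 / q)) * epowr (\<integral>\<^sup>+x\<in>E. ennreal (\<bar>f x\<bar> powr q) * ennreal (w x) \<partial>lebesgue) (1 / q)"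
proof -
  let ?n = "real DIM('a)" and ?c = "unit_ball_vol (real DIM('a))"
  define v where "v x = w x powr (- 1 / (q - 1))" for x
  have dw: "dual_weight q w v" unfolding v_def by (rule muckenhoupt_dual(1)[OF w q])
  obtain C where C: "C > 0" and Aq: "\<And>z r. r > 0 \<Longrightarrow> weight_measure w (ball z r) * epowr (weight_measure v (ball z r)) (q - 1) \<le> ennreal C * epowr (emeasure lebesgue (ball z r)) q"
    using muckenhoupt_dual(2)[OF w q] unfolding v_def by blast
  have q0: "q > 0" and qq: "1 / q > 0" using q by auto
  define K where "K = (C * (?c * 2 powr ?n) powr q) powr (1 / q)"
  have c0: "?c > 0" by (rule unit_vol_pos)
  have Kpos: "K > 0" using C c0 unfolding K_def by (metis less_irrefl mult_eq_0_iff powr_eq_0_iff powr_gt_zero zero_less_numeral)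
  show ?thesis
  proof (intro exI[of _ K] conjI allI ballI impI Kpos)
    fix l :: int and E :: "'a set" and f :: "'a \<Rightarrow> real"
    assume fm [measurable]: "f \<in> borel_measurable lebesgue" and E [measurable]: "E \<in> sets lebesgue" and sub: "E \<subseteq> dyadic_ball l"
    let ?B = "ball (0::'a) (2 powr (of_int l + 1))"
    let ?W = "dyadic_weight w l"
    let ?N = "\<integral>\<^sup>+x\<in>E. ennreal (\<bar>f x\<bar> powr q) * ennreal (w x) \<partial>lebesgue"
    have W: "?W > 0" by (rule dyadic_weight(2)[OF w])
    have "ennreal ?W * epowr (weight_measure v E) (q - 1) \<le> weight_measure w ?B * epowr (weight_measure v ?B) (q - 1)"
      unfolding dyadic_weight(1)[OF w, symmetric] using q sub dyadic_ball_subset_ball[of l]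
      by (intro mult_mono epowr_mono weight_measure_mono) auto
    also have "\<dots> \<le> ennreal C * epowr (emeasure lebesgue ?B) q" by (rule Aq) simp
    also have "epowr (emeasure lebesgue ?B) q = ennreal ((?c * 2 powr ((of_int l + 1) * ?n)) powr q)"
      unfolding emeasure_ball_0 using q0 c0 by (intro epowr_ennreal) auto
    also have "(?c * 2 powr ((of_int l + 1) * ?n)) powr q = (?c * 2 powr ?n) powr q * (2 powr (?n * of_int l)) powr q"
    proof -
      have "2 powr ((of_int l + 1) * ?n) = 2 powr ?n * 2 powr (?n * of_int l)"
        unfolding powr_add[symmetric] by (simp add: algebra_simps)
      then show ?thesis by (simp add: powr_mult mult.assoc)
    qed
    finally have V: "ennreal ?W * epowr (weight_measure v E) (q - 1) \<le> ennreal C * ennreal ((?c * 2 powr ?n) powr q * (2 powr (?n * of_int l)) powr q)" .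
    have "epowr (\<integral>\<^sup>+x\<in>E. ennreal \<bar>f x\<bar> \<partial>lebesgue) q
      \<le> (\<integral>\<^sup>+x\<in>E. epowr (ennreal \<bar>f x\<bar>) q * ennreal (w x) \<partial>lebesgue) * epowr (weight_measure v E) (q - 1)"
      unfolding weight_measure_def by (rule nn_integral_Holder_weight[OF q(1) dw]) measurable
    also have "(\<integral>\<^sup>+x\<in>E. epowr (ennreal \<bar>f x\<bar>) q * ennreal (w x) \<partial>lebesgue) = ?N"
      using q0 by (simp add: epowr_ennreal)
    finally have "ennreal ?W * epowr (\<integral>\<^sup>+x\<in>E. ennreal \<bar>f x\<bar> \<partial>lebesgue) q \<le> ennreal ?W * (?N * epowr (weight_measure v E) (q - 1))"
      by (rule mult_left_mono) simp
    also have "\<dots> = (ennreal ?W * epowr (weight_measure v E) (q - 1)) * ?N" by (simp only: mult_ac)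
    also have "\<dots> \<le> (ennreal C * ennreal ((?c * 2 powr ?n) powr q * (2 powr (?n * of_int l)) powr q)) * ?N"
      by (rule mult_right_mono[OF V]) simp
    finally have "ennreal ?W * epowr (\<integral>\<^sup>+x\<in>E. ennreal \<bar>f x\<bar> \<partial>lebesgue) q \<le> \<dots>" .
    then have "ennreal (1 / ?W) * (ennreal ?W * epowr (\<integral>\<^sup>+x\<in>E. ennreal \<bar>f x\<bar> \<partial>lebesgue) q)
      \<le> ennreal (1 / ?W) * ((ennreal C * ennreal ((?c * 2 powr ?n) powr q * (2 powr (?n * of_int l)) powr q)) * ?N)"
      by (rule mult_left_mono) simp
    also have "ennreal (1 / ?W) * (ennreal ?W * epowr (\<integral>\<^sup>+x\<in>E. ennreal \<bar>f x\<bar> \<partial>lebesgue) q) = epowr (\<integral>\<^sup>+x\<in>E. ennreal \<bar>f x\<bar> \<partial>lebesgue) q"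
    proof -
      have "ennreal (1 / ?W) * ennreal ?W = 1" using W by (simp add: ennreal_mult[symmetric])
      then show ?thesis by (simp only: mult.assoc[symmetric] mult_1)
    qed
    also have "ennreal (1 / ?W) * ((ennreal C * ennreal ((?c * 2 powr ?n) powr q * (2 powr (?n * of_int l)) powr q)) * ?N)
      = ennreal (1 / ?W * (C * ((?c * 2 powr ?n) powr q * (2 powr (?n * of_int l)) powr q))) * ?N"
      using W C by (simp only: ennreal_mult' powr_ge_zero mult_nonneg_nonneg mult.assoc less_imp_le divide_nonneg_pos zero_le_one)
    finally have "(\<integral>\<^sup>+x\<in>E. ennreal \<bar>f x\<bar> \<partial>lebesgue)
      \<le> epowr (ennreal (1 / ?W * (C * ((?c * 2 powr ?n) powr q * (2 powr (?n * of_int l)) powr q))) * ?N) (1 / q)"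
      by (subst (asm) epowr_inverse_le_iff[OF q0])
    also have "\<dots> = ennreal ((1 / ?W * (C * ((?c * 2 powr ?n) powr q * (2 powr (?n * of_int l)) powr q))) powr (1 / q)) * epowr ?N (1 / q)"
    proof -
      have "1 / ?W * (C * ((?c * 2 powr ?n) powr q * (2 powr (?n * of_int l)) powr q)) \<ge> 0"
        using W C by (intro mult_nonneg_nonneg) auto
      from epowr_ennreal[OF qq this] show ?thesis by (simp only: epowr_mult[OF qq])
    qed
    also have "(1 / ?W * (C * ((?c * 2 powr ?n) powr q * (2 powr (?n * of_int l)) powr q))) powr (1 / q) = K * 2 powr (?n * of_int l) * ?W powr (- 1 / q)"
    proof -
      have "1 / ?W * (C * ((?c * 2 powr ?n) powr q * (2 powr (?n * of_int l)) powr q)) = (1 / ?W) * ((C * (?c * 2 powr ?n) powr q) * (2 powr (?n * of_int l)) powr q)"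
        by (simp only: mult.assoc)
      also have "\<dots> powr (1 / q) = (1 / ?W) powr (1 / q) * (K * ((2 powr (?n * of_int l)) powr q) powr (1 / q))"
        unfolding K_def using W C by (simp only: powr_mult powr_ge_zero mult_nonneg_nonneg less_imp_le)
      also have "((2 powr (?n * of_int l)) powr q) powr (1 / q) = 2 powr (?n * of_int l)" using q0 by (simp add: powr_powr)
      also have "(1 / ?W) powr (1 / q) = ?W powr (- 1 / q)" using W by (simp add: powr_divide powr_minus_divide)
      finally show ?thesis by (simp only: mult_ac)
    qed
    finally show "(\<integral>\<^sup>+x\<in>E. ennreal \<bar>f x\<bar> \<partial>lebesgue) \<le> ennreal (K * 2 powr (?n * of_int l) * ?W powr (- 1 / q)) * epowr ?N (1 / q)" .
  qed
qed

text \<open>The square of the sum is estimated by its supremum times its sum, which replaces Minkowski's inequality.\<close>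
lemma tail_square_sum_le:
  fixes M :: "int \<Rightarrow> ennreal" and a :: "int \<Rightarrow> int" and n :: real
  assumes n: "n \<ge> 1"
  shows "epowr (\<integral>\<^sup>+j. (ennreal (2 powr (- (n * of_int j))) * (\<integral>\<^sup>+l. M l * indicator {a l..} j \<partial>count_space UNIV))\<^sup>2 \<partial>count_space UNIV) (1 / 2)
    \<le> ennreal (2 powr (1 / 2)) * (\<integral>\<^sup>+l. ennreal (2 powr (- (n * of_int (a l)))) * M l \<partial>count_space UNIV)"
proof -
  define s where "s = (\<integral>\<^sup>+l. ennreal (2 powr (- (n * of_int (a l)))) * M l \<partial>count_space UNIV)"
  define b where "b j = ennreal (2 powr (- (n * of_int j))) * (\<integral>\<^sup>+l. M l * indicator {a l..} j \<partial>count_space UNIV)" for j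
  have b_eq: "b j = (\<integral>\<^sup>+l. ennreal (2 powr (- (n * of_int j))) * (M l * indicator {a l..} j) \<partial>count_space UNIV)" for j
    unfolding b_def by (rule nn_integral_cmult[symmetric]) simp
  have b_le: "b j \<le> s" for j
    unfolding b_eq s_def
  proof (rule nn_integral_mono)
    fix l
    show "ennreal (2 powr (- (n * of_int j))) * (M l * indicator {a l..} j) \<le> ennreal (2 powr (- (n * of_int (a l)))) * M l"
    proof (cases "a l \<le> j")
      case True
      then have "2 powr (- (n * of_int j)) \<le> 2 powr (- (n * of_int (a l)))"
        using n by (intro powr_mono) (auto intro: mult_left_mono)
      then show ?thesis using True by (auto intro!: mult_right_mono ennreal_leI)
    qed simp
  qed
  have b_sum: "(\<integral>\<^sup>+j. b j \<partial>count_space UNIV) \<le> 2 * s"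
  proof -
    have "(\<integral>\<^sup>+j. b j \<partial>count_space UNIV) = (\<integral>\<^sup>+l. (\<integral>\<^sup>+j. ennreal (2 powr (- (n * of_int j))) * (M l * indicator {a l..} j) \<partial>count_space UNIV) \<partial>count_space UNIV)"
      unfolding b_eq by (rule nn_integral_count_space_nn_integral) auto
    also have "\<dots> \<le> (\<integral>\<^sup>+l. 2 * (ennreal (2 powr (- (n * of_int (a l)))) * M l) \<partial>count_space UNIV)"
    proof (rule nn_integral_mono)
      fix l
      have "(\<integral>\<^sup>+j. ennreal (2 powr (- (n * of_int j))) * (M l * indicator {a l..} j) \<partial>count_space UNIV)
        = (\<integral>\<^sup>+j. M l * (ennreal (2 powr (- n * of_int j)) * indicator {a l..} j) \<partial>count_space UNIV)"
        by (intro nn_integral_cong) (simp add: mult_ac)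
      also have "\<dots> = M l * (\<integral>\<^sup>+j. ennreal (2 powr (- n * of_int j)) * indicator {a l..} j \<partial>count_space UNIV)"
        by (rule nn_integral_cmult) simp
      also have "\<dots> = M l * ennreal (2 powr (- n * of_int (a l)) / (1 - 2 powr (- n)))"
        using n by (subst nn_integral_geometric_ge) auto
      also have "\<dots> \<le> M l * ennreal (2 * 2 powr (- (n * of_int (a l))))"
      proof (intro mult_left_mono ennreal_leI)
        have "(2::real) powr (- n) \<le> 2 powr (- 1)" using n by (intro powr_mono) auto
        then have h: "1 / 2 \<le> 1 - (2::real) powr (- n)" by (simp add: powr_minus)
        then have "2 powr (- (n * of_int (a l))) / (1 - 2 powr (- n)) \<le> 2 powr (- (n * of_int (a l))) / (1 / 2)"
          by (intro divide_left_mono) auto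
        then show "2 powr (- n * of_int (a l)) / (1 - 2 powr (- n)) \<le> 2 * 2 powr (- (n * of_int (a l)))" by simp
      qed simp
      also have "\<dots> = 2 * (ennreal (2 powr (- (n * of_int (a l)))) * M l)"
        by (simp add: ennreal_mult mult_ac)
      finally show "(\<integral>\<^sup>+j. ennreal (2 powr (- (n * of_int j))) * (M l * indicator {a l..} j) \<partial>count_space UNIV)
        \<le> 2 * (ennreal (2 powr (- (n * of_int (a l)))) * M l)" .
    qed
    also have "\<dots> = 2 * s" unfolding s_def by (rule nn_integral_cmult) simp
    finally show ?thesis .
  qed
  have "(\<integral>\<^sup>+j. (b j)\<^sup>2 \<partial>count_space UNIV) \<le> (\<integral>\<^sup>+j. s * b j \<partial>count_space UNIV)"
    unfolding power2_eq_square by (intro nn_integral_mono mult_right_mono b_le) simp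
  also have "\<dots> = s * (\<integral>\<^sup>+j. b j \<partial>count_space UNIV)" by (rule nn_integral_cmult) simp
  also have "\<dots> \<le> s * (2 * s)" by (intro mult_left_mono b_sum) simp
  also have "\<dots> = 2 * epowr s 2" by (simp add: epowr_two power2_eq_square mult_ac)
  finally have "epowr (\<integral>\<^sup>+j. (b j)\<^sup>2 \<partial>count_space UNIV) (1 / 2) \<le> epowr (2 * epowr s 2) (1 / 2)"
    by (intro epowr_mono) auto
  also have "\<dots> = epowr 2 (1 / 2) * epowr (epowr s 2) (1 / 2)" by (rule epowr_mult) simp
  also have "epowr (epowr s 2) (1 / 2) = s" by (subst epowr_epowr) auto
  also have "epowr 2 (1 / 2) = ennreal (2 powr (1 / 2))" using epowr_ennreal[of "1/2" 2] by simp
  finally show ?thesis unfolding b_def s_def .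
qed

text \<open>Covers the annuli of the homogeneous space and, continued by empty sets for negative indices, the shells of
  the nonhomogeneous space.\<close>
definition shell_family :: "(int \<Rightarrow> 'a::euclidean_space set) \<Rightarrow> bool" where
  "shell_family D \<longleftrightarrow> (\<forall>k. D k \<in> sets lebesgue \<and> D k \<subseteq> dyadic_ball k) \<and>
     (\<forall>k l. l < k \<longrightarrow> D l \<noteq> {} \<longrightarrow> D k \<inter> dyadic_ball (k - 1) = {}) \<and> (AE x in lebesgue. \<exists>k. x \<in> D k)"

text \<open>Points of shells at least two indices apart are farther apart than 2^(max k l - 2). Both
  lie within 2^j of a common point, so the scale j cannot be much smaller.\<close>

lemma shell_distance:
  fixes D :: "int \<Rightarrow> 'a::euclidean_space set"
  assumes D: "shell_family D" and x: "x \<in> D k" and z: "z \<in> D l" and kl: "2 \<le> \<bar>k - l\<bar>"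
    and xz: "norm (x - z) < 2 * 2 powr of_int j"
  shows "max k l - 2 \<le> j"
proof -
  have *: "max k l - 2 \<le> j" if x: "x \<in> D k" and z: "z \<in> D l" and kl: "l + 2 \<le> k" and xz: "norm (x - z) < 2 * 2 powr of_int j"
    for x z :: 'a and k l
  proof -
    have "D l \<noteq> {}" using z by auto
    moreover have "l < k" using kl by simp
    ultimately have "D k \<inter> dyadic_ball (k - 1) = {}" using D unfolding shell_family_def by blast
    then have "x \<notin> dyadic_ball (k - 1)" using x by blast
    then have x1: "norm x > 2 powr (of_int k - 1)" by (simp add: dyadic_ball_cball)
    have "z \<in> dyadic_ball l" using D z unfolding shell_family_def by blast
    then have "norm z \<le> 2 powr of_int l" by (simp add: dyadic_ball_cball)
    also have "\<dots> \<le> 2 powr (of_int k - 2)" using kl by (intro powr_mono) auto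
    finally have z1: "norm z \<le> 2 powr (of_int k - 2)" .
    have e1: "2 powr (of_int k - 1) = 2 * (2::real) powr (of_int k - 2)"
      using powr_add[of "2::real" 1 "of_int k - 2"] by simp
    have "norm x - norm z \<le> norm (x - z)" by (rule norm_triangle_ineq2)
    then have "2 powr (of_int k - 2) < norm (x - z)" using x1 z1 e1 by linarith
    also note xz
    also have "2 * 2 powr of_int j = (2::real) powr (of_int j + 1)" by (simp add: powr_add)
    finally have "of_int k - 2 < (of_int j + 1 :: real)" by simp
    then show ?thesis using kl by linarith
  qed
  show ?thesis
  proof (cases "l \<le> k")
    case True
    then show ?thesis using *[OF x z _ xz] kl by simp
  next
    case False
    then show ?thesis using *[OF z x] kl xz by (simp add: norm_minus_commute max.commute)
  qed
qed

text \<open>Off the three neighbouring shells almost every point lies in a distant shell l, which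
  the scale j reaches only if j >= max k l - 2.\<close>

lemma shell_complement_integral:
  fixes D :: "int \<Rightarrow> 'a::euclidean_space set"
  assumes D: "shell_family D" and x: "x \<in> D k" and [measurable]: "f \<in> borel_measurable lebesgue"
    and xy: "norm (x - y) < t" "t \<le> 2 powr of_int j"
  shows "(\<integral>\<^sup>+z. ennreal \<bar>f z\<bar> * indicator (cball y t - (\<Union>l\<in>{k-1..k+1}. D l)) z \<partial>lebesgue)
    \<le> (\<integral>\<^sup>+l. ((\<integral>\<^sup>+z\<in>D l. ennreal \<bar>f z\<bar> \<partial>lebesgue) * indicator {l. 2 \<le> \<bar>k - l\<bar>} l) * indicator {max k l - 2..} j \<partial>count_space UNIV)"
proof -
  have Ds [measurable]: "D l \<in> sets lebesgue" for l using D by (simp add: shell_family_def)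
  let ?c = "\<lambda>l. indicator {l. 2 \<le> \<bar>k - l\<bar>} l * indicator {max k l - 2..} j :: ennreal"
  have "(\<integral>\<^sup>+z. ennreal \<bar>f z\<bar> * indicator (cball y t - (\<Union>l\<in>{k-1..k+1}. D l)) z \<partial>lebesgue)
    \<le> (\<integral>\<^sup>+z. (\<integral>\<^sup>+l. (ennreal \<bar>f z\<bar> * indicator (D l) z) * ?c l \<partial>count_space UNIV) \<partial>lebesgue)"
  proof (rule nn_integral_mono_AE)
    have "AE z in lebesgue. \<exists>l. z \<in> D l" using D by (simp add: shell_family_def)
    then show "AE z in lebesgue. ennreal \<bar>f z\<bar> * indicator (cball y t - (\<Union>l\<in>{k-1..k+1}. D l)) z
      \<le> (\<integral>\<^sup>+l. (ennreal \<bar>f z\<bar> * indicator (D l) z) * ?c l \<partial>count_space UNIV)"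
    proof eventually_elim
      case (elim z)
      show ?case
      proof (cases "z \<in> cball y t - (\<Union>l\<in>{k-1..k+1}. D l)")
        case True
        obtain l where l: "z \<in> D l" using elim by blast
        have far: "2 \<le> \<bar>k - l\<bar>"
        proof (rule ccontr)
          assume "\<not> 2 \<le> \<bar>k - l\<bar>"
          then have "l \<in> {k-1..k+1}" by auto
          then show False using True l by blast
        qed
        have "norm (x - z) \<le> norm (x - y) + norm (y - z)" using norm_triangle_ineq[of "x - y" "y - z"] by simp
        then have "norm (x - z) < 2 * 2 powr of_int j" using xy True by (auto simp: dist_norm)
        then have "max k l - 2 \<le> j" by (rule shell_distance[OF D x l far])
        then have "ennreal \<bar>f z\<bar> * indicator (cball y t - (\<Union>l\<in>{k-1..k+1}. D l)) z = (ennreal \<bar>f z\<bar> * indicator (D l) z) * ?c l"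
          using True l far by (simp add: indicator_def)
        also have "\<dots> \<le> (\<integral>\<^sup>+l. (ennreal \<bar>f z\<bar> * indicator (D l) z) * ?c l \<partial>count_space UNIV)"
          by (rule nn_integral_ge_point) simp
        finally show ?thesis .
      qed simp
    qed
  qed
  also have "\<dots> = (\<integral>\<^sup>+l. (\<integral>\<^sup>+z. (ennreal \<bar>f z\<bar> * indicator (D l) z) * ?c l \<partial>lebesgue) \<partial>count_space UNIV)"
    by (rule nn_integral_count_space_nn_integral) auto
  also have "\<dots> = (\<integral>\<^sup>+l. ((\<integral>\<^sup>+z\<in>D l. ennreal \<bar>f z\<bar> \<partial>lebesgue) * indicator {l. 2 \<le> \<bar>k - l\<bar>} l) * indicator {max k l - 2..} j \<partial>count_space UNIV)"
  proof (intro nn_integral_cong)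
    fix l
    have "(\<integral>\<^sup>+z. (ennreal \<bar>f z\<bar> * indicator (D l) z) * ?c l \<partial>lebesgue) = (\<integral>\<^sup>+z\<in>D l. ennreal \<bar>f z\<bar> \<partial>lebesgue) * ?c l"
      by (rule nn_integral_multc) measurable
    then show "(\<integral>\<^sup>+z. (ennreal \<bar>f z\<bar> * indicator (D l) z) * ?c l \<partial>lebesgue)
      = ((\<integral>\<^sup>+z\<in>D l. ennreal \<bar>f z\<bar> \<partial>lebesgue) * indicator {l. 2 \<le> \<bar>k - l\<bar>} l) * indicator {max k l - 2..} j"
      by (simp only: mult.assoc)
  qed
  finally show ?thesis .
qed

definition shell_norm :: "real \<Rightarrow> ('a::euclidean_space \<Rightarrow> real) \<Rightarrow> 'a set \<Rightarrow> ('a \<Rightarrow> ennreal) \<Rightarrow> ennreal" where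
  "shell_norm q w E g = epowr (\<integral>\<^sup>+x\<in>E. epowr (g x) q * ennreal (w x) \<partial>lebesgue) (1 / q)"

text \<open>Neighbouring shells are covered by the weighted norm bound and get weight 1. For distant
  ones it is the size of the kernel at the smallest contributing scale times the Hoelder factor of
  shell l and the weight of shell k.\<close>

definition shell_kernel :: "real \<Rightarrow> ('a::euclidean_space \<Rightarrow> real) \<Rightarrow> int \<Rightarrow> int \<Rightarrow> real" where
  "shell_kernel q w k l = (if \<bar>k - l\<bar> \<le> 1 then 1
     else 2 powr (real DIM('a) * of_int (l - max k l)) * (dyadic_weight w k / dyadic_weight w l) powr (1 / q))"

lemma shell_norm_powr: "q > 0 \<Longrightarrow> epowr (shell_norm q w E g) q = (\<integral>\<^sup>+x\<in>E. epowr (g x) q * ennreal (w x) \<partial>lebesgue)"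
  unfolding shell_norm_def by (subst epowr_epowr) auto

lemma muckenhoupt_grid_square_bound:
  fixes w :: "'a::euclidean_space \<Rightarrow> real"
  assumes w: "muckenhoupt s w" and q: "q > 1" "s \<le> q" and \<beta>: "\<beta> > 0"
  shows "\<exists>C>0. \<forall>f\<in>borel_measurable lebesgue.
    (\<integral>\<^sup>+x. epowr (grid_square \<beta> f x) (q / 2) * ennreal (w x) \<partial>lebesgue)
    \<le> ennreal C * (\<integral>\<^sup>+x. ennreal (\<bar>f x\<bar> powr q) * ennreal (w x) \<partial>lebesgue)"
proof -
  define v where "v x = w x powr (- 1 / (q - 1))" for x
  let ?c = "unit_ball_vol (real DIM('a))"
  have isw: "is_weight w" using w by (simp add: muckenhoupt_def)
  have dw: "dual_weight q w v" unfolding v_def by (rule muckenhoupt_dual(1)[OF w q])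
  obtain C where C: "C > 0" and Aq: "\<And>z r. r > 0 \<Longrightarrow> weight_measure w (ball z r) * epowr (weight_measure v (ball z r)) (q - 1) \<le> ennreal C * epowr (emeasure lebesgue (ball z r)) q"
    and vfin: "\<And>z r. r > 0 \<Longrightarrow> weight_measure v (ball z r) < top"
    using muckenhoupt_dual(2)[OF w q] unfolding v_def by blast
  \<comment> \<open>The diameter of a cell is at most n 2^-i; the extra 1 makes the inclusion in an
    open ball strict.\<close>
  define R where "R = real DIM('a) + 1"
  have R: "R > 0" by (simp add: R_def)
  have c0: "?c > 0" by (rule unit_vol_pos)
  define Cw where "Cw = C * (?c * R ^ DIM('a)) powr q"
  have Cw: "Cw > 0" using C c0 R by (simp add: Cw_def del: unit_ball_vol_pos)
  have wc: "weighted_cells (grid_cell U) w v q Cw" for U :: "'a set"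
  proof (intro weighted_cells.intro grid.dyadic_cells_axioms weighted_cells_axioms.intro q(1) Cw dw)
    fix i :: int and x :: 'a
    let ?Q = "grid_cell U i x" and ?r = "R * 2 powr (- of_int i)"
    have r: "?r > 0" using R by simp
    have sub: "?Q \<subseteq> ball x ?r"
    proof
      fix y assume y: "y \<in> ?Q"
      have "norm (x - y) \<le> real DIM('a) * 2 powr (- of_int i)" by (rule grid.cell_diam[OF grid.cell_self y])
      also have "\<dots> < ?r" by (simp add: R_def)
      finally show "y \<in> ball x ?r" by (simp add: dist_norm)
    qed
    have W: "(\<integral>\<^sup>+y\<in>?Q. ennreal (w y) \<partial>lebesgue) \<le> weight_measure w (ball x ?r)"
      and V: "(\<integral>\<^sup>+y\<in>?Q. ennreal (v y) \<partial>lebesgue) \<le> weight_measure v (ball x ?r)"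
      using weight_measure_mono[OF sub] unfolding weight_measure_def[of _ ?Q] by auto
    show "(\<integral>\<^sup>+y\<in>?Q. ennreal (w y) \<partial>lebesgue) < top"
      using W weight_measure_ball_finite[OF isw] by (rule order_le_less_trans)
    show "(\<integral>\<^sup>+y\<in>?Q. ennreal (v y) \<partial>lebesgue) < top" using V vfin[OF r] by (rule order_le_less_trans)
    have "(\<integral>\<^sup>+y\<in>?Q. ennreal (w y) \<partial>lebesgue) * epowr (\<integral>\<^sup>+y\<in>?Q. ennreal (v y) \<partial>lebesgue) (q - 1)
      \<le> weight_measure w (ball x ?r) * epowr (weight_measure v (ball x ?r)) (q - 1)"
      using q by (intro mult_mono epowr_mono W V) auto
    also have "\<dots> \<le> ennreal C * epowr (emeasure lebesgue (ball x ?r)) q" by (rule Aq[OF r])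
    also have "emeasure lebesgue (ball x ?r) = ennreal ((?c * R ^ DIM('a)) * grid.vol TYPE('a) i)"
    proof -
      have "?r ^ DIM('a) = R ^ DIM('a) * grid.vol TYPE('a) i"
        unfolding grid.vol_def by (simp add: power_mult_distrib powr_realpow[symmetric] powr_powr mult.commute)
      then show ?thesis using emeasure_ball[of ?r x] r by (simp add: mult.assoc)
    qed
    also have "epowr (ennreal ((?c * R ^ DIM('a)) * grid.vol TYPE('a) i)) q = ennreal (((?c * R ^ DIM('a)) * grid.vol TYPE('a) i) powr q)"
      using q c0 R grid.vol_pos[where 'a='a, of i] by (intro epowr_ennreal) auto
    also have "ennreal C * ennreal (((?c * R ^ DIM('a)) * grid.vol TYPE('a) i) powr q) = ennreal (Cw * grid.vol TYPE('a) i powr q)"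
      unfolding Cw_def using C by (simp add: powr_mult ennreal_mult mult.assoc)
    finally show "(\<integral>\<^sup>+y\<in>?Q. ennreal (w y) \<partial>lebesgue) * epowr (\<integral>\<^sup>+y\<in>?Q. ennreal (v y) \<partial>lebesgue) (q - 1)
      \<le> ennreal (Cw * grid.vol TYPE('a) i powr q)" .
  qed
  show ?thesis by (rule grid_square_bound[OF \<beta> q(1) wc is_weightD(1)[OF isw]])
qed

text \<open>On D k the distant shells contribute at most a constant, so their norm is that constant
  times a power of the weight of the shell; the neighbouring ones are handled by the bound for
  \<open>grid_square\<close>.\<close>

lemma shell_estimate:
  fixes w :: "'a::euclidean_space \<Rightarrow> real"
  assumes \<beta>: "0 < \<beta>" "\<beta> \<le> 1" and w: "muckenhoupt s w" and q: "q > 1" "s \<le> q"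
  shows "\<exists>C>0. \<forall>D. shell_family D \<longrightarrow> (\<forall>f\<in>borel_measurable lebesgue. \<forall>k.
    shell_norm q w (D k) (intrinsic_S \<beta> f)
      \<le> ennreal C * (\<integral>\<^sup>+l. ennreal (shell_kernel q w k l) * shell_norm q w (D l) (\<lambda>x. ennreal \<bar>f x\<bar>) \<partial>count_space UNIV))"
proof -
  let ?n = "real DIM('a)"
  let ?W = "dyadic_weight w"
  have q0: "q > 0" and qq: "1 / q > 0" and q2: "q / 2 > 0" using q by auto
  have wm [measurable]: "w \<in> borel_measurable lebesgue" using w is_weightD(1) by (auto simp: muckenhoupt_def)
  obtain CG where CG: "CG > 0" and grid_bound: "\<And>f. f \<in> borel_measurable lebesgue \<Longrightarrow>
    (\<integral>\<^sup>+x. epowr (grid_square \<beta> f x) (q / 2) * ennreal (w x) \<partial>lebesgue) \<le> ennreal CG * (\<integral>\<^sup>+x. ennreal (\<bar>f x\<bar> powr q) * ennreal (w x) \<partial>lebesgue)"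
    using muckenhoupt_grid_square_bound[OF w q \<beta>(1)] by blast
  obtain CH where CH: "CH > 0" and holder: "\<And>l E f. f \<in> borel_measurable lebesgue \<Longrightarrow> E \<in> sets lebesgue \<Longrightarrow> E \<subseteq> dyadic_ball l \<Longrightarrow>
    (\<integral>\<^sup>+x\<in>E. ennreal \<bar>f x\<bar> \<partial>lebesgue) \<le> ennreal (CH * 2 powr (?n * of_int l) * ?W l powr (- 1 / q)) * epowr (\<integral>\<^sup>+x\<in>E. ennreal (\<bar>f x\<bar> powr q) * ennreal (w x) \<partial>lebesgue) (1 / q)"
    using shell_Holder[OF w q] by blast
  have Wpos: "?W k > 0" for k by (rule dyadic_weight(2)[OF w])
  define S0 where "S0 = split_const TYPE('a)"
  define S1 where "S1 = S0 powr q * 2 powr q"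
  define R2 :: real where "R2 = 2 powr (1 / 2)"
  \<comment> \<open>The factor 2^(2 n) pays for the two levels in
    \<open>max k l - 2\<close>.\<close>
  define H where "H = CH * 2 powr (2 * ?n)"
  define R where "R = S1 * (3 * CG + (R2 * H) powr q)"
  have S0: "S0 \<ge> 0" by (simp add: S0_def split_const_def)
  have S1: "S1 \<ge> 0" by (simp add: S1_def)
  have H: "H > 0" using CH by (simp add: H_def)
  have R: "R \<ge> 0" using S1 CG by (simp add: R_def)
  have kernel_pos: "shell_kernel q w k l \<ge> 0" for k l by (simp add: shell_kernel_def)
  show ?thesis
  proof (intro exI[of _ "R powr (1 / q) + 1"] conjI allI impI ballI)
    show "R powr (1 / q) + 1 > 0" by (simp add: add_nonneg_pos)
    fix D :: "int \<Rightarrow> 'a set" and f :: "'a \<Rightarrow> real" and k :: int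
    assume D: "shell_family D" and fm [measurable]: "f \<in> borel_measurable lebesgue"
    have Ds [measurable]: "D l \<in> sets lebesgue" and Dsub: "D l \<subseteq> dyadic_ball l" for l using D by (auto simp: shell_family_def)
    define N where "N l = shell_norm q w (D l) (\<lambda>x. ennreal \<bar>f x\<bar>)" for l
    define T where "T = (\<integral>\<^sup>+l. ennreal (shell_kernel q w k l) * N l \<partial>count_space UNIV)"
    define near where "near = {k-1..k+1}"
    define Dn where "Dn = (\<Union>l\<in>near. D l)"
    have Dns [measurable]: "Dn \<in> sets lebesgue" unfolding Dn_def near_def by (intro sets.finite_UN) auto
    define g where "g = (\<lambda>z. f z * indicator Dn z)"
    have gm [measurable]: "g \<in> borel_measurable lebesgue" unfolding g_def by measurable
    define M where "M l = (\<integral>\<^sup>+z\<in>D l. ennreal \<bar>f z\<bar> \<partial>lebesgue) * indicator {l. 2 \<le> \<bar>k - l\<bar>} l" for l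
    define s where "s = (\<integral>\<^sup>+l. ennreal (2 powr (- (?n * of_int (max k l - 2)))) * M l \<partial>count_space UNIV)"
    have Nq: "epowr (N l) q = (\<integral>\<^sup>+x\<in>D l. ennreal (\<bar>f x\<bar> powr q) * ennreal (w x) \<partial>lebesgue)" for l
      unfolding N_def shell_norm_powr[OF q0] by (simp add: epowr_ennreal q0)
    have N_near: "N l \<le> T" if "l \<in> near" for l
    proof -
      have "N l = ennreal (shell_kernel q w k l) * N l" using that by (auto simp: shell_kernel_def near_def)
      also have "\<dots> \<le> T" unfolding T_def by (rule nn_integral_ge_point) simp
      finally show ?thesis .
    qed
    have pw: "intrinsic_S \<beta> f x \<le> ennreal S0 * (epowr (grid_square \<beta> g x) (1 / 2) + ennreal R2 * s)" if x: "x \<in> D k" for x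
    proof -
      have "intrinsic_S \<beta> f x \<le> ennreal (split_const TYPE('a)) *
         (epowr (grid_square \<beta> (\<lambda>z. f z * indicator Dn z) x) (1 / 2)
          + epowr (\<integral>\<^sup>+j. (ennreal (2 powr (- (?n * of_int j))) * (\<integral>\<^sup>+l. M l * indicator {max k l - 2..} j \<partial>count_space UNIV))\<^sup>2 \<partial>count_space UNIV) (1 / 2))"
      proof (rule intrinsic_S_split[OF \<beta> fm Dns])
        fix j :: int and y :: 'a and t :: real assume "norm (x - y) < t" "t \<le> 2 powr of_int j"
        then show "(\<integral>\<^sup>+z. ennreal \<bar>f z\<bar> * indicator (cball y t - Dn) z \<partial>lebesgue) \<le> (\<integral>\<^sup>+l. M l * indicator {max k l - 2..} j \<partial>count_space UNIV)"
          unfolding Dn_def near_def M_def by (rule shell_complement_integral[OF D x fm])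
      qed
      also have "\<dots> \<le> ennreal S0 * (epowr (grid_square \<beta> g x) (1 / 2) + ennreal R2 * s)"
        unfolding S0_def g_def R2_def s_def
      proof (intro mult_left_mono add_left_mono tail_square_sum_le)
        show "1 \<le> ?n" using DIM_positive[where 'a='a] by linarith
      qed simp
      finally show ?thesis .
    qed
    have pwq: "epowr (intrinsic_S \<beta> f x) q \<le> ennreal S1 * (epowr (grid_square \<beta> g x) (q / 2) + epowr (ennreal R2 * s) q)" if x: "x \<in> D k" for x
    proof -
      have "epowr (intrinsic_S \<beta> f x) q \<le> epowr (ennreal S0 * (epowr (grid_square \<beta> g x) (1 / 2) + ennreal R2 * s)) q"
        by (intro epowr_mono q0 pw x)
      also have "\<dots> = ennreal (S0 powr q) * epowr (epowr (grid_square \<beta> g x) (1 / 2) + ennreal R2 * s) q"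
        using S0 q0 by (simp only: epowr_mult epowr_ennreal)
      also have "\<dots> \<le> ennreal (S0 powr q) * (ennreal (2 powr q) * (epowr (epowr (grid_square \<beta> g x) (1 / 2)) q + epowr (ennreal R2 * s) q))"
        by (intro mult_left_mono epowr_add_le q0) simp
      also have "\<dots> = ennreal S1 * (epowr (epowr (grid_square \<beta> g x) (1 / 2)) q + epowr (ennreal R2 * s) q)"
        unfolding S1_def by (simp only: ennreal_mult' powr_ge_zero mult.assoc)
      also have "epowr (epowr (grid_square \<beta> g x) (1 / 2)) q = epowr (grid_square \<beta> g x) (q / 2)"
        using q0 by (subst epowr_epowr) auto
      finally show ?thesis .
    qed
    have Gm [measurable]: "(\<lambda>x. epowr (grid_square \<beta> g x) (q / 2)) \<in> borel_measurable lebesgue"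
      using q2 by (intro borel_measurable_epowr) auto
    have "(\<integral>\<^sup>+x\<in>D k. epowr (intrinsic_S \<beta> f x) q * ennreal (w x) \<partial>lebesgue)
      \<le> (\<integral>\<^sup>+x. ennreal S1 * (epowr (grid_square \<beta> g x) (q / 2) * ennreal (w x) + epowr (ennreal R2 * s) q * (ennreal (w x) * indicator (D k) x)) \<partial>lebesgue)"
    proof (rule nn_integral_mono)
      fix x
      show "epowr (intrinsic_S \<beta> f x) q * ennreal (w x) * indicator (D k) x
        \<le> ennreal S1 * (epowr (grid_square \<beta> g x) (q / 2) * ennreal (w x) + epowr (ennreal R2 * s) q * (ennreal (w x) * indicator (D k) x))"
      proof (cases "x \<in> D k")
        case True
        have "epowr (intrinsic_S \<beta> f x) q * ennreal (w x) \<le> ennreal S1 * (epowr (grid_square \<beta> g x) (q / 2) + epowr (ennreal R2 * s) q) * ennreal (w x)"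
          by (intro mult_right_mono pwq True) simp
        then show ?thesis using True by (simp only: indicator_simps mult_1_right mult.assoc distrib_right)
      qed simp
    qed
    also have "\<dots> = ennreal S1 * ((\<integral>\<^sup>+x. epowr (grid_square \<beta> g x) (q / 2) * ennreal (w x) \<partial>lebesgue) + epowr (ennreal R2 * s) q * weight_measure w (D k))"
      unfolding weight_measure_def
      by (subst nn_integral_cmult, measurable, subst nn_integral_add, measurable, subst nn_integral_cmult, measurable)
    also have "\<dots> \<le> ennreal S1 * (ennreal (3 * CG) * epowr T q + ennreal ((R2 * H) powr q) * epowr T q)"
    proof (intro mult_left_mono add_mono)
      have "(\<integral>\<^sup>+x. epowr (grid_square \<beta> g x) (q / 2) * ennreal (w x) \<partial>lebesgue) \<le> ennreal CG * (\<integral>\<^sup>+x. ennreal (\<bar>g x\<bar> powr q) * ennreal (w x) \<partial>lebesgue)"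
        by (rule grid_bound[OF gm])
      also have "(\<integral>\<^sup>+x. ennreal (\<bar>g x\<bar> powr q) * ennreal (w x) \<partial>lebesgue) \<le> (\<integral>\<^sup>+x. (\<Sum>l\<in>near. ennreal (\<bar>f x\<bar> powr q) * ennreal (w x) * indicator (D l) x) \<partial>lebesgue)"
      proof (rule nn_integral_mono)
        fix x
        show "ennreal (\<bar>g x\<bar> powr q) * ennreal (w x) \<le> (\<Sum>l\<in>near. ennreal (\<bar>f x\<bar> powr q) * ennreal (w x) * indicator (D l) x)"
        proof (cases "x \<in> Dn")
          case True
          then obtain l where l: "l \<in> near" "x \<in> D l" by (auto simp: Dn_def)
          have "ennreal (\<bar>g x\<bar> powr q) * ennreal (w x) = ennreal (\<bar>f x\<bar> powr q) * ennreal (w x) * indicator (D l) x"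
            using True l by (simp add: g_def)
          also have "\<dots> \<le> (\<Sum>l\<in>near. ennreal (\<bar>f x\<bar> powr q) * ennreal (w x) * indicator (D l) x)"
            using l(1) by (rule member_le_sum) (auto simp: near_def)
          finally show ?thesis .
        qed (simp add: g_def)
      qed
      also have "\<dots> = (\<Sum>l\<in>near. epowr (N l) q)"
        unfolding Nq by (rule nn_integral_sum) measurable
      also have "\<dots> \<le> (\<Sum>l\<in>near. epowr T q)" by (intro sum_mono epowr_mono q0 N_near)
      also have "\<dots> = ennreal 3 * epowr T q" by (simp add: near_def)
      finally have "(\<integral>\<^sup>+x. epowr (grid_square \<beta> g x) (q / 2) * ennreal (w x) \<partial>lebesgue) \<le> ennreal CG * (ennreal 3 * epowr T q)"
        by (simp add: mult_left_mono)
      also have "ennreal CG * (ennreal 3 * epowr T q) = ennreal (3 * CG) * epowr T q"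
      proof -
        have "ennreal (3 * CG) = ennreal CG * ennreal 3" using CG by (subst ennreal_mult[symmetric]) (auto simp: mult.commute)
        then show ?thesis by (simp only: mult.assoc)
      qed
      finally show "(\<integral>\<^sup>+x. epowr (grid_square \<beta> g x) (q / 2) * ennreal (w x) \<partial>lebesgue) \<le> ennreal (3 * CG) * epowr T q" .
      \<comment> \<open>The constant s on D k has norm at most s times the 1/q-th power of the
        weight of the dyadic ball. \<open>shell_Holder\<close> turns the masses M l into shell
        norms, and the powers of 2 and of the weights combine to
        \<open>shell_kernel\<close>.\<close>
      have sT: "s * ennreal (?W k powr (1 / q)) \<le> ennreal H * T"
      proof -
        have "s * ennreal (?W k powr (1 / q)) = (\<integral>\<^sup>+l. ennreal (2 powr (- (?n * of_int (max k l - 2)))) * M l * ennreal (?W k powr (1 / q)) \<partial>count_space UNIV)"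
          unfolding s_def by (rule nn_integral_multc[symmetric]) simp
        also have "\<dots> \<le> (\<integral>\<^sup>+l. ennreal H * (ennreal (shell_kernel q w k l) * N l) \<partial>count_space UNIV)"
        proof (rule nn_integral_mono)
          fix l
          show "ennreal (2 powr (- (?n * of_int (max k l - 2)))) * M l * ennreal (?W k powr (1 / q)) \<le> ennreal H * (ennreal (shell_kernel q w k l) * N l)"
          proof (cases "2 \<le> \<bar>k - l\<bar>")
            case True
            let ?a = "2 powr (- (?n * of_int (max k l - 2)))" and ?b = "CH * 2 powr (?n * of_int l) * ?W l powr (- 1 / q)" and ?d = "?W k powr (1 / q)"
            have Ml: "M l \<le> ennreal ?b * N l"
            proof -
              have NN: "epowr (epowr (N l) q) (1 / q) = N l" using q0 by (subst epowr_epowr) auto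
              have "(\<integral>\<^sup>+x\<in>D l. ennreal \<bar>f x\<bar> \<partial>lebesgue) \<le> ennreal ?b * epowr (epowr (N l) q) (1 / q)"
                unfolding Nq by (rule holder[OF fm Ds Dsub])
              then have "(\<integral>\<^sup>+x\<in>D l. ennreal \<bar>f x\<bar> \<partial>lebesgue) \<le> ennreal ?b * N l" unfolding NN .
              then show ?thesis unfolding M_def using True by simp
            qed
            have "ennreal ?a * M l * ennreal ?d \<le> ennreal ?a * (ennreal ?b * N l) * ennreal ?d"
              by (intro mult_right_mono mult_left_mono Ml) auto
            also have "\<dots> = (ennreal ?a * ennreal ?b * ennreal ?d) * N l" by (simp only: mult_ac)
            also have "ennreal ?a * ennreal ?b * ennreal ?d = ennreal (?a * ?b * ?d)"
              using CH by (simp only: ennreal_mult mult_nonneg_nonneg powr_ge_zero less_imp_le)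
            also have "?a * ?b * ?d = H * shell_kernel q w k l"
            proof -
              have "2 powr (- (?n * of_int (max k l - 2))) * 2 powr (?n * of_int l) = 2 powr (2 * ?n) * 2 powr (?n * of_int (l - max k l))"
                unfolding powr_add[symmetric] by (simp add: algebra_simps)
              moreover have "?W l powr (- 1 / q) * ?d = (?W k / ?W l) powr (1 / q)"
                using Wpos[of k] Wpos[of l] by (simp add: powr_divide powr_minus_divide)
              moreover have "shell_kernel q w k l = 2 powr (?n * of_int (l - max k l)) * (?W k / ?W l) powr (1 / q)"
                using True by (simp add: shell_kernel_def)
              moreover have "?a * ?b * ?d = CH * (?a * 2 powr (?n * of_int l)) * (?W l powr (- 1 / q) * ?d)" by (simp only: mult_ac)
              ultimately show ?thesis unfolding H_def by (simp only: mult_ac)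
            qed
            also have "ennreal (H * shell_kernel q w k l) * N l = ennreal H * (ennreal (shell_kernel q w k l) * N l)"
              using H kernel_pos by (simp only: ennreal_mult less_imp_le mult.assoc)
            finally show ?thesis .
          qed (simp add: M_def)
        qed
        also have "\<dots> = ennreal H * T" unfolding T_def by (rule nn_integral_cmult) simp
        finally show ?thesis .
      qed
      have "epowr (ennreal R2 * s) q * weight_measure w (D k) \<le> epowr (ennreal R2 * s) q * ennreal (?W k)"
        unfolding dyadic_weight(1)[OF w, symmetric] by (intro mult_left_mono weight_measure_mono Dsub) simp
      also have "ennreal (?W k) = epowr (ennreal (?W k powr (1 / q))) q"
        using Wpos[of k] q0 by (simp add: epowr_ennreal powr_powr)
      also have "epowr (ennreal R2 * s) q * epowr (ennreal (?W k powr (1 / q))) q = epowr (ennreal R2 * (s * ennreal (?W k powr (1 / q)))) q"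
        by (simp only: epowr_mult[OF q0] mult.assoc)
      also have "\<dots> \<le> epowr (ennreal R2 * (ennreal H * T)) q"
        by (intro epowr_mono q0 mult_left_mono sT) simp
      also have "\<dots> = ennreal ((R2 * H) powr q) * epowr T q"
      proof -
        have "ennreal R2 * (ennreal H * T) = ennreal (R2 * H) * T" using H by (simp add: R2_def ennreal_mult mult.assoc)
        moreover have "R2 * H \<ge> 0" using H by (simp add: R2_def)
        ultimately show ?thesis by (simp only: epowr_mult[OF q0] epowr_ennreal[OF q0])
      qed
      finally show "epowr (ennreal R2 * s) q * weight_measure w (D k) \<le> ennreal ((R2 * H) powr q) * epowr T q" .
    qed simp
    also have "\<dots> = ennreal R * epowr T q"
    proof -
      have "ennreal (3 * CG) * epowr T q + ennreal ((R2 * H) powr q) * epowr T q = ennreal (3 * CG + (R2 * H) powr q) * epowr T q"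
        using CG by (simp add: distrib_right[symmetric])
      then show ?thesis unfolding R_def using S1 CG by (simp add: ennreal_mult mult.assoc)
    qed
    finally have "shell_norm q w (D k) (intrinsic_S \<beta> f) \<le> epowr (ennreal R * epowr T q) (1 / q)"
      unfolding shell_norm_def by (intro epowr_mono qq)
    also have "\<dots> = ennreal (R powr (1 / q)) * T"
      using R q0 by (simp add: epowr_mult epowr_ennreal epowr_epowr)
    also have "\<dots> \<le> ennreal (R powr (1 / q) + 1) * T"
      by (intro mult_right_mono ennreal_leI) auto
    finally show "shell_norm q w (D k) (intrinsic_S \<beta> f) \<le> ennreal (R powr (1 / q) + 1) *
      (\<integral>\<^sup>+l. ennreal (shell_kernel q w k l) * shell_norm q w (D l) (\<lambda>x. ennreal \<bar>f x\<bar>) \<partial>count_space UNIV)"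
      unfolding T_def N_def .
  qed
qed

section \<open>Herz spaces\<close>

text \<open>Multiplying the shell norms by the power of w1 turns \<open>shell_kernel\<close> into a
  matrix with decay in |k - l|; such a matrix acts boundedly on sequences for every p > 0. The
  constant is uniform over all shell families.\<close>

lemma shell_sum_bound:
  fixes w1 w2 :: "'a::euclidean_space \<Rightarrow> real"
  assumes \<beta>: "0 < \<beta>" "\<beta> \<le> 1" and p: "0 < p" and q: "1 < q"
    and w: "muckenhoupt q1 w1" "muckenhoupt q2 w2"
    and hyp: "(w1 = w2 \<and> 1 \<le> q1 \<and> q1 = q2 \<and> q2 \<le> q \<and>
            - real DIM('a) * q1 / q < \<alpha> * q1 \<and> \<alpha> * q1 < real DIM('a) * (1 - q2 / q))
         \<or> (w1 \<noteq> w2 \<and> 1 \<le> q1 \<and> 1 \<le> q2 \<and> q2 \<le> q \<and>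
            0 < \<alpha> * q1 \<and> \<alpha> * q1 < real DIM('a) * (1 - q2 / q))"
  shows "\<exists>C>0. \<forall>D. shell_family D \<longrightarrow> (\<forall>f\<in>borel_measurable lebesgue.
    (\<integral>\<^sup>+k. epowr (weight_measure w1 (dyadic_ball k)) (\<alpha> * p / real DIM('a)) * epowr (shell_norm q w2 (D k) (intrinsic_S \<beta> f)) p \<partial>count_space UNIV)
    \<le> ennreal C * (\<integral>\<^sup>+k. epowr (weight_measure w1 (dyadic_ball k)) (\<alpha> * p / real DIM('a)) * epowr (shell_norm q w2 (D k) (\<lambda>x. ennreal \<bar>f x\<bar>)) p \<partial>count_space UNIV))"
proof -
  let ?n = "real DIM('a)"
  let ?W = "dyadic_weight w1"
  have Wpos: "?W k > 0" for k by (rule dyadic_weight(2)[OF w(1)])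
  have q12: "1 \<le> q1" "q2 \<le> q" using hyp by auto
  obtain C1 where C1: "C1 > 0" and est: "\<And>D f k. shell_family D \<Longrightarrow> f \<in> borel_measurable lebesgue \<Longrightarrow>
    shell_norm q w2 (D k) (intrinsic_S \<beta> f)
      \<le> ennreal C1 * (\<integral>\<^sup>+l. ennreal (shell_kernel q w2 k l) * shell_norm q w2 (D l) (\<lambda>x. ennreal \<bar>f x\<bar>) \<partial>count_space UNIV)"
    using shell_estimate[OF \<beta> w(2) q q12(2)] by blast
  obtain C2 \<epsilon> where C2: "C2 > 0" and \<epsilon>: "\<epsilon> > 0" and decay: "\<And>k l. shell_matrix \<alpha> q w1 w2 k l \<le> C2 * 2 powr (- \<epsilon> * \<bar>of_int (k - l)\<bar>)"
    using shell_matrix_decay[OF q w hyp] by blast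
  obtain C3 where C3: "C3 > 0" and near: "\<And>k l. \<bar>k - l\<bar> \<le> 1 \<Longrightarrow> (?W k / ?W l) powr (\<alpha> / ?n) \<le> C3"
    using neighbour_weight_ratio[OF w(1) q12(1), of "\<alpha> / ?n"] by blast
  \<comment> \<open>Next to the diagonal the entries are bounded without decay; since |k - l| <= 1
    there, the factor 2^eps restores it.\<close>
  define C4 where "C4 = max C2 (C3 * 2 powr \<epsilon>)"
  have C4: "C4 > 0" using C2 by (simp add: C4_def less_max_iff_disj)
  have ker: "shell_kernel q w2 k l * (?W k / ?W l) powr (\<alpha> / ?n) \<le> C4 * 2 powr (- \<epsilon> * \<bar>of_int (k - l)\<bar>)" for k l
  proof (cases "\<bar>k - l\<bar> \<le> 1")
    case True
    have "\<epsilon> * \<bar>of_int (k - l)\<bar> \<le> \<epsilon> * 1" using True \<epsilon> by (intro mult_left_mono) linarith+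
    then have "1 \<le> 2 powr \<epsilon> * 2 powr (- \<epsilon> * \<bar>of_int (k - l)\<bar>)"
      unfolding powr_add[symmetric] by (intro ge_one_powr_ge_zero) auto
    then have "C3 * 1 \<le> C3 * (2 powr \<epsilon> * 2 powr (- \<epsilon> * \<bar>of_int (k - l)\<bar>))" using C3 by (intro mult_left_mono) auto
    also have "\<dots> = (C3 * 2 powr \<epsilon>) * 2 powr (- \<epsilon> * \<bar>of_int (k - l)\<bar>)" by (simp only: mult.assoc)
    also have "\<dots> \<le> C4 * 2 powr (- \<epsilon> * \<bar>of_int (k - l)\<bar>)" by (intro mult_right_mono) (auto simp: C4_def)
    finally have "C3 \<le> C4 * 2 powr (- \<epsilon> * \<bar>of_int (k - l)\<bar>)" by simp
    moreover have "shell_kernel q w2 k l * (?W k / ?W l) powr (\<alpha> / ?n) \<le> C3"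
      using near[OF True] True by (simp add: shell_kernel_def)
    ultimately show ?thesis by (rule order_trans[rotated])
  next
    case False
    then have "shell_kernel q w2 k l * (?W k / ?W l) powr (\<alpha> / ?n) = shell_matrix \<alpha> q w1 w2 k l"
      by (simp add: shell_kernel_def shell_matrix_def)
    also have "\<dots> \<le> C2 * 2 powr (- \<epsilon> * \<bar>of_int (k - l)\<bar>)" by (rule decay)
    also have "\<dots> \<le> C4 * 2 powr (- \<epsilon> * \<bar>of_int (k - l)\<bar>)" by (intro mult_right_mono) (auto simp: C4_def)
    finally show ?thesis .
  qed
  \<comment> \<open>The square root of the decay: \<open>epowr_nn_integral_count_le\<close> takes it
    twice, once for the sum over l and once for the p-th powers.\<close>
  define c where "c k l = ennreal (2 powr (- (\<epsilon> / 2) * \<bar>of_int (k - l)\<bar>))" for k l :: int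
  have cc: "c k l * c k l = ennreal (2 powr (- \<epsilon> * \<bar>of_int (k - l)\<bar>))" for k l
    unfolding c_def by (subst ennreal_mult[symmetric]) (auto simp: powr_add[symmetric])
  define A where "A = 2 / (1 - 2 powr (- (\<epsilon> / 2)))"
  define B where "B = 2 / (1 - 2 powr (- (\<epsilon> * p / 2)))"
  have A: "A > 0" using \<epsilon> by (simp add: A_def powr_less_one)
  have B: "B > 0" using \<epsilon> p by (simp add: B_def powr_less_one)
  have c_sum: "(\<integral>\<^sup>+l. c k l \<partial>count_space UNIV) \<le> ennreal A" for k
    unfolding c_def A_def using \<epsilon> by (intro nn_integral_geometric_two_sided) simp
  have cp_sum: "(\<integral>\<^sup>+k. epowr (c k l) p \<partial>count_space UNIV) \<le> ennreal B" for l
  proof -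
    have "epowr (c k l) p = ennreal (2 powr (- (\<epsilon> * p / 2) * \<bar>of_int (l - k)\<bar>))" for k
      unfolding c_def using p by (simp add: epowr_ennreal powr_powr abs_minus_commute mult_ac)
    then show ?thesis unfolding B_def
      using nn_integral_geometric_two_sided[of "\<epsilon> * p / 2" l] \<epsilon> p by simp
  qed
  define C where "C = (C1 * C4) powr p * (A powr p * B)"
  have C: "C > 0" using C1 C4 A B by (simp add: C_def)
  show ?thesis
  proof (intro exI[of _ C] conjI allI impI ballI C)
    fix D :: "int \<Rightarrow> 'a set" and f :: "'a \<Rightarrow> real"
    assume D: "shell_family D" and fm: "f \<in> borel_measurable lebesgue"
    define N where "N l = shell_norm q w2 (D l) (\<lambda>x. ennreal \<bar>f x\<bar>)" for l
    define NS where "NS k = shell_norm q w2 (D k) (intrinsic_S \<beta> f)" for k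
    define u where "u l = ennreal (?W l powr (\<alpha> / ?n)) * N l" for l
    define uS where "uS k = ennreal (?W k powr (\<alpha> / ?n)) * NS k" for k
    have weight: "epowr (weight_measure w1 (dyadic_ball k)) (\<alpha> * p / ?n) * epowr y p = epowr (ennreal (?W k powr (\<alpha> / ?n)) * y) p" for k y
    proof -
      have "epowr (weight_measure w1 (dyadic_ball k)) (\<alpha> * p / ?n) = ennreal (?W k powr (\<alpha> * p / ?n))"
        unfolding dyadic_weight(1)[OF w(1)] by (rule epowr_ennreal_pos[OF Wpos])
      also have "?W k powr (\<alpha> * p / ?n) = (?W k powr (\<alpha> / ?n)) powr p" by (simp add: powr_powr)
      also have "ennreal \<dots> = epowr (ennreal (?W k powr (\<alpha> / ?n))) p" using p by (intro epowr_ennreal[symmetric]) auto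
      finally show ?thesis by (simp only: epowr_mult[OF p])
    qed
    have uS_le: "uS k \<le> ennreal (C1 * C4) * (\<integral>\<^sup>+l. c k l * c k l * u l \<partial>count_space UNIV)" for k
    proof -
      have "uS k \<le> ennreal (?W k powr (\<alpha> / ?n)) * (ennreal C1 * (\<integral>\<^sup>+l. ennreal (shell_kernel q w2 k l) * N l \<partial>count_space UNIV))"
        unfolding uS_def NS_def N_def by (intro mult_left_mono est D fm) simp
      also have "\<dots> = ennreal C1 * (\<integral>\<^sup>+l. ennreal (?W k powr (\<alpha> / ?n)) * (ennreal (shell_kernel q w2 k l) * N l) \<partial>count_space UNIV)"
        by (subst nn_integral_cmult) (simp_all add: mult.left_commute)
      also have "\<dots> \<le> ennreal C1 * (\<integral>\<^sup>+l. ennreal C4 * (c k l * c k l * u l) \<partial>count_space UNIV)"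
      proof (intro mult_left_mono nn_integral_mono)
        fix l
        have "shell_kernel q w2 k l \<ge> 0" by (simp add: shell_kernel_def)
        have W: "?W k powr (\<alpha> / ?n) = (?W k / ?W l) powr (\<alpha> / ?n) * ?W l powr (\<alpha> / ?n)"
          using Wpos[of k] Wpos[of l] by (simp add: powr_divide)
        have "ennreal (?W k powr (\<alpha> / ?n)) * (ennreal (shell_kernel q w2 k l) * N l)
          = ennreal (shell_kernel q w2 k l * (?W k / ?W l) powr (\<alpha> / ?n)) * u l"
          unfolding W u_def using \<open>shell_kernel q w2 k l \<ge> 0\<close>
          by (simp only: ennreal_mult powr_ge_zero) (simp only: mult_ac)
        also have "\<dots> \<le> ennreal (C4 * 2 powr (- \<epsilon> * \<bar>of_int (k - l)\<bar>)) * u l"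
          by (intro mult_right_mono ennreal_leI ker) simp
        also have "\<dots> = ennreal C4 * (c k l * c k l * u l)"
          unfolding cc using C4 by (simp add: ennreal_mult mult.assoc)
        finally show "ennreal (?W k powr (\<alpha> / ?n)) * (ennreal (shell_kernel q w2 k l) * N l) \<le> ennreal C4 * (c k l * c k l * u l)" .
      qed simp
      also have "\<dots> = ennreal (C1 * C4) * (\<integral>\<^sup>+l. c k l * c k l * u l \<partial>count_space UNIV)"
        using C1 C4 by (subst nn_integral_cmult) (simp_all add: ennreal_mult mult.assoc)
      finally show ?thesis .
    qed
    have "(\<integral>\<^sup>+k. epowr (uS k) p \<partial>count_space UNIV)
      \<le> (\<integral>\<^sup>+k. ennreal ((C1 * C4) powr p * A powr p) * (\<integral>\<^sup>+l. epowr (c k l) p * epowr (u l) p \<partial>count_space UNIV) \<partial>count_space UNIV)"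
    proof (rule nn_integral_mono)
      fix k
      have "epowr (uS k) p \<le> epowr (ennreal (C1 * C4) * (\<integral>\<^sup>+l. c k l * c k l * u l \<partial>count_space UNIV)) p"
        by (intro epowr_mono p uS_le)
      also have "\<dots> = ennreal ((C1 * C4) powr p) * epowr (\<integral>\<^sup>+l. c k l * c k l * u l \<partial>count_space UNIV) p"
        using C1 C4 p by (simp add: epowr_mult epowr_ennreal)
      also have "\<dots> \<le> ennreal ((C1 * C4) powr p) * (epowr (\<integral>\<^sup>+l. c k l \<partial>count_space UNIV) p * (\<integral>\<^sup>+l. epowr (c k l) p * epowr (u l) p \<partial>count_space UNIV))"
        by (intro mult_left_mono epowr_nn_integral_count_le p) simp
      also have "\<dots> \<le> ennreal ((C1 * C4) powr p) * (epowr (ennreal A) p * (\<integral>\<^sup>+l. epowr (c k l) p * epowr (u l) p \<partial>count_space UNIV))"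
        by (intro mult_left_mono mult_right_mono epowr_mono p c_sum) auto
      also have "\<dots> = ennreal ((C1 * C4) powr p * A powr p) * (\<integral>\<^sup>+l. epowr (c k l) p * epowr (u l) p \<partial>count_space UNIV)"
        using A p by (simp add: epowr_ennreal ennreal_mult mult.assoc)
      finally show "epowr (uS k) p \<le> ennreal ((C1 * C4) powr p * A powr p) * (\<integral>\<^sup>+l. epowr (c k l) p * epowr (u l) p \<partial>count_space UNIV)" .
    qed
    also have "\<dots> = ennreal ((C1 * C4) powr p * A powr p) * (\<integral>\<^sup>+k. (\<integral>\<^sup>+l. epowr (c k l) p * epowr (u l) p \<partial>count_space UNIV) \<partial>count_space UNIV)"
      by (rule nn_integral_cmult) simp
    also have "(\<integral>\<^sup>+k. (\<integral>\<^sup>+l. epowr (c k l) p * epowr (u l) p \<partial>count_space UNIV) \<partial>count_space UNIV)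
      = (\<integral>\<^sup>+l. (\<integral>\<^sup>+k. epowr (c k l) p * epowr (u l) p \<partial>count_space UNIV) \<partial>count_space UNIV)"
      by (rule nn_integral_count_space_nn_integral) auto
    also have "\<dots> = (\<integral>\<^sup>+l. (\<integral>\<^sup>+k. epowr (c k l) p \<partial>count_space UNIV) * epowr (u l) p \<partial>count_space UNIV)"
      by (intro nn_integral_cong nn_integral_multc) simp
    also have "\<dots> \<le> (\<integral>\<^sup>+l. ennreal B * epowr (u l) p \<partial>count_space UNIV)"
      by (intro nn_integral_mono mult_right_mono cp_sum) simp
    also have "\<dots> = ennreal B * (\<integral>\<^sup>+l. epowr (u l) p \<partial>count_space UNIV)" by (rule nn_integral_cmult) simp
    also have "ennreal ((C1 * C4) powr p * A powr p) * (ennreal B * (\<integral>\<^sup>+l. epowr (u l) p \<partial>count_space UNIV)) = ennreal C * (\<integral>\<^sup>+l. epowr (u l) p \<partial>count_space UNIV)"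
      using B unfolding C_def by (simp add: ennreal_mult mult.assoc)
    finally have "(\<integral>\<^sup>+k. epowr (uS k) p \<partial>count_space UNIV) \<le> ennreal C * (\<integral>\<^sup>+l. epowr (u l) p \<partial>count_space UNIV)"
      by (simp add: mult_left_mono)
    then show "(\<integral>\<^sup>+k. epowr (weight_measure w1 (dyadic_ball k)) (\<alpha> * p / ?n) * epowr (shell_norm q w2 (D k) (intrinsic_S \<beta> f)) p \<partial>count_space UNIV)
      \<le> ennreal C * (\<integral>\<^sup>+k. epowr (weight_measure w1 (dyadic_ball k)) (\<alpha> * p / ?n) * epowr (shell_norm q w2 (D k) (\<lambda>x. ennreal \<bar>f x\<bar>)) p \<partial>count_space UNIV)"
      unfolding weight N_def[symmetric] NS_def[symmetric] u_def[symmetric] uS_def[symmetric] .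
  qed
qed

section \<open>The two Herz norms as sums over shell families\<close>

lemma shell_norm_eq_Lq_norm:
  assumes "q > 0"
  shows "Lq_norm q w (\<lambda>x. g x * indicator E x) = shell_norm q w E g"
  unfolding Lq_norm_def shell_norm_def using assms
  by (intro arg_cong2[where f=epowr] nn_integral_cong) (auto simp: indicator_def)

lemma annuli_shell_family: "shell_family (dyadic_annulus :: int \<Rightarrow> 'a::euclidean_space set)"
  unfolding shell_family_def
proof (intro conjI allI impI)
  fix k l :: int
  show "dyadic_annulus k \<in> sets lebesgue" unfolding dyadic_annulus_def by (intro sets.Diff dyadic_ball_sets)
  show "dyadic_annulus k \<subseteq> dyadic_ball k" by (auto simp: dyadic_annulus_def)
  show "dyadic_annulus k \<inter> dyadic_ball (k - 1) = {}" by (auto simp: dyadic_annulus_def)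
next
  \<comment> \<open>The origin lies in no annulus, which is why \<open>shell_family\<close> asks for
    a covering only almost everywhere.\<close>
  have "AE x in lebesgue. x \<noteq> (0::'a)" by (rule AE_I'[of "{0}"]) (auto simp: negligible_iff_null_sets[symmetric])
  then show "AE x in lebesgue. \<exists>k. (x::'a) \<in> dyadic_annulus k"
  proof eventually_elim
    case (elim x)
    then obtain k :: int where k: "2 powr (of_int k - 1) < norm x" "norm x \<le> 2 powr of_int k"
      using dyadic_shell[of "norm x"] by auto
    then have "x \<in> dyadic_annulus k" by (simp add: dyadic_annulus_def dyadic_ball_cball)
    then show ?case ..
  qed
qed

definition nonhom_family :: "int \<Rightarrow> 'a::euclidean_space set" where
  "nonhom_family k = (if k < 0 then {} else nonhom_shell (nat k))"

lemma nonhom_shell_family: "shell_family (nonhom_family :: int \<Rightarrow> 'a::euclidean_space set)"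
  unfolding shell_family_def
proof (intro conjI allI impI)
  fix k l :: int
  show "nonhom_family k \<in> sets lebesgue"
    by (simp add: nonhom_family_def nonhom_shell_def dyadic_annulus_def dyadic_ball_cball)
  show "nonhom_family k \<subseteq> dyadic_ball k" by (auto simp: nonhom_family_def nonhom_shell_def dyadic_annulus_def)
  assume "l < k" "nonhom_family l \<noteq> ({} :: 'a set)"
  then have "0 < k" by (auto simp: nonhom_family_def split: if_splits)
  then show "nonhom_family k \<inter> dyadic_ball (k - 1) = ({} :: 'a set)"
    by (auto simp: nonhom_family_def nonhom_shell_def dyadic_annulus_def)
next
  have "\<exists>k. x \<in> nonhom_family k" for x :: 'a
  proof (cases "norm x \<le> 1")
    case True
    then have "x \<in> nonhom_family 0" by (simp add: nonhom_family_def nonhom_shell_def dyadic_ball_def)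
    then show ?thesis ..
  next
    case False
    then have "norm x > 0" by linarith
    then obtain k :: int where k: "2 powr (of_int k - 1) < norm x" "norm x \<le> 2 powr of_int k"
      using dyadic_shell by blast
    have "k > 0"
    proof (rule ccontr)
      assume "\<not> k > 0"
      then have "2 powr of_int k \<le> (2::real) powr 0" by (intro powr_mono) auto
      then show False using k False by simp
    qed
    then have "x \<in> nonhom_family k"
      using k by (simp add: nonhom_family_def nonhom_shell_def dyadic_annulus_def dyadic_ball_cball)
    then show ?thesis ..
  qed
  then show "AE x in lebesgue. \<exists>k. (x::'a) \<in> nonhom_family k" by simp
qed

lemma hom_Herz_norm_eq:
  assumes "q > 0"
  shows "hom_Herz_norm \<alpha> p q w1 w2 g = epowr (\<integral>\<^sup>+k. epowr (weight_measure w1 (dyadic_ball k)) (\<alpha> * p / real DIM('a::euclidean_space))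
    * epowr (shell_norm q w2 (dyadic_annulus k :: 'a set) g) p \<partial>count_space UNIV) (1 / p)"
  unfolding hom_Herz_norm_def infsum_int_eq_nn_integral shell_norm_eq_Lq_norm[OF assms] ..

lemma nonhom_Herz_norm_eq:
  assumes "q > 0" "p > 0"
  shows "nonhom_Herz_norm \<alpha> p q w1 w2 g = epowr (\<integral>\<^sup>+k. epowr (weight_measure w1 (dyadic_ball k)) (\<alpha> * p / real DIM('a::euclidean_space))
    * epowr (shell_norm q w2 (nonhom_family k :: 'a set) g) p \<partial>count_space UNIV) (1 / p)"
proof -
  let ?F = "\<lambda>k. epowr (weight_measure w1 (dyadic_ball k)) (\<alpha> * p / real DIM('a)) * epowr (shell_norm q w2 (nonhom_family k :: 'a set) g) p"
  have neg: "?F k = 0" if "k < 0" for k using that assms by (simp add: nonhom_family_def shell_norm_def)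
  have "(\<integral>\<^sup>+k. ?F k \<partial>count_space UNIV) = (\<integral>\<^sup>+k. ?F k * indicator {0..} k \<partial>count_space UNIV)"
    using neg by (intro nn_integral_cong) (auto simp: indicator_def not_le)
  also have "\<dots> = (\<integral>\<^sup>+k. ?F k \<partial>count_space {0..})"
    by (simp add: nn_integral_count_space_indicator)
  also have "\<dots> = (\<integral>\<^sup>+i. ?F (int i) \<partial>count_space UNIV)"
  proof (rule nn_integral_bij_count_space[symmetric])
    show "bij_betw int UNIV {0..}" by (rule bij_betw_byWitness[where f'=nat]) auto
  qed
  also have "\<dots> = (\<Sum>i. ?F (int i))" by (rule nn_integral_count_space_nat)
  finally show ?thesis
    unfolding nonhom_Herz_norm_def shell_norm_eq_Lq_norm[OF assms(1)] by (simp add: nonhom_family_def)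
qed

theorem theorem1p1:
  fixes \<beta> p q \<alpha> q1 q2 :: real
    and w1 w2 :: "'a::euclidean_space \<Rightarrow> real"
  assumes "0 < \<beta>" "\<beta> \<le> 1" "0 < p" "1 < q"
    and "muckenhoupt q1 w1" "muckenhoupt q2 w2"
    and "(w1 = w2 \<and> 1 \<le> q1 \<and> q1 = q2 \<and> q2 \<le> q \<and>
            - real DIM('a) * q1 / q < \<alpha> * q1 \<and> \<alpha> * q1 < real DIM('a) * (1 - q2 / q))
         \<or> (w1 \<noteq> w2 \<and> 1 \<le> q1 \<and> 1 \<le> q2 \<and> q2 \<le> q \<and>
            0 < \<alpha> * q1 \<and> \<alpha> * q1 < real DIM('a) * (1 - q2 / q))"
  shows "\<exists>C::real. C > 0 \<and>
           (\<forall>f \<in> hom_Herz \<alpha> p q w1 w2.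
              hom_Herz_norm \<alpha> p q w1 w2 (intrinsic_S \<beta> f)
                \<le> ennreal C * hom_Herz_norm \<alpha> p q w1 w2 (\<lambda>x. ennreal \<bar>f x\<bar>)) \<and>
           (\<forall>f \<in> nonhom_Herz \<alpha> p q w1 w2.
              nonhom_Herz_norm \<alpha> p q w1 w2 (intrinsic_S \<beta> f)
                \<le> ennreal C * nonhom_Herz_norm \<alpha> p q w1 w2 (\<lambda>x. ennreal \<bar>f x\<bar>))"
proof -
  let ?H = "\<lambda>D g. \<integral>\<^sup>+k. epowr (weight_measure w1 (dyadic_ball k)) (\<alpha> * p / real DIM('a)) * epowr (shell_norm q w2 (D k) g) p \<partial>count_space UNIV"
  \<comment> \<open>The constant does not depend on the shell family, so the same one serves the
    homogeneous and the nonhomogeneous space.\<close>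
  obtain C where C: "C > 0" and bound: "\<And>D f. shell_family D \<Longrightarrow> f \<in> borel_measurable lebesgue \<Longrightarrow>
    ?H D (intrinsic_S \<beta> f) \<le> ennreal C * ?H D (\<lambda>x. ennreal \<bar>f x\<bar>)"
    using shell_sum_bound[OF assms] by blast
  have pp: "1 / p > 0" and q0: "q > 0" using assms(3,4) by auto
  have root: "epowr (?H D (intrinsic_S \<beta> f)) (1 / p) \<le> ennreal (C powr (1 / p)) * epowr (?H D (\<lambda>x. ennreal \<bar>f x\<bar>)) (1 / p)"
    if "shell_family D" "f \<in> borel_measurable lebesgue" for D :: "int \<Rightarrow> 'a set" and f
  proof -
    have "epowr (?H D (intrinsic_S \<beta> f)) (1 / p) \<le> epowr (ennreal C * ?H D (\<lambda>x. ennreal \<bar>f x\<bar>)) (1 / p)"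
      by (intro epowr_mono pp bound that)
    also have "\<dots> = ennreal (C powr (1 / p)) * epowr (?H D (\<lambda>x. ennreal \<bar>f x\<bar>)) (1 / p)"
      using C by (simp only: epowr_mult[OF pp] epowr_ennreal_pos)
    finally show ?thesis .
  qed
  show ?thesis
  proof (intro exI[of _ "C powr (1 / p)"] conjI ballI)
    show "C powr (1 / p) > 0" using C by simp
    fix f assume "f \<in> hom_Herz \<alpha> p q w1 w2"
    then have "f \<in> borel_measurable lebesgue" by (simp add: hom_Herz_def Lq_loc_def)
    then show "hom_Herz_norm \<alpha> p q w1 w2 (intrinsic_S \<beta> f) \<le> ennreal (C powr (1 / p)) * hom_Herz_norm \<alpha> p q w1 w2 (\<lambda>x. ennreal \<bar>f x\<bar>)"
      unfolding hom_Herz_norm_eq[OF q0] by (rule root[OF annuli_shell_family])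
  next
    fix f assume "f \<in> nonhom_Herz \<alpha> p q w1 w2"
    then have "f \<in> borel_measurable lebesgue" by (simp add: nonhom_Herz_def Lq_loc_def)
    then show "nonhom_Herz_norm \<alpha> p q w1 w2 (intrinsic_S \<beta> f) \<le> ennreal (C powr (1 / p)) * nonhom_Herz_norm \<alpha> p q w1 w2 (\<lambda>x. ennreal \<bar>f x\<bar>)"
      unfolding nonhom_Herz_norm_eq[OF q0 assms(3)] by (rule root[OF nonhom_shell_family])
  qed
qed

end
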